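(* Let $n\in\{1,2\}$ and let $p,q\geqslant 2$ satisfy the critical condition $$\frac{\max\{p,q\}+1}{pq-1}=\frac{n}{2}.$$ Assume that the initial data satisfy $$\left((u_0,u_1),(v_0,v_1)\right)\in\mathcal{D}:=\left(\left(H^1(\mathbb{R}^n)\cap L^1(\mathbb{R}^n)\right)\times\left(L^2(\mathbb{R}^n)\cap L^1(\mathbb{R}^n)\right)\right)^2,$$ and set $$J[u_0,u_1,v_0,v_1]:=\|u_0\|_{H^1}+\|u_0\|_{L^1}+\|u_1\|_{L^2}+\|u_1\|_{L^1}+\|v_0\|_{H^1}+\|v_0\|_{L^1}+\|v_1\|_{L^2}+\|v_1\|_{L^1},$$ all norms being over $\mathbb{R}^n$. Then there exists a positive constant $\varepsilon_0$ such that for any $\varepsilon\in(0,\varepsilon_0]$ the lifespan $T_{\varepsilon,\mathrm{m}}$ of mild solutions to the Cauchy problem $$\begin{cases}u_{tt}-\Delta u+u_t=|v|^p,&x\in\mathbb{R}^n,\ t\in(0,T),\\ v_{tt}-\Delta v+v_t=|u|^q,&x\in\mathbb{R}^n,\ t\in(0,T),\\ (u,u_t,v,v_t)(0,x)=(\varepsilon u_0,\varepsilon u_1,\varepsilon v_0,\varepsilon v_1)(x),&x\in\mathbb{R}^n,\end{cases}$$ satisfies $$T_{\varepsilon,\mathrm{m}}\geqslant\begin{cases}\exp\left(c\,\varepsilon^{-(p-1)}\right)&\text{if } p=q,\\ \exp\left(c\,\varepsilon^{-\max\left\{\frac{p(pq-1)}{p+1},\frac{q(pq-1)}{q+1}\right\}}\right)&\text{if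 } p\neq q,\end{cases}$$ where $c$ is a positive constant depending on $n$ and $J[u_0,u_1,v_0,v_1]$ only.
   Context: Mild solution: for $T>0$, a pair $(u,v)$ is a mild solution of the Cauchy problem on $[0,T)$ if $(u,v)\in\mathcal{C}([0,T),H^1(\mathbb{R}^n))\times\mathcal{C}([0,T),H^1(\mathbb{R}^n))$, it takes the prescribed initial data, and for any $t\in[0,T)$ $$u(t,x)=\varepsilon(\partial_t+1)\mathcal{H}(t,\nabla)u_0(x)+\varepsilon\mathcal{H}(t,\nabla)u_1(x)+\int_0^t\mathcal{H}(t-\tau,\nabla)|v(\tau,x)|^p\,\mathrm{d}\tau,$$ $$v(t,x)=\varepsilon(\partial_t+1)\mathcal{H}(t,\nabla)v_0(x)+\varepsilon\mathcal{H}(t,\nabla)v_1(x)+\int_0^t\mathcal{H}(t-\tau,\nabla)|u(\tau,x)|^q\,\mathrm{d}\tau.$$ Here $\mathcal{H}(t,\nabla)$ is the Fourier multiplier operator with symbol $$\mathrm{e}^{-\frac t2}\,\frac{\sin\left(t\sqrt{|\xi|^2-1/4}\right)}{\sqrt{|\xi|^2-1/4}},$$ where for $|\xi|<1/2$ the square root is imaginary, so the quotient equals $\sinh\left(t\sqrt{1/4-|\xi|^2}\right)/\sqrt{1/4-|\xi|^2}$, and for $|\xi|=1/2$ the quotient is understood as $t$. The operator $(\partial_t+1)\mathcal{H}(t,\nabla)$ is the multiplier obtained by applying $\partial_t+1$ to this symbol. Lifespan: for fixed $\varepsilon>0$, $T_{\varepsilon,\mathrm{m}}$ is the supremum of all $T\in(0,\infty)$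 such that there exists a unique local (in time) mild solution $(u,v)$ of the Cauchy problem on $[0,T)$ with this $\varepsilon$. *)

theory Defs
  imports "HOL-Analysis.Analysis"
begin

subsection \<open>The Hilbert space of square-integrable functions\<close>

definition square_integrable :: "('a::euclidean_space \<Rightarrow> 'b::euclidean_space) \<Rightarrow> bool" where
  "square_integrable f \<longleftrightarrow>
     f \<in> borel_measurable lborel \<and> integrable lborel (\<lambda>x. (norm (f x))\<^sup>2)"

lemma integrable_inner_L2:
  fixes f g :: "'a::euclidean_space \<Rightarrow> 'b::euclidean_space"
  assumes "square_integrable f" "square_integrable g"
  shows "integrable lborel (\<lambda>x. f x \<bullet> g x)"
proof (rule Bochner_Integration.integrable_bound)
  show "integrable lborel (\<lambda>x. (norm (f x))\<^sup>2 + (norm (g x))\<^sup>2)"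
    using assms by (auto simp: square_integrable_def)
  show "(\<lambda>x. f x \<bullet> g x) \<in> borel_measurable lborel"
    using assms by (intro borel_measurable_inner) (auto simp: square_integrable_def)
  have "norm (f x \<bullet> g x) \<le> norm ((norm (f x))\<^sup>2 + (norm (g x))\<^sup>2)" for x
  proof -
    have "\<bar>f x \<bullet> g x\<bar> \<le> norm (f x) * norm (g x)" by (rule Cauchy_Schwarz_ineq2)
    moreover have "2 * (norm (f x) * norm (g x)) \<le> (norm (f x))\<^sup>2 + (norm (g x))\<^sup>2"
      using sum_squares_bound[of "norm (f x)" "norm (g x)"] by (simp add: mult.assoc)
    moreover have "0 \<le> norm (f x) * norm (g x)" by simp
    ultimately show ?thesis by simp
  qed
  then show "AE x in lborel. norm (f x \<bullet> g x) \<le> norm ((norm (f x))\<^sup>2 + (norm (g x))\<^sup>2)"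
    by simp
qed

lemma square_integrable_zero: "square_integrable (\<lambda>x. 0)"
  by (simp add: square_integrable_def)

lemma square_integrable_scaleR:
  "square_integrable f \<Longrightarrow> square_integrable (\<lambda>x. c *\<^sub>R f x)"
  by (auto simp: square_integrable_def power_mult_distrib)

lemma square_integrable_add:
  fixes f g :: "'a::euclidean_space \<Rightarrow> 'b::euclidean_space"
  assumes "square_integrable f" "square_integrable g"
  shows "square_integrable (\<lambda>x. f x + g x)"
proof -
  have eq: "(norm (f x + g x))\<^sup>2 = (norm (f x))\<^sup>2 + 2 * (f x \<bullet> g x) + (norm (g x))\<^sup>2" for x
    by (simp add: power2_norm_eq_inner algebra_simps inner_commute)
  show ?thesis
    using assms integrable_inner_L2[OF assms]
    by (auto simp: square_integrable_def eq)
qed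

lemma square_integrable_uminus: "square_integrable f \<Longrightarrow> square_integrable (\<lambda>x. - f x)"
  using square_integrable_scaleR[of f "-1"] by simp

lemma square_integrable_diff:
  "square_integrable f \<Longrightarrow> square_integrable g \<Longrightarrow> square_integrable (\<lambda>x. f x - g x)"
  using square_integrable_add[OF _ square_integrable_uminus, of f g] by simp

quotient_type (overloaded) ('a, 'b) L2 = "'a::euclidean_space \<Rightarrow> 'b::euclidean_space"
  / partial: "\<lambda>f g. square_integrable f \<and> square_integrable g \<and> (AE x in lborel. f x = g x)"
proof (rule part_equivpI)
  show "\<exists>f::'a \<Rightarrow> 'b. square_integrable f \<and> square_integrable f \<and> (AE x in lborel. f x = f x)"
    using square_integrable_zero by auto
qed (auto simp: symp_def transp_def)

instantiation L2 :: (euclidean_space, euclidean_space) real_inner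
begin

lift_definition zero_L2 :: "('a, 'b) L2" is "\<lambda>x. 0"
  by (simp add: square_integrable_zero)

lift_definition plus_L2 :: "('a, 'b) L2 \<Rightarrow> ('a, 'b) L2 \<Rightarrow> ('a, 'b) L2" is "\<lambda>f g x. f x + g x"
  by (auto simp: square_integrable_add)

lift_definition uminus_L2 :: "('a, 'b) L2 \<Rightarrow> ('a, 'b) L2" is "\<lambda>f x. - f x"
  by (auto simp: square_integrable_uminus)

lift_definition minus_L2 :: "('a, 'b) L2 \<Rightarrow> ('a, 'b) L2 \<Rightarrow> ('a, 'b) L2" is "\<lambda>f g x. f x - g x"
  by (auto simp: square_integrable_diff)

lift_definition scaleR_L2 :: "real \<Rightarrow> ('a, 'b) L2 \<Rightarrow> ('a, 'b) L2" is "\<lambda>c f x. c *\<^sub>R f x"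
  by (auto simp: square_integrable_scaleR)

lift_definition inner_L2 :: "('a, 'b) L2 \<Rightarrow> ('a, 'b) L2 \<Rightarrow> real"
  is "\<lambda>f g. LINT x|lborel. f x \<bullet> g x"
proof -
  fix f f' g g' :: "'a \<Rightarrow> 'b"
  assume f: "square_integrable f \<and> square_integrable f' \<and> (AE x in lborel. f x = f' x)"
    and g: "square_integrable g \<and> square_integrable g' \<and> (AE x in lborel. g x = g' x)"
  have "AE x in lborel. f x \<bullet> g x = f' x \<bullet> g' x"
    using f g by auto
  then show "(LINT x|lborel. f x \<bullet> g x) = (LINT x|lborel. f' x \<bullet> g' x)"
    using f g integrable_inner_L2[of f g] integrable_inner_L2[of f' g']
    by (intro integral_cong_AE) auto
qed

definition norm_L2 :: "('a, 'b) L2 \<Rightarrow> real" where "norm_L2 f = sqrt (f \<bullet> f)"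
definition dist_L2 :: "('a, 'b) L2 \<Rightarrow> ('a, 'b) L2 \<Rightarrow> real" where "dist_L2 f g = norm (f - g)"
definition sgn_L2 :: "('a, 'b) L2 \<Rightarrow> ('a, 'b) L2" where "sgn_L2 f = scaleR (inverse (norm f)) f"
definition uniformity_L2 :: "(('a, 'b) L2 \<times> ('a, 'b) L2) filter" where
  "uniformity_L2 = (INF e\<in>{0<..}. principal {(f, g). dist f g < e})"
definition open_L2 :: "('a, 'b) L2 set \<Rightarrow> bool" where
  "open_L2 U \<longleftrightarrow> (\<forall>x\<in>U. eventually (\<lambda>(x', y). x' = x \<longrightarrow> y \<in> U) uniformity)"

instance
proof
  fix f g h :: "('a, 'b) L2" and a b :: real and U :: "('a, 'b) L2 set"
  show "f + g + h = f + (g + h)"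
    by transfer (auto simp: square_integrable_add add.assoc)
  show "f + g = g + f"
    by transfer (auto simp: square_integrable_add add.commute)
  show "0 + f = f"
    by transfer auto
  show "- f + f = 0"
    by transfer (auto simp: square_integrable_zero)
  show "f - g = f + - g"
    by transfer (auto simp: square_integrable_diff)
  show "a *\<^sub>R (f + g) = a *\<^sub>R f + a *\<^sub>R g"
    by transfer (auto simp: square_integrable_add square_integrable_scaleR scaleR_add_right)
  show "(a + b) *\<^sub>R f = a *\<^sub>R f + b *\<^sub>R f"
    by transfer (auto simp: square_integrable_add square_integrable_scaleR
        simp flip: scaleR_add_left)
  show "a *\<^sub>R b *\<^sub>R f = (a * b) *\<^sub>R f"
    by transfer (auto simp: square_integrable_scaleR)
  show "1 *\<^sub>R f = f"
    by transfer auto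
  show "dist f g = norm (f - g)" by (rule dist_L2_def)
  show "sgn f = scaleR (inverse (norm f)) f" by (rule sgn_L2_def)
  show "uniformity = (INF e\<in>{0<..}. principal {(f, g). dist f (g::('a, 'b) L2) < e})"
    by (rule uniformity_L2_def)
  show "open U \<longleftrightarrow> (\<forall>x\<in>U. eventually (\<lambda>(x', y). x' = x \<longrightarrow> y \<in> U) uniformity)"
    by (rule open_L2_def)
  show "f \<bullet> g = g \<bullet> f"
    by transfer (simp add: inner_commute)
  show "(f + g) \<bullet> h = f \<bullet> h + g \<bullet> h"
    by transfer (simp add: inner_add_left integrable_inner_L2)
  show "(a *\<^sub>R f) \<bullet> g = a * (f \<bullet> g)"
    by transfer simp
  show "0 \<le> f \<bullet> f"
    by transfer (simp add: integral_nonneg_AE)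
  show "f \<bullet> f = 0 \<longleftrightarrow> f = 0"
  proof transfer
    fix f :: "'a \<Rightarrow> 'b"
    assume "square_integrable f \<and> square_integrable f \<and> (AE x in lborel. f x = f x)"
    then have f: "square_integrable f" by simp
    have "(LINT x|lborel. f x \<bullet> f x) = 0 \<longleftrightarrow> (AE x in lborel. f x \<bullet> f x = 0)"
      by (rule integral_nonneg_eq_0_iff_AE[OF integrable_inner_L2[OF f f]]) simp
    then show "((LINT x|lborel. f x \<bullet> f x) = 0) =
        (square_integrable f \<and> square_integrable (\<lambda>x::'a. 0::'b) \<and> (AE x in lborel. f x = 0))"
      using f by (simp add: square_integrable_zero)
  qed
  show "norm f = sqrt (f \<bullet> f)" by (rule norm_L2_def)
qed

end

text \<open>
  An element of \<open>('a, 'b) L2\<close> is an a.e.-equality class; \<open>rep_L2\<close> selects a (Borel measurable)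
  representative, and every notion below is independent of that choice. \<open>abs_L2 f\<close> is the class
  of \<open>f\<close>, which is meaningful only for square-integrable \<open>f\<close>.
\<close>


subsection \<open>Fourier transform, Fourier multipliers, Sobolev and Lebesgue spaces\<close>

definition fourier_integral :: "(real^'n \<Rightarrow> complex) \<Rightarrow> real^'n \<Rightarrow> complex" where
  "fourier_integral f \<xi> =
     of_real ((2 * pi) powr (- real CARD('n) / 2)) * (LINT x|lborel. cis (- (x \<bullet> \<xi>)) * f x)"

text \<open>
  The Fourier--Plancherel transform: the continuous extension to all of \<open>L2\<close> of the integral
  transform on integrable functions, obtained by approximating with the truncations to balls.
\<close>

definition fourier :: "(real^'n, real) L2 \<Rightarrow> (real^'n, complex) L2" where
  "fourier f = lim (\<lambda>k::nat. abs_L2 (fourier_integral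
     (\<lambda>x. of_real (indicator (cball 0 (real k)) x * rep_L2 f x))))"

text \<open>
  For a real symbol that is bounded, measurable and even (as all symbols below are) the multiplier
  operator maps real-valued functions to real-valued functions and is defined everywhere.
\<close>

definition fourier_multiplier ::
    "(real^'n \<Rightarrow> real) \<Rightarrow> (real^'n, real) L2 \<Rightarrow> (real^'n, real) L2" where
  "fourier_multiplier m f = (THE g. AE \<xi> in lborel.
     rep_L2 (fourier g) \<xi> = of_real (m \<xi>) * rep_L2 (fourier f) \<xi>)"

text \<open>
  With the unitary normalisation of the transform, \<open>norm_H1 f\<close> is the square root of
  the sum of the squared \<open>L2\<close> norms of \<open>f\<close> and of its gradient.
\<close>

definition H1 :: "(real^'n, real) L2 set" where
  "H1 = {f. integrable lborel (\<lambda>\<xi>. (1 + (norm \<xi>)\<^sup>2) * (norm (rep_L2 (fourier f) \<xi>))\<^sup>2)}"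

definition norm_H1 :: "(real^'n, real) L2 \<Rightarrow> real" where
  "norm_H1 f = sqrt (LINT \<xi>|lborel. (1 + (norm \<xi>)\<^sup>2) * (norm (rep_L2 (fourier f) \<xi>))\<^sup>2)"

definition continuous_on_H1 :: "real set \<Rightarrow> (real \<Rightarrow> (real^'n, real) L2) \<Rightarrow> bool" where
  "continuous_on_H1 I u \<longleftrightarrow>
     (\<forall>t\<in>I. u t \<in> H1) \<and> (\<forall>t\<in>I. ((\<lambda>s. norm_H1 (u s - u t)) \<longlongrightarrow> 0) (at t within I))"

definition L2_Int_L1 :: "(real^'n, real) L2 set" where
  "L2_Int_L1 = {f. integrable lborel (rep_L2 f)}"

definition norm_L1 :: "(real^'n, real) L2 \<Rightarrow> real" where
  "norm_L1 f = (LINT x|lborel. \<bar>rep_L2 f x\<bar>)"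

definition data_space ::
    "(((real^'n, real) L2 \<times> (real^'n, real) L2) \<times> ((real^'n, real) L2 \<times> (real^'n, real) L2)) set"
where
  "data_space = ((H1 \<inter> L2_Int_L1) \<times> L2_Int_L1) \<times> ((H1 \<inter> L2_Int_L1) \<times> L2_Int_L1)"

definition data_norm :: "(real^'n, real) L2 \<Rightarrow> (real^'n, real) L2 \<Rightarrow>
    (real^'n, real) L2 \<Rightarrow> (real^'n, real) L2 \<Rightarrow> real" where
  "data_norm u0 u1 v0 v1 =
     norm_H1 u0 + norm_L1 u0 + norm u1 + norm_L1 u1 +
     norm_H1 v0 + norm_L1 v0 + norm v1 + norm_L1 v1"


subsection \<open>Mild solutions and lifespan\<close>

definition damped_wave_symbol :: "real \<Rightarrow> real^'n \<Rightarrow> real" where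
  "damped_wave_symbol t \<xi> = exp (- t / 2) *
     (if norm \<xi> > 1/2 then sin (t * sqrt ((norm \<xi>)\<^sup>2 - 1/4)) / sqrt ((norm \<xi>)\<^sup>2 - 1/4)
      else if norm \<xi> < 1/2 then sinh (t * sqrt (1/4 - (norm \<xi>)\<^sup>2)) / sqrt (1/4 - (norm \<xi>)\<^sup>2)
      else t)"

definition damped_wave_op :: "real \<Rightarrow> (real^'n, real) L2 \<Rightarrow> (real^'n, real) L2" where
  "damped_wave_op t = fourier_multiplier (damped_wave_symbol t)"

definition dt_plus_one_damped_wave_op :: "real \<Rightarrow> (real^'n, real) L2 \<Rightarrow> (real^'n, real) L2" where
  "dt_plus_one_damped_wave_op t = fourier_multiplier
     (\<lambda>\<xi>. deriv (\<lambda>s. damped_wave_symbol s \<xi>) t + damped_wave_symbol t \<xi>)"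

text \<open>
  Used only for \<open>f \<in> H1\<close>, \<open>p \<ge> 2\<close> in dimensions 1 and 2, where the power is again square-integrable
  by Sobolev embedding.
\<close>

definition abs_power :: "real \<Rightarrow> (real^'n, real) L2 \<Rightarrow> (real^'n, real) L2" where
  "abs_power p f = abs_L2 (\<lambda>x. \<bar>rep_L2 f x\<bar> powr p)"

text \<open>
  The integral over \<open>{0..t}\<close> in the Duhamel formula is that of an \<open>L2\<close>-valued function.
\<close>

definition satisfies_duhamel :: "real \<Rightarrow> real \<Rightarrow> (real^'n, real) L2 \<Rightarrow> (real^'n, real) L2 \<Rightarrow> real \<Rightarrow>
    (real \<Rightarrow> (real^'n, real) L2) \<Rightarrow> (real \<Rightarrow> (real^'n, real) L2) \<Rightarrow> bool" where
  "satisfies_duhamel p \<epsilon> w0 w1 T w z \<longleftrightarrow> (\<forall>t\<in>{0..<T}.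
     (\<lambda>\<tau>. damped_wave_op (t - \<tau>) (abs_power p (z \<tau>))) integrable_on {0..t} \<and>
     w t = \<epsilon> *\<^sub>R dt_plus_one_damped_wave_op t w0 + \<epsilon> *\<^sub>R damped_wave_op t w1
         + integral {0..t} (\<lambda>\<tau>. damped_wave_op (t - \<tau>) (abs_power p (z \<tau>))))"

text \<open>
  The initial velocities are taken in the \<open>L2\<close> sense, as one-sided derivatives of the curves at 0.
\<close>

definition mild_solution :: "real \<Rightarrow> real \<Rightarrow> real \<Rightarrow>
    (real^'n, real) L2 \<Rightarrow> (real^'n, real) L2 \<Rightarrow> (real^'n, real) L2 \<Rightarrow> (real^'n, real) L2 \<Rightarrow> real \<Rightarrow>
    (real \<Rightarrow> (real^'n, real) L2) \<Rightarrow> (real \<Rightarrow> (real^'n, real) L2) \<Rightarrow> bool" where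
  "mild_solution p q \<epsilon> u0 u1 v0 v1 T u v \<longleftrightarrow>
     continuous_on_H1 {0..<T} u \<and> continuous_on_H1 {0..<T} v \<and>
     u 0 = \<epsilon> *\<^sub>R u0 \<and> (u has_vector_derivative \<epsilon> *\<^sub>R u1) (at 0 within {0..<T}) \<and>
     v 0 = \<epsilon> *\<^sub>R v0 \<and> (v has_vector_derivative \<epsilon> *\<^sub>R v1) (at 0 within {0..<T}) \<and>
     satisfies_duhamel p \<epsilon> u0 u1 T u v \<and>
     satisfies_duhamel q \<epsilon> v0 v1 T v u"

definition unique_mild_solution_exists :: "real \<Rightarrow> real \<Rightarrow> real \<Rightarrow>
    (real^'n, real) L2 \<Rightarrow> (real^'n, real) L2 \<Rightarrow> (real^'n, real) L2 \<Rightarrow> (real^'n, real) L2 \<Rightarrow>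
    real \<Rightarrow> bool" where
  "unique_mild_solution_exists p q \<epsilon> u0 u1 v0 v1 T \<longleftrightarrow>
     (\<exists>u v. mild_solution p q \<epsilon> u0 u1 v0 v1 T u v \<and>
       (\<forall>u' v'. mild_solution p q \<epsilon> u0 u1 v0 v1 T u' v' \<longrightarrow>
          (\<forall>t\<in>{0..<T}. u' t = u t \<and> v' t = v t)))"

definition lifespan :: "real \<Rightarrow> real \<Rightarrow> real \<Rightarrow>
    (real^'n, real) L2 \<Rightarrow> (real^'n, real) L2 \<Rightarrow> (real^'n, real) L2 \<Rightarrow> (real^'n, real) L2 \<Rightarrow> ereal"
where
  "lifespan p q \<epsilon> u0 u1 v0 v1 =
     Sup {ereal T | T. 0 < T \<and> unique_mild_solution_exists p q \<epsilon> u0 u1 v0 v1 T}"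

end

theory Submission imports Defs "HOL-Probability.Probability"
begin

text \<open>
  On the Fourier side the damped wave flow is bounded by \<open>exp (- (1 + t) |\<xi>|\<^sup>2) + exp (- t / 8)\<close>, so that it maps
  \<open>L\<^sup>1 \<inter> L\<^sup>2\<close> data into functions whose weighted energy norm \<open>wnorm t\<close>, which carries the decay of the heat
  flow, stays bounded. By the Sobolev embedding (into \<open>L\<^sup>\<infinity>\<close> for \<open>n = 1\<close>, into \<open>L\<^sup>4\<close> for \<open>n = 2\<close>, where criticality
  forces \<open>p = q = 2\<close>) the nonlinearity \<open>|u|\<^bsup>p\<^esup>\<close> of a function of unit weighted norm has \<open>L\<^sup>1 \<inter> L\<^sup>2\<close> size
  \<open>(1 + t)\<^bsup>- n (p - 1) / 2\<^esup>\<close>. The Duhamel map is therefore a contraction on \<open>[0, T]\<close>, between weighted balls of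
  radii \<open>a(t)\<close> and \<open>b(t)\<close>, as soon as two scalar integral inequalities hold. In the critical case
  these integrals grow only logarithmically, which gives an exponential lifespan: for \<open>p = q\<close> with
  constant radii of size \<open>\<epsilon>\<close>, and for \<open>p < q\<close> when the radius for the component with the smaller exponent may grow in time.
\<close>

subsection \<open>Completeness of the space of square-integrable functions\<close>

text \<open>Curves in \<open>H1\<close> are handled through \<open>U\<close> with
  \<open>u = bessel_op U\<close>: this isometry of \<open>L2\<close> onto \<open>H1\<close> turns
  their continuity, integrals and limits into statements in the Banach space \<open>L2\<close>. The
  constant \<open>c\<close> may depend on the dimension and the data norm only, and this shapes the
  two cases. If \<open>p = q\<close>, criticality forces \<open>p = 1 + 2 / n\<close>, so the
  constant of the nonlinear estimate depends on \<open>n\<close> alone. If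
  \<open>p \<noteq> q\<close>, that constant depends on the exponents; but the growing radius leaves
  a spare power of \<epsilon> at the final time, so that any \<open>c > 0\<close> will do and the
  exponents only enter through the choice of \<open>\<epsilon>0\<close>. The lifespan asks for
  uniqueness among all mild solutions, not only among those obeying the weighted bounds; an
  unweighted Gronwall argument settles this. Since \<open>fourier\<close> and
  \<open>fourier_multiplier\<close> are given by \<open>lim\<close> and \<open>THE\<close>,
  convergence, isometry and the characterisation of the range by Hermitian symmetry have to be
  established before any decay can be discussed.\<close>

lemma square_integrable_rep [simp]: "square_integrable (rep_L2 f)"
  using Quotient3_rep_reflp[OF Quotient3_L2, of f] by simp

lemma abs_rep_L2 [simp]: "abs_L2 (rep_L2 f) = f"
  by (rule Quotient3_abs_rep[OF Quotient3_L2])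

lemma rep_abs_L2: "square_integrable f \<Longrightarrow> AE x in lborel. rep_L2 (abs_L2 f) x = f x"
  using Quotient3_rel_rep[OF Quotient3_L2] Quotient3_rep_abs[OF Quotient3_L2, of f] by auto

lemma abs_L2_cong_AE:
  "square_integrable f \<Longrightarrow> square_integrable g \<Longrightarrow> AE x in lborel. f x = g x \<Longrightarrow> abs_L2 f = abs_L2 g"
  using Quotient3_rel_abs[OF Quotient3_L2, of f g] by auto

lemma L2_eqI: "AE x in lborel. rep_L2 f x = rep_L2 g x \<Longrightarrow> f = g"
  using abs_L2_cong_AE[of "rep_L2 f" "rep_L2 g"] by simp

lemma borel_measurable_rep_L2 [measurable]: "rep_L2 f \<in> borel_measurable borel"
  using square_integrable_rep[of f] by (simp add: square_integrable_def)

lemma integrable_rep_L2_sq [simp]: "integrable lborel (\<lambda>x. (norm (rep_L2 f x))\<^sup>2)"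
  using square_integrable_rep[of f] by (simp add: square_integrable_def)

lemma rep_L2_add: "AE x in lborel. rep_L2 (f + g) x = rep_L2 f x + rep_L2 g x"
proof -
  have "f + g = abs_L2 (\<lambda>x. rep_L2 f x + rep_L2 g x)"
    using plus_L2.abs_eq[of "rep_L2 f" "rep_L2 g"] by simp
  then show ?thesis using rep_abs_L2[OF square_integrable_add[of "rep_L2 f" "rep_L2 g"]] by simp
qed

lemma rep_L2_diff: "AE x in lborel. rep_L2 (f - g) x = rep_L2 f x - rep_L2 g x"
proof -
  have "f - g = abs_L2 (\<lambda>x. rep_L2 f x - rep_L2 g x)"
    using minus_L2.abs_eq[of "rep_L2 f" "rep_L2 g"] by simp
  then show ?thesis using rep_abs_L2[OF square_integrable_diff[of "rep_L2 f" "rep_L2 g"]] by simp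
qed

lemma rep_L2_scaleR: "AE x in lborel. rep_L2 (c *\<^sub>R f) x = c *\<^sub>R rep_L2 f x"
proof -
  have "c *\<^sub>R f = abs_L2 (\<lambda>x. c *\<^sub>R rep_L2 f x)"
    using scaleR_L2.abs_eq[of "rep_L2 f" c] by simp
  then show ?thesis using rep_abs_L2[OF square_integrable_scaleR[of "rep_L2 f" c]] by simp
qed

lemma rep_L2_zero: "AE x in lborel. rep_L2 0 x = 0"
  using rep_abs_L2[OF square_integrable_zero] by (simp add: zero_L2_def)

lemma inner_L2_eq: "f \<bullet> g = (LINT x|lborel. rep_L2 f x \<bullet> rep_L2 g x)"
  using inner_L2.abs_eq[of "rep_L2 f" "rep_L2 g"] by simp

lemma norm_L2_sq: "(norm f)\<^sup>2 = (LINT x|lborel. (norm (rep_L2 f x))\<^sup>2)"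
  unfolding power2_norm_eq_inner inner_L2_eq by simp

lemma norm_abs_L2_sq:
  assumes "square_integrable f"
  shows "(norm (abs_L2 f))\<^sup>2 = (LINT x|lborel. (norm (f x))\<^sup>2)"
proof -
  have [measurable]: "f \<in> borel_measurable borel" using assms by (simp add: square_integrable_def)
  show ?thesis
    unfolding norm_L2_sq
    by (intro integral_cong_AE) (use rep_abs_L2[OF assms] in auto)
qed

lemma square_integrable_bound:
  assumes [measurable]: "g \<in> borel_measurable borel" and f: "square_integrable f"
    and le: "AE x in lborel. norm (g x) \<le> norm (f x)"
  shows "square_integrable g"
proof -
  have "integrable lborel (\<lambda>x. (norm (f x))\<^sup>2)" using f by (simp add: square_integrable_def)
  then have "integrable lborel (\<lambda>x. (norm (g x))\<^sup>2)"
  proof (rule Bochner_Integration.integrable_bound)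
    show "AE x in lborel. norm ((norm (g x))\<^sup>2) \<le> norm ((norm (f x))\<^sup>2)"
      using le by eventually_elim (auto intro: power_mono)
  qed measurable
  then show ?thesis by (simp add: square_integrable_def)
qed

lemma norm_L2_diff_sq: "(norm (f - g))\<^sup>2 = (LINT x|lborel. (norm (rep_L2 f x - rep_L2 g x))\<^sup>2)"
  unfolding norm_L2_sq by (intro integral_cong_AE) (use rep_L2_diff[of f g] in auto)

lemma nn_integral_rep_L2: "(\<integral>\<^sup>+x. (norm (rep_L2 f x))\<^sup>2 \<partial>lborel) = ennreal ((norm f)\<^sup>2)"
  unfolding norm_L2_sq by (intro nn_integral_eq_integral) auto

lemma nn_integral_rep_L2_diff:
  "(\<integral>\<^sup>+x. (norm (rep_L2 f x - rep_L2 g x))\<^sup>2 \<partial>lborel) = ennreal ((norm (f - g))\<^sup>2)"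
  unfolding nn_integral_rep_L2[symmetric]
  by (intro nn_integral_cong_AE) (use rep_L2_diff[of f g] in auto)

text \<open>Norm convergence means that the squared differences tend to 0 in \<open>L1\<close>,
  which yields an a.e. convergent subsequence. In this way norm limits become accessible to Fatou's
  lemma on representatives.\<close>

lemma L2_tendsto_AE_subseq:
  fixes f :: "nat \<Rightarrow> ('a::euclidean_space, 'b::euclidean_space) L2"
  assumes "f \<longlonglongrightarrow> g"
  obtains r :: "nat \<Rightarrow> nat" where "strict_mono r" "AE x in lborel. (\<lambda>n. rep_L2 (f (r n)) x) \<longlonglongrightarrow> rep_L2 g x"
proof -
  have "(\<lambda>n. (norm (f n - g))\<^sup>2) \<longlonglongrightarrow> 0\<^sup>2"
    by (intro tendsto_intros) (use assms in \<open>simp add: LIM_zero tendsto_norm_zero\<close>)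
  then have "(\<lambda>n. LINT x|lborel. norm ((norm (rep_L2 (f n) x - rep_L2 g x))\<^sup>2)) \<longlonglongrightarrow> 0"
    unfolding norm_L2_diff_sq by simp
  moreover have "integrable lborel (\<lambda>x. (norm (rep_L2 (f n) x - rep_L2 g x))\<^sup>2)" for n
    using square_integrable_diff[of "rep_L2 (f n)" "rep_L2 g"] by (simp add: square_integrable_def)
  ultimately obtain r :: "nat \<Rightarrow> nat" where r: "strict_mono r"
    "AE x in lborel. (\<lambda>n. (norm (rep_L2 (f (r n)) x - rep_L2 g x))\<^sup>2) \<longlonglongrightarrow> 0"
    using tendsto_L1_AE_subseq[of lborel "\<lambda>n x. (norm (rep_L2 (f n) x - rep_L2 g x))\<^sup>2"] by blast
  from r(2) have "AE x in lborel. (\<lambda>n. rep_L2 (f (r n)) x) \<longlonglongrightarrow> rep_L2 g x"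
  proof eventually_elim
    case (elim x)
    then have "(\<lambda>n. sqrt ((norm (rep_L2 (f (r n)) x - rep_L2 g x))\<^sup>2)) \<longlonglongrightarrow> sqrt 0"
      by (intro tendsto_intros)
    then have "(\<lambda>n. norm (rep_L2 (f (r n)) x - rep_L2 g x)) \<longlonglongrightarrow> 0" by simp
    then show ?case by (simp add: LIM_zero_iff tendsto_norm_zero_iff)
  qed
  with r(1) show ?thesis by (rule that)
qed

text \<open>
  The weights \<open>2 ^ k\<close> make the sum of the squared increments integrable, so that the increments
  are a.e. dominated by a geometric series.
\<close>

lemma L2_fast_Cauchy_converges:
  fixes f :: "nat \<Rightarrow> ('a::euclidean_space, 'b::euclidean_space) L2"
  assumes fast: "\<And>m n. m \<le> n \<Longrightarrow> norm (f n - f m) \<le> (1/2)^m"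
  shows "convergent f"
proof -
  let ?d = "\<lambda>k x. (norm (rep_L2 (f (Suc k)) x - rep_L2 (f k) x))\<^sup>2"
  have "(\<integral>\<^sup>+x. (\<Sum>k. ennreal (2^k * ?d k x)) \<partial>lborel) = (\<Sum>k. \<integral>\<^sup>+x. ennreal (2^k * ?d k x) \<partial>lborel)"
    by (rule nn_integral_suminf) measurable
  also have "\<dots> = (\<Sum>k. ennreal (2^k * (norm (f (Suc k) - f k))\<^sup>2))"
    by (simp add: ennreal_mult nn_integral_cmult nn_integral_rep_L2_diff)
  also have "\<dots> \<le> (\<Sum>k. ennreal ((1/2)^k))"
  proof (intro suminf_le ennreal_leI)
    fix k
    have "(norm (f (Suc k) - f k))\<^sup>2 \<le> ((1/2)^k)\<^sup>2"
      by (intro power_mono fast) auto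
    then have "2^k * (norm (f (Suc k) - f k))\<^sup>2 \<le> 2^k * ((1/2)^k)\<^sup>2"
      by simp
    also have "\<dots> = (1/2)^k" by (simp add: power2_eq_square flip: power_mult_distrib)
    finally show "2^k * (norm (f (Suc k) - f k))\<^sup>2 \<le> (1/2)^k" .
  qed auto
  also have "\<dots> = ennreal (\<Sum>k. (1/2)^k)"
    by (intro suminf_ennreal2) (auto intro: summable_geometric)
  also have "\<dots> < \<infinity>" by simp
  finally have "AE x in lborel. (\<Sum>k. ennreal (2^k * ?d k x)) \<noteq> \<infinity>"
    by (intro nn_integral_PInf_AE) auto
  then have conv: "AE x in lborel. convergent (\<lambda>n. rep_L2 (f n) x)"
  proof eventually_elim
    case (elim x)
    then have "summable (\<lambda>k. 2^k * ?d k x)"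
      by (intro summable_suminf_not_top) auto
    then have "Bseq (\<lambda>k. 2^k * ?d k x)"
      by (intro convergent_imp_Bseq) (auto simp: convergent_def dest: summable_LIMSEQ_zero)
    then obtain B where B: "\<And>k. norm (2^k * ?d k x) \<le> B" "B > 0" by (auto simp: Bseq_def)
    have "norm (rep_L2 (f (Suc k)) x - rep_L2 (f k) x) \<le> sqrt B * (sqrt (1/2))^k" for k
    proof (rule power2_le_imp_le)
      have "?d k x \<le> B * (1/2)^k" using B(1)[of k] by (simp add: field_simps)
      also have "\<dots> = (sqrt B * (sqrt (1/2))^k)\<^sup>2"
        using B(2) by (simp add: power_mult_distrib flip: power_mult)
          (simp add: power_mult mult.commute[of k] real_sqrt_pow2 power_one_over)
      finally show "?d k x \<le> (sqrt B * (sqrt (1/2))^k)\<^sup>2" .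
    qed (use B(2) in auto)
    note bd = this
    have "sqrt (1/2) < sqrt (1::real)" by (rule real_sqrt_less_mono) simp
    then have "summable (\<lambda>k. sqrt B * (sqrt (1/2))^k)"
      by (intro summable_mult summable_geometric) simp
    then have "summable (\<lambda>k. rep_L2 (f (Suc k)) x - rep_L2 (f k) x)"
      by (rule summable_comparison_test'[of _ 0]) (rule bd)
    then have "convergent (\<lambda>n. \<Sum>k<n. rep_L2 (f (Suc k)) x - rep_L2 (f k) x)"
      by (simp add: summable_iff_convergent)
    then have "convergent (\<lambda>n. (rep_L2 (f n) x - rep_L2 (f 0) x) + rep_L2 (f 0) x)"
      unfolding sum_lessThan_telescope[of "\<lambda>n. rep_L2 (f n) x"]
      by (intro convergent_add convergent_const)
    then show ?case by simp
  qed
  \<comment> \<open>Where the representatives diverge, \<open>lim\<close> is some unspecified value;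
    that set is null, and \<open>g\<close> is measurable all the same.\<close>
  define g where "g = (\<lambda>x. lim (\<lambda>n. rep_L2 (f n) x))"
  have [measurable]: "g \<in> borel_measurable borel" unfolding g_def
    by (intro borel_measurable_lim_metric) measurable
  have fatou: "(\<integral>\<^sup>+x. ennreal ((norm (g x - rep_L2 (f m) x))\<^sup>2) \<partial>lborel) \<le> ennreal (((1/2)^m)\<^sup>2)" for m
  proof -
    have "(\<integral>\<^sup>+x. ennreal ((norm (g x - rep_L2 (f m) x))\<^sup>2) \<partial>lborel)
        = (\<integral>\<^sup>+x. liminf (\<lambda>n. ennreal ((norm (rep_L2 (f n) x - rep_L2 (f m) x))\<^sup>2)) \<partial>lborel)"
    proof (intro nn_integral_cong_AE)
      show "AE x in lborel. ennreal ((norm (g x - rep_L2 (f m) x))\<^sup>2) =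
          liminf (\<lambda>n. ennreal ((norm (rep_L2 (f n) x - rep_L2 (f m) x))\<^sup>2))"
        using conv
      proof eventually_elim
        case (elim x)
        then have "(\<lambda>n. rep_L2 (f n) x) \<longlonglongrightarrow> g x" by (simp add: g_def convergent_LIMSEQ_iff)
        then have "(\<lambda>n. ennreal ((norm (rep_L2 (f n) x - rep_L2 (f m) x))\<^sup>2)) \<longlonglongrightarrow>
            ennreal ((norm (g x - rep_L2 (f m) x))\<^sup>2)"
          by (intro tendsto_intros)
        then show ?case by (intro lim_imp_Liminf[symmetric]) auto
      qed
    qed
    also have "\<dots> \<le> liminf (\<lambda>n. \<integral>\<^sup>+x. ennreal ((norm (rep_L2 (f n) x - rep_L2 (f m) x))\<^sup>2) \<partial>lborel)"
      by (intro nn_integral_liminf) measurable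
    also have "\<dots> = liminf (\<lambda>n. ennreal ((norm (f n - f m))\<^sup>2))"
      by (simp add: nn_integral_rep_L2_diff)
    also have "\<dots> \<le> ennreal (((1/2)^m)\<^sup>2)"
      by (intro Liminf_le eventually_sequentiallyI[of m] ennreal_leI power_mono fast) auto
    finally show ?thesis .
  qed
  have sq: "square_integrable (\<lambda>x. g x - rep_L2 (f m) x)" for m
    unfolding square_integrable_def
    by (auto intro!: integrableI_bounded order_le_less_trans[OF fatou[of m]])
  have g: "square_integrable g"
    using square_integrable_add[OF sq[of 0] square_integrable_rep[of "f 0"]] by simp
  have "norm (abs_L2 g - f m) \<le> (1/2)^m" for m
  proof -
    have "ennreal ((norm (abs_L2 g - f m))\<^sup>2) =
        (\<integral>\<^sup>+x. ennreal ((norm (g x - rep_L2 (f m) x))\<^sup>2) \<partial>lborel)"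
      unfolding nn_integral_rep_L2_diff[symmetric]
      by (intro nn_integral_cong_AE) (use rep_abs_L2[OF g] in auto)
    then have "ennreal ((norm (abs_L2 g - f m))\<^sup>2) \<le> ennreal (((1/2)^m)\<^sup>2)"
      using fatou[of m] by argo
    then have "(norm (abs_L2 g - f m))\<^sup>2 \<le> ((1/2)^m)\<^sup>2"
      by (subst (asm) ennreal_le_iff) auto
    then show ?thesis by (rule power2_le_imp_le) simp
  qed
  then have "\<forall>\<^sub>F m in sequentially. norm (abs_L2 g - f m) \<le> (1/2)^m" by simp
  moreover have "(\<lambda>m. (1/2::real)^m) \<longlonglongrightarrow> 0" by (rule LIMSEQ_realpow_zero) auto
  ultimately have "(\<lambda>m. abs_L2 g - f m) \<longlonglongrightarrow> 0" by (rule Lim_null_comparison)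
  from tendsto_diff[OF tendsto_const[of "abs_L2 g"] this] have "f \<longlonglongrightarrow> abs_L2 g" by simp
  then show ?thesis by (auto simp: convergent_def)
qed

text \<open>Integrability of continuous \<open>L2\<close>-valued curves, convergence of the Picard
  series and the \<open>lim\<close> in the definition of the transform all rest on
  completeness.\<close>

instance L2 :: (euclidean_space, euclidean_space) banach
proof
  fix X :: "nat \<Rightarrow> ('a, 'b) L2"
  assume X: "Cauchy X"
  have "\<exists>M. \<forall>m\<ge>M. \<forall>n\<ge>M. norm (X m - X n) < (1/2)^k" for k
    using CauchyD[OF X, of "(1/2)^k"] by simp
  then obtain M where M: "\<And>k m n. m \<ge> M k \<Longrightarrow> n \<ge> M k \<Longrightarrow> norm (X m - X n) < (1/2)^k"
    by metis
  \<comment> \<open>Two requirements are built in: \<open>s\<close> is strictly increasing, and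
    \<open>M k \<le> s k\<close>, so that the increments of the subsequence decay geometrically. A
    Cauchy sequence converges with any of its subsequences.\<close>
  define s where "s = rec_nat (M 0) (\<lambda>k r. max (Suc r) (M (Suc k)))"
  have s0: "s 0 = M 0" and sS: "s (Suc k) = max (Suc (s k)) (M (Suc k))" for k
    by (simp_all add: s_def)
  have s: "strict_mono s" by (intro strict_monoI_Suc) (simp add: sS)
  have sM: "M k \<le> s k" for k by (cases k) (auto simp: s0 sS)
  have "norm ((X \<circ> s) n - (X \<circ> s) m) \<le> (1/2)^m" if "m \<le> n" for m n
  proof -
    have "s m \<le> s n" using strict_mono_mono[OF s] that by (rule monoD)
    then show ?thesis using M[of m "s n" "s m"] sM[of m] by simp
  qed
  then have "convergent (X \<circ> s)" by (rule L2_fast_Cauchy_converges)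
  then obtain l where "(X \<circ> s) \<longlonglongrightarrow> l" by (auto simp: convergent_def)
  then have "X \<longlonglongrightarrow> l" using Cauchy_converges_subseq[OF X s] by simp
  then show "convergent X" by (auto simp: convergent_def)
qed

subsection \<open>Lebesgue measure and Gaussian integrals\<close>

lemma borel_measurable_cis [measurable]: "cis \<in> borel_measurable borel"
  by (intro borel_measurable_continuous_onI continuous_intros)

text \<open>The tensor product \<open>f x * g y\<close> is an integrable majorant on the product
  space, so that interchanging the order of integration becomes a matter of domination.\<close>

lemma integrable_lborel_product_bound:
  fixes k :: "'a::euclidean_space \<Rightarrow> 'b::euclidean_space \<Rightarrow> complex"
    and f :: "'a \<Rightarrow> real" and g :: "'b \<Rightarrow> real"
  assumes [measurable]: "case_prod k \<in> borel_measurable (lborel \<Otimes>\<^sub>M lborel)"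
    and f: "integrable lborel f" and g: "integrable lborel g"
    and le: "\<And>x y. norm (k x y) \<le> f x * g y"
  shows "integrable (lborel \<Otimes>\<^sub>M lborel) (case_prod k)"
proof -
  have [measurable]: "f \<in> borel_measurable borel" "g \<in> borel_measurable borel"
    using f g by (auto dest: borel_measurable_integrable)
  have "integrable (lborel \<Otimes>\<^sub>M lborel) (\<lambda>p::'a \<times> 'b. f (fst p) * g (snd p))"
  proof (rule lborel_pair.Fubini_integrable)
    show "integrable lborel (\<lambda>x. LINT y|lborel. norm (f (fst (x, y)) * g (snd (x, y))))"
      using f by (simp add: abs_mult)
    show "AE x in lborel. integrable lborel (\<lambda>y. f (fst (x, y)) * g (snd (x, y)))"
      using g by simp
  qed measurable
  then show ?thesis
  proof (rule Bochner_Integration.integrable_bound)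
    show "AE p in lborel \<Otimes>\<^sub>M lborel. norm (case_prod k p) \<le> norm (f (fst p) * g (snd p))"
      using order_trans[OF le abs_ge_self] by (auto simp: split_beta)
  qed measurable
qed

lemma integral_swap_bound:
  fixes k :: "'a::euclidean_space \<Rightarrow> 'b::euclidean_space \<Rightarrow> complex"
    and f :: "'a \<Rightarrow> real" and g :: "'b \<Rightarrow> real"
  assumes "case_prod k \<in> borel_measurable (lborel \<Otimes>\<^sub>M lborel)"
    and "integrable lborel f" and "integrable lborel g"
    and "\<And>x y. norm (k x y) \<le> f x * g y"
  shows "(LINT x|lborel. LINT y|lborel. k x y) = (LINT y|lborel. LINT x|lborel. k x y)"
  using lborel_pair.Fubini_integral[OF integrable_lborel_product_bound[OF assms]] by simp

lemma lborel_scale_integral: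
  fixes f :: "'a::euclidean_space \<Rightarrow> 'b::{banach, second_countable_topology}"
  assumes c: "c \<noteq> 0" and [measurable]: "f \<in> borel_measurable borel"
  shows "(LINT x|lborel. f (t + c *\<^sub>R x)) = (LINT x|lborel. f x) /\<^sub>R (\<bar>c\<bar>^DIM('a))"
proof -
  have "(LINT x|lborel. f x) = (LINT x|density (distr lborel borel (\<lambda>x. t + c *\<^sub>R x)) (\<lambda>_. ennreal (\<bar>c\<bar>^DIM('a))). f x)"
    using lborel_affine[OF c, of t] by (simp add: ennreal_power)
  also have "\<dots> = (\<bar>c\<bar>^DIM('a)) *\<^sub>R (LINT x|lborel. f (t + c *\<^sub>R x))"
    by (subst integral_density) (auto simp: integral_distr)
  finally show ?thesis using c by simp
qed

lemma lborel_scale_nn_integral: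
  fixes f :: "'a::euclidean_space \<Rightarrow> ennreal"
  assumes c: "c \<noteq> 0" and [measurable]: "f \<in> borel_measurable borel"
  shows "(\<integral>\<^sup>+x. f x \<partial>lborel) = ennreal (\<bar>c\<bar>^DIM('a)) * (\<integral>\<^sup>+x. f (t + c *\<^sub>R x) \<partial>lborel)"
proof -
  have "(\<integral>\<^sup>+x. f x \<partial>lborel) = (\<integral>\<^sup>+x. f x \<partial>density (distr lborel borel (\<lambda>x. t + c *\<^sub>R x)) (\<lambda>_. ennreal (\<bar>c\<bar>^DIM('a))))"
    using lborel_affine[OF c, of t] by (simp add: ennreal_power)
  also have "\<dots> = ennreal (\<bar>c\<bar>^DIM('a)) * (\<integral>\<^sup>+x. f (t + c *\<^sub>R x) \<partial>lborel)"
    by (subst nn_integral_density) (auto simp: nn_integral_distr nn_integral_cmult)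
  finally show ?thesis .
qed

lemma lborel_uminus: "lborel = distr lborel borel (uminus :: 'a::euclidean_space \<Rightarrow> 'a)"
  using lborel_affine[of "-1" "0::'a"] by (simp add: density_1)

lemma integral_lborel_uminus:
  fixes f :: "'a::euclidean_space \<Rightarrow> 'b::{banach, second_countable_topology}"
  assumes "f \<in> borel_measurable borel"
  shows "(LINT x|lborel. f (- x)) = (LINT x|lborel. f x)"
  using lborel_scale_integral[of "-1" f 0] assms by simp

lemma integrable_lborel_uminus:
  fixes f :: "'a::euclidean_space \<Rightarrow> 'b::{banach, second_countable_topology}"
  assumes "integrable lborel f"
  shows "integrable lborel (\<lambda>x. f (- x))"
proof -
  have "integrable (distr lborel borel uminus) f" using assms lborel_uminus[where 'a='a] by simp
  then show ?thesis by (rule integrable_distr[rotated]) simp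
qed

lemma AE_lborel_uminus:
  assumes "AE x::'a::euclidean_space in lborel. P x"
  shows "AE x in lborel. P (- x)"
proof -
  from assms have "AE x in distr lborel borel (uminus :: 'a \<Rightarrow> 'a). P x"
    using lborel_uminus by metis
  then show ?thesis by (rule AE_distrD[rotated]) simp
qed

text \<open>The case \<open>a = 1\<close> is the characteristic function of the standard normal
  distribution; the substitution \<open>x \<mapsto> sqrt a * x\<close> gives the rest.\<close>

lemma gaussian_transform_real:
  fixes t a :: real
  assumes a: "a > 0"
  shows "integrable lborel (\<lambda>x. cis (- (x * t)) * of_real (exp (- a * x\<^sup>2 / 2)))" (is ?I)
    and "(LINT x|lborel. cis (- (x * t)) * of_real (exp (- a * x\<^sup>2 / 2)))
      = of_real (sqrt (2 * pi / a) * exp (- t\<^sup>2 / (2 * a)))" (is ?E)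
proof -
  have std: "(LINT x|lborel. of_real (exp (- x\<^sup>2 / 2)) * cis (s * x))
      = of_real (sqrt (2 * pi) * exp (- s\<^sup>2 / 2))" for s
  proof -
    have "complex_of_real (exp (- s\<^sup>2 / 2)) = (LINT x|lborel. std_normal_density x *\<^sub>R cis (s * x))"
      using char_std_normal_distribution[THEN fun_cong, of s]
      unfolding char_def by (subst (asm) integral_density) (auto simp: cis_conv_exp)
    also have "\<dots> = (LINT x|lborel. of_real (1 / sqrt (2 * pi)) * (of_real (exp (- x\<^sup>2 / 2)) * cis (s * x)))"
      by (intro Bochner_Integration.integral_cong) (auto simp: std_normal_density_def scaleR_conv_of_real)
    also have "\<dots> = of_real (1 / sqrt (2 * pi)) * (LINT x|lborel. of_real (exp (- x\<^sup>2 / 2)) * cis (s * x))"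
      by (rule integral_mult_right_zero)
    finally show ?thesis by (simp add: field_simps)
  qed
  define r where "r = sqrt a"
  have r: "r > 0" "r\<^sup>2 = a" using a by (auto simp: r_def)
  have "(LINT x|lborel. of_real (exp (- (r * x)\<^sup>2 / 2)) * cis ((- t / r) * (r * x)))
      = of_real (sqrt (2 * pi) * exp (- (- t / r)\<^sup>2 / 2)) /\<^sub>R r"
  proof -
    have "(\<lambda>x::real. complex_of_real (exp (- x\<^sup>2 / 2)) * cis ((- t / r) * x)) \<in> borel_measurable borel"
      by measurable
    from lborel_scale_integral[OF _ this, of r 0] show ?thesis
      using r unfolding std by simp
  qed
  moreover have "of_real (exp (- (r * x)\<^sup>2 / 2)) * cis ((- t / r) * (r * x)) =
      cis (- (x * t)) * of_real (exp (- a * x\<^sup>2 / 2))" for x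
    using r by (simp add: power_mult_distrib mult.commute)
  moreover have "of_real (sqrt (2 * pi) * exp (- (- t / r)\<^sup>2 / 2)) /\<^sub>R r =
      complex_of_real (sqrt (2 * pi / a) * exp (- t\<^sup>2 / (2 * a)))"
    using r by (simp add: scaleR_conv_of_real real_sqrt_divide power_divide field_simps r_def[symmetric])
  ultimately show ?E by simp
  have "integrable lborel (\<lambda>x. std_normal_density (0 + r * x) * sqrt (2 * pi))"
    using r by (intro integrable_mult_left lborel_integrable_real_affine integrable_normal_density) auto
  moreover have "(\<lambda>x. std_normal_density (0 + r * x) * sqrt (2 * pi)) = (\<lambda>x. exp (- a * x\<^sup>2 / 2))"
    using r by (simp add: std_normal_density_def power_mult_distrib fun_eq_iff)
  ultimately have "integrable lborel (\<lambda>x. exp (- a * x\<^sup>2 / 2))" by metis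
  then show ?I
    by (rule Bochner_Integration.integrable_bound) (auto simp: norm_mult)
qed

text \<open>Lebesgue measure is the image of a product of one-dimensional measures over
  \<open>Basis\<close>, and the integrand factorises over \<open>Basis\<close> as well, which
  reduces everything to dimension one.\<close>

lemma gaussian_transform:
  fixes \<xi> :: "'a::euclidean_space" and a :: real
  assumes a: "a > 0"
  shows "integrable lborel (\<lambda>x. cis (- (x \<bullet> \<xi>)) * of_real (exp (- a * (norm x)\<^sup>2 / 2)))" (is ?I)
    and "(LINT x|lborel. cis (- (x \<bullet> \<xi>)) * of_real (exp (- a * (norm x)\<^sup>2 / 2)))
      = of_real ((2 * pi / a) powr (DIM('a) / 2) * exp (- (norm \<xi>)\<^sup>2 / (2 * a)))" (is ?E)
proof -
  let ?g = "\<lambda>b x. cis (- (x * (\<xi> \<bullet> b))) * of_real (exp (- a * x\<^sup>2 / 2))"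
  interpret product_sigma_finite "\<lambda>_::'a. lborel :: real measure" ..
  have prod_exp: "exp (sum f A) = (\<Prod>b\<in>A. exp (f b))" if "finite A" for f :: "'a \<Rightarrow> complex" and A
    using that by (induction A) (auto simp: exp_add)
  have eq: "cis (- (x \<bullet> \<xi>)) * of_real (exp (- a * (norm x)\<^sup>2 / 2)) = (\<Prod>b\<in>Basis. ?g b (x \<bullet> b))" for x :: 'a
  proof -
    have "cis (- (x \<bullet> \<xi>)) * of_real (exp (- a * (norm x)\<^sup>2 / 2)) =
        exp (\<Sum>b\<in>Basis. \<i> * of_real (- ((x \<bullet> b) * (\<xi> \<bullet> b))) + of_real (- a * (x \<bullet> b)\<^sup>2 / 2))"
    proof -
      have "(\<Sum>b\<in>Basis. \<i> * of_real (- ((x \<bullet> b) * (\<xi> \<bullet> b))) + of_real (- a * (x \<bullet> b)\<^sup>2 / 2)) =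
          \<i> * of_real (- (\<Sum>b\<in>Basis. (x \<bullet> b) * (\<xi> \<bullet> b))) + of_real (- a * (\<Sum>b\<in>Basis. (x \<bullet> b) * (x \<bullet> b)) / 2)"
        by (simp add: sum.distrib sum_subtractf sum_negf sum_distrib_left sum_divide_distrib power2_eq_square mult.assoc)
      also have "\<dots> = \<i> * of_real (- (x \<bullet> \<xi>)) + of_real (- a * (norm x)\<^sup>2 / 2)"
        by (simp only: euclidean_inner[symmetric] power2_norm_eq_inner)
      finally show ?thesis by (simp only: exp_add cis_conv_exp exp_of_real)
    qed
    also have "\<dots> = (\<Prod>b\<in>Basis. ?g b (x \<bullet> b))"
      by (subst prod_exp, simp, intro prod.cong refl) (simp only: exp_add cis_conv_exp exp_of_real)
    finally show ?thesis .
  qed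
  have meas: "(\<lambda>f. \<Sum>b\<in>Basis. f b *\<^sub>R b) \<in> (\<Pi>\<^sub>M b\<in>(Basis::'a set). lborel) \<rightarrow>\<^sub>M borel"
    by measurable
  have gi: "integrable lborel (?g b)" for b by (rule gaussian_transform_real(1)[OF a])
  have gm: "(\<lambda>x. (\<Prod>b\<in>(Basis :: 'a set). ?g b (x \<bullet> b))) \<in> borel_measurable borel" by measurable
  have eq': "(\<Prod>b\<in>Basis. ?g b ((\<Sum>c\<in>Basis. f c *\<^sub>R c) \<bullet> b)) = (\<Prod>b\<in>Basis. ?g b (f b))" for f :: "'a \<Rightarrow> real"
    by (intro prod.cong refl) (simp add: inner_sum_left_Basis)
  show ?I
    unfolding eq by (subst lborel_eq, subst integrable_distr_eq[OF meas gm])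
      (simp only: eq', rule product_integrable_prod[OF finite_Basis gi])
  have "(LINT x|lborel. (\<Prod>b\<in>(Basis :: 'a set). ?g b (x \<bullet> b))) = (\<Prod>b\<in>Basis. (LINT x|lborel. ?g b x))"
    by (subst lborel_eq, subst integral_distr[OF meas gm])
      (simp only: eq', rule product_integral_prod[OF finite_Basis gi])
  also have "\<dots> = (\<Prod>b\<in>Basis. of_real (sqrt (2 * pi / a) * exp (- (\<xi> \<bullet> b)\<^sup>2 / (2 * a))))"
    by (intro prod.cong refl gaussian_transform_real[OF a])
  also have "\<dots> = of_real (sqrt (2 * pi / a) ^ DIM('a) * exp (\<Sum>b\<in>(Basis::'a set). - (\<xi> \<bullet> b)\<^sup>2 / (2 * a)))"
    by (simp add: exp_sum prod.distrib)
  also have "sqrt (2 * pi / a) ^ DIM('a) = (2 * pi / a) powr (DIM('a) / 2)"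
    using a by (simp add: powr_half_sqrt[symmetric] powr_powr flip: powr_realpow)
  also have "(\<Sum>b\<in>(Basis::'a set). - (\<xi> \<bullet> b)\<^sup>2 / (2 * a)) = - (norm \<xi>)\<^sup>2 / (2 * a)"
    unfolding power2_norm_eq_inner euclidean_inner[of \<xi> \<xi>]
    by (simp add: sum_negf sum_divide_distrib power2_eq_square)
  finally show ?E unfolding eq .
qed

lemma gaussian_integral:
  fixes a :: real
  assumes a: "a > 0"
  shows "integrable lborel (\<lambda>x::'a::euclidean_space. exp (- a * (norm x)\<^sup>2 / 2))" (is ?I)
    and "(LINT x::'a|lborel. exp (- a * (norm x)\<^sup>2 / 2)) = (2 * pi / a) powr (DIM('a) / 2)" (is ?E)
proof -
  have *: "integrable lborel (\<lambda>x::'a. complex_of_real (exp (- a * (norm x)\<^sup>2 / 2)))"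
    using gaussian_transform(1)[OF a, of "0::'a"] by simp
  then show ?I by (simp only: complex_of_real_integrable_eq)
  have "complex_of_real (LINT x::'a|lborel. exp (- a * (norm x)\<^sup>2 / 2)) = of_real ((2 * pi / a) powr (DIM('a) / 2))"
    using gaussian_transform(2)[OF a, of "0::'a"] by (simp del: of_real_exp exp_of_real flip: integral_complex_of_real)
  then show ?E by (simp only: of_real_eq_iff)
qed

subsection \<open>The Fourier integral and the Plancherel identity\<close>

abbreviation fourier_const :: "'n::finite itself \<Rightarrow> real" where
  "fourier_const _ \<equiv> (2 * pi) powr (- real CARD('n) / 2)"

lemma norm_fourier_integral_le:
  fixes f :: "real^'n \<Rightarrow> complex"
  shows "norm (fourier_integral f \<xi>) \<le> fourier_const TYPE('n) * (LINT x|lborel. norm (f x))"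
proof -
  have "norm (LINT x|lborel. cis (- (x \<bullet> \<xi>)) * f x) \<le> (LINT x|lborel. norm (cis (- (x \<bullet> \<xi>)) * f x))"
    by (rule integral_norm_bound)
  then show ?thesis unfolding fourier_integral_def by (simp add: norm_mult)
qed

lemma borel_measurable_fourier_integral [measurable]:
  fixes f :: "real^'n \<Rightarrow> complex"
  assumes [measurable]: "f \<in> borel_measurable borel"
  shows "fourier_integral f \<in> borel_measurable borel"
  unfolding fourier_integral_def[abs_def] by measurable

lemma integrable_cis_mult:
  fixes f :: "real^'n \<Rightarrow> complex"
  assumes "integrable lborel f"
  shows "integrable lborel (\<lambda>x. cis (- (x \<bullet> \<xi>)) * f x)"
proof -
  have [measurable]: "f \<in> borel_measurable borel" using assms by (auto dest: borel_measurable_integrable)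
  show ?thesis using assms by (rule Bochner_Integration.integrable_bound) (auto simp: norm_mult)
qed

lemma fourier_integral_add:
  "integrable lborel f \<Longrightarrow> integrable lborel g \<Longrightarrow>
    fourier_integral (\<lambda>x. f x + g x) \<xi> = fourier_integral f \<xi> + fourier_integral g \<xi>"
  unfolding fourier_integral_def by (simp add: distrib_left integrable_cis_mult)

lemma fourier_integral_diff:
  "integrable lborel f \<Longrightarrow> integrable lborel g \<Longrightarrow>
    fourier_integral (\<lambda>x. f x - g x) \<xi> = fourier_integral f \<xi> - fourier_integral g \<xi>"
  unfolding fourier_integral_def by (simp add: right_diff_distrib integrable_cis_mult)

lemma fourier_integral_cmult: "fourier_integral (\<lambda>x. c * f x) \<xi> = c * fourier_integral f \<xi>"
proof -
  have "(LINT x|lborel. cis (- (x \<bullet> \<xi>)) * (c * f x)) = (LINT x|lborel. c * (cis (- (x \<bullet> \<xi>)) * f x))"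
    by (simp add: mult_ac)
  then show ?thesis unfolding fourier_integral_def by (simp add: mult_ac)
qed

lemma fourier_integral_cong_AE:
  fixes f g :: "real^'n \<Rightarrow> complex"
  assumes [measurable]: "f \<in> borel_measurable borel" "g \<in> borel_measurable borel"
    and "AE x in lborel. f x = g x"
  shows "fourier_integral f = fourier_integral g"
proof
  fix \<xi> show "fourier_integral f \<xi> = fourier_integral g \<xi>"
    unfolding fourier_integral_def using assms(3)
    by (intro arg_cong2[where f="(*)"] refl integral_cong_AE) auto
qed

lemma fourier_integral_cnj: "cnj (fourier_integral f \<xi>) = fourier_integral (\<lambda>x. cnj (f x)) (- \<xi>)"
proof -
  have "cnj (LINT x|lborel. cis (- (x \<bullet> \<xi>)) * f x) = (LINT x|lborel. cis (x \<bullet> \<xi>) * cnj (f x))"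
    unfolding Bochner_Integration.integral_cnj[symmetric] by (simp add: cis_cnj)
  then show ?thesis by (simp add: fourier_integral_def)
qed

lemma fourier_integral_reflect:
  fixes f :: "real^'n \<Rightarrow> complex"
  assumes [measurable]: "f \<in> borel_measurable borel"
  shows "fourier_integral (\<lambda>x. f (- x)) \<xi> = fourier_integral f (- \<xi>)"
  unfolding fourier_integral_def
proof -
  have "(\<lambda>x. cis (x \<bullet> \<xi>) * f x) \<in> borel_measurable borel" by measurable
  from integral_lborel_uminus[OF this]
  show "complex_of_real (fourier_const TYPE('n)) * (LINT x|lborel. cis (- (x \<bullet> \<xi>)) * f (- x)) =
      complex_of_real (fourier_const TYPE('n)) * (LINT x|lborel. cis (- (x \<bullet> - \<xi>)) * f x)" by simp
qed

text \<open>Fubini, with a multiple of \<open>norm (f x) * norm (g \<xi>)\<close> as majorant: the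
  kernel is symmetric in \<open>x\<close> and \<open>\<xi>\<close>. Both the Gaussian energy
  identity and the adjoint of the transform come from here.\<close>

lemma fourier_integral_mult_formula:
  fixes f g :: "real^'n \<Rightarrow> complex"
  assumes f: "integrable lborel f" and g: "integrable lborel g"
  shows "(LINT \<xi>|lborel. fourier_integral f \<xi> * g \<xi>) = (LINT x|lborel. f x * fourier_integral g x)"
proof -
  have [measurable]: "f \<in> borel_measurable borel" "g \<in> borel_measurable borel"
    using f g by (auto dest: borel_measurable_integrable)
  let ?c = "complex_of_real (fourier_const TYPE('n))"
  have "(LINT \<xi>|lborel. fourier_integral f \<xi> * g \<xi>) =
      (LINT \<xi>|lborel. LINT x|lborel. ?c * (cis (- (x \<bullet> \<xi>)) * f x * g \<xi>))"
    unfolding fourier_integral_def mult.assoc integral_mult_right_zero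
    by (simp add: mult.assoc flip: integral_mult_left_zero)
  also have "\<dots> = (LINT x|lborel. LINT \<xi>|lborel. ?c * (cis (- (x \<bullet> \<xi>)) * f x * g \<xi>))"
    by (rule integral_swap_bound[of _ "\<lambda>\<xi>. fourier_const TYPE('n) * norm (g \<xi>)" "\<lambda>x. norm (f x)"])
      (auto intro!: integrable_norm integrable_mult_right f g simp: norm_mult)
  also have "\<dots> = (LINT x|lborel. f x * fourier_integral g x)"
  proof (intro Bochner_Integration.integral_cong refl)
    fix x
    have "(LINT \<xi>|lborel. ?c * (cis (- (x \<bullet> \<xi>)) * f x * g \<xi>)) =
        (LINT \<xi>|lborel. (?c * f x) * (cis (- (\<xi> \<bullet> x)) * g \<xi>))"
      by (simp add: mult_ac inner_commute)
    also have "\<dots> = (?c * f x) * (LINT \<xi>|lborel. cis (- (\<xi> \<bullet> x)) * g \<xi>)"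
      by (rule integral_mult_right_zero)
    finally show "(LINT \<xi>|lborel. ?c * (cis (- (x \<bullet> \<xi>)) * f x * g \<xi>)) = f x * fourier_integral g x"
      unfolding fourier_integral_def by (simp add: mult_ac)
  qed
  finally show ?thesis .
qed

lemma borel_measurable_cnj [measurable]: "cnj \<in> borel_measurable borel"
  by (intro borel_measurable_continuous_onI continuous_intros)

text \<open>The standard normal density. Scaled by \<open>s\<close> it acts as an approximate
  identity.\<close>

definition gauss :: "real^'n \<Rightarrow> real" where
  "gauss z = fourier_const TYPE('n) * exp (- (norm z)\<^sup>2 / 2)"

lemma gauss_nonneg: "0 \<le> gauss z" by (simp add: gauss_def)

lemma borel_measurable_gauss [measurable]: "gauss \<in> borel_measurable borel"
  unfolding gauss_def[abs_def] by measurable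

lemma integrable_gauss: "integrable lborel (gauss :: real^'n \<Rightarrow> real)"
  and integral_gauss: "(LINT z|lborel. gauss (z :: real^'n)) = 1"
  using gaussian_integral[of 1, where 'a="real^'n"]
  unfolding gauss_def[abs_def] by (simp_all add: flip: powr_add)

lemma nn_integral_gauss: "(\<integral>\<^sup>+z. gauss (z :: real^'n) \<partial>lborel) = 1"
  by (subst nn_integral_eq_integral) (auto simp: integrable_gauss integral_gauss gauss_nonneg)

text \<open>
  Two applications of the multiplication formula turn the Gaussian-regularised energy of the
  transform into a mollified inner product on the physical side.
\<close>

lemma fourier_integral_gauss_energy:
  fixes f :: "real^'n \<Rightarrow> complex"
  assumes f: "integrable lborel f" and s: "s > 0"
  shows "(LINT \<xi>|lborel. fourier_integral f \<xi> * (of_real (exp (- s\<^sup>2 * (norm \<xi>)\<^sup>2 / 2)) * cnj (fourier_integral f \<xi>)))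
    = (LINT x|lborel. f x * (LINT z|lborel. of_real (gauss z) * cnj (f (x + s *\<^sub>R z))))"
proof -
  have [measurable]: "f \<in> borel_measurable borel" using f by (auto dest: borel_measurable_integrable)
  let ?\<gamma> = "\<lambda>\<xi>::real^'n. complex_of_real (exp (- s\<^sup>2 * (norm \<xi>)\<^sup>2 / 2))"
  let ?c = "fourier_const TYPE('n)"
  have s2: "s\<^sup>2 > 0" using s by simp
  have \<gamma>: "integrable lborel (\<lambda>\<xi>::real^'n. exp (- s\<^sup>2 * (norm \<xi>)\<^sup>2 / 2))"
    by (rule gaussian_integral(1)[OF s2])
  have g: "integrable lborel (\<lambda>\<xi>. ?\<gamma> \<xi> * cnj (fourier_integral f \<xi>))"
  proof (rule Bochner_Integration.integrable_bound[OF integrable_mult_right[OF \<gamma>]])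
    show "AE \<xi> in lborel. norm (?\<gamma> \<xi> * cnj (fourier_integral f \<xi>)) \<le>
        norm ((?c * (LINT x|lborel. norm (f x))) * exp (- s\<^sup>2 * (norm \<xi>)\<^sup>2 / 2))"
      using norm_fourier_integral_le[of f]
      by (auto simp: norm_mult abs_mult mult.commute intro!: mult_left_mono)
  qed measurable
  have "fourier_integral (\<lambda>\<xi>. ?\<gamma> \<xi> * cnj (fourier_integral f \<xi>)) x =
      (LINT z|lborel. of_real (gauss z) * cnj (f (x + s *\<^sub>R z)))" for x
  proof -
    \<comment> \<open>The transform of the conjugate reflection of \<open>f\<close> is the conjugate
      of the transform of \<open>f\<close>, so the multiplication formula applies a second time, now
      with the modulated Gaussian \<open>?k\<close>.\<close>
    define h where "h y = cnj (f (- y))" for y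
    have [measurable]: "h \<in> borel_measurable borel" unfolding h_def[abs_def] by measurable
    have h: "integrable lborel h" unfolding h_def[abs_def]
      using integrable_lborel_uminus[OF f] by simp
    have Fh: "fourier_integral h \<xi> = cnj (fourier_integral f \<xi>)" for \<xi>
      unfolding h_def[abs_def] fourier_integral_cnj
      using fourier_integral_reflect[of "\<lambda>x. cnj (f x)" \<xi>] by simp
    let ?k = "\<lambda>\<xi>. complex_of_real ?c * (cis (- (\<xi> \<bullet> x)) * ?\<gamma> \<xi>)"
    have k: "integrable lborel ?k"
      by (intro integrable_mult_right gaussian_transform(1)[OF s2])
    have Fk: "fourier_integral ?k y = of_real (?c * ?c * (2 * pi / s\<^sup>2) powr (CARD('n) / 2) * exp (- (norm (x + y))\<^sup>2 / (2 * s\<^sup>2)))" for y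
    proof -
      have "fourier_integral ?k y = of_real ?c * of_real ?c * (LINT \<xi>|lborel. cis (- (\<xi> \<bullet> (x + y))) * ?\<gamma> \<xi>)"
        unfolding fourier_integral_cmult unfolding fourier_integral_def
        by (simp add: mult.assoc[symmetric] cis_mult inner_add_right add.commute)
      also have "(LINT \<xi>|lborel. cis (- (\<xi> \<bullet> (x + y))) * ?\<gamma> \<xi>) =
          of_real ((2 * pi / s\<^sup>2) powr (CARD('n) / 2) * exp (- (norm (x + y))\<^sup>2 / (2 * s\<^sup>2)))"
        using gaussian_transform(2)[OF s2, of "x + y"] by simp
      finally show ?thesis by simp
    qed
    have "fourier_integral (\<lambda>\<xi>. ?\<gamma> \<xi> * cnj (fourier_integral f \<xi>)) x =
        (LINT \<xi>|lborel. of_real ?c * (cis (- (\<xi> \<bullet> x)) * (?\<gamma> \<xi> * cnj (fourier_integral f \<xi>))))"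
      unfolding fourier_integral_def by simp
    also have "\<dots> = (LINT \<xi>|lborel. fourier_integral h \<xi> * ?k \<xi>)"
      by (simp only: Fh mult_ac)
    also have "\<dots> = (LINT y|lborel. h y * fourier_integral ?k y)"
      by (rule fourier_integral_mult_formula[OF h k])
    also have "\<dots> = (LINT y|lborel. h y * of_real (?c * ?c * (2 * pi / s\<^sup>2) powr (CARD('n) / 2) * exp (- (norm (x + y))\<^sup>2 / (2 * s\<^sup>2))))"
      (is "_ = (LINT y|lborel. ?F y)")
      by (simp only: Fk)
    \<comment> \<open>The substitution \<open>y = - x - s z\<close> brings the Gaussian to unit
      width, and \<open>h\<close> turns \<open>- x - s z\<close> into
      \<open>cnj (f (x + s z))\<close>: a mollification of \<open>cnj f\<close> at \<open>x\<close>
      appears.\<close>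
    also have "\<dots> = s ^ CARD('n) *\<^sub>R (LINT z|lborel. ?F (- x + (- s) *\<^sub>R z))"
    proof -
      have F: "?F \<in> borel_measurable borel" by measurable
      show ?thesis using lborel_scale_integral[OF _ F, of "-s" "-x"] s by simp
    qed
    also have "\<dots> = (LINT z|lborel. s ^ CARD('n) *\<^sub>R ?F (- x + (- s) *\<^sub>R z))"
      by (rule integral_scaleR_right[symmetric])
    also have "\<dots> = (LINT z|lborel. of_real (gauss z) * cnj (f (x + s *\<^sub>R z)))"
    proof (intro Bochner_Integration.integral_cong refl)
      fix z :: "real^'n"
      have "(2 * pi / s\<^sup>2) powr (CARD('n) / 2) = (2 * pi) powr (CARD('n) / 2) / (s\<^sup>2) powr (CARD('n) / 2)"
        using s by (simp add: powr_divide)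
      also have "(s\<^sup>2) powr (CARD('n) / 2) = s ^ CARD('n)"
        using s by (simp add: powr_powr flip: powr_numeral powr_realpow)
      finally have "s ^ CARD('n) * (?c * ?c * (2 * pi / s\<^sup>2) powr (CARD('n) / 2)) = ?c * (?c * (2 * pi) powr (CARD('n) / 2))"
        using s by simp
      also have "?c * (2 * pi) powr (CARD('n) / 2) = 1"
        by (simp flip: powr_add)
      finally have c: "s ^ CARD('n) * (?c * ?c * (2 * pi / s\<^sup>2) powr (CARD('n) / 2)) = ?c" by simp
      have e: "(norm (x + (- x + (- s) *\<^sub>R z)))\<^sup>2 / (2 * s\<^sup>2) = (norm z)\<^sup>2 / 2"
        using s by (simp add: power_mult_distrib)
      have "s ^ CARD('n) *\<^sub>R ?F (- x + (- s) *\<^sub>R z) = cnj (f (x + s *\<^sub>R z)) *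
          of_real (s ^ CARD('n) * (?c * ?c * (2 * pi / s\<^sup>2) powr (CARD('n) / 2)) * exp (- ((norm (x + (- x + (- s) *\<^sub>R z)))\<^sup>2 / (2 * s\<^sup>2))))"
        by (simp add: h_def scaleR_conv_of_real[where 'a=complex] add.commute mult_ac)
      also have "\<dots> = of_real (gauss z) * cnj (f (x + s *\<^sub>R z))"
        unfolding c e gauss_def by (simp add: mult_ac)
      finally show "s ^ CARD('n) *\<^sub>R ?F (- x + (- s) *\<^sub>R z) = of_real (gauss z) * cnj (f (x + s *\<^sub>R z))" .
    qed
    finally show ?thesis .
  qed
  then show ?thesis
    using fourier_integral_mult_formula[OF f g] by simp
qed

lemma gauss_energy_limit: "(\<lambda>k::nat. exp (- (1 / real (Suc k))\<^sup>2 * r / 2)) \<longlonglongrightarrow> 1"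
proof -
  have "(\<lambda>k. 1 / real (Suc k)) \<longlonglongrightarrow> 0" by (rule LIMSEQ_Suc[OF lim_1_over_n])
  then have "(\<lambda>k. exp (- (1 / real (Suc k))\<^sup>2 * r / 2)) \<longlonglongrightarrow> exp (- 0\<^sup>2 * r / 2)"
    by (intro tendsto_intros) auto
  then show ?thesis by simp
qed

text \<open>In the mollified inner product \<open>2 a b \<le> a\<^sup>2 + b\<^sup>2\<close>,
  translation invariance and the unit mass of \<open>gauss\<close> give a bound that is the same for
  every \<open>s\<close>.\<close>

lemma fourier_integral_gauss_energy_le:
  fixes f :: "real^'n \<Rightarrow> complex"
  assumes f: "integrable lborel f" and f2: "square_integrable f" and s: "s > 0"
  shows "(\<integral>\<^sup>+\<xi>. ennreal (exp (- s\<^sup>2 * (norm \<xi>)\<^sup>2 / 2) * (norm (fourier_integral f \<xi>))\<^sup>2) \<partial>lborel)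
    \<le> (\<integral>\<^sup>+x. (norm (f x))\<^sup>2 \<partial>lborel)"
proof -
  have [measurable]: "f \<in> borel_measurable borel" using f by (auto dest: borel_measurable_integrable)
  let ?e = "\<lambda>\<xi>. exp (- s\<^sup>2 * (norm \<xi>)\<^sup>2 / 2) * (norm (fourier_integral f \<xi>))\<^sup>2"
  let ?I = "\<lambda>x. LINT z|lborel. of_real (gauss z) * cnj (f (x + s *\<^sub>R z))"
  let ?B = "fourier_const TYPE('n) * (LINT x|lborel. norm (f x))"
  have s2: "s\<^sup>2 > 0" using s by simp
  have ei: "integrable lborel ?e"
  proof (rule Bochner_Integration.integrable_bound[OF integrable_mult_right[OF gaussian_integral(1)[OF s2]]])
    show "AE \<xi> in lborel. norm (?e \<xi>) \<le> norm (?B\<^sup>2 * exp (- s\<^sup>2 * (norm \<xi>)\<^sup>2 / 2))"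
      using norm_fourier_integral_le[of f]
      by (auto simp: abs_mult mult.commute intro!: mult_left_mono power_mono)
  qed measurable
  have "complex_of_real (LINT \<xi>|lborel. ?e \<xi>) = (LINT \<xi>|lborel. of_real (?e \<xi>))"
    by (simp only: integral_complex_of_real)
  also have "\<dots> = (LINT \<xi>|lborel. fourier_integral f \<xi> * (of_real (exp (- s\<^sup>2 * (norm \<xi>)\<^sup>2 / 2)) * cnj (fourier_integral f \<xi>)))"
    by (intro Bochner_Integration.integral_cong refl)
      (simp add: complex_norm_square mult_ac del: of_real_power)
  also have "\<dots> = (LINT x|lborel. f x * ?I x)"
    by (rule fourier_integral_gauss_energy[OF f s])
  finally have eq: "complex_of_real (LINT \<xi>|lborel. ?e \<xi>) = (LINT x|lborel. f x * ?I x)" .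
  have "(\<integral>\<^sup>+\<xi>. ?e \<xi> \<partial>lborel) = ennreal (LINT \<xi>|lborel. ?e \<xi>)"
    by (intro nn_integral_eq_integral ei) auto
  also have "(LINT \<xi>|lborel. ?e \<xi>) = norm (complex_of_real (LINT \<xi>|lborel. ?e \<xi>))"
    by (simp add: integral_nonneg_AE)
  also have "\<dots> \<le> (\<integral>\<^sup>+x. norm (f x * ?I x) \<partial>lborel)"
    unfolding eq by (cases "integrable lborel (\<lambda>x. f x * ?I x)")
      (auto intro: integral_norm_bound_ennreal simp: not_integrable_integral_eq)
  also have "\<dots> \<le> (\<integral>\<^sup>+x. \<integral>\<^sup>+z. ennreal (gauss z * ((norm (f x))\<^sup>2 + (norm (f (x + s *\<^sub>R z)))\<^sup>2) / 2) \<partial>lborel \<partial>lborel)"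
  proof (intro nn_integral_mono)
    fix x
    have "ennreal (norm (f x * ?I x)) = ennreal (norm (LINT z|lborel. f x * (of_real (gauss z) * cnj (f (x + s *\<^sub>R z)))))"
      by simp
    also have "\<dots> \<le> (\<integral>\<^sup>+z. norm (f x * (of_real (gauss z) * cnj (f (x + s *\<^sub>R z)))) \<partial>lborel)"
      by (cases "integrable lborel (\<lambda>z. f x * (of_real (gauss z) * cnj (f (x + s *\<^sub>R z))))")
        (auto intro: integral_norm_bound_ennreal simp: not_integrable_integral_eq simp del: integral_mult_right_zero)
    also have "\<dots> \<le> (\<integral>\<^sup>+z. ennreal (gauss z * ((norm (f x))\<^sup>2 + (norm (f (x + s *\<^sub>R z)))\<^sup>2) / 2) \<partial>lborel)"
    proof (intro nn_integral_mono ennreal_leI)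
      fix z
      have "norm (f x) * norm (f (x + s *\<^sub>R z)) \<le> ((norm (f x))\<^sup>2 + (norm (f (x + s *\<^sub>R z)))\<^sup>2) / 2"
        using sum_squares_bound[of "norm (f x)" "norm (f (x + s *\<^sub>R z))"] by (simp add: mult.assoc)
      from mult_left_mono[OF this gauss_nonneg[of z]]
      show "norm (f x * (of_real (gauss z) * cnj (f (x + s *\<^sub>R z)))) \<le> gauss z * ((norm (f x))\<^sup>2 + (norm (f (x + s *\<^sub>R z)))\<^sup>2) / 2"
        by (simp add: norm_mult gauss_nonneg mult_ac)
    qed
    finally show "ennreal (norm (f x * ?I x)) \<le> (\<integral>\<^sup>+z. ennreal (gauss z * ((norm (f x))\<^sup>2 + (norm (f (x + s *\<^sub>R z)))\<^sup>2) / 2) \<partial>lborel)" .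
  qed
  also have "\<dots> = (\<integral>\<^sup>+z. \<integral>\<^sup>+x. ennreal (gauss z * ((norm (f x))\<^sup>2 + (norm (f (x + s *\<^sub>R z)))\<^sup>2) / 2) \<partial>lborel \<partial>lborel)"
    by (rule lborel_pair.Fubini'[symmetric]) measurable
  also have "\<dots> = (\<integral>\<^sup>+z. ennreal (gauss (z::real^'n)) * (\<integral>\<^sup>+x. (norm (f x))\<^sup>2 \<partial>lborel) \<partial>lborel)"
  proof (intro nn_integral_cong)
    fix z :: "real^'n"
    have fin: "(\<integral>\<^sup>+x. (norm (f x))\<^sup>2 \<partial>lborel) < \<infinity>"
      using f2 by (simp add: square_integrable_def integrable_iff_bounded)
    have shift: "(\<integral>\<^sup>+x. ennreal ((norm (f (x + s *\<^sub>R z)))\<^sup>2) \<partial>lborel) = (\<integral>\<^sup>+x. ennreal ((norm (f x))\<^sup>2) \<partial>lborel)"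
    proof -
      have "(\<lambda>x. ennreal ((norm (f x))\<^sup>2)) \<in> borel_measurable borel" by measurable
      from lborel_scale_nn_integral[OF _ this, of 1 "s *\<^sub>R z"] show ?thesis by (simp add: add.commute)
    qed
    have "(\<integral>\<^sup>+x. ennreal (gauss z * ((norm (f x))\<^sup>2 + (norm (f (x + s *\<^sub>R z)))\<^sup>2) / 2) \<partial>lborel) =
        (\<integral>\<^sup>+x. ennreal (gauss z / 2) * (ennreal ((norm (f x))\<^sup>2) + ennreal ((norm (f (x + s *\<^sub>R z)))\<^sup>2)) \<partial>lborel)"
      by (intro nn_integral_cong) (simp add: gauss_nonneg flip: ennreal_mult ennreal_plus)
    also have "\<dots> = ennreal (gauss z / 2) * ((\<integral>\<^sup>+x. (norm (f x))\<^sup>2 \<partial>lborel) + (\<integral>\<^sup>+x. (norm (f x))\<^sup>2 \<partial>lborel))"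
      by (subst nn_integral_cmult, measurable, subst nn_integral_add, auto simp: shift)
    also have "\<dots> = ennreal (gauss z) * (\<integral>\<^sup>+x. (norm (f x))\<^sup>2 \<partial>lborel)"
    proof -
      obtain m where m: "(\<integral>\<^sup>+x. (norm (f x))\<^sup>2 \<partial>lborel) = ennreal m" "0 \<le> m"
        using fin by (metis ennreal_cases infinity_ennreal_def less_irrefl)
      show ?thesis unfolding m using m(2) gauss_nonneg[of z] by (simp flip: ennreal_mult ennreal_plus)
    qed
    finally show "(\<integral>\<^sup>+x. ennreal (gauss z * ((norm (f x))\<^sup>2 + (norm (f (x + s *\<^sub>R z)))\<^sup>2) / 2) \<partial>lborel) =
      ennreal (gauss z) * (\<integral>\<^sup>+x. (norm (f x))\<^sup>2 \<partial>lborel)" .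
  qed
  also have "\<dots> = (\<integral>\<^sup>+x. (norm (f x))\<^sup>2 \<partial>lborel)"
    by (subst nn_integral_multc) (auto simp: nn_integral_gauss)
  finally show ?thesis .
qed

text \<open>Fatou's lemma as the Gaussian regularisation is removed. It yields an inequality only,
  which suffices to extend the transform by continuity; equality is recovered later from a dense
  class.\<close>

lemma square_integrable_fourier_integral:
  fixes f :: "real^'n \<Rightarrow> complex"
  assumes f: "integrable lborel f" and f2: "square_integrable f"
  shows "square_integrable (fourier_integral f)" (is ?S)
    and "norm (abs_L2 (fourier_integral f)) \<le> norm (abs_L2 f)" (is ?N)
proof -
  have [measurable]: "f \<in> borel_measurable borel" using f by (auto dest: borel_measurable_integrable)
  let ?e = "\<lambda>k \<xi>. ennreal (exp (- (1 / real (Suc k))\<^sup>2 * (norm \<xi>)\<^sup>2 / 2) * (norm (fourier_integral f \<xi>))\<^sup>2)"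
  have "(\<integral>\<^sup>+\<xi>. ennreal ((norm (fourier_integral f \<xi>))\<^sup>2) \<partial>lborel) = (\<integral>\<^sup>+\<xi>. liminf (\<lambda>k. ?e k \<xi>) \<partial>lborel)"
  proof (intro nn_integral_cong)
    fix \<xi>
    have "(\<lambda>k. ?e k \<xi>) \<longlonglongrightarrow> ennreal (1 * (norm (fourier_integral f \<xi>))\<^sup>2)"
      by (intro tendsto_ennrealI tendsto_mult gauss_energy_limit tendsto_const)
    then show "ennreal ((norm (fourier_integral f \<xi>))\<^sup>2) = liminf (\<lambda>k. ?e k \<xi>)"
      by (intro lim_imp_Liminf[symmetric]) auto
  qed
  also have "\<dots> \<le> liminf (\<lambda>k. \<integral>\<^sup>+\<xi>. ?e k \<xi> \<partial>lborel)"
    by (rule nn_integral_liminf) measurable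
  also have "\<dots> \<le> (\<integral>\<^sup>+x. (norm (f x))\<^sup>2 \<partial>lborel)"
    by (intro Liminf_le always_eventually allI fourier_integral_gauss_energy_le[OF f f2]) auto
  finally have le: "(\<integral>\<^sup>+\<xi>. ennreal ((norm (fourier_integral f \<xi>))\<^sup>2) \<partial>lborel) \<le> (\<integral>\<^sup>+x. (norm (f x))\<^sup>2 \<partial>lborel)" .
  also have "\<dots> < \<infinity>"
    using f2 by (simp add: square_integrable_def integrable_iff_bounded)
  finally show S: ?S
    by (auto simp: square_integrable_def intro!: integrableI_bounded)
  have "ennreal ((norm (abs_L2 (fourier_integral f)))\<^sup>2) = (\<integral>\<^sup>+\<xi>. ennreal ((norm (fourier_integral f \<xi>))\<^sup>2) \<partial>lborel)"
    unfolding norm_abs_L2_sq[OF S] using S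
    by (intro nn_integral_eq_integral[symmetric]) (auto simp: square_integrable_def)
  also note le
  also have "(\<integral>\<^sup>+x. (norm (f x))\<^sup>2 \<partial>lborel) = ennreal ((norm (abs_L2 f))\<^sup>2)"
    unfolding norm_abs_L2_sq[OF f2] using f2
    by (intro nn_integral_eq_integral) (auto simp: square_integrable_def)
  finally have "(norm (abs_L2 (fourier_integral f)))\<^sup>2 \<le> (norm (abs_L2 f))\<^sup>2"
    by (subst (asm) ennreal_le_iff) auto
  then show ?N by (rule power2_le_imp_le) simp
qed

text \<open>For continuous bounded \<open>f\<close> the mollifications converge pointwise and
  boundedly, so dominated convergence applies to both sides of the Gaussian energy identity and
  gives equality.\<close>

lemma plancherel_continuous:
  fixes f :: "real^'n \<Rightarrow> complex"
  assumes f: "integrable lborel f" and cont: "continuous_on UNIV f" and bd: "\<And>x. norm (f x) \<le> B"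
    and f2: "square_integrable f"
  shows "norm (abs_L2 (fourier_integral f)) = norm (abs_L2 f)"
proof -
  have [measurable]: "f \<in> borel_measurable borel" using f by (auto dest: borel_measurable_integrable)
  note S = square_integrable_fourier_integral(1)[OF f f2]
  have B: "0 \<le> B" using bd[of 0] norm_ge_zero order_trans by blast
  let ?s = "\<lambda>k. 1 / real (Suc k)"
  let ?I = "\<lambda>k x. LINT z|lborel. of_real (gauss z) * cnj (f (x + ?s k *\<^sub>R z))"
  let ?L = "\<lambda>k. LINT \<xi>|lborel. fourier_integral f \<xi> * (of_real (exp (- (?s k)\<^sup>2 * (norm \<xi>)\<^sup>2 / 2)) * cnj (fourier_integral f \<xi>))"
  have 1: "?L \<longlonglongrightarrow> (LINT \<xi>|lborel. of_real ((norm (fourier_integral f \<xi>))\<^sup>2))"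
  proof (rule integral_dominated_convergence)
    show "integrable lborel (\<lambda>\<xi>. (norm (fourier_integral f \<xi>))\<^sup>2)" using S by (simp add: square_integrable_def)
    show "AE \<xi> in lborel. (\<lambda>k. fourier_integral f \<xi> * (of_real (exp (- (?s k)\<^sup>2 * (norm \<xi>)\<^sup>2 / 2)) * cnj (fourier_integral f \<xi>))) \<longlonglongrightarrow> of_real ((norm (fourier_integral f \<xi>))\<^sup>2)"
    proof (intro AE_I2)
      fix \<xi> :: "real^'n"
      have "(\<lambda>k. fourier_integral f \<xi> * (of_real (exp (- (?s k)\<^sup>2 * (norm \<xi>)\<^sup>2 / 2)) * cnj (fourier_integral f \<xi>))) \<longlonglongrightarrow> fourier_integral f \<xi> * (of_real 1 * cnj (fourier_integral f \<xi>))"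
        by (intro tendsto_mult tendsto_const tendsto_of_real gauss_energy_limit)
      then show "(\<lambda>k. fourier_integral f \<xi> * (of_real (exp (- (?s k)\<^sup>2 * (norm \<xi>)\<^sup>2 / 2)) * cnj (fourier_integral f \<xi>))) \<longlonglongrightarrow> of_real ((norm (fourier_integral f \<xi>))\<^sup>2)"
        by (simp add: complex_norm_square del: of_real_power)
    qed
    show "AE \<xi> in lborel. norm (fourier_integral f \<xi> * (of_real (exp (- (?s k)\<^sup>2 * (norm \<xi>)\<^sup>2 / 2)) * cnj (fourier_integral f \<xi>))) \<le> (norm (fourier_integral f \<xi>))\<^sup>2" for k
    proof (intro AE_I2)
      fix \<xi> :: "real^'n"
      have "exp (- (?s k)\<^sup>2 * (norm \<xi>)\<^sup>2 / 2) \<le> 1" by simp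
      from mult_right_mono[OF this, of "(norm (fourier_integral f \<xi>))\<^sup>2"]
      show "norm (fourier_integral f \<xi> * (of_real (exp (- (?s k)\<^sup>2 * (norm \<xi>)\<^sup>2 / 2)) * cnj (fourier_integral f \<xi>))) \<le> (norm (fourier_integral f \<xi>))\<^sup>2"
        by (simp add: norm_mult power2_eq_square mult_ac)
    qed
  qed measurable
  have 2: "?L = (\<lambda>k. LINT x|lborel. f x * ?I k x)"
    by (intro ext fourier_integral_gauss_energy[OF f]) simp
  have 3: "(\<lambda>k. LINT x|lborel. f x * ?I k x) \<longlonglongrightarrow> (LINT x|lborel. of_real ((norm (f x))\<^sup>2))"
  proof (rule integral_dominated_convergence)
    show "integrable lborel (\<lambda>x. norm (f x) * B)" using f by simp
    show "AE x in lborel. norm (f x * ?I k x) \<le> norm (f x) * B" for k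
    proof (intro AE_I2)
      fix x
      have "norm (?I k x) \<le> (LINT z|lborel. norm (of_real (gauss z) * cnj (f (x + ?s k *\<^sub>R z))))"
        by (rule integral_norm_bound)
      also have "\<dots> \<le> (LINT z|lborel. gauss (z::real^'n) * B)"
        by (rule integral_mono_AE')
          (auto intro!: mult_left_mono bd gauss_nonneg integrable_mult_left integrable_gauss simp: norm_mult gauss_nonneg B)
      also have "\<dots> = B" by (simp add: integral_gauss)
      finally show "norm (f x * ?I k x) \<le> norm (f x) * B" by (simp add: norm_mult mult_left_mono)
    qed
    show "AE x in lborel. (\<lambda>k. f x * ?I k x) \<longlonglongrightarrow> of_real ((norm (f x))\<^sup>2)"
    proof (intro AE_I2)
      fix x
      have "(\<lambda>k. ?I k x) \<longlonglongrightarrow> (LINT z|lborel. of_real (gauss (z::real^'n)) * cnj (f x))"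
      proof (rule integral_dominated_convergence)
        show "integrable lborel (\<lambda>z::real^'n. gauss z * B)" by (intro integrable_mult_left integrable_gauss)
        show "AE z in lborel. norm (of_real (gauss z) * cnj (f (x + ?s k *\<^sub>R z))) \<le> gauss z * B" for k
          by (auto intro!: mult_left_mono bd gauss_nonneg simp: norm_mult gauss_nonneg)
        show "AE z in lborel. (\<lambda>k. of_real (gauss z) * cnj (f (x + ?s k *\<^sub>R z))) \<longlonglongrightarrow> of_real (gauss z) * cnj (f x)"
        proof (intro AE_I2)
          fix z :: "real^'n"
          have "?s \<longlonglongrightarrow> 0" by (rule LIMSEQ_Suc[OF lim_1_over_n])
          then have "(\<lambda>k. x + ?s k *\<^sub>R z) \<longlonglongrightarrow> x + 0 *\<^sub>R z" by (intro tendsto_intros)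
          then have "(\<lambda>k. x + ?s k *\<^sub>R z) \<longlonglongrightarrow> x" by simp
          moreover have "isCont f x" using cont by (simp add: continuous_on_eq_continuous_at)
          ultimately have "(\<lambda>k. f (x + ?s k *\<^sub>R z)) \<longlonglongrightarrow> f x" by (rule isCont_tendsto_compose[rotated])
          then show "(\<lambda>k. of_real (gauss z) * cnj (f (x + ?s k *\<^sub>R z))) \<longlonglongrightarrow> of_real (gauss z) * cnj (f x)"
            by (intro tendsto_intros)
        qed
      qed measurable
      also have "(LINT z|lborel. of_real (gauss (z::real^'n)) * cnj (f x)) = cnj (f x)"
      proof -
        have "(LINT z|lborel. complex_of_real (gauss (z::real^'n))) = 1"
          using integral_gauss[where 'n='n] by (simp only: integral_complex_of_real of_real_1)
        then show ?thesis by simp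
      qed
      finally have "(\<lambda>k. f x * ?I k x) \<longlonglongrightarrow> f x * cnj (f x)" by (intro tendsto_intros)
      then show "(\<lambda>k. f x * ?I k x) \<longlonglongrightarrow> of_real ((norm (f x))\<^sup>2)"
        by (simp add: complex_norm_square del: of_real_power)
    qed
  qed measurable
  have "(LINT \<xi>|lborel. complex_of_real ((norm (fourier_integral f \<xi>))\<^sup>2)) = (LINT x|lborel. complex_of_real ((norm (f x))\<^sup>2))"
    by (rule LIMSEQ_unique[OF 1[unfolded 2] 3])
  then have "(norm (abs_L2 (fourier_integral f)))\<^sup>2 = (norm (abs_L2 f))\<^sup>2"
    unfolding norm_abs_L2_sq[OF S] norm_abs_L2_sq[OF f2]
    by (simp only: integral_complex_of_real of_real_eq_iff)
  then show ?thesis by simp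
qed

subsection \<open>The Fourier transform on square-integrable functions\<close>

lemma sets_borel_cball [measurable]: "cball c r \<in> sets (borel :: 'a::metric_space measure)"
  by (simp add: borel_closed)

lemma integrable_indicator_cball: "integrable lborel (indicator (cball (0::'a::euclidean_space) r) :: _ \<Rightarrow> real)"
  by (intro integrable_real_indicator emeasure_bounded_finite) auto

text \<open>
  Functions on which the transform is given by the integral and the isometry is already known.
\<close>

definition nice :: "('a::euclidean_space \<Rightarrow> complex) \<Rightarrow> bool" where
  "nice f \<longleftrightarrow> integrable lborel f \<and> square_integrable f \<and> continuous_on UNIV f \<and> (\<exists>B. \<forall>x. norm (f x) \<le> B)"

lemma L2_dominated_convergence:
  fixes f :: "nat \<Rightarrow> 'a::euclidean_space \<Rightarrow> 'b::euclidean_space"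
  assumes f: "\<And>k. square_integrable (f k)" and g: "square_integrable g"
    and w: "integrable lborel w" and le: "\<And>k. AE x in lborel. (norm (f k x - g x))\<^sup>2 \<le> w x"
    and lim: "AE x in lborel. (\<lambda>k. f k x) \<longlonglongrightarrow> g x"
  shows "(\<lambda>k. abs_L2 (f k)) \<longlonglongrightarrow> abs_L2 g"
proof -
  have [measurable]: "f k \<in> borel_measurable borel" "g \<in> borel_measurable borel" for k
    using f[of k] g by (auto simp: square_integrable_def)
  have "(\<lambda>k. LINT x|lborel. (norm (f k x - g x))\<^sup>2) \<longlonglongrightarrow> (LINT x|(lborel::'a measure). 0)"
  proof (rule integral_dominated_convergence[OF _ _ w])
    show "AE x in lborel. norm ((norm (f k x - g x))\<^sup>2) \<le> w x" for k using le[of k] by simp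
    show "AE x in lborel. (\<lambda>k. (norm (f k x - g x))\<^sup>2) \<longlonglongrightarrow> 0"
      using lim
    proof eventually_elim
      case (elim x)
      then have "(\<lambda>k. (norm (f k x - g x))\<^sup>2) \<longlonglongrightarrow> (norm (g x - g x))\<^sup>2" by (intro tendsto_intros)
      then show ?case by simp
    qed
  qed measurable
  moreover have "(LINT x|lborel. (norm (f k x - g x))\<^sup>2) = (norm (abs_L2 (f k) - abs_L2 g))\<^sup>2" for k
    unfolding norm_L2_diff_sq by (intro integral_cong_AE) (use rep_abs_L2[OF f[of k]] rep_abs_L2[OF g] in auto)
  ultimately have "(\<lambda>k. (norm (abs_L2 (f k) - abs_L2 g))\<^sup>2) \<longlonglongrightarrow> 0" by simp
  then have "(\<lambda>k. sqrt ((norm (abs_L2 (f k) - abs_L2 g))\<^sup>2)) \<longlonglongrightarrow> sqrt 0" by (intro tendsto_intros)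
  then have "(\<lambda>k. norm (abs_L2 (f k) - abs_L2 g)) \<longlonglongrightarrow> 0" by simp
  then show ?thesis by (simp add: LIM_zero_iff tendsto_norm_zero_iff)
qed

lemma integrable_bounded_support:
  fixes f :: "'a::euclidean_space \<Rightarrow> 'b::euclidean_space"
  assumes [measurable]: "f \<in> borel_measurable borel" and "\<And>x. norm (f x) \<le> B * indicator (cball 0 r) x"
  shows "integrable lborel f"
proof (rule Bochner_Integration.integrable_bound)
  show "integrable lborel (\<lambda>x::'a. B * indicator (cball 0 r) x)"
    by (intro integrable_mult_right integrable_indicator_cball)
  show "AE x in lborel. norm (f x) \<le> norm (B * indicator (cball 0 r) x)"
    using assms(2) by (auto intro!: AE_I2 order_trans[OF _ abs_ge_self] simp del: abs_mult)
qed measurable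

lemma square_integrable_bounded_support:
  fixes f :: "'a::euclidean_space \<Rightarrow> 'b::euclidean_space"
  assumes [measurable]: "f \<in> borel_measurable borel" and le: "\<And>x. norm (f x) \<le> B * indicator (cball 0 r) x"
  shows "square_integrable f"
  unfolding square_integrable_def
proof (intro conjI integrable_bounded_support[where B="B\<^sup>2" and r=r])
  fix x
  have "(norm (f x))\<^sup>2 \<le> (B * indicator (cball 0 r) x)\<^sup>2" by (intro power_mono le) auto
  then show "norm ((norm (f x))\<^sup>2) \<le> B\<^sup>2 * indicator (cball 0 r) x"
    by (auto simp: indicator_def split: if_splits)
qed measurable

lemma square_integrable_truncate:
  fixes f :: "'a::euclidean_space \<Rightarrow> 'b::euclidean_space"
  assumes "square_integrable f"
  shows "square_integrable (\<lambda>x. indicator (cball 0 r) x *\<^sub>R f x)"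
proof -
  have [measurable]: "f \<in> borel_measurable borel" using assms by (simp add: square_integrable_def)
  show ?thesis
    by (rule square_integrable_bound[OF _ assms], measurable) (auto simp: indicator_def)
qed

lemma integrable_truncate:
  fixes f :: "'a::euclidean_space \<Rightarrow> 'b::euclidean_space"
  assumes f: "square_integrable f"
  shows "integrable lborel (\<lambda>x. indicator (cball 0 r) x *\<^sub>R f x)"
proof -
  have [measurable]: "f \<in> borel_measurable borel" using f by (simp add: square_integrable_def)
  show ?thesis
  proof (rule Bochner_Integration.integrable_bound)
    show "integrable lborel (\<lambda>x. indicator (cball 0 r) x + (norm (f x))\<^sup>2)"
      using f by (auto simp: square_integrable_def intro!: Bochner_Integration.integrable_add integrable_indicator_cball)
    have "norm (f x) \<le> 1 + (norm (f x))\<^sup>2" for x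
      using sum_squares_bound[of 1 "norm (f x)"] norm_ge_zero[of "f x"] by (simp del: norm_ge_zero)
    then show "AE x in lborel. norm (indicator (cball 0 r) x *\<^sub>R f x) \<le> norm (indicator (cball 0 r) x + (norm (f x))\<^sup>2)"
      by (auto simp: indicator_def)
  qed measurable
qed

lemma truncate_tendsto:
  fixes f :: "'a::euclidean_space \<Rightarrow> 'b::euclidean_space"
  assumes f: "square_integrable f"
  shows "(\<lambda>k::nat. abs_L2 (\<lambda>x. indicator (cball 0 (real k)) x *\<^sub>R f x)) \<longlonglongrightarrow> abs_L2 f"
proof (rule L2_dominated_convergence[OF square_integrable_truncate[OF f] f])
  show "integrable lborel (\<lambda>x. (norm (f x))\<^sup>2)" using f by (simp add: square_integrable_def)
  show "AE x in lborel. (norm (indicator (cball 0 (real k)) x *\<^sub>R f x - f x))\<^sup>2 \<le> (norm (f x))\<^sup>2" for k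
    by (auto simp: indicator_def)
  show "AE x in lborel. (\<lambda>k. indicator (cball 0 (real k)) x *\<^sub>R f x) \<longlonglongrightarrow> f x"
  proof (intro AE_I2 tendsto_eventually)
    fix x :: 'a
    obtain N where "norm x \<le> real N" using real_arch_simple by blast
    then show "\<forall>\<^sub>F k in sequentially. indicator (cball 0 (real k)) x *\<^sub>R f x = f x"
      by (intro eventually_sequentiallyI[of N]) (auto simp: indicator_def)
  qed
qed

text \<open>A measurable function is an a.e. limit of continuous ones. These are shrunk to norm at
  most \<open>B\<close> and multiplied by the continuous cutoff \<open>cut\<close>, which is 1 on
  the ball of radius \<open>r\<close> and 0 beyond \<open>r + 1\<close>. Neither operation moves the
  limit, because \<open>f\<close> obeys the same bound and lives in the smaller ball.\<close>

lemma nice_approx_bounded: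
  fixes f :: "'a::euclidean_space \<Rightarrow> complex"
  assumes [measurable]: "f \<in> borel_measurable borel" and le: "\<And>x. norm (f x) \<le> B * indicator (cball 0 r) x"
    and B: "B > 0"
  shows "\<exists>g. (\<forall>k. nice (g k)) \<and> (\<lambda>k::nat. abs_L2 (g k)) \<longlonglongrightarrow> abs_L2 f"
proof -
  have "f \<in> borel_measurable lebesgue" using assms(1) by (simp add: measurable_completion)
  then have "f measurable_on UNIV" by (intro lebesgue_measurable_imp_measurable_on) auto
  then obtain N h where N: "negligible N" and h: "\<And>n. continuous_on UNIV (h n)"
    and lim: "\<And>x. x \<notin> N \<Longrightarrow> (\<lambda>n. h n x) \<longlonglongrightarrow> f x" by (auto simp: measurable_on_def)
  define cut where "cut x = max 0 (min 1 (r + 1 - norm x))" for x :: 'a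
  define g where "g n x = (cut x / max 1 (norm (h n x) / B)) *\<^sub>R h n x" for n x
  have cut: "0 \<le> cut x" "cut x \<le> 1" for x by (auto simp: cut_def)
  have gcont: "continuous_on UNIV (g n)" for n
    unfolding g_def[abs_def] cut_def using B by (intro continuous_intros h) auto
  have [measurable]: "g n \<in> borel_measurable borel" for n
    by (intro borel_measurable_continuous_onI gcont)
  have gle: "norm (g n x) \<le> B * indicator (cball 0 (r + 1)) x" for n x
  proof -
    have "norm (h n x) \<le> B * max 1 (norm (h n x) / B)" using B by (simp add: max_def field_simps)
    then have "norm (h n x) / max 1 (norm (h n x) / B) \<le> B" by (simp add: field_simps)
    then have "cut x * (norm (h n x) / max 1 (norm (h n x) / B)) \<le> cut x * B"
      by (intro mult_left_mono cut)
    also have "\<dots> \<le> B * indicator (cball 0 (r + 1)) x"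
      using B cut[of x] by (auto simp: indicator_def cut_def)
    finally show ?thesis using cut[of x] by (simp add: g_def)
  qed
  have gs: "square_integrable (g n)" for n by (rule square_integrable_bounded_support[OF _ gle]) measurable
  have fs: "square_integrable f" by (rule square_integrable_bounded_support[OF _ le]) measurable
  have "norm (g n x) \<le> B" for n x using order_trans[OF gle[of n x]] B by (auto simp: indicator_def)
  then have "nice (g n)" for n
    unfolding nice_def using gcont gs integrable_bounded_support[OF _ gle[of n]] by auto
  moreover have "(\<lambda>k. abs_L2 (g k)) \<longlonglongrightarrow> abs_L2 f"
  proof (rule L2_dominated_convergence[OF gs fs])
    show "integrable lborel (\<lambda>x::'a. (2 * B)\<^sup>2 * indicator (cball 0 (r + 1)) x)"
      by (intro integrable_mult_right integrable_indicator_cball)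
    show "AE x in lborel. (norm (g k x - f x))\<^sup>2 \<le> (2 * B)\<^sup>2 * indicator (cball 0 (r + 1)) x" for k
    proof (intro AE_I2)
      fix x :: 'a
      have "indicator (cball 0 r) x \<le> (indicator (cball 0 (r + 1)) x :: real)" by (auto simp: indicator_def)
      from mult_left_mono[OF this, of B] have "norm (g k x - f x) \<le> 2 * B * indicator (cball 0 (r + 1)) x"
        using norm_triangle_ineq4[of "g k x" "f x"] gle[of k x] le[of x] B by linarith
      then have "(norm (g k x - f x))\<^sup>2 \<le> (2 * B * indicator (cball 0 (r + 1)) x)\<^sup>2"
        by (intro power_mono) auto
      then show "(norm (g k x - f x))\<^sup>2 \<le> (2 * B)\<^sup>2 * indicator (cball 0 (r + 1)) x"
        by (auto simp: indicator_def split: if_splits)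
    qed
    have "AE x in lebesgue. x \<notin> N" using N by (auto simp: negligible_iff_null_sets intro: AE_not_in)
    then have "AE x in lborel. x \<notin> N" by (simp add: AE_completion_iff)
    then show "AE x in lborel. (\<lambda>k. g k x) \<longlonglongrightarrow> f x"
    proof eventually_elim
      case (elim x)
      have m: "max 1 (norm (f x) / B) = 1"
      proof -
        have "norm (f x) \<le> B" using le[of x] B by (cases "x \<in> cball 0 r") auto
        then show ?thesis using B by (simp add: max_def)
      qed
      have "(\<lambda>k. max 1 (norm (h k x) / B)) \<longlonglongrightarrow> max 1 (norm (f x) / B)"
        using B by (intro tendsto_max tendsto_const tendsto_divide tendsto_norm lim[OF elim]) auto
      then have "(\<lambda>k. cut x / max 1 (norm (h k x) / B)) \<longlonglongrightarrow> cut x / max 1 (norm (f x) / B)"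
        by (rule tendsto_divide[OF tendsto_const]) (simp add: m)
      from tendsto_scaleR[OF this lim[OF elim]]
      have "(\<lambda>k. g k x) \<longlonglongrightarrow> (cut x / max 1 (norm (f x) / B)) *\<^sub>R f x"
        unfolding g_def .
      moreover have "(cut x / max 1 (norm (f x) / B)) *\<^sub>R f x = f x"
        unfolding m using le[of x] by (cases "x \<in> cball 0 r") (auto simp: cut_def)
      ultimately show ?case by simp
    qed
  qed
  ultimately show ?thesis by blast
qed

lemma nice_dense:
  fixes f :: "('a::euclidean_space, complex) L2"
  shows "f \<in> closure {abs_L2 g | g. nice g}"
proof -
  let ?t = "\<lambda>k x. (if norm (rep_L2 f x) \<le> real k then 1 else 0) *\<^sub>R indicator (cball 0 (real k)) x *\<^sub>R rep_L2 f x"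
  have "abs_L2 (?t k) \<in> closure {abs_L2 g | g. nice g}" for k
  proof -
    have "\<exists>g. (\<forall>j. nice (g j)) \<and> (\<lambda>j::nat. abs_L2 (g j)) \<longlonglongrightarrow> abs_L2 (?t k)"
    proof (rule nice_approx_bounded[where B="real k + 1" and r="real k"])
      show "norm (?t k x) \<le> (real k + 1) * indicator (cball 0 (real k)) x" for x
        by (auto simp: indicator_def)
    qed auto
    then obtain g where "\<forall>j. nice (g j)" "(\<lambda>j::nat. abs_L2 (g j)) \<longlonglongrightarrow> abs_L2 (?t k)" by blast
    then show ?thesis unfolding closure_sequential by (intro exI[of _ "\<lambda>j. abs_L2 (g j)"]) auto
  qed
  note mem = this
  have lim: "(\<lambda>k. abs_L2 (?t k)) \<longlonglongrightarrow> abs_L2 (rep_L2 f)"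
  proof (rule L2_dominated_convergence)
    show "square_integrable (?t k)" for k
      by (rule square_integrable_bound[OF _ square_integrable_rep[of f]], measurable) (auto simp: indicator_def)
    show "integrable lborel (\<lambda>x. (norm (rep_L2 f x))\<^sup>2)" by simp
    show "AE x in lborel. (norm (?t k x - rep_L2 f x))\<^sup>2 \<le> (norm (rep_L2 f x))\<^sup>2" for k
      by (auto simp: indicator_def)
    show "AE x in lborel. (\<lambda>k. ?t k x) \<longlonglongrightarrow> rep_L2 f x"
    proof (intro AE_I2 tendsto_eventually)
      fix x :: 'a
      obtain N where "max (norm x) (norm (rep_L2 f x)) \<le> real N" using real_arch_simple by blast
      then show "\<forall>\<^sub>F k in sequentially. ?t k x = rep_L2 f x"
        by (intro eventually_sequentiallyI[of N]) (auto simp: indicator_def)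
    qed
  qed simp
  have "abs_L2 (rep_L2 f) \<in> closure {abs_L2 g | g. nice g}"
    by (rule closed_sequentially[OF closed_closure mem lim])
  then show ?thesis by simp
qed

text \<open>Two continuous maps agree on a closed set. This carries identities of the integral
  transform from nice functions over to all of \<open>L2\<close>.\<close>

lemma eq_on_nice:
  fixes A B :: "('a::euclidean_space, complex) L2 \<Rightarrow> 'b::real_normed_vector"
  assumes "continuous_on UNIV A" "continuous_on UNIV B" and eq: "\<And>g. nice g \<Longrightarrow> A (abs_L2 g) = B (abs_L2 g)"
  shows "A f = B f"
proof -
  have "closed {f. A f = B f}" using assms(1,2) by (intro closed_Collect_eq)
  then have "closure {abs_L2 g | g. nice g} \<subseteq> {f. A f = B f}"
    by (rule closure_minimal[rotated]) (auto simp: eq)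
  then show ?thesis using nice_dense[of f] by auto
qed

text \<open>The complex counterpart of \<open>fourier\<close>, which is recovered from it through
  \<open>L2_of_real\<close>. Adjoint, conjugation and inversion take place among complex-valued
  functions.\<close>

definition cfourier :: "(real^'n, complex) L2 \<Rightarrow> (real^'n, complex) L2" where
  "cfourier f = lim (\<lambda>k::nat. abs_L2 (fourier_integral (\<lambda>x. indicator (cball 0 (real k)) x *\<^sub>R rep_L2 f x)))"

lemma abs_L2_diff:
  "square_integrable f \<Longrightarrow> square_integrable g \<Longrightarrow> abs_L2 (\<lambda>x. f x - g x) = abs_L2 f - abs_L2 g"
  by (rule minus_L2.abs_eq[symmetric]) auto

lemma abs_L2_add:
  "square_integrable f \<Longrightarrow> square_integrable g \<Longrightarrow> abs_L2 (\<lambda>x. f x + g x) = abs_L2 f + abs_L2 g"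
  by (rule plus_L2.abs_eq[symmetric]) auto

lemma abs_L2_scaleR: "square_integrable f \<Longrightarrow> abs_L2 (\<lambda>x. c *\<^sub>R f x) = c *\<^sub>R abs_L2 f"
  by (rule scaleR_L2.abs_eq[symmetric]) auto

lemma norm_fourier_integral_diff_le:
  fixes f g :: "real^'n \<Rightarrow> complex"
  assumes f: "integrable lborel f" "square_integrable f" and g: "integrable lborel g" "square_integrable g"
  shows "norm (abs_L2 (fourier_integral f) - abs_L2 (fourier_integral g)) \<le> norm (abs_L2 f - abs_L2 g)"
proof -
  have "abs_L2 (fourier_integral f) - abs_L2 (fourier_integral g) = abs_L2 (fourier_integral (\<lambda>x. f x - g x))"
    by (simp add: fourier_integral_diff[OF f(1) g(1), abs_def] abs_L2_diff square_integrable_fourier_integral f g)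
  moreover have "abs_L2 f - abs_L2 g = abs_L2 (\<lambda>x. f x - g x)" by (simp add: abs_L2_diff f g)
  ultimately show ?thesis
    using square_integrable_fourier_integral(2)[of "\<lambda>x. f x - g x"] f g by (simp add: square_integrable_diff)
qed

text \<open>The transform is a contraction on truncations, so their Cauchy property is inherited and
  the \<open>lim\<close> in the definition is a genuine limit.\<close>

lemma cfourier_LIMSEQ:
  "(\<lambda>k::nat. abs_L2 (fourier_integral (\<lambda>x. indicator (cball 0 (real k)) x *\<^sub>R rep_L2 f x))) \<longlonglongrightarrow> cfourier f"
proof -
  let ?t = "\<lambda>k x. indicator (cball 0 (real k)) x *\<^sub>R rep_L2 f x"
  have "Cauchy (\<lambda>k. abs_L2 (?t k))"
    by (intro LIMSEQ_imp_Cauchy[OF truncate_tendsto]) simp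
  moreover have "norm (abs_L2 (fourier_integral (?t j)) - abs_L2 (fourier_integral (?t k))) \<le> norm (abs_L2 (?t j) - abs_L2 (?t k))" for j k
    by (intro norm_fourier_integral_diff_le integrable_truncate square_integrable_truncate square_integrable_rep)
  ultimately have "Cauchy (\<lambda>k. abs_L2 (fourier_integral (?t k)))"
    unfolding Cauchy_iff by (meson le_less_trans)
  then show ?thesis unfolding cfourier_def by (simp add: Cauchy_convergent convergent_LIMSEQ_iff[symmetric])
qed

lemma cfourier_abs:
  fixes f :: "real^'n \<Rightarrow> complex"
  assumes f: "integrable lborel f" "square_integrable f"
  shows "cfourier (abs_L2 f) = abs_L2 (fourier_integral f)"
proof -
  let ?t = "\<lambda>k x. indicator (cball 0 (real k)) x *\<^sub>R rep_L2 (abs_L2 f) x"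
  have "(\<lambda>k. norm (abs_L2 (?t k) - abs_L2 f)) \<longlonglongrightarrow> 0"
    using truncate_tendsto[OF square_integrable_rep, of "abs_L2 f"] by (simp add: LIM_zero tendsto_norm_zero)
  moreover have "\<forall>\<^sub>F k in sequentially. norm (abs_L2 (fourier_integral (?t k)) - abs_L2 (fourier_integral f)) \<le> norm (abs_L2 (?t k) - abs_L2 f)"
    by (intro always_eventually allI norm_fourier_integral_diff_le integrable_truncate square_integrable_truncate square_integrable_rep f)
  ultimately have "(\<lambda>k. abs_L2 (fourier_integral (?t k)) - abs_L2 (fourier_integral f)) \<longlonglongrightarrow> 0"
    by (rule Lim_null_comparison[rotated])
  then have "(\<lambda>k. abs_L2 (fourier_integral (?t k))) \<longlonglongrightarrow> abs_L2 (fourier_integral f)" by (simp add: LIM_zero_iff)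
  with cfourier_LIMSEQ show ?thesis by (rule LIMSEQ_unique)
qed

lemma bounded_linear_cfourier: "bounded_linear (cfourier :: (real^'n, complex) L2 \<Rightarrow> _)"
proof (rule bounded_linear_intro[where K=1])
  let ?t = "\<lambda>f k x. indicator (cball 0 (real k)) x *\<^sub>R rep_L2 f x"
  have [simp]: "integrable lborel (?t f k)" "square_integrable (?t f k)" for f :: "(real^'n, complex) L2" and k
    by (simp_all add: integrable_truncate square_integrable_truncate)
  have [measurable]: "?t f k \<in> borel_measurable borel" for f :: "(real^'n, complex) L2" and k by measurable
  fix f g :: "(real^'n, complex) L2" and r :: real
  have add: "abs_L2 (fourier_integral (?t (f + g) k)) = abs_L2 (fourier_integral (?t f k)) + abs_L2 (fourier_integral (?t g k))" for k
  proof -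
    have "fourier_integral (?t (f + g) k) = fourier_integral (\<lambda>x. ?t f k x + ?t g k x)"
      using rep_L2_add[of f g] by (intro fourier_integral_cong_AE) (auto simp: scaleR_add_right)
    also have "\<dots> = (\<lambda>\<xi>. fourier_integral (?t f k) \<xi> + fourier_integral (?t g k) \<xi>)"
      by (intro ext fourier_integral_add) auto
    finally show ?thesis
      by (simp add: abs_L2_add square_integrable_fourier_integral)
  qed
  show "cfourier (f + g) = cfourier f + cfourier g"
    by (rule LIMSEQ_unique[OF cfourier_LIMSEQ[of "f + g", unfolded add]
          tendsto_add[OF cfourier_LIMSEQ[of f] cfourier_LIMSEQ[of g]]])
  have scale: "abs_L2 (fourier_integral (?t (r *\<^sub>R f) k)) = r *\<^sub>R abs_L2 (fourier_integral (?t f k))" for k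
  proof -
    have "fourier_integral (?t (r *\<^sub>R f) k) = fourier_integral (\<lambda>x. of_real r * ?t f k x)"
      using rep_L2_scaleR[of r f] by (intro fourier_integral_cong_AE) (auto simp: scaleR_conv_of_real mult_ac)
    also have "\<dots> = (\<lambda>\<xi>. r *\<^sub>R fourier_integral (?t f k) \<xi>)"
      by (intro ext) (simp only: fourier_integral_cmult scaleR_conv_of_real)
    finally show ?thesis
      by (simp add: abs_L2_scaleR square_integrable_fourier_integral)
  qed
  show "cfourier (r *\<^sub>R f) = r *\<^sub>R cfourier f"
    by (rule LIMSEQ_unique[OF cfourier_LIMSEQ[of "r *\<^sub>R f", unfolded scale]
          tendsto_scaleR[OF tendsto_const cfourier_LIMSEQ[of f]]])
  show "norm (cfourier f) \<le> norm f * 1"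
  proof -
    have "norm (abs_L2 (fourier_integral (?t f k))) \<le> norm (abs_L2 (?t f k))" for k
      by (intro square_integrable_fourier_integral) auto
    moreover have "(\<lambda>k. norm (abs_L2 (?t f k))) \<longlonglongrightarrow> norm f"
      using tendsto_norm[OF truncate_tendsto[OF square_integrable_rep, of f]] by simp
    ultimately show ?thesis
      using tendsto_le[OF sequentially_bot _ tendsto_norm[OF cfourier_LIMSEQ[of f]]] by auto
  qed
qed

lemmas continuous_on_cfourier = bounded_linear.continuous_on[OF bounded_linear_cfourier]

lemma norm_cfourier: "norm (cfourier f) = norm (f :: (real^'n, complex) L2)"
proof (rule eq_on_nice[where f=f])
  fix g :: "real^'n \<Rightarrow> complex" assume "nice g"
  then obtain B where "integrable lborel g" "square_integrable g" "continuous_on UNIV g" "\<And>x. norm (g x) \<le> B"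
    by (auto simp: nice_def)
  then show "norm (cfourier (abs_L2 g)) = norm (abs_L2 g)"
    by (simp add: cfourier_abs plancherel_continuous[of g B])
qed (intro continuous_intros continuous_on_cfourier)+

text \<open>Polarisation of the isometry.\<close>

lemma inner_cfourier: "cfourier f \<bullet> cfourier g = f \<bullet> (g :: (real^'n, complex) L2)"
proof -
  interpret bounded_linear "cfourier :: (real^'n, complex) L2 \<Rightarrow> _" by (rule bounded_linear_cfourier)
  show ?thesis unfolding dot_norm[of _ "cfourier g"] dot_norm[of f]
    by (simp add: norm_cfourier flip: add)
qed

section \<open>Conjugation, reflection and Fourier inversion\<close>

definition L2_cnj :: "('a::euclidean_space, complex) L2 \<Rightarrow> ('a, complex) L2" where
  "L2_cnj f = abs_L2 (\<lambda>x. cnj (rep_L2 f x))"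

definition L2_reflect :: "('a::euclidean_space, 'b::euclidean_space) L2 \<Rightarrow> ('a, 'b) L2" where
  "L2_reflect f = abs_L2 (\<lambda>x. rep_L2 f (- x))"

lemma square_integrable_cnj: "square_integrable f \<Longrightarrow> square_integrable (\<lambda>x. cnj (f x))"
  by (auto simp: square_integrable_def)

lemma square_integrable_reflect: "square_integrable f \<Longrightarrow> square_integrable (\<lambda>x. f (- x))"
  by (auto simp: square_integrable_def intro: integrable_lborel_uminus)

lemma rep_L2_cnj: "AE x in lborel. rep_L2 (L2_cnj f) x = cnj (rep_L2 f x)"
  unfolding L2_cnj_def by (intro rep_abs_L2 square_integrable_cnj square_integrable_rep)

lemma rep_L2_reflect: "AE x in lborel. rep_L2 (L2_reflect f) x = rep_L2 f (- x)"
  unfolding L2_reflect_def by (intro rep_abs_L2 square_integrable_reflect square_integrable_rep)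

lemma L2_cnj_abs: "square_integrable f \<Longrightarrow> L2_cnj (abs_L2 f) = abs_L2 (\<lambda>x. cnj (f x))"
  unfolding L2_cnj_def
  by (intro abs_L2_cong_AE square_integrable_cnj square_integrable_rep) (use rep_abs_L2[of f] in auto)

lemma L2_reflect_abs: "square_integrable f \<Longrightarrow> L2_reflect (abs_L2 f) = abs_L2 (\<lambda>x. f (- x))"
  unfolding L2_reflect_def
  by (intro abs_L2_cong_AE square_integrable_reflect square_integrable_rep AE_lborel_uminus rep_abs_L2)

lemma bounded_linear_L2_cnj: "bounded_linear L2_cnj"
proof (rule bounded_linear_intro[where K=1])
  fix f g :: "('a, complex) L2" and r :: real
  show "L2_cnj (f + g) = L2_cnj f + L2_cnj g"
    using rep_L2_add[of f g] rep_L2_add[of "L2_cnj f" "L2_cnj g"] rep_L2_cnj[of "f + g"] rep_L2_cnj[of f] rep_L2_cnj[of g]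
    by (intro L2_eqI) auto
  show "L2_cnj (r *\<^sub>R f) = r *\<^sub>R L2_cnj f"
    using rep_L2_scaleR[of r f] rep_L2_scaleR[of r "L2_cnj f"] rep_L2_cnj[of "r *\<^sub>R f"] rep_L2_cnj[of f]
    by (intro L2_eqI) auto
  have "(norm (L2_cnj f))\<^sup>2 = (norm f)\<^sup>2"
    unfolding norm_L2_sq using rep_L2_cnj[of f] by (intro integral_cong_AE) auto
  then show "norm (L2_cnj f) \<le> norm f * 1" by simp
qed

lemma bounded_linear_L2_reflect: "bounded_linear L2_reflect"
proof (rule bounded_linear_intro[where K=1])
  fix f g :: "('a, 'b) L2" and r :: real
  show "L2_reflect (f + g) = L2_reflect f + L2_reflect g"
    using AE_lborel_uminus[OF rep_L2_add[of f g]] rep_L2_add[of "L2_reflect f" "L2_reflect g"]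
      rep_L2_reflect[of "f + g"] rep_L2_reflect[of f] rep_L2_reflect[of g]
    by (intro L2_eqI) auto
  show "L2_reflect (r *\<^sub>R f) = r *\<^sub>R L2_reflect f"
    using AE_lborel_uminus[OF rep_L2_scaleR[of r f]] rep_L2_scaleR[of r "L2_reflect f"]
      rep_L2_reflect[of "r *\<^sub>R f"] rep_L2_reflect[of f]
    by (intro L2_eqI) auto
  have "(norm (L2_reflect f))\<^sup>2 = (LINT x|lborel. (norm (rep_L2 f (- x)))\<^sup>2)"
    unfolding norm_L2_sq using rep_L2_reflect[of f] by (intro integral_cong_AE) auto
  also have "\<dots> = (norm f)\<^sup>2"
    unfolding norm_L2_sq by (rule integral_lborel_uminus) measurable
  finally show "norm (L2_reflect f) \<le> norm f * 1" by simp
qed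

lemma L2_cnj_cnj [simp]: "L2_cnj (L2_cnj f) = f"
  using rep_L2_cnj[of f] rep_L2_cnj[of "L2_cnj f"] by (intro L2_eqI) auto

lemmas continuous_on_L2_cnj = bounded_linear.continuous_on[OF bounded_linear_L2_cnj]
lemmas continuous_on_L2_reflect = bounded_linear.continuous_on[OF bounded_linear_L2_reflect]

lemma cnj_cfourier: "L2_cnj (cfourier f) = L2_reflect (cfourier (L2_cnj (f :: (real^'n, complex) L2)))"
proof (rule eq_on_nice[where f=f])
  fix g :: "real^'n \<Rightarrow> complex" assume "nice g"
  then have g: "integrable lborel g" "square_integrable g" by (auto simp: nice_def)
  then show "L2_cnj (cfourier (abs_L2 g)) = L2_reflect (cfourier (L2_cnj (abs_L2 g)))"
    using square_integrable_fourier_integral(1)[OF g]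
    by (simp add: cfourier_abs L2_cnj_abs L2_reflect_abs square_integrable_cnj square_integrable_fourier_integral
        fourier_integral_cnj)
qed (intro continuous_intros continuous_on_cfourier continuous_on_L2_cnj continuous_on_L2_reflect)+

lemma cfourier_reflect: "cfourier (L2_reflect f) = L2_reflect (cfourier (f :: (real^'n, complex) L2))"
proof (rule eq_on_nice[where f=f])
  fix g :: "real^'n \<Rightarrow> complex" assume "nice g"
  then have g: "integrable lborel g" "square_integrable g" by (auto simp: nice_def)
  then have [measurable]: "g \<in> borel_measurable borel" by (simp add: square_integrable_def)
  have r: "fourier_integral (\<lambda>x. g (- x)) = (\<lambda>\<xi>. fourier_integral g (- \<xi>))"
    by (intro ext fourier_integral_reflect) measurable
  show "cfourier (L2_reflect (abs_L2 g)) = L2_reflect (cfourier (abs_L2 g))"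
    using square_integrable_fourier_integral(1)[OF g] g
    by (simp add: cfourier_abs L2_reflect_abs square_integrable_reflect integrable_lborel_uminus r)
qed (intro continuous_intros continuous_on_cfourier continuous_on_L2_reflect)+

lemma inner_abs_L2:
  assumes f: "square_integrable f" and g: "square_integrable g"
  shows "abs_L2 f \<bullet> abs_L2 g = (LINT x|lborel. f x \<bullet> g x)"
  by (rule inner_L2.abs_eq) (use f g in auto)

text \<open>The adjoint of the transform is the transform conjugated on both sides. Density is
  applied to one argument after the other, until the multiplication formula for integrable functions
  is within reach.\<close>

lemma inner_cfourier_left:
  "cfourier f \<bullet> g = f \<bullet> L2_cnj (cfourier (L2_cnj (g :: (real^'n, complex) L2)))"
proof (rule eq_on_nice[where f=f])
  fix h :: "real^'n \<Rightarrow> complex" assume "nice h"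
  then have h: "integrable lborel h" "square_integrable h" by (auto simp: nice_def)
  show "cfourier (abs_L2 h) \<bullet> g = abs_L2 h \<bullet> L2_cnj (cfourier (L2_cnj g))"
  proof (rule eq_on_nice[where f=g])
    fix k :: "real^'n \<Rightarrow> complex" assume "nice k"
    then have k: "integrable lborel k" "square_integrable k" by (auto simp: nice_def)
    then have k': "integrable lborel (\<lambda>x. cnj (k x))" "square_integrable (\<lambda>x. cnj (k x))"
      by (auto simp: square_integrable_cnj)
    note S = square_integrable_fourier_integral(1)
    have prod: "integrable lborel (\<lambda>x. a x * b x)"
      if a: "square_integrable a" and b: "square_integrable b" for a b :: "real^'n \<Rightarrow> complex"
    proof (rule Bochner_Integration.integrable_bound)
      show "integrable lborel (\<lambda>x. (norm (a x))\<^sup>2 + (norm (b x))\<^sup>2)"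
        using a b by (auto simp: square_integrable_def)
      show "(\<lambda>x. a x * b x) \<in> borel_measurable lborel" using a b by (auto simp: square_integrable_def)
      have "norm (a x * b x) \<le> (norm (a x))\<^sup>2 + (norm (b x))\<^sup>2" for x
        using sum_squares_bound[of "norm (a x)" "norm (b x)"] mult_nonneg_nonneg[of "norm (a x)" "norm (b x)"]
        unfolding norm_mult by (simp del: mult_nonneg_nonneg)
      then show "AE x in lborel. norm (a x * b x) \<le> norm ((norm (a x))\<^sup>2 + (norm (b x))\<^sup>2)" by simp
    qed
    have inner: "z \<bullet> w = Re (z * cnj w)" for z w :: complex by (simp add: inner_complex_def)
    have "cfourier (abs_L2 h) \<bullet> abs_L2 k = (LINT x|lborel. Re (fourier_integral h x * cnj (k x)))"
      by (simp add: cfourier_abs h inner_abs_L2 S k inner)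
    also have "\<dots> = Re (LINT x|lborel. fourier_integral h x * cnj (k x))"
      by (intro integral_Re prod S h k')
    also have "\<dots> = Re (LINT x|lborel. h x * fourier_integral (\<lambda>x. cnj (k x)) x)"
      by (simp only: fourier_integral_mult_formula[OF h(1) k'(1)])
    also have "\<dots> = (LINT x|lborel. Re (h x * cnj (cnj (fourier_integral (\<lambda>x. cnj (k x)) x))))"
      unfolding complex_cnj_cnj by (intro integral_Re[symmetric] prod S h k')
    also have "\<dots> = abs_L2 h \<bullet> L2_cnj (cfourier (L2_cnj (abs_L2 k)))"
      by (simp only: L2_cnj_abs k cfourier_abs[OF k'] S[OF k'] inner_abs_L2 h square_integrable_cnj inner)
    finally show "cfourier (abs_L2 h) \<bullet> abs_L2 k = abs_L2 h \<bullet> L2_cnj (cfourier (L2_cnj (abs_L2 k)))" .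
  qed (intro continuous_intros continuous_on_cfourier continuous_on_L2_cnj)+
qed (intro continuous_intros continuous_on_cfourier)+

text \<open>For an isometry the adjoint is a left inverse: the difference is orthogonal to every
  \<open>h\<close>, in particular to itself.\<close>

lemma cfourier_inverse: "L2_cnj (cfourier (L2_cnj (cfourier f))) = (f :: (real^'n, complex) L2)"
proof -
  let ?g = "L2_cnj (cfourier (L2_cnj (cfourier f)))"
  have "(f - ?g) \<bullet> h = 0" for h
  proof -
    have "?g \<bullet> h = h \<bullet> ?g" by (rule inner_commute)
    also have "\<dots> = cfourier h \<bullet> cfourier f" by (rule inner_cfourier_left[symmetric])
    also have "\<dots> = f \<bullet> h" by (simp add: inner_cfourier inner_commute)
    finally show ?thesis by (simp add: inner_diff_left)
  qed
  from this[of "f - ?g"] show ?thesis by simp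
qed

text \<open>Conjugating the left inverse identity turns it into a right inverse identity, so the
  transform is onto.\<close>

lemma cfourier_inverse': "cfourier (L2_cnj (cfourier (L2_cnj f))) = (f :: (real^'n, complex) L2)"
  using arg_cong[OF cfourier_inverse[of "L2_cnj f"], of L2_cnj] by simp

section \<open>The transform of real-valued functions\<close>

definition L2_of_real :: "('a::euclidean_space, real) L2 \<Rightarrow> ('a, complex) L2" where
  "L2_of_real f = abs_L2 (\<lambda>x. complex_of_real (rep_L2 f x))"

lemma square_integrable_of_real:
  "square_integrable f \<Longrightarrow> square_integrable (\<lambda>x. complex_of_real (f x))"
  by (auto simp: square_integrable_def)

lemma rep_L2_of_real: "AE x in lborel. rep_L2 (L2_of_real f) x = of_real (rep_L2 f x)"
  unfolding L2_of_real_def by (intro rep_abs_L2 square_integrable_of_real square_integrable_rep)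

lemma norm_L2_of_real [simp]: "norm (L2_of_real f) = norm f"
proof -
  have "(norm (L2_of_real f))\<^sup>2 = (norm f)\<^sup>2"
    unfolding norm_L2_sq using rep_L2_of_real[of f] by (intro integral_cong_AE) auto
  then show ?thesis by simp
qed

lemma bounded_linear_L2_of_real: "bounded_linear L2_of_real"
proof (rule bounded_linear_intro[where K=1])
  fix f g :: "('a, real) L2" and r :: real
  show "L2_of_real (f + g) = L2_of_real f + L2_of_real g"
    using rep_L2_add[of f g] rep_L2_add[of "L2_of_real f" "L2_of_real g"] rep_L2_of_real[of "f + g"] rep_L2_of_real[of f] rep_L2_of_real[of g]
    by (intro L2_eqI) auto
  show "L2_of_real (r *\<^sub>R f) = r *\<^sub>R L2_of_real f"
    using rep_L2_scaleR[of r f] rep_L2_scaleR[of r "L2_of_real f"] rep_L2_of_real[of "r *\<^sub>R f"] rep_L2_of_real[of f]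
    by (intro L2_eqI) (auto simp: scaleR_conv_of_real)
qed simp

lemma fourier_eq_cfourier: "fourier f = cfourier (L2_of_real f)"
proof -
  have "fourier_integral (\<lambda>x. of_real (indicator (cball 0 (real k)) x * rep_L2 f x)) =
      fourier_integral (\<lambda>x. indicator (cball 0 (real k)) x *\<^sub>R rep_L2 (L2_of_real f) x)" for k
    using rep_L2_of_real[of f]
    by (intro fourier_integral_cong_AE) (measurable, auto simp: scaleR_conv_of_real)
  then show ?thesis unfolding fourier_def cfourier_def by simp
qed

lemma bounded_linear_fourier: "bounded_linear (fourier :: (real^'n, real) L2 \<Rightarrow> _)"
  unfolding fourier_eq_cfourier[abs_def]
  using bounded_linear_compose[OF bounded_linear_cfourier bounded_linear_L2_of_real] by (simp add: o_def)

lemma norm_fourier [simp]: "norm (fourier f) = norm f"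
  by (simp add: fourier_eq_cfourier norm_cfourier)

lemma fourier_inj: "fourier f = fourier g \<Longrightarrow> f = g"
proof -
  assume "fourier f = fourier g"
  then have "fourier (f - g) = 0" by (simp add: bounded_linear.linear[OF bounded_linear_fourier] linear_diff)
  then have "norm (f - g) = 0" using norm_fourier[of "f - g"] by simp
  then show "f = g" by simp
qed

lemma fourier_eqI: "AE \<xi> in lborel. rep_L2 (fourier f) \<xi> = rep_L2 (fourier g) \<xi> \<Longrightarrow> f = g"
  by (intro fourier_inj L2_eqI)

lemma norm_sq_fourier: "(norm f)\<^sup>2 = (LINT \<xi>|lborel. (norm (rep_L2 (fourier f) \<xi>))\<^sup>2)"
  using norm_L2_sq[of "fourier f"] by simp

lemma L2_cnj_of_real [simp]: "L2_cnj (L2_of_real f) = L2_of_real f"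
  using rep_L2_of_real[of f] rep_L2_cnj[of "L2_of_real f"] by (intro L2_eqI) auto

lemma fourier_hermitian: "L2_cnj (fourier f) = L2_reflect (fourier f)"
  by (simp add: fourier_eq_cfourier cnj_cfourier)

text \<open>Inverting a Hermitian \<open>h\<close> produces a function fixed by conjugation, hence
  real a.e. This is the existence half of the \<open>THE\<close> in
  \<open>fourier_multiplier\<close>.\<close>

lemma fourier_surj_hermitian:
  fixes h :: "(real^'n, complex) L2"
  assumes h: "L2_cnj h = L2_reflect h"
  shows "\<exists>f. fourier f = h"
proof -
  define g where "g = L2_cnj (cfourier (L2_cnj h))"
  have g: "cfourier g = h" by (simp add: g_def cfourier_inverse')
  have "L2_cnj g = L2_reflect (cfourier h)" by (simp add: g_def h cfourier_reflect)
  also have "\<dots> = g" by (simp add: g_def cnj_cfourier)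
  finally have "AE x in lborel. cnj (rep_L2 g x) = rep_L2 g x"
    using rep_L2_cnj[of g] by auto
  then have real: "AE x in lborel. rep_L2 g x = of_real (Re (rep_L2 g x))"
    by eventually_elim (auto simp: complex_eq_iff)
  have S: "square_integrable (\<lambda>x. Re (rep_L2 g x))"
  proof (rule square_integrable_bound[OF _ square_integrable_rep[of g]])
    show "AE x in lborel. norm (Re (rep_L2 g x)) \<le> norm (rep_L2 g x)" by (simp add: abs_Re_le_cmod)
  qed measurable
  have "L2_of_real (abs_L2 (\<lambda>x. Re (rep_L2 g x))) = g"
    using rep_L2_of_real[of "abs_L2 (\<lambda>x. Re (rep_L2 g x))"] rep_abs_L2[OF S] real
    by (intro L2_eqI) auto
  then show ?thesis using g
    by (intro exI[of _ "abs_L2 (\<lambda>x. Re (rep_L2 g x))"]) (simp add: fourier_eq_cfourier)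
qed

text \<open>For integrable data the transform agrees a.e. with the integral, which is bounded;
  through this the \<open>L1\<close> norms of the data enter the decay estimates.\<close>

lemma rep_fourier_of_integrable:
  fixes f :: "(real^'n, real) L2"
  assumes "integrable lborel (rep_L2 f)"
  shows "AE \<xi> in lborel. norm (rep_L2 (fourier f) \<xi>) \<le> fourier_const TYPE('n) * norm_L1 f"
proof -
  have int: "integrable lborel (\<lambda>x. complex_of_real (rep_L2 f x))" using assms by simp
  have S: "square_integrable (\<lambda>x. complex_of_real (rep_L2 f x))" by (simp add: square_integrable_of_real)
  have "fourier f = abs_L2 (fourier_integral (\<lambda>x. complex_of_real (rep_L2 f x)))"
    unfolding fourier_eq_cfourier L2_of_real_def by (rule cfourier_abs[OF int S])
  then have "AE \<xi> in lborel. rep_L2 (fourier f) \<xi> = fourier_integral (\<lambda>x. complex_of_real (rep_L2 f x)) \<xi>"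
    using rep_abs_L2[OF square_integrable_fourier_integral(1)[OF int S]] by simp
  then show ?thesis
  proof eventually_elim
    case (elim \<xi>)
    then show ?case
      using norm_fourier_integral_le[of "\<lambda>x. complex_of_real (rep_L2 f x)" \<xi>] by (simp add: norm_L1_def)
  qed
qed

text \<open>Once the transform is integrable, the inverse transform is given by an integral, and
  pointwise bounds on \<open>f\<close> become available.\<close>

lemma L2_of_real_inversion:
  fixes f :: "(real^'n, real) L2"
  assumes "integrable lborel (rep_L2 (fourier f))"
  shows "AE x in lborel. complex_of_real (rep_L2 f x) =
    cnj (fourier_integral (\<lambda>\<xi>. cnj (rep_L2 (fourier f) \<xi>)) x)"
proof -
  have int: "integrable lborel (\<lambda>\<xi>. cnj (rep_L2 (fourier f) \<xi>))" using assms by simp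
  have S: "square_integrable (\<lambda>\<xi>. cnj (rep_L2 (fourier f) \<xi>))" by (simp add: square_integrable_cnj)
  have "L2_of_real f = L2_cnj (cfourier (L2_cnj (fourier f)))"
    unfolding fourier_eq_cfourier cfourier_inverse ..
  also have "\<dots> = L2_cnj (abs_L2 (fourier_integral (\<lambda>\<xi>. cnj (rep_L2 (fourier f) \<xi>))))"
    unfolding L2_cnj_def[of "fourier f"] by (simp only: cfourier_abs[OF int S])
  finally show ?thesis
    using rep_L2_of_real[of f] rep_L2_cnj[of "abs_L2 (fourier_integral (\<lambda>\<xi>. cnj (rep_L2 (fourier f) \<xi>)))"]
      rep_abs_L2[OF square_integrable_fourier_integral(1)[OF int S]] by auto
qed

text \<open>An even real symbol preserves Hermitian symmetry, so the product is again a transform,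
  and injectivity of \<open>fourier\<close> makes it unique. Square-integrability is asked of the
  product for this one \<open>f\<close>, which admits the unbounded symbol
  \<open>sqrt (1 + (norm \<xi>)\<^sup>2)\<close> on \<open>H1\<close>.\<close>

lemma fourier_multiplier_unbounded:
  fixes f :: "(real^'n, real) L2" and m :: "real^'n \<Rightarrow> real"
  assumes [measurable]: "m \<in> borel_measurable borel" and even: "\<And>\<xi>. m (- \<xi>) = m \<xi>"
    and S: "square_integrable (\<lambda>\<xi>. of_real (m \<xi>) * rep_L2 (fourier f) \<xi>)"
  shows "AE \<xi> in lborel. rep_L2 (fourier (fourier_multiplier m f)) \<xi> = of_real (m \<xi>) * rep_L2 (fourier f) \<xi>"
proof -
  define h where "h = abs_L2 (\<lambda>\<xi>. of_real (m \<xi>) * rep_L2 (fourier f) \<xi>)"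
  have rep_h: "AE \<xi> in lborel. rep_L2 h \<xi> = of_real (m \<xi>) * rep_L2 (fourier f) \<xi>"
    unfolding h_def by (rule rep_abs_L2[OF S])
  have "AE \<xi> in lborel. cnj (rep_L2 (fourier f) \<xi>) = rep_L2 (fourier f) (- \<xi>)"
    using rep_L2_cnj[of "fourier f"] rep_L2_reflect[of "fourier f"] fourier_hermitian[of f] by auto
  then have "L2_cnj h = L2_reflect h"
    using rep_h AE_lborel_uminus[OF rep_h] rep_L2_cnj[of h] rep_L2_reflect[of h]
    by (intro L2_eqI) (auto simp: even)
  then obtain g where "fourier g = h" using fourier_surj_hermitian by blast
  then have g: "AE \<xi> in lborel. rep_L2 (fourier g) \<xi> = of_real (m \<xi>) * rep_L2 (fourier f) \<xi>"
    using rep_h by simp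
  show ?thesis
    unfolding fourier_multiplier_def
  proof (rule theI[where a=g])
    fix g' assume "AE \<xi> in lborel. rep_L2 (fourier g') \<xi> = of_real (m \<xi>) * rep_L2 (fourier f) \<xi>"
    with g show "g' = g" by (intro fourier_eqI) auto
  qed (rule g)
qed

subsection \<open>Fourier multipliers\<close>

definition symbol :: "(real^'n \<Rightarrow> real) \<Rightarrow> bool" where
  "symbol m \<longleftrightarrow> m \<in> borel_measurable borel \<and> (\<exists>B. \<forall>\<xi>. \<bar>m \<xi>\<bar> \<le> B) \<and> (\<forall>\<xi>. m (- \<xi>) = m \<xi>)"

lemma symbolI: "m \<in> borel_measurable borel \<Longrightarrow> (\<And>\<xi>. \<bar>m \<xi>\<bar> \<le> B) \<Longrightarrow> (\<And>\<xi>. m (- \<xi>) = m \<xi>) \<Longrightarrow> symbol m"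
  by (auto simp: symbol_def)

lemma symbol_measurable [dest]: "symbol m \<Longrightarrow> m \<in> borel_measurable borel"
  by (simp add: symbol_def)

lemma symbol_times:
  assumes "symbol m" "symbol k"
  shows "symbol (\<lambda>\<xi>. m \<xi> * k \<xi>)"
proof -
  obtain B C where BC: "\<And>\<xi>. \<bar>m \<xi>\<bar> \<le> B" "\<And>\<xi>. \<bar>k \<xi>\<bar> \<le> C" using assms by (auto simp: symbol_def)
  have "B \<ge> 0" using BC(1)[of 0] by linarith
  then have "\<bar>m \<xi> * k \<xi>\<bar> \<le> B * C" for \<xi>
    unfolding abs_mult using BC by (intro mult_mono) auto
  then show ?thesis using assms by (auto simp: symbol_def)
qed

lemma symbol_diff:
  assumes "symbol m" "symbol k"
  shows "symbol (\<lambda>\<xi>. m \<xi> - k \<xi>)"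
proof -
  obtain B C where BC: "\<And>\<xi>. \<bar>m \<xi>\<bar> \<le> B" "\<And>\<xi>. \<bar>k \<xi>\<bar> \<le> C" using assms by (auto simp: symbol_def)
  have "\<bar>m \<xi> - k \<xi>\<bar> \<le> B + C" for \<xi> using BC(1)[of \<xi>] BC(2)[of \<xi>] by linarith
  then show ?thesis using assms by (auto simp: symbol_def)
qed

lemma square_integrable_symbol_mult:
  assumes "symbol m"
  shows "square_integrable (\<lambda>\<xi>. of_real (m \<xi>) * rep_L2 (g :: (real^'n, complex) L2) \<xi>)"
proof -
  obtain B where B: "\<And>\<xi>. \<bar>m \<xi>\<bar> \<le> B" using assms by (auto simp: symbol_def)
  have [measurable]: "m \<in> borel_measurable borel" using assms by auto
  have "B \<ge> 0" using B[of 0] by linarith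
  show ?thesis
  proof (rule square_integrable_bound[OF _ square_integrable_scaleR[OF square_integrable_rep[of g], of B]])
    show "AE \<xi> in lborel. norm (of_real (m \<xi>) * rep_L2 g \<xi>) \<le> norm (B *\<^sub>R rep_L2 g \<xi>)"
      using B \<open>B \<ge> 0\<close> by (auto simp: norm_mult intro!: mult_right_mono)
  qed measurable
qed

lemma fourier_multiplier:
  assumes "symbol m"
  shows "AE \<xi> in lborel. rep_L2 (fourier (fourier_multiplier m f)) \<xi> = of_real (m \<xi>) * rep_L2 (fourier f) \<xi>"
  using assms square_integrable_symbol_mult[OF assms] by (intro fourier_multiplier_unbounded) (auto simp: symbol_def)

lemma fourier_multiplierI:
  assumes m: "symbol m" and g: "AE \<xi> in lborel. rep_L2 (fourier g) \<xi> = of_real (m \<xi>) * rep_L2 (fourier f) \<xi>"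
  shows "fourier_multiplier m f = g"
  using fourier_multiplier[OF m, of f] g by (intro fourier_eqI) auto

lemma norm_fourier_multiplier_sq:
  assumes m: "symbol m"
  shows "(norm (fourier_multiplier m f))\<^sup>2 = (LINT \<xi>|lborel. (m \<xi>)\<^sup>2 * (norm (rep_L2 (fourier f) \<xi>))\<^sup>2)"
proof -
  have [measurable]: "m \<in> borel_measurable borel" using m by auto
  show ?thesis
    unfolding norm_sq_fourier using fourier_multiplier[OF m, of f]
    by (intro integral_cong_AE) (auto simp: norm_mult power_mult_distrib)
qed

lemma integrable_fourier_multiplier_sq:
  assumes m: "symbol m"
  shows "integrable lborel (\<lambda>\<xi>. (m \<xi>)\<^sup>2 * (norm (rep_L2 (fourier f) \<xi>))\<^sup>2)"
  using square_integrable_symbol_mult[OF m, of "fourier f"]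
  by (auto simp: square_integrable_def norm_mult power_mult_distrib)

lemma norm_fourier_multiplier_le:
  assumes m: "symbol m" and B: "\<And>\<xi>. \<bar>m \<xi>\<bar> \<le> B"
  shows "norm (fourier_multiplier m f) \<le> B * norm f"
proof (rule power2_le_imp_le)
  have B0: "B \<ge> 0" using B[of 0] by linarith
  have "(norm (fourier_multiplier m f))\<^sup>2 \<le> (LINT \<xi>|lborel. B\<^sup>2 * (norm (rep_L2 (fourier f) \<xi>))\<^sup>2)"
    unfolding norm_fourier_multiplier_sq[OF m]
  proof (rule integral_mono)
    show "(m \<xi>)\<^sup>2 * (norm (rep_L2 (fourier f) \<xi>))\<^sup>2 \<le> B\<^sup>2 * (norm (rep_L2 (fourier f) \<xi>))\<^sup>2" for \<xi>
      using B[of \<xi>] B0 by (intro mult_right_mono) (auto simp flip: abs_le_square_iff)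
  qed (use integrable_fourier_multiplier_sq[OF m] in auto)
  also have "\<dots> = (B * norm f)\<^sup>2" by (simp add: norm_sq_fourier[symmetric] power_mult_distrib)
  finally show "(norm (fourier_multiplier m f))\<^sup>2 \<le> (B * norm f)\<^sup>2" .
  show "0 \<le> B * norm f" using B0 by simp
qed

lemma bounded_linear_fourier_multiplier:
  fixes m :: "real^'n \<Rightarrow> real"
  assumes m: "symbol m"
  shows "bounded_linear (fourier_multiplier m)"
proof -
  obtain B where B: "\<And>\<xi>. \<bar>m \<xi>\<bar> \<le> B" using m by (auto simp: symbol_def)
  have lin: "linear (fourier :: (real^'n, real) L2 \<Rightarrow> _)" by (rule bounded_linear.linear[OF bounded_linear_fourier])
  show ?thesis
  proof (rule bounded_linear_intro[where K=B])
    fix f g :: "(real^'n, real) L2" and r :: real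
    show "fourier_multiplier m (f + g) = fourier_multiplier m f + fourier_multiplier m g"
      using rep_L2_add[of "fourier f" "fourier g"] fourier_multiplier[OF m, of f] fourier_multiplier[OF m, of g]
        rep_L2_add[of "fourier (fourier_multiplier m f)" "fourier (fourier_multiplier m g)"]
      by (intro fourier_multiplierI[OF m]) (auto simp: linear_add[OF lin] distrib_left)
    show "fourier_multiplier m (r *\<^sub>R f) = r *\<^sub>R fourier_multiplier m f"
      using rep_L2_scaleR[of r "fourier f"] fourier_multiplier[OF m, of f]
        rep_L2_scaleR[of r "fourier (fourier_multiplier m f)"]
      by (intro fourier_multiplierI[OF m]) (auto simp: linear_scale[OF lin])
    show "norm (fourier_multiplier m f) \<le> norm f * B"
      using norm_fourier_multiplier_le[OF m B, of f] by (simp add: mult.commute)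
  qed
qed

lemma fourier_multiplier_mult:
  assumes m: "symbol m" and k: "symbol k"
  shows "fourier_multiplier m (fourier_multiplier k f) = fourier_multiplier (\<lambda>\<xi>. m \<xi> * k \<xi>) f"
  using fourier_multiplier[OF m, of "fourier_multiplier k f"] fourier_multiplier[OF k, of f]
  by (intro fourier_multiplierI[OF symbol_times[OF m k], symmetric]) auto

lemma fourier_multiplier_diff:
  assumes m: "symbol m" and k: "symbol k"
  shows "fourier_multiplier m f - fourier_multiplier k f = fourier_multiplier (\<lambda>\<xi>. m \<xi> - k \<xi>) f"
proof -
  have lin: "linear (fourier :: (real^'n, real) L2 \<Rightarrow> _)" by (rule bounded_linear.linear[OF bounded_linear_fourier])
  show ?thesis
    using fourier_multiplier[OF m, of f] fourier_multiplier[OF k, of f]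
      rep_L2_diff[of "fourier (fourier_multiplier m f)" "fourier (fourier_multiplier k f)"]
    by (intro fourier_multiplierI[OF symbol_diff[OF m k], symmetric]) (auto simp: linear_diff[OF lin] left_diff_distrib)
qed

text \<open>Dominated convergence on the Fourier side gives strong continuity in a parameter.\<close>

lemma fourier_multiplier_LIMSEQ:
  fixes m :: "nat \<Rightarrow> real^'n \<Rightarrow> real"
  assumes m: "\<And>j. symbol (m j)" and k: "symbol k" and B: "\<And>j \<xi>. \<bar>m j \<xi>\<bar> \<le> B"
    and lim: "\<And>\<xi>. (\<lambda>j. m j \<xi>) \<longlonglongrightarrow> k \<xi>"
  shows "(\<lambda>j. fourier_multiplier (m j) f) \<longlonglongrightarrow> fourier_multiplier k f"
proof -
  have [measurable]: "m j \<in> borel_measurable borel" "k \<in> borel_measurable borel" for j using m k by auto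
  have kB: "\<bar>k \<xi>\<bar> \<le> B" for \<xi>
    using tendsto_le[OF sequentially_bot tendsto_const tendsto_rabs[OF lim[of \<xi>]]] B by auto
  have "(\<lambda>j. LINT \<xi>|lborel. (m j \<xi> - k \<xi>)\<^sup>2 * (norm (rep_L2 (fourier f) \<xi>))\<^sup>2) \<longlonglongrightarrow> (LINT \<xi>|(lborel::(real^'n) measure). 0)"
  proof (rule integral_dominated_convergence)
    show "integrable lborel (\<lambda>\<xi>. (2 * B)\<^sup>2 * (norm (rep_L2 (fourier f) \<xi>))\<^sup>2)" by simp
    show "AE \<xi> in lborel. norm ((m j \<xi> - k \<xi>)\<^sup>2 * (norm (rep_L2 (fourier f) \<xi>))\<^sup>2) \<le> (2 * B)\<^sup>2 * (norm (rep_L2 (fourier f) \<xi>))\<^sup>2" for j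
    proof (intro AE_I2)
      fix \<xi> :: "real^'n"
      have "\<bar>m j \<xi> - k \<xi>\<bar> \<le> \<bar>2 * B\<bar>" using B[of j \<xi>] kB[of \<xi>] by linarith
      then have "(m j \<xi> - k \<xi>)\<^sup>2 \<le> (2 * B)\<^sup>2" by (simp only: abs_le_square_iff)
      then show "norm ((m j \<xi> - k \<xi>)\<^sup>2 * (norm (rep_L2 (fourier f) \<xi>))\<^sup>2) \<le> (2 * B)\<^sup>2 * (norm (rep_L2 (fourier f) \<xi>))\<^sup>2"
        by (simp add: mult_right_mono)
    qed
    show "AE \<xi> in lborel. (\<lambda>j. (m j \<xi> - k \<xi>)\<^sup>2 * (norm (rep_L2 (fourier f) \<xi>))\<^sup>2) \<longlonglongrightarrow> 0"
    proof (intro AE_I2)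
      fix \<xi> :: "real^'n"
      have "(\<lambda>j. (m j \<xi> - k \<xi>)\<^sup>2 * (norm (rep_L2 (fourier f) \<xi>))\<^sup>2) \<longlonglongrightarrow> (k \<xi> - k \<xi>)\<^sup>2 * (norm (rep_L2 (fourier f) \<xi>))\<^sup>2"
        by (intro tendsto_intros lim)
      then show "(\<lambda>j. (m j \<xi> - k \<xi>)\<^sup>2 * (norm (rep_L2 (fourier f) \<xi>))\<^sup>2) \<longlonglongrightarrow> 0" by simp
    qed
  qed measurable
  then have "(\<lambda>j. (norm (fourier_multiplier (m j) f - fourier_multiplier k f))\<^sup>2) \<longlonglongrightarrow> 0"
    by (simp add: fourier_multiplier_diff m k norm_fourier_multiplier_sq symbol_diff)
  then have "(\<lambda>j. sqrt ((norm (fourier_multiplier (m j) f - fourier_multiplier k f))\<^sup>2)) \<longlonglongrightarrow> sqrt 0" by (intro tendsto_intros)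
  then have "(\<lambda>j. norm (fourier_multiplier (m j) f - fourier_multiplier k f)) \<longlonglongrightarrow> 0" by simp
  then show ?thesis by (simp add: LIM_zero_iff tendsto_norm_zero_iff)
qed

text \<open>The symbol of the Bessel potential of order one, the inverse square root of 1 -
  \<Delta>.\<close>

definition bessel :: "real^'n \<Rightarrow> real" where "bessel \<xi> = 1 / sqrt (1 + (norm \<xi>)\<^sup>2)"

lemma bessel_sq: "(bessel \<xi>)\<^sup>2 = 1 / (1 + (norm \<xi>)\<^sup>2)"
  by (simp add: bessel_def power_divide add_nonneg_nonneg)

lemma bessel_pos: "0 < bessel \<xi>"
  by (simp add: bessel_def add_pos_nonneg)

lemma bessel_le_1: "bessel \<xi> \<le> 1"
  by (simp add: bessel_def add_pos_nonneg)

lemma symbol_bessel: "symbol bessel"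
proof (rule symbolI[where B=1])
  show "\<bar>bessel \<xi>\<bar> \<le> 1" for \<xi> :: "real^'n" using bessel_pos[of \<xi>] bessel_le_1[of \<xi>] by linarith
  show "bessel \<in> borel_measurable (borel :: (real^'n) measure)" unfolding bessel_def[abs_def] by measurable
qed (simp add: bessel_def)

abbreviation bessel_op :: "(real^'n, real) L2 \<Rightarrow> (real^'n, real) L2" where
  "bessel_op \<equiv> fourier_multiplier bessel"

lemma bessel_op_H1: "bessel_op f \<in> H1" and norm_H1_bessel_op: "norm_H1 (bessel_op f) = norm f"
proof -
  have ae: "AE \<xi> in lborel. (1 + (norm \<xi>)\<^sup>2) * (norm (rep_L2 (fourier (bessel_op f)) \<xi>))\<^sup>2 = (norm (rep_L2 (fourier f) \<xi>))\<^sup>2"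
    using fourier_multiplier[OF symbol_bessel, of f]
  proof eventually_elim
    case (elim \<xi>)
    have "1 + (norm \<xi>)\<^sup>2 \<noteq> 0" by (simp add: add_pos_nonneg less_imp_neq[symmetric])
    then show ?case unfolding elim by (simp add: norm_mult power_mult_distrib bessel_sq)
  qed
  show "norm_H1 (bessel_op f) = norm f"
    unfolding norm_H1_def using ae
    by (subst integral_cong_AE[where g="\<lambda>\<xi>. (norm (rep_L2 (fourier f) \<xi>))\<^sup>2"]) (auto simp flip: norm_sq_fourier)
  show "bessel_op f \<in> H1"
    unfolding H1_def mem_Collect_eq
    by (subst integrable_cong_AE[where g="\<lambda>\<xi>. (norm (rep_L2 (fourier f) \<xi>))\<^sup>2"]) (use ae in auto)
qed

text \<open>The preimage comes from the unbounded symbol \<open>?m\<close>; membership in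
  \<open>H1\<close> is exactly the square-integrability that lets this multiplier act on
  \<open>u\<close>.\<close>

lemma H1_eq_bessel_op:
  fixes u :: "(real^'n, real) L2"
  assumes "u \<in> H1"
  obtains U where "u = bessel_op U"
proof -
  let ?m = "\<lambda>\<xi>::real^'n. sqrt (1 + (norm \<xi>)\<^sup>2)"
  have S: "square_integrable (\<lambda>\<xi>. of_real (?m \<xi>) * rep_L2 (fourier u) \<xi>)"
    using assms by (auto simp: square_integrable_def H1_def norm_mult power_mult_distrib add_nonneg_nonneg)
  have U: "AE \<xi> in lborel. rep_L2 (fourier (fourier_multiplier ?m u)) \<xi> = of_real (?m \<xi>) * rep_L2 (fourier u) \<xi>"
    by (rule fourier_multiplier_unbounded[OF _ _ S]) auto
  have "bessel_op (fourier_multiplier ?m u) = u"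
  proof (rule fourier_multiplierI[OF symbol_bessel])
    show "AE \<xi> in lborel. rep_L2 (fourier u) \<xi> = of_real (bessel \<xi>) * rep_L2 (fourier (fourier_multiplier ?m u)) \<xi>"
      using U
    proof eventually_elim
      case (elim \<xi>)
      have "1 + (norm \<xi>)\<^sup>2 \<noteq> 0" by (simp add: add_pos_nonneg less_imp_neq[symmetric])
      then have "?m \<xi> \<noteq> 0" by simp
      then show ?case unfolding elim by (simp add: bessel_def)
    qed
  qed
  then show ?thesis using that by metis
qed

lemma bessel_op_inj: "bessel_op f = bessel_op (g :: (real^'n, real) L2) \<Longrightarrow> f = g"
proof -
  assume eq: "bessel_op f = bessel_op g"
  have "bessel_op (f - g) = 0"
    using eq linear_diff[OF bounded_linear.linear[OF bounded_linear_fourier_multiplier[OF symbol_bessel]], of f g] by simp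
  then have "norm_H1 (bessel_op (f - g)) = norm_H1 (bessel_op (0 :: (real^'n, real) L2))"
    by (simp add: linear_0[OF bounded_linear.linear[OF bounded_linear_fourier_multiplier[OF symbol_bessel]]])
  then show "f = g" by (simp add: norm_H1_bessel_op)
qed

subsection \<open>Symbols of the damped wave equation\<close>

text \<open>Removing the factor \<open>exp (- t / 2)\<close> from the damped equation at frequency
  \<open>r\<close> leaves \<open>y'' = (1/4 - r\<^sup>2) y\<close>. Its solutions with value 0 and
  slope 1, respectively value 1 and slope 0, at time 0 are \<open>wave_sin\<close> and
  \<open>wave_cos\<close>.\<close>

definition wave_sin :: "real \<Rightarrow> real \<Rightarrow> real" where
  "wave_sin t r = (if r > 1/2 then sin (t * sqrt (r\<^sup>2 - 1/4)) / sqrt (r\<^sup>2 - 1/4)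
      else if r < 1/2 then sinh (t * sqrt (1/4 - r\<^sup>2)) / sqrt (1/4 - r\<^sup>2) else t)"

definition wave_cos :: "real \<Rightarrow> real \<Rightarrow> real" where
  "wave_cos t r = (if r > 1/2 then cos (t * sqrt (r\<^sup>2 - 1/4))
      else if r < 1/2 then cosh (t * sqrt (1/4 - r\<^sup>2)) else 1)"

lemma damped_wave_symbol_eq: "damped_wave_symbol t \<xi> = exp (- t / 2) * wave_sin t (norm \<xi>)"
  by (simp add: damped_wave_symbol_def wave_sin_def)

lemma quarter_less_sq: "r > 1/2 \<Longrightarrow> 1/4 < (r::real)\<^sup>2"
  using power_strict_mono[of "1/2" r 2] by (simp add: power2_eq_square)

lemma sq_less_quarter: "0 \<le> r \<Longrightarrow> r < 1/2 \<Longrightarrow> (r::real)\<^sup>2 < 1/4"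
  using power_strict_mono[of r "1/2" 2] by (simp add: power2_eq_square)

lemma DERIV_wave_sin:
  assumes "0 \<le> r"
  shows "((\<lambda>t. wave_sin t r) has_real_derivative wave_cos t r) (at t within X)"
proof -
  consider "r > 1/2" | "r < 1/2" | "r = 1/2" by linarith
  then show ?thesis
  proof cases
    case 1
    define \<mu> where "\<mu> = sqrt (r\<^sup>2 - 1/4)"
    have "\<mu> > 0" using quarter_less_sq[OF 1] by (simp add: \<mu>_def)
    then have "((\<lambda>t. sin (t * \<mu>) / \<mu>) has_real_derivative cos (t * \<mu>)) (at t within X)"
      by (auto intro!: derivative_eq_intros)
    then show ?thesis using 1 by (simp add: wave_sin_def wave_cos_def \<mu>_def)
  next
    case 2
    define \<mu> where "\<mu> = sqrt (1/4 - r\<^sup>2)"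
    have "\<mu> > 0" using sq_less_quarter[OF assms 2] by (simp add: \<mu>_def)
    then have "((\<lambda>t. sinh (t * \<mu>) / \<mu>) has_real_derivative cosh (t * \<mu>)) (at t within X)"
      by (auto intro!: derivative_eq_intros)
    then show ?thesis using 2 by (simp add: wave_sin_def wave_cos_def \<mu>_def)
  next
    case 3
    then show ?thesis unfolding wave_sin_def wave_cos_def by (auto intro!: derivative_eq_intros)
  qed
qed

lemma DERIV_wave_cos:
  assumes "0 \<le> r"
  shows "((\<lambda>t. wave_cos t r) has_real_derivative (1/4 - r\<^sup>2) * wave_sin t r) (at t within X)"
proof -
  consider "r > 1/2" | "r < 1/2" | "r = 1/2" by linarith
  then show ?thesis
  proof cases
    case 1
    define \<mu> where "\<mu> = sqrt (r\<^sup>2 - 1/4)"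
    have \<mu>: "\<mu> > 0" "1/4 - r\<^sup>2 = - \<mu>\<^sup>2" using quarter_less_sq[OF 1] by (auto simp: \<mu>_def)
    have "((\<lambda>t. cos (t * \<mu>)) has_real_derivative - \<mu>\<^sup>2 * (sin (t * \<mu>) / \<mu>)) (at t within X)"
      using \<mu>(1) by (auto intro!: derivative_eq_intros simp: power2_eq_square)
    then show ?thesis using 1 \<mu>(2) by (simp add: wave_sin_def wave_cos_def \<mu>_def)
  next
    case 2
    define \<mu> where "\<mu> = sqrt (1/4 - r\<^sup>2)"
    have \<mu>: "\<mu> > 0" "1/4 - r\<^sup>2 = \<mu>\<^sup>2" using sq_less_quarter[OF assms 2] by (auto simp: \<mu>_def)
    have "((\<lambda>t. cosh (t * \<mu>)) has_real_derivative \<mu>\<^sup>2 * (sinh (t * \<mu>) / \<mu>)) (at t within X)"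
      using \<mu>(1) by (auto intro!: derivative_eq_intros simp: power2_eq_square)
    then show ?thesis using 2 \<mu>(1) by (simp add: wave_sin_def wave_cos_def \<mu>(2))
  next
    case 3
    have e: "(1/4 - r\<^sup>2) * wave_sin t r = 0" by (simp add: 3 power_divide)
    show ?thesis unfolding e wave_cos_def by (simp add: 3)
  qed
qed

text \<open>The symbol of \<open>(\<partial>\<^sub>t + 1) \<H>(t, \<nabla>)\<close>.\<close>

definition wave_symbol1 :: "real \<Rightarrow> real^'n \<Rightarrow> real" where
  "wave_symbol1 t \<xi> = exp (- t / 2) * (wave_sin t (norm \<xi>) / 2 + wave_cos t (norm \<xi>))"

lemma DERIV_damped_wave_symbol:
  "((\<lambda>t. damped_wave_symbol t \<xi>) has_real_derivative wave_symbol1 t \<xi> - damped_wave_symbol t \<xi>) (at t within X)"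
  unfolding damped_wave_symbol_eq wave_symbol1_def
  by (auto intro!: derivative_eq_intros DERIV_wave_sin simp: field_simps)

text \<open>Together with the preceding derivative this is the damped wave equation
  \<open>w'' + w' + (norm \<xi>)\<^sup>2 w = 0\<close>, written as a first-order system for
  \<open>w\<close> and \<open>w' + w\<close>.\<close>

lemma DERIV_wave_symbol1:
  "((\<lambda>t. wave_symbol1 t \<xi>) has_real_derivative - (norm \<xi>)\<^sup>2 * damped_wave_symbol t \<xi>) (at t within X)"
  unfolding damped_wave_symbol_eq wave_symbol1_def
  by (auto intro!: derivative_eq_intros DERIV_wave_sin DERIV_wave_cos simp: field_simps)

lemma dt_plus_one_damped_wave_op_eq: "dt_plus_one_damped_wave_op t = fourier_multiplier (wave_symbol1 t)"
  unfolding dt_plus_one_damped_wave_op_def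
  by (simp add: DERIV_imp_deriv[OF DERIV_damped_wave_symbol])

lemma borel_measurable_cosh [measurable]: "(cosh :: real \<Rightarrow> real) \<in> borel_measurable borel"
  by (intro borel_measurable_continuous_onI continuous_intros)

lemma borel_measurable_sinh [measurable]: "(sinh :: real \<Rightarrow> real) \<in> borel_measurable borel"
  by (intro borel_measurable_continuous_onI continuous_intros)

lemma borel_measurable_damped_wave_symbol [measurable]: "damped_wave_symbol t \<in> borel_measurable borel"
  unfolding damped_wave_symbol_def[abs_def] by measurable

lemma borel_measurable_wave_symbol1 [measurable]: "wave_symbol1 t \<in> borel_measurable borel"
  unfolding wave_symbol1_def[abs_def] wave_sin_def wave_cos_def by measurable

lemma sinh_le_mult_exp: "0 \<le> x \<Longrightarrow> sinh x \<le> x * exp (x::real)"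
proof -
  assume x: "0 \<le> x"
  have "1 - 2 * x \<le> exp (- (2 * x))" using exp_ge_add_one_self[of "- (2 * x)"] by simp
  then have "(1 - 2 * x) * exp x \<le> exp (- (2 * x)) * exp x" by (intro mult_right_mono) auto
  also have "\<dots> = exp (- x)" by (simp flip: exp_add)
  finally show ?thesis by (simp add: sinh_def algebra_simps)
qed

lemma abs_sin_mult_le:
  assumes "0 \<le> (t::real)" "0 < \<mu>"
  shows "\<bar>sin (t * \<mu>) / \<mu>\<bar> \<le> t" "\<bar>sin (t * \<mu>) / \<mu>\<bar> \<le> 1 / \<mu>"
proof -
  have "\<bar>sin (t * \<mu>)\<bar> \<le> t * \<mu>" using abs_sin_x_le_abs_x[of "t * \<mu>"] assms by simp
  then show "\<bar>sin (t * \<mu>) / \<mu>\<bar> \<le> t" using assms by (simp add: field_simps)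
  show "\<bar>sin (t * \<mu>) / \<mu>\<bar> \<le> 1 / \<mu>" using assms abs_sin_le_one[of "t * \<mu>"] by (simp add: field_simps)
qed

text \<open>The source of the heat-like decay: the slow characteristic root
  \<open>- 1/2 + sqrt (1/4 - r\<^sup>2)\<close> is at most \<open>- r\<^sup>2\<close>.\<close>

lemma sqrt_quarter_minus_le:
  assumes "0 \<le> (r::real)" "r < 1/2"
  shows "sqrt (1/4 - r\<^sup>2) \<le> 1/2 - r\<^sup>2"
proof (rule real_le_lsqrt)
  have "(1/2 - r\<^sup>2)\<^sup>2 = 1/4 - r\<^sup>2 + (r\<^sup>2)\<^sup>2" by (simp add: power2_eq_square algebra_simps)
  then show "1/4 - r\<^sup>2 \<le> (1/2 - r\<^sup>2)\<^sup>2" using zero_le_power2[of "r\<^sup>2"] by linarith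
qed (use sq_less_quarter[OF assms] in auto)

text \<open>Meant for small times: it makes the Duhamel term quadratic in time and dominates
  difference quotients when the initial velocity is computed.\<close>

lemma abs_damped_wave_symbol_le: "0 \<le> t \<Longrightarrow> \<bar>damped_wave_symbol t \<xi>\<bar> \<le> t"
proof -
  assume t: "0 \<le> t"
  define r where "r = norm \<xi>"
  have r: "0 \<le> r" by (simp add: r_def)
  consider "r > 1/2" | "r < 1/2" | "r = 1/2" by linarith
  then have "exp (- t / 2) * \<bar>wave_sin t r\<bar> \<le> t"
  proof cases
    case 1
    have "exp (- t / 2) * \<bar>wave_sin t r\<bar> \<le> 1 * t"
      using 1 t quarter_less_sq[OF 1] abs_sin_mult_le(1)[of t "sqrt (r\<^sup>2 - 1/4)"]
      by (intro mult_mono) (auto simp: wave_sin_def)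
    then show ?thesis by simp
  next
    case 2
    define \<mu> where "\<mu> = sqrt (1/4 - r\<^sup>2)"
    have "\<mu> \<le> 1/2 - r\<^sup>2" using sqrt_quarter_minus_le[OF r 2] by (simp add: \<mu>_def)
    then have \<mu>: "0 < \<mu>" "\<mu> \<le> 1/2"
      using sq_less_quarter[OF r 2] zero_le_power2[of r] by (simp add: \<mu>_def, linarith)
    have "sinh (t * \<mu>) / \<mu> \<le> t * exp (t * \<mu>)"
      using sinh_le_mult_exp[of "t * \<mu>"] t \<mu> by (simp add: field_simps)
    also have "\<dots> \<le> t * exp (t / 2)" using t \<mu> mult_left_mono[OF \<mu>(2) t] by (intro mult_left_mono) auto
    finally have "exp (- t / 2) * (sinh (t * \<mu>) / \<mu>) \<le> exp (- t / 2) * (t * exp (t / 2))"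
      by (rule mult_left_mono) simp
    also have "\<dots> = t" by (simp add: exp_minus)
    finally show ?thesis using 2 t \<mu> by (simp add: wave_sin_def \<mu>_def[symmetric])
  next
    case 3
    then show ?thesis using t by (simp add: wave_sin_def mult_left_le_one_le)
  qed
  then show ?thesis unfolding damped_wave_symbol_eq r_def by (simp add: abs_mult)
qed

text \<open>A factor \<open>t\<close> is paid for with half of the exponential rate.\<close>

lemma time_exp_le: "t * exp (- t / 4) \<le> 8 * exp (- (t::real) / 8)"
proof -
  have "t \<le> 8 * exp (t / 8)" using exp_ge_add_one_self[of "t / 8"] by linarith
  then have "t * exp (- t / 4) \<le> 8 * exp (t / 8) * exp (- t / 4)" by (intro mult_right_mono) auto
  also have "\<dots> = 8 * exp (- t / 8)" by (simp add: mult.assoc flip: exp_add)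
  finally show ?thesis .
qed

lemma le_mult_add: "0 \<le> a \<Longrightarrow> 0 \<le> b \<Longrightarrow> 0 \<le> c \<Longrightarrow> x \<le> c * a \<or> x \<le> c * b \<Longrightarrow> x \<le> c * (a + b :: real)"
  by (auto simp: distrib_left intro: add_increasing add_increasing2)

text \<open>The factor \<open>sqrt (1 + (norm \<xi>)\<^sup>2)\<close> is the derivative gained by
  the flow. For \<open>norm \<xi> > 1\<close> the denominator of the sine quotient absorbs it.
  Around \<open>norm \<xi> = 1/2\<close>, where that denominator degenerates, the quotient is
  bounded by \<open>t\<close> times at most \<open>exp (t / 4)\<close>, and the damping wins. At low
  frequency, where the denominator is at least 1/4, the slow root produces the Gaussian.\<close>

lemma damped_wave_symbol_decay:
  assumes t: "0 \<le> t"
  shows "sqrt (1 + (norm \<xi>)\<^sup>2) * \<bar>damped_wave_symbol t \<xi>\<bar>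
      \<le> 16 * (exp (- (1 + t) * (norm \<xi>)\<^sup>2) + exp (- t / 8))" (is ?A)
    and "\<bar>wave_symbol1 t \<xi>\<bar> \<le> 16 * (exp (- (1 + t) * (norm \<xi>)\<^sup>2) + exp (- t / 8))" (is ?B)
proof -
  define r where "r = norm \<xi>"
  have r: "0 \<le> r" by (simp add: r_def)
  have sq2: "sqrt (1 + r\<^sup>2) \<le> 2" if "r \<le> 1"
    using power_le_one[OF r that, of 2] by (intro real_le_lsqrt) auto
  have sq1: "1 \<le> sqrt (1 + r\<^sup>2)" by simp
  have half: "t * exp (- t / 2) \<le> 8 * exp (- t / 8)"
    using time_exp_le[of t] mult_left_mono[of "exp (- t / 2)" "exp (- t / 4)" t] t by simp
  \<comment> \<open>The slow root alone gives a Gaussian with \<open>t\<close> in the exponent;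
    having \<open>1 + t\<close> there costs \<open>exp (r\<^sup>2) \<le> 2\<close>.\<close>
  have low: "exp (- t / 2) * exp (t * sqrt (1/4 - r\<^sup>2)) \<le> 2 * exp (- (1 + t) * r\<^sup>2)" if "r < 1/2"
  proof -
    have "t * sqrt (1/4 - r\<^sup>2) \<le> t * (1/2 - r\<^sup>2)" using sqrt_quarter_minus_le[OF r that] t by (intro mult_left_mono)
    then have "exp (- t / 2) * exp (t * sqrt (1/4 - r\<^sup>2)) \<le> exp (r\<^sup>2) * exp (- (1 + t) * r\<^sup>2)"
      unfolding exp_add[symmetric] by (simp add: algebra_simps)
    also have "\<dots> \<le> 2 * exp (- (1 + t) * r\<^sup>2)"
    proof (intro mult_right_mono)
      have "exp (r\<^sup>2) \<le> 1 + r\<^sup>2 + (r\<^sup>2)\<^sup>2" using sq_less_quarter[OF r that] by (intro exp_bound) auto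
      also have "\<dots> \<le> 2" using sq_less_quarter[OF r that] power_mono[of "r\<^sup>2" "1/4" 2] by (simp add: power2_eq_square)
      finally show "exp (r\<^sup>2) \<le> 2" .
    qed simp
    finally show ?thesis .
  qed
  consider "r > 1" | "1/2 < r" "r \<le> 1" | "r < 1/2" "1/4 \<le> sqrt (1/4 - r\<^sup>2)" | "r < 1/2" "sqrt (1/4 - r\<^sup>2) < 1/4" | "r = 1/2"
    by linarith
  then have A: "sqrt (1 + r\<^sup>2) * (exp (- t / 2) * \<bar>wave_sin t r\<bar>) \<le> 16 * (exp (- (1 + t) * r\<^sup>2) + exp (- t / 8))"
  proof cases
    case 1
    have "1 < r\<^sup>2" using power_strict_mono[of 1 r 2] 1 by simp
    then have s: "sqrt (1 + r\<^sup>2) \<le> 2 * sqrt (r\<^sup>2 - 1/4)" by (intro real_le_lsqrt) (auto simp: power_mult_distrib)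
    have p: "0 < sqrt (r\<^sup>2 - 1/4)" using \<open>1 < r\<^sup>2\<close> by simp
    have "sqrt (1 + r\<^sup>2) * \<bar>wave_sin t r\<bar> \<le> (2 * sqrt (r\<^sup>2 - 1/4)) * (1 / sqrt (r\<^sup>2 - 1/4))"
      using s abs_sin_mult_le(2)[OF t p] 1 p by (intro mult_mono) (auto simp: wave_sin_def)
    also have "\<dots> = 2" using p by simp
    finally have "exp (- t / 2) * (sqrt (1 + r\<^sup>2) * \<bar>wave_sin t r\<bar>) \<le> exp (- t / 2) * 2" by simp
    also have "\<dots> \<le> 2 * exp (- t / 8)" using t by simp
    finally have "sqrt (1 + r\<^sup>2) * (exp (- t / 2) * \<bar>wave_sin t r\<bar>) \<le> 2 * exp (- t / 8)" by (simp only: mult_ac)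
    also have "\<dots> \<le> 16 * exp (- t / 8)" by simp
    finally show ?thesis by (intro le_mult_add disjI2) simp_all
  next
    case 2
    have p: "0 < sqrt (r\<^sup>2 - 1/4)" using quarter_less_sq[OF 2(1)] by simp
    have "exp (- t / 2) * \<bar>wave_sin t r\<bar> \<le> exp (- t / 2) * t"
      using abs_sin_mult_le(1)[OF t p] 2 by (intro mult_left_mono) (auto simp: wave_sin_def)
    also have "\<dots> \<le> 8 * exp (- t / 8)" using half by (simp only: mult.commute)
    finally have "sqrt (1 + r\<^sup>2) * (exp (- t / 2) * \<bar>wave_sin t r\<bar>) \<le> 2 * (8 * exp (- t / 8))"
      using sq2[OF 2(2)] by (rule_tac mult_mono) auto
    then show ?thesis by (intro le_mult_add disjI2) simp_all
  next
    case 3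
    define \<mu> where "\<mu> = sqrt (1/4 - r\<^sup>2)"
    have \<mu>: "\<mu> \<ge> 1/4" using 3 by (simp add: \<mu>_def)
    have "sinh (t * \<mu>) \<le> exp (t * \<mu>) / 2" by (simp add: sinh_def)
    then have "sinh (t * \<mu>) / \<mu> \<le> (exp (t * \<mu>) / 2) / (1/4)" using \<mu> by (intro frac_le) auto
    then have "exp (- t / 2) * \<bar>wave_sin t r\<bar> \<le> exp (- t / 2) * (2 * exp (t * \<mu>))"
      using 3 t \<mu> by (intro mult_left_mono) (auto simp: wave_sin_def \<mu>_def[symmetric])
    also have "\<dots> \<le> 4 * exp (- (1 + t) * r\<^sup>2)" using low[OF 3(1)] by (simp add: \<mu>_def)
    finally have "sqrt (1 + r\<^sup>2) * (exp (- t / 2) * \<bar>wave_sin t r\<bar>) \<le> 2 * (4 * exp (- (1 + t) * r\<^sup>2))"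
      using sq2 3 by (rule_tac mult_mono) auto
    also have "\<dots> \<le> 16 * exp (- (1 + t) * r\<^sup>2)" by simp
    finally show ?thesis by (intro le_mult_add disjI1) simp_all
  next
    case 4
    define \<mu> where "\<mu> = sqrt (1/4 - r\<^sup>2)"
    have \<mu>: "0 < \<mu>" "\<mu> \<le> 1/4" using less_imp_le[OF 4(2)] sq_less_quarter[OF r 4(1)] by (simp_all only: \<mu>_def real_sqrt_gt_0_iff diff_gt_0_iff_gt)
    have "sinh (t * \<mu>) / \<mu> \<le> t * exp (t * \<mu>)"
      using sinh_le_mult_exp[of "t * \<mu>"] t \<mu> by (simp add: field_simps)
    also have "\<dots> \<le> t * exp (t / 4)" using t mult_left_mono[OF \<mu>(2) t] by (intro mult_left_mono) auto
    finally have "exp (- t / 2) * \<bar>wave_sin t r\<bar> \<le> exp (- t / 2) * (t * exp (t / 4))"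
      using 4 t \<mu> by (intro mult_left_mono) (auto simp: wave_sin_def \<mu>_def[symmetric])
    also have "\<dots> = t * exp (- t / 4)" by (simp add: mult.left_commute flip: exp_add)
    also note time_exp_le
    finally have "sqrt (1 + r\<^sup>2) * (exp (- t / 2) * \<bar>wave_sin t r\<bar>) \<le> 2 * (8 * exp (- t / 8))"
      using sq2 4 by (rule_tac mult_mono) auto
    then show ?thesis by (intro le_mult_add disjI2) simp_all
  next
    case 5
    then have "sqrt (1 + r\<^sup>2) * (exp (- t / 2) * \<bar>wave_sin t r\<bar>) \<le> 2 * (8 * exp (- t / 8))"
      using sq2 half t by (rule_tac mult_mono) (auto simp: wave_sin_def mult.commute)
    then show ?thesis by (intro le_mult_add disjI2) simp_all
  qed
  then show ?A unfolding damped_wave_symbol_eq r_def by (simp add: abs_mult)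
  have cos: "exp (- t / 2) * \<bar>wave_cos t r\<bar> \<le> 2 * (exp (- (1 + t) * r\<^sup>2) + exp (- t / 8))"
  proof (cases "r < 1/2")
    case True
    have "cosh (t * sqrt (1/4 - r\<^sup>2)) \<le> exp (t * sqrt (1/4 - r\<^sup>2))"
      using t sq_less_quarter[OF r True] by (simp add: cosh_def)
    then have "exp (- t / 2) * \<bar>wave_cos t r\<bar> \<le> exp (- t / 2) * exp (t * sqrt (1/4 - r\<^sup>2))"
      using True by (intro mult_left_mono) (auto simp: wave_cos_def)
    also note low[OF True]
    finally show ?thesis by (intro le_mult_add disjI1) simp_all
  next
    case False
    have "exp (- t / 2) * \<bar>wave_cos t r\<bar> \<le> exp (- t / 8) * 1"
      using False t by (intro mult_mono) (auto simp: wave_cos_def)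
    also have "\<dots> \<le> 2 * exp (- t / 8)" by simp
    finally show ?thesis by (intro le_mult_add disjI2) simp_all
  qed
  have sin: "exp (- t / 2) * \<bar>wave_sin t r\<bar> \<le> 16 * (exp (- (1 + t) * r\<^sup>2) + exp (- t / 8))"
    using order_trans[OF mult_right_mono[OF sq1, of "exp (- t / 2) * \<bar>wave_sin t r\<bar>"] A] by simp
  define x y where "x = exp (- t / 2) * \<bar>wave_sin t r\<bar>" and "y = exp (- t / 2) * \<bar>wave_cos t r\<bar>"
  have "\<bar>2 * (exp (- t / 2) * (wave_sin t r / 2 + wave_cos t r))\<bar> = \<bar>exp (- t / 2) * wave_sin t r + 2 * (exp (- t / 2) * wave_cos t r)\<bar>"
    by (simp add: algebra_simps)
  also have "\<dots> \<le> x + 2 * y"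
    using abs_triangle_ineq[of "exp (- t / 2) * wave_sin t r" "2 * (exp (- t / 2) * wave_cos t r)"]
    by (simp add: abs_mult x_def y_def)
  finally have "2 * \<bar>wave_symbol1 t \<xi>\<bar> \<le> x + 2 * y"
    by (simp add: wave_symbol1_def r_def abs_mult)
  then have "2 * \<bar>wave_symbol1 t \<xi>\<bar> \<le> 20 * (exp (- (1 + t) * r\<^sup>2) + exp (- t / 8))"
    using cos sin unfolding x_def[symmetric] y_def[symmetric] by linarith
  moreover have "0 \<le> exp (- (1 + t) * r\<^sup>2) + exp (- t / 8)" by simp
  ultimately show ?B unfolding r_def by linarith
qed

text \<open>
  A solution is written as \<open>u = bessel_op U\<close> with \<open>U\<close> in \<open>L\<^sup>2\<close>, so that \<open>wave_symbol2\<close> is the symbol by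
  which \<open>\<H>(t, \<nabla>)\<close> acts on data of \<open>u\<close> when it is expressed in terms of \<open>U\<close>.
\<close>

definition wave_symbol2 :: "real \<Rightarrow> real^'n \<Rightarrow> real" where
  "wave_symbol2 t \<xi> = sqrt (1 + (norm \<xi>)\<^sup>2) * damped_wave_symbol t \<xi>"

lemma bessel_wave_symbol2: "bessel \<xi> * wave_symbol2 t \<xi> = damped_wave_symbol t \<xi>"
  using add_pos_nonneg[of 1 "(norm \<xi>)\<^sup>2"] by (simp add: bessel_def wave_symbol2_def)

lemma wave_symbol_bounded:
  assumes t: "0 \<le> t"
  shows "\<bar>wave_symbol2 t \<xi>\<bar> \<le> 32" "\<bar>wave_symbol1 t \<xi>\<bar> \<le> 32" "\<bar>damped_wave_symbol t \<xi>\<bar> \<le> 32"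
proof -
  have "exp (- (1 + t) * (norm \<xi>)\<^sup>2) \<le> 1" using t
    by (simp only: exp_le_one_iff mult_minus_left neg_le_0_iff_le) (intro mult_nonneg_nonneg, auto)
  moreover have "exp (- t / 8) \<le> 1" using t by simp
  ultimately show "\<bar>wave_symbol1 t \<xi>\<bar> \<le> 32" and 2: "\<bar>wave_symbol2 t \<xi>\<bar> \<le> 32"
    using damped_wave_symbol_decay[OF t, of \<xi>] by (auto simp: wave_symbol2_def abs_mult simp del: exp_le_one_iff)
  have "1 * \<bar>damped_wave_symbol t \<xi>\<bar> \<le> sqrt (1 + (norm \<xi>)\<^sup>2) * \<bar>damped_wave_symbol t \<xi>\<bar>"
    by (intro mult_right_mono) auto
  then show "\<bar>damped_wave_symbol t \<xi>\<bar> \<le> 32" using 2 by (simp add: wave_symbol2_def abs_mult)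
qed

lemma symbol_wave:
  assumes t: "0 \<le> t"
  shows "symbol (wave_symbol1 t)" "symbol (wave_symbol2 t)" "symbol (damped_wave_symbol t)"
proof -
  have [measurable]: "wave_symbol2 t \<in> borel_measurable borel" unfolding wave_symbol2_def[abs_def] by measurable
  show "symbol (wave_symbol1 t)" "symbol (wave_symbol2 t)" "symbol (damped_wave_symbol t)"
    by (rule symbolI[OF _ wave_symbol_bounded(2)[OF t]], measurable, simp add: wave_symbol1_def)
      (rule symbolI[OF _ wave_symbol_bounded(1)[OF t]], measurable, simp add: wave_symbol2_def damped_wave_symbol_def,
       rule symbolI[OF _ wave_symbol_bounded(3)[OF t]], measurable, simp add: damped_wave_symbol_def)
qed

lemma isCont_wave_symbols:
  "isCont (\<lambda>t. wave_symbol1 t \<xi>) t" "isCont (\<lambda>t. wave_symbol2 t \<xi>) t" "isCont (\<lambda>t. damped_wave_symbol t \<xi>) t"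
  unfolding wave_symbol2_def
  by (intro continuous_intros DERIV_isCont[OF DERIV_wave_symbol1] DERIV_isCont[OF DERIV_damped_wave_symbol])+

lemma square_le_two_squares: "0 \<le> x \<Longrightarrow> x \<le> c * (a + b) \<Longrightarrow> (x::real)\<^sup>2 \<le> 2 * c\<^sup>2 * (a\<^sup>2 + b\<^sup>2)"
proof -
  assume x: "0 \<le> x" "x \<le> c * (a + b)"
  have "(a + b)\<^sup>2 \<le> 2 * (a\<^sup>2 + b\<^sup>2)" using sum_squares_bound[of a b] by (simp add: power2_sum)
  then have "c\<^sup>2 * (a + b)\<^sup>2 \<le> c\<^sup>2 * (2 * (a\<^sup>2 + b\<^sup>2))" by (intro mult_left_mono) auto
  moreover have "x\<^sup>2 \<le> c\<^sup>2 * (a + b)\<^sup>2" unfolding power_mult_distrib[symmetric] by (intro power_mono x)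
  ultimately show ?thesis by (simp only: mult.assoc mult.left_commute[of "c\<^sup>2"])
qed

text \<open>The constant 512 is \<open>2 * 16\<^sup>2\<close>: squaring a sum of two terms costs a
  factor 2.\<close>

lemma wave_symbol_sq_decay:
  assumes t: "0 \<le> t"
  shows "(wave_symbol1 t \<xi>)\<^sup>2 \<le> 512 * (exp (- 2 * (1 + t) * (norm \<xi>)\<^sup>2) + exp (- t / 4))"
    and "(wave_symbol2 t \<xi>)\<^sup>2 \<le> 512 * (exp (- 2 * (1 + t) * (norm \<xi>)\<^sup>2) + exp (- t / 4))"
proof -
  have e: "(exp (- (1 + t) * (norm \<xi>)\<^sup>2))\<^sup>2 = exp (- 2 * (1 + t) * (norm \<xi>)\<^sup>2)" "(exp (- t / 8))\<^sup>2 = exp (- t / 4)"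
    by (simp_all add: power2_eq_square flip: exp_add)
  have "\<bar>wave_symbol2 t \<xi>\<bar> \<le> 16 * (exp (- (1 + t) * (norm \<xi>)\<^sup>2) + exp (- t / 8))"
    using damped_wave_symbol_decay(1)[OF t, of \<xi>] by (simp add: wave_symbol2_def abs_mult)
  from square_le_two_squares[OF abs_ge_zero this] square_le_two_squares[OF abs_ge_zero damped_wave_symbol_decay(2)[OF t, of \<xi>]]
  show "(wave_symbol1 t \<xi>)\<^sup>2 \<le> 512 * (exp (- 2 * (1 + t) * (norm \<xi>)\<^sup>2) + exp (- t / 4))"
    and "(wave_symbol2 t \<xi>)\<^sup>2 \<le> 512 * (exp (- 2 * (1 + t) * (norm \<xi>)\<^sup>2) + exp (- t / 4))"
    unfolding e by (simp_all only: power2_abs, simp_all)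
qed

subsection \<open>Decay of the linear flow\<close>

definition time_weight :: "real \<Rightarrow> real^'n \<Rightarrow> real" where
  "time_weight t \<xi> = sqrt ((1 + (1 + t) * (norm \<xi>)\<^sup>2) / (1 + (norm \<xi>)\<^sup>2))"

lemma time_weight_sq: "0 \<le> t \<Longrightarrow> (time_weight t \<xi>)\<^sup>2 = (1 + (1 + t) * (norm \<xi>)\<^sup>2) / (1 + (norm \<xi>)\<^sup>2)"
  unfolding time_weight_def by (intro real_sqrt_pow2 divide_nonneg_nonneg) (auto intro!: add_nonneg_nonneg)

lemma time_weight_bounds:
  assumes t: "0 \<le> t"
  shows "1 \<le> time_weight t \<xi>" "(time_weight t \<xi>)\<^sup>2 \<le> 1 + t"
proof -
  have p: "0 < 1 + (norm \<xi>)\<^sup>2" by (simp add: add_pos_nonneg)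
  have "0 \<le> t * (norm \<xi>)\<^sup>2" using t by simp
  then have "1 + (norm \<xi>)\<^sup>2 \<le> 1 + (1 + t) * (norm \<xi>)\<^sup>2" "1 + (1 + t) * (norm \<xi>)\<^sup>2 \<le> (1 + t) * (1 + (norm \<xi>)\<^sup>2)"
    using t by (simp_all add: algebra_simps)
  then have "1 \<le> (1 + (1 + t) * (norm \<xi>)\<^sup>2) / (1 + (norm \<xi>)\<^sup>2)" "(1 + (1 + t) * (norm \<xi>)\<^sup>2) / (1 + (norm \<xi>)\<^sup>2) \<le> 1 + t"
    using p by (simp_all add: le_divide_eq divide_le_eq)
  then show "1 \<le> time_weight t \<xi>" "(time_weight t \<xi>)\<^sup>2 \<le> 1 + t"
    unfolding time_weight_sq[OF t] by (simp_all add: time_weight_def)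
qed

lemma symbol_time_weight:
  assumes t: "0 \<le> t"
  shows "symbol (time_weight t)"
proof (rule symbolI)
  show "\<bar>time_weight t \<xi>\<bar> \<le> 1 + t" for \<xi> :: "real^'n"
  proof (rule power2_le_imp_le)
    have "1 + t \<le> (1 + t)\<^sup>2" using t by (simp add: power2_eq_square algebra_simps)
    then show "\<bar>time_weight t \<xi>\<bar>\<^sup>2 \<le> (1 + t)\<^sup>2" using time_weight_bounds(2)[OF t, of \<xi>] by simp
  qed (use t in simp)
  show "time_weight t \<in> borel_measurable (borel :: (real^'n) measure)" unfolding time_weight_def[abs_def] by measurable
qed (simp add: time_weight_def)

text \<open>
  In terms of \<open>u = bessel_op U\<close> this is \<open>(1 + t)\<^bsup>n/4\<^esup> (\<parallel>u\<parallel>\<^sup>2 + (1 + t) \<parallel>\<nabla>u\<parallel>\<^sup>2)\<^bsup>1/2\<^esup>\<close>,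
  which the linear flow keeps bounded.
\<close>

definition wnorm :: "real \<Rightarrow> (real^'n, real) L2 \<Rightarrow> real" where
  "wnorm t U = (1 + t) powr (real CARD('n) / 4) * norm (fourier_multiplier (time_weight t) U)"

lemma norm_le_wnorm:
  fixes U :: "(real^'n, real) L2"
  assumes t: "0 \<le> t"
  shows "norm U \<le> wnorm t U"
proof -
  have "(norm U)\<^sup>2 \<le> (norm (fourier_multiplier (time_weight t) U))\<^sup>2"
    unfolding norm_sq_fourier[of U] norm_fourier_multiplier_sq[OF symbol_time_weight[OF t]]
  proof (rule integral_mono)
    fix \<xi> :: "real^'n"
    have "1 \<le> (time_weight t \<xi>)\<^sup>2" using time_weight_bounds(1)[OF t, of \<xi>] by simp
    from mult_right_mono[OF this, of "(norm (rep_L2 (fourier U) \<xi>))\<^sup>2"]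
    show "(norm (rep_L2 (fourier U) \<xi>))\<^sup>2 \<le> (time_weight t \<xi>)\<^sup>2 * (norm (rep_L2 (fourier U) \<xi>))\<^sup>2" by simp
  qed (use integrable_fourier_multiplier_sq[OF symbol_time_weight[OF t]] in auto)
  then have "norm U \<le> norm (fourier_multiplier (time_weight t) U)" by (rule power2_le_imp_le) simp
  moreover have "1 \<le> (1 + t) powr (real CARD('n) / 4)" using t by (intro ge_one_powr_ge_zero) auto
  ultimately have "1 * norm U \<le> wnorm t U" unfolding wnorm_def by (intro mult_mono) auto
  then show ?thesis by simp
qed

lemma wnorm_triangle: "0 \<le> t \<Longrightarrow> wnorm t (U + V) \<le> wnorm t U + wnorm t V"
  unfolding wnorm_def bounded_linear.linear[OF bounded_linear_fourier_multiplier[OF symbol_time_weight], THEN linear_add]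
  by (simp flip: distrib_left add: mult_left_mono norm_triangle_ineq)

lemma wnorm_scaleR: "0 \<le> t \<Longrightarrow> wnorm t (c *\<^sub>R U) = \<bar>c\<bar> * wnorm t U"
  unfolding wnorm_def bounded_linear.linear[OF bounded_linear_fourier_multiplier[OF symbol_time_weight], THEN linear_scale]
  by simp

lemma wnorm_nonneg: "0 \<le> wnorm t U"
  by (simp add: wnorm_def)

text \<open>Two times are involved: the weight is taken at \<open>t\<close>, while the flow has run
  only for the time \<open>r - 1\<close>; the quotient \<open>(1 + t) / r\<close> measures the loss.
  Against the Gaussian part of the kernel the pointwise bound on the transform is integrated; the
  exponential part is taken against the \<open>L2\<close> norm and absorbs all powers of
  \<open>r\<close>. The transform may grow like \<open>sqrt (1 + (norm \<xi>)\<^sup>2)\<close>, so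
  that the lemma also serves an argument \<open>U\<close> for which the integrable function is
  \<open>bessel_op U\<close>.\<close>

lemma wnorm_decay:
  fixes F :: "(real^'n, real) L2"
  assumes n: "CARD('n) \<le> 2" and k: "symbol k" and r: "1 \<le> r" "r \<le> 1 + t" and b: "0 \<le> b"
    and kle: "\<And>\<xi>. (k \<xi>)\<^sup>2 \<le> b\<^sup>2 * (exp (- 2 * r * (norm \<xi>)\<^sup>2) + exp (- (r - 1) / 4))"
    and A: "0 \<le> A" "AE \<xi> in lborel. (norm (rep_L2 (fourier F) \<xi>))\<^sup>2 \<le> A\<^sup>2 * (1 + (norm \<xi>)\<^sup>2)"
  shows "wnorm t (fourier_multiplier k F) \<le> 8 * b * ((1 + t) / r) powr (real CARD('n) / 4 + 1 / 2) * (A + norm F)"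
proof (rule power2_le_imp_le)
  let ?N = "real CARD('n)"
  let ?q = "(1 + t) / r"
  let ?F = "\<lambda>\<xi>. (norm (rep_L2 (fourier F) \<xi>))\<^sup>2"
  let ?w = "time_weight t"
  have t: "0 \<le> t" using r by simp
  have q: "1 \<le> ?q" using r by simp
  note sw = symbol_times[OF symbol_time_weight[OF t] k]
  have r2: "0 < 2 * r" using r by simp
  have g: "integrable lborel (\<lambda>\<xi>::real^'n. exp (- r * (norm \<xi>)\<^sup>2))"
    "(LINT \<xi>::real^'n|lborel. exp (- r * (norm \<xi>)\<^sup>2)) = (pi / r) powr (?N / 2)"
    using gaussian_integral[OF r2, where 'a="real^'n"] by simp_all
  have "(norm (fourier_multiplier (\<lambda>\<xi>. ?w \<xi> * k \<xi>) F))\<^sup>2 \<le>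
      (LINT \<xi>|lborel. b\<^sup>2 * (A\<^sup>2 * ?q * exp (- r * (norm \<xi>)\<^sup>2) + (1 + t) * exp (- (r - 1) / 4) * ?F \<xi>))"
    unfolding norm_fourier_multiplier_sq[OF sw]
  proof (rule integral_mono_AE[OF integrable_fourier_multiplier_sq[OF sw]])
    show "integrable lborel (\<lambda>\<xi>. b\<^sup>2 * (A\<^sup>2 * ?q * exp (- r * (norm \<xi>)\<^sup>2) + (1 + t) * exp (- (r - 1) / 4) * ?F \<xi>))"
      by (intro integrable_mult_right Bochner_Integration.integrable_add g integrable_rep_L2_sq)
    show "AE \<xi> in lborel. (?w \<xi> * k \<xi>)\<^sup>2 * ?F \<xi> \<le> b\<^sup>2 * (A\<^sup>2 * ?q * exp (- r * (norm \<xi>)\<^sup>2) + (1 + t) * exp (- (r - 1) / 4) * ?F \<xi>)"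
      using A(2)
    proof eventually_elim
      case (elim \<xi>)
      let ?x = "(norm \<xi>)\<^sup>2"
      have p: "0 < 1 + ?x" by (simp add: add_pos_nonneg)
      have "(?w \<xi>)\<^sup>2 * ?F \<xi> \<le> (1 + (1 + t) * ?x) / (1 + ?x) * (A\<^sup>2 * (1 + ?x))"
        unfolding time_weight_sq[OF t] using elim t p by (intro mult_left_mono) auto
      also have "\<dots> = A\<^sup>2 * (1 + (1 + t) * ?x)" using p by simp
      finally have 1: "(?w \<xi>)\<^sup>2 * ?F \<xi> \<le> A\<^sup>2 * (1 + (1 + t) * ?x)" .
      \<comment> \<open>Half of the Gaussian exponent is spent on the growing weight; the other half
        remains for the integration.\<close>
      have "1 + (1 + t) * ?x \<le> ?q * (1 + r * ?x)" using q r by (simp add: distrib_left)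
      also have "\<dots> \<le> ?q * exp (r * ?x)" using q by (intro mult_left_mono exp_ge_add_one_self) auto
      finally have 2: "A\<^sup>2 * (1 + (1 + t) * ?x) * exp (- 2 * r * ?x) \<le> A\<^sup>2 * (?q * exp (r * ?x)) * exp (- 2 * r * ?x)"
        by (intro mult_right_mono mult_left_mono) auto
      have "(?w \<xi>)\<^sup>2 * ?F \<xi> * exp (- 2 * r * ?x) \<le> A\<^sup>2 * (1 + (1 + t) * ?x) * exp (- 2 * r * ?x)"
        by (intro mult_right_mono 1) auto
      also note 2
      also have "A\<^sup>2 * (?q * exp (r * ?x)) * exp (- 2 * r * ?x) = A\<^sup>2 * ?q * exp (- r * ?x)"
        by (simp add: mult.assoc flip: exp_add)
      finally have 2: "(?w \<xi>)\<^sup>2 * ?F \<xi> * exp (- 2 * r * ?x) \<le> A\<^sup>2 * ?q * exp (- r * ?x)" .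
      have 3: "(?w \<xi>)\<^sup>2 * ?F \<xi> * exp (- (r - 1) / 4) \<le> (1 + t) * ?F \<xi> * exp (- (r - 1) / 4)"
        using time_weight_bounds(2)[OF t, of \<xi>] by (intro mult_right_mono) auto
      have "(?w \<xi> * k \<xi>)\<^sup>2 * ?F \<xi> = (?w \<xi>)\<^sup>2 * ?F \<xi> * (k \<xi>)\<^sup>2" by (simp add: power_mult_distrib)
      also have "\<dots> \<le> (?w \<xi>)\<^sup>2 * ?F \<xi> * (b\<^sup>2 * (exp (- 2 * r * ?x) + exp (- (r - 1) / 4)))"
        by (intro mult_left_mono kle) auto
      also have "\<dots> = b\<^sup>2 * ((?w \<xi>)\<^sup>2 * ?F \<xi> * exp (- 2 * r * ?x) + (?w \<xi>)\<^sup>2 * ?F \<xi> * exp (- (r - 1) / 4))"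
        by (simp only: distrib_left mult_ac)
      also have "\<dots> \<le> b\<^sup>2 * (A\<^sup>2 * ?q * exp (- r * ?x) + (1 + t) * ?F \<xi> * exp (- (r - 1) / 4))"
        by (intro mult_left_mono add_mono 2 3) auto
      finally show ?case by (simp only: mult_ac)
    qed
  qed
  also have "\<dots> = b\<^sup>2 * (A\<^sup>2 * ?q * (pi / r) powr (?N / 2) + (1 + t) * exp (- (r - 1) / 4) * (norm F)\<^sup>2)"
    using g by (simp add: norm_sq_fourier)
  finally have I: "(norm (fourier_multiplier (\<lambda>\<xi>. ?w \<xi> * k \<xi>) F))\<^sup>2 \<le> \<dots>" .
  have sq: "((1 + t) powr (?N / 4))\<^sup>2 = (1 + t) powr (?N / 2)"
    using t by (simp add: power2_eq_square flip: powr_add)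
  have "(wnorm t (fourier_multiplier k F))\<^sup>2 = (1 + t) powr (?N / 2) * (norm (fourier_multiplier (\<lambda>\<xi>. ?w \<xi> * k \<xi>) F))\<^sup>2"
    unfolding wnorm_def power_mult_distrib sq fourier_multiplier_mult[OF symbol_time_weight[OF t] k] ..
  also have "\<dots> \<le> (1 + t) powr (?N / 2) * (b\<^sup>2 * (A\<^sup>2 * ?q * (pi / r) powr (?N / 2) + (1 + t) * exp (- (r - 1) / 4) * (norm F)\<^sup>2))"
    by (intro mult_left_mono I) auto
  also have "\<dots> = b\<^sup>2 * ?q powr (?N / 2 + 1) * (A\<^sup>2 * pi powr (?N / 2) + (r powr (?N / 2 + 1) * exp (- (r - 1) / 4)) * (norm F)\<^sup>2)"
  proof -
    have "(1 + t) powr (?N / 2) * (?q * (pi / r) powr (?N / 2)) = ?q powr (?N / 2 + 1) * pi powr (?N / 2)"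
      using r t by (simp add: powr_divide powr_add mult_ac)
    moreover have "(1 + t) powr (?N / 2) * (1 + t) = ?q powr (?N / 2 + 1) * r powr (?N / 2 + 1)"
      using r t by (simp add: powr_divide powr_add)
    moreover have "X * (b2 * (A2 * q * Y + T * e * G)) = b2 * Z * (A2 * W + (R * e) * G)"
      if "X * (q * Y) = Z * W" "X * T = Z * R" for X b2 A2 q Y T e G Z W R :: real
    proof -
      have "X * (b2 * (A2 * q * Y + T * e * G)) = b2 * (A2 * (X * (q * Y)) + (X * T) * (e * G))"
        by (simp add: algebra_simps)
      then show ?thesis unfolding that by (simp add: algebra_simps)
    qed
    ultimately show ?thesis by blast
  qed
  also have "\<dots> \<le> b\<^sup>2 * ?q powr (?N / 2 + 1) * (A\<^sup>2 * 64 + 64 * (norm F)\<^sup>2)"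
  proof (intro mult_left_mono add_mono mult_right_mono)
    have "pi powr (?N / 2) \<le> pi powr 1" using n pi_ge_two by (intro powr_mono) auto
    then show "pi powr (?N / 2) \<le> 64" using pi_less_4 by simp
    \<comment> \<open>In dimension at most 2 there is at most \<open>r\<^sup>2\<close> to absorb;
      the constant 64 is the square of the 8 in
      \<open>r \<le> 8 * exp ((r - 1) / 8)\<close>.\<close>
    have "r powr (?N / 2 + 1) \<le> r powr 2" using n r by (intro powr_mono) auto
    also have "\<dots> = r\<^sup>2" using r by simp
    also have "r \<le> 8 * exp ((r - 1) / 8)"
    proof -
      define e where "e = exp ((r - 1) / 8)"
      have "1 + (r - 1) / 8 \<le> e" unfolding e_def by (rule exp_ge_add_one_self)
      then show ?thesis unfolding e_def[symmetric] by (simp add: field_simps)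
    qed
    then have "r\<^sup>2 \<le> (8 * exp ((r - 1) / 8))\<^sup>2"
      using r by (intro power_mono) auto
    also have "\<dots> = 64 * exp ((r - 1) / 4)" by (simp add: power_mult_distrib flip: exp_double)
    finally have "r powr (?N / 2 + 1) * exp (- (r - 1) / 4) \<le> 64 * exp ((r - 1) / 4) * exp (- (r - 1) / 4)"
      by (intro mult_right_mono) auto
    also have "\<dots> = 64"
    proof -
      have "exp ((r - 1) / 4) * exp (- (r - 1) / 4) = 1" by (simp add: field_simps flip: exp_add)
      then show ?thesis by simp
    qed
    finally show "r powr (?N / 2 + 1) * exp (- (r - 1) / 4) \<le> 64" .
  qed auto
  also have "\<dots> \<le> b\<^sup>2 * ?q powr (?N / 2 + 1) * (64 * (A + norm F)\<^sup>2)"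
    using A(1) by (rule_tac mult_left_mono) (simp_all add: power2_sum)
  also have "?q powr (?N / 2 + 1) = (?q powr (?N / 4 + 1 / 2))\<^sup>2"
    using q by (simp add: power2_eq_square flip: powr_add)
  finally show "(wnorm t (fourier_multiplier k F))\<^sup>2 \<le> (8 * b * ?q powr (?N / 4 + 1 / 2) * (A + norm F))\<^sup>2"
    by (simp add: power_mult_distrib mult_ac)
  show "0 \<le> 8 * b * ?q powr (?N / 4 + 1 / 2) * (A + norm F)" using b A by simp
qed

section \<open>Sobolev embedding in dimension one\<close>

lemma bracket_dyadic:
  fixes y :: real
  assumes "1 \<le> y"
  obtains i :: nat where "4 ^ i \<le> y" "y < 4 ^ Suc i"
proof -
  define j where "j = (LEAST j. y < 4 ^ j)"
  have "\<exists>j. y < 4 ^ j" by (rule real_arch_pow) simp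
  then have j: "y < 4 ^ j" unfolding j_def by (rule LeastI_ex)
  then obtain i where i: "j = Suc i" using assms by (cases j) auto
  have "\<not> y < 4 ^ i" unfolding not_less_Least[of i "\<lambda>j. y < 4 ^ j", folded j_def] i using not_less_Least[of i "\<lambda>j. y < 4 ^ j", folded j_def] i by simp
  then show ?thesis using that[of i] j i by simp
qed

text \<open>The bracket is compared with a dyadic sum of Gaussians, whose integrals are explicit.\<close>

lemma bracket_integrable:
  assumes n: "CARD('n) < 2 * k" and k: "0 < k"
  shows "integrable lborel (\<lambda>\<xi>::real^'n. 1 / (1 + (norm \<xi>)\<^sup>2) ^ k)"
proof (rule integrableI_bounded)
  \<comment> \<open>On the shell where \<open>1 + (norm \<xi>)\<^sup>2\<close> lies between
    \<open>4 ^ j\<close> and \<open>4 ^ Suc j\<close> the Gaussian exponent is at least -4; the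
    factor \<open>exp 4\<close> compensates for it.\<close>
  let ?g = "\<lambda>j \<xi>::real^'n. exp 4 * (1 / 4 ^ j) ^ k * exp (- (1 / 4 ^ j) * (norm \<xi>)\<^sup>2)"
  have le: "ennreal (1 / (1 + (norm \<xi>)\<^sup>2) ^ k) \<le> (\<Sum>j. ennreal (?g j \<xi>))" for \<xi> :: "real^'n"
  proof -
    obtain i where i: "4 ^ i \<le> 1 + (norm \<xi>)\<^sup>2" "1 + (norm \<xi>)\<^sup>2 < 4 ^ Suc i"
      using bracket_dyadic[of "1 + (norm \<xi>)\<^sup>2"] by auto
    have "(norm \<xi>)\<^sup>2 \<le> 4 * 4 ^ i" using i(2) by simp
    then have "(norm \<xi>)\<^sup>2 / 4 ^ i \<le> 4" by (simp add: divide_le_eq)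
    moreover have "exp 4 * exp (- (1 / 4 ^ i) * (norm \<xi>)\<^sup>2) = exp (4 - (norm \<xi>)\<^sup>2 / 4 ^ i)" by (simp flip: exp_add)
    ultimately have e: "1 \<le> exp 4 * exp (- (1 / 4 ^ i) * (norm \<xi>)\<^sup>2)" by simp
    have "1 / (1 + (norm \<xi>)\<^sup>2) ^ k \<le> 1 / (4 ^ i) ^ k"
      using i(1) by (intro divide_left_mono power_mono mult_pos_pos zero_less_power add_pos_nonneg) auto
    also have "\<dots> = (1 / 4 ^ i) ^ k * 1" by (simp add: power_one_over)
    also have "\<dots> \<le> (1 / 4 ^ i) ^ k * (exp 4 * exp (- (1 / 4 ^ i) * (norm \<xi>)\<^sup>2))"
      by (intro mult_left_mono e) auto
    finally have "ennreal (1 / (1 + (norm \<xi>)\<^sup>2) ^ k) \<le> ennreal (?g i \<xi>)" by (intro ennreal_leI) (simp add: mult_ac)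
    also have "\<dots> = (\<Sum>j\<in>{i}. ennreal (?g j \<xi>))" by simp
    also have "\<dots> \<le> (\<Sum>j. ennreal (?g j \<xi>))" by (intro sum_le_suminf) auto
    finally show ?thesis .
  qed
  have "(\<integral>\<^sup>+\<xi>. ennreal (norm (1 / (1 + (norm \<xi>)\<^sup>2) ^ k)) \<partial>(lborel::(real^'n) measure)) \<le> (\<integral>\<^sup>+\<xi>. (\<Sum>j. ennreal (?g j \<xi>)) \<partial>lborel)"
  proof (intro nn_integral_mono)
    fix \<xi> :: "real^'n"
    have nn: "0 \<le> 1 / (1 + (norm \<xi>)\<^sup>2) ^ k" by (intro divide_nonneg_nonneg zero_le_power add_nonneg_nonneg) auto
    show "ennreal (norm (1 / (1 + (norm \<xi>)\<^sup>2) ^ k)) \<le> (\<Sum>j. ennreal (?g j \<xi>))"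
      unfolding real_norm_def abs_of_nonneg[OF nn] by (rule le)
  qed
  also have "\<dots> = (\<Sum>j. \<integral>\<^sup>+\<xi>. ennreal (?g j \<xi>) \<partial>lborel)"
    by (rule nn_integral_suminf) measurable
  also have "\<dots> \<le> (\<Sum>j. ennreal (exp 4 * pi powr (CARD('n) / 2) * (1 / 2) ^ j))"
  proof (intro suminf_le)
    fix j
    let ?a = "2 / 4 ^ j :: real"
    have a: "0 < ?a" by simp
    have e: "- ?a * x / 2 = - (1 / 4 ^ j) * x" for x :: real by simp
    note gi = gaussian_integral[OF a, where 'a="real^'n", unfolded e]
    have "(\<integral>\<^sup>+\<xi>. ennreal (?g j \<xi>) \<partial>(lborel::(real^'n) measure)) = ennreal (LINT \<xi>::real^'n|lborel. ?g j \<xi>)"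
      by (intro nn_integral_eq_integral integrable_mult_right gi) auto
    also have "(LINT \<xi>::real^'n|lborel. ?g j \<xi>) = exp 4 * (1 / 4 ^ j) ^ k * (pi * 4 ^ j) powr (CARD('n) / 2)"
      unfolding integral_mult_right_zero gi by simp
    also have "(pi * 4 ^ j) powr (CARD('n) / 2) = pi powr (CARD('n) / 2) * (2 ^ j) ^ CARD('n)"
    proof -
      have "(4::real) ^ j = (2 ^ 2) ^ j" by simp
      also have "\<dots> = (2 ^ j) ^ 2" by (simp only: power_mult[symmetric] mult.commute)
      also have "\<dots> = (2 ^ j) powr 2" by simp
      finally have four: "(4::real) ^ j = (2 ^ j) powr 2" .
      have "(4 ^ j) powr (CARD('n) / 2) = ((2::real) ^ j) powr (real CARD('n))"
        unfolding four powr_powr by simp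
      then show ?thesis by (simp add: powr_mult powr_realpow)
    qed
    also have "exp 4 * (1 / 4 ^ j) ^ k * (pi powr (CARD('n) / 2) * (2 ^ j) ^ CARD('n)) \<le> exp 4 * pi powr (CARD('n) / 2) * (1 / 2) ^ j"
    proof -
      \<comment> \<open>As \<open>n < 2 k\<close>, at least one factor \<open>2 ^ j\<close> is to
        spare, and this makes the series geometric.\<close>
      have "(2 ^ j :: real) ^ (CARD('n) + 1) \<le> (2 ^ j) ^ (2 * k)" using n by (intro power_increasing) auto
      also have "\<dots> = (4 ^ j) ^ k" by (simp add: power_mult power_mult_distrib[symmetric] power2_eq_square)
      finally have "(1 / 4 ^ j) ^ k * (2 ^ j :: real) ^ CARD('n) \<le> (1 / 2) ^ j"
        by (simp add: power_one_over field_simps)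
      from mult_left_mono[OF this, of "exp 4 * pi powr (CARD('n) / 2)"] show ?thesis by (simp add: mult_ac)
    qed
    finally show "(\<integral>\<^sup>+\<xi>. ennreal (?g j \<xi>) \<partial>(lborel::(real^'n) measure)) \<le> ennreal (exp 4 * pi powr (CARD('n) / 2) * (1 / 2) ^ j)"
      by (simp add: ennreal_leI)
  qed auto
  also have "\<dots> = ennreal (\<Sum>j. exp 4 * pi powr (CARD('n) / 2) * (1 / 2) ^ j)"
    by (intro suminf_ennreal2 summable_mult summable_geometric) auto
  finally show "(\<integral>\<^sup>+\<xi>. ennreal (norm (1 / (1 + (norm \<xi>)\<^sup>2) ^ k)) \<partial>(lborel::(real^'n) measure)) < \<infinity>"
    by (rule order_le_less_trans) simp
qed measurable

lemma fourier_const_le_1: "fourier_const TYPE('n::finite) \<le> 1"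
proof -
  have "(2 * pi) powr (- real CARD('n) / 2) \<le> (2 * pi) powr 0"
    using pi_ge_two by (intro powr_mono) auto
  then show ?thesis by simp
qed

lemma abs_rep_L2_le_fourier_L1:
  fixes f :: "(real^'n, real) L2"
  assumes int: "integrable lborel (rep_L2 (fourier f))"
  shows "AE x in lborel. \<bar>rep_L2 f x\<bar> \<le> (LINT \<xi>|lborel. norm (rep_L2 (fourier f) \<xi>))"
  using L2_of_real_inversion[OF int]
proof eventually_elim
  case (elim x)
  let ?I = "LINT \<xi>|lborel. norm (rep_L2 (fourier f) \<xi>)"
  have "\<bar>rep_L2 f x\<bar> = norm (complex_of_real (rep_L2 f x))" by simp
  also have "\<dots> = norm (fourier_integral (\<lambda>\<xi>. cnj (rep_L2 (fourier f) \<xi>)) x)"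
    unfolding elim by simp
  also have "\<dots> \<le> fourier_const TYPE('n) * ?I"
    using norm_fourier_integral_le[of "\<lambda>\<xi>. cnj (rep_L2 (fourier f) \<xi>)" x] by simp
  also have "\<dots> \<le> 1 * ?I" by (intro mult_right_mono fourier_const_le_1) auto
  finally show ?case by simp
qed

lemma integral_norm_mult_le_L2:
  fixes f g :: "'a::euclidean_space \<Rightarrow> 'b::euclidean_space"
  assumes f: "square_integrable f" and g: "square_integrable g"
  shows "integrable lborel (\<lambda>x. norm (f x) * norm (g x))"
    and "(LINT x|lborel. norm (f x) * norm (g x)) \<le> norm (abs_L2 f) * norm (abs_L2 g)"
proof -
  have S: "square_integrable (\<lambda>x. norm (f x))" "square_integrable (\<lambda>x. norm (g x))"
    using f g by (auto simp: square_integrable_def)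
  then show "integrable lborel (\<lambda>x. norm (f x) * norm (g x))" using integrable_inner_L2[OF S] by simp
  have eq: "norm (abs_L2 (\<lambda>x. norm (f x))) = norm (abs_L2 f)" "norm (abs_L2 (\<lambda>x. norm (g x))) = norm (abs_L2 g)"
    using norm_abs_L2_sq[OF S(1)] norm_abs_L2_sq[OF S(2)] norm_abs_L2_sq[OF f] norm_abs_L2_sq[OF g]
    by (auto intro: power2_eq_imp_eq)
  have "(LINT x|lborel. norm (f x) * norm (g x)) = abs_L2 (\<lambda>x. norm (f x)) \<bullet> abs_L2 (\<lambda>x. norm (g x))"
    by (simp add: inner_abs_L2 S)
  also have "\<dots> \<le> norm (abs_L2 (\<lambda>x. norm (f x))) * norm (abs_L2 (\<lambda>x. norm (g x)))"
    by (rule norm_cauchy_schwarz)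
  finally show "(LINT x|lborel. norm (f x) * norm (g x)) \<le> norm (abs_L2 f) * norm (abs_L2 g)"
    unfolding eq .
qed

lemma wnorm_bessel_op:
  fixes U :: "(real^'n, real) L2"
  assumes t: "0 \<le> t"
  shows "norm (bessel_op U) \<le> (1 + t) powr (- real CARD('n) / 4) * wnorm t U"
    and "norm U \<le> (1 + t) powr (- real CARD('n) / 4) * wnorm t U"
proof -
  have eq: "(1 + t) powr (- real CARD('n) / 4) * wnorm t U = norm (fourier_multiplier (time_weight t) U)"
    using t by (simp add: wnorm_def mult.assoc[symmetric] flip: powr_add)
  have "(norm U)\<^sup>2 \<le> (norm (fourier_multiplier (time_weight t) U))\<^sup>2"
    unfolding norm_sq_fourier[of U] norm_fourier_multiplier_sq[OF symbol_time_weight[OF t]]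
  proof (rule integral_mono)
    fix \<xi> :: "real^'n"
    have "1 \<le> (time_weight t \<xi>)\<^sup>2" using time_weight_bounds(1)[OF t, of \<xi>] by simp
    from mult_right_mono[OF this, of "(norm (rep_L2 (fourier U) \<xi>))\<^sup>2"]
    show "(norm (rep_L2 (fourier U) \<xi>))\<^sup>2 \<le> (time_weight t \<xi>)\<^sup>2 * (norm (rep_L2 (fourier U) \<xi>))\<^sup>2" by simp
  qed (use integrable_fourier_multiplier_sq[OF symbol_time_weight[OF t]] in auto)
  then show U: "norm U \<le> (1 + t) powr (- real CARD('n) / 4) * wnorm t U"
    unfolding eq by (rule power2_le_imp_le) simp
  have "norm (bessel_op U) \<le> 1 * norm U"
    by (intro norm_fourier_multiplier_le[OF symbol_bessel]) (simp add: abs_of_pos bessel_pos bessel_le_1)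
  with U show "norm (bessel_op U) \<le> (1 + t) powr (- real CARD('n) / 4) * wnorm t U" by simp
qed

text \<open>
  In dimension one the frequency weight of \<open>wnorm t\<close> is square-integrable after inversion, with
  norm \<open>O((1 + t)\<^bsup>-1/4\<^esup>)\<close>; so \<open>wnorm t\<close> controls the supremum with decay \<open>(1 + t)\<^bsup>-1/2\<^esup>\<close>.
\<close>

lemma sup_bound_dim1:
  assumes n: "CARD('n::finite) = 1"
  obtains C :: real where "0 < C"
    "\<And>t (U :: (real^'n, real) L2). 0 \<le> t \<Longrightarrow>
      AE x in lborel. \<bar>rep_L2 (bessel_op U) x\<bar> \<le> C * (1 + t) powr (- 1 / 2) * wnorm t U"
proof -
  define H where "H = (LINT \<xi>::real^'n|lborel. 1 / (1 + (norm \<xi>)\<^sup>2))"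
  have Hint: "integrable lborel (\<lambda>\<xi>::real^'n. 1 / (1 + (norm \<xi>)\<^sup>2))"
    using bracket_integrable[of 1, where 'n='n] n by simp
  have H: "0 \<le> H" unfolding H_def by (intro integral_nonneg_AE) (auto simp: add_nonneg_nonneg)
  show ?thesis
  proof (rule that[of "sqrt H + 1"])
    show "0 < sqrt H + 1" using H by (simp add: add_nonneg_pos)
    fix t :: real and U :: "(real^'n, real) L2"
    assume t: "0 \<le> t"
    let ?a = "\<lambda>\<xi>::real^'n. complex_of_real (1 / sqrt (1 + (1 + t) * (norm \<xi>)\<^sup>2))"
    let ?u = "bessel_op U"
    have p: "0 < 1 + (1 + t) * (norm \<xi>)\<^sup>2" for \<xi> :: "real^'n" using t by (intro add_pos_nonneg) auto
    have scale: "1 + (1 + t) * (norm \<xi>)\<^sup>2 = 1 + (norm (0 + sqrt (1 + t) *\<^sub>R \<xi>))\<^sup>2" for \<xi> :: "real^'n"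
      using t by (simp add: power_mult_distrib)
    have s0: "sqrt (1 + t) \<noteq> 0" using t by simp
    have "integrable lborel (\<lambda>\<xi>::real^'n. 1 / (1 + (1 + t) * (norm \<xi>)\<^sup>2))"
    proof (rule Bochner_Integration.integrable_bound[OF Hint])
      show "AE \<xi>::real^'n in lborel. norm (1 / (1 + (1 + t) * (norm \<xi>)\<^sup>2)) \<le> norm (1 / (1 + (norm \<xi>)\<^sup>2))"
      proof (intro AE_I2)
        fix \<xi> :: "real^'n"
        have "(norm \<xi>)\<^sup>2 \<le> (1 + t) * (norm \<xi>)\<^sup>2" using t by (simp add: mult_right_le_one_le algebra_simps)
        then show "norm (1 / (1 + (1 + t) * (norm \<xi>)\<^sup>2)) \<le> norm (1 / (1 + (norm \<xi>)\<^sup>2))"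
          using p[of \<xi>] by (simp add: abs_of_pos add_pos_nonneg frac_le)
      qed
    qed measurable
    then have aint: "integrable lborel (\<lambda>\<xi>. (norm (?a \<xi>))\<^sup>2)"
      using p by (simp add: norm_divide power_divide less_imp_le)
    have aS: "square_integrable ?a" using aint by (simp add: square_integrable_def)
    have "(norm (abs_L2 ?a))\<^sup>2 = (LINT \<xi>::real^'n|lborel. 1 / (1 + (norm (0 + sqrt (1 + t) *\<^sub>R \<xi>))\<^sup>2))"
      unfolding norm_abs_L2_sq[OF aS] scale[symmetric] using p by (simp add: norm_divide power_divide less_imp_le)
    also have "\<dots> = H / sqrt (1 + t)"
      using lborel_scale_integral[OF s0, of "\<lambda>\<xi>::real^'n. 1 / (1 + (norm \<xi>)\<^sup>2)" 0] t n
      by (simp add: H_def divide_inverse mult.commute)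
    also have "\<dots> = (sqrt H * (1 + t) powr (- 1 / 4))\<^sup>2"
      using H t by (simp add: power_mult_distrib power2_eq_square powr_half_sqrt powr_minus_divide flip: powr_add)
    finally have "(norm (abs_L2 ?a))\<^sup>2 = (sqrt H * (1 + t) powr (- 1 / 4))\<^sup>2" .
    then have na: "norm (abs_L2 ?a) = sqrt H * (1 + t) powr (- 1 / 4)"
      using H by (rule_tac power2_eq_imp_eq) auto
    let ?W = "fourier_multiplier (time_weight t) U"
    let ?b = "rep_L2 (fourier ?W)"
    \<comment> \<open>Writing \<open>bessel\<close> as \<open>?a\<close> times
      \<open>time_weight t\<close> prepares Cauchy-Schwarz: one factor carries the explicit decay,
      the other is the weighted norm of \<open>U\<close>.\<close>
    have prod: "AE \<xi> in lborel. norm (?a \<xi>) * norm (?b \<xi>) = norm (rep_L2 (fourier ?u) \<xi>)"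
      using fourier_multiplier[OF symbol_time_weight[OF t], of U] fourier_multiplier[OF symbol_bessel, of U]
    proof eventually_elim
      case (elim \<xi>)
      have "norm (?a \<xi>) * time_weight t \<xi> = bessel \<xi>"
        using p[of \<xi>] by (simp add: time_weight_def bessel_def real_sqrt_divide norm_divide)
      then show ?case unfolding elim using time_weight_bounds(1)[OF t, of \<xi>] bessel_pos[of \<xi>]
        by (simp add: norm_mult mult.assoc[symmetric])
    qed
    note I = integral_norm_mult_le_L2[OF aS square_integrable_rep[of "fourier ?W"]]
    have "integrable lborel (\<lambda>\<xi>. norm (rep_L2 (fourier ?u) \<xi>))"
      using I(1) by (subst integrable_cong_AE[where g="\<lambda>\<xi>. norm (?a \<xi>) * norm (?b \<xi>)"]) (use prod in auto)
    then have int: "integrable lborel (rep_L2 (fourier ?u))" by (simp add: integrable_norm_iff)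
    have "(LINT \<xi>|lborel. norm (rep_L2 (fourier ?u) \<xi>)) = (LINT \<xi>|lborel. norm (?a \<xi>) * norm (?b \<xi>))"
      using prod by (intro integral_cong_AE) auto
    also have "\<dots> \<le> (sqrt H * (1 + t) powr (- 1 / 4)) * norm ?W"
      using I(2) unfolding na abs_rep_L2 norm_fourier .
    also have "\<dots> = sqrt H * (1 + t) powr (- 1 / 2) * wnorm t U"
      using t n by (simp add: wnorm_def mult.assoc flip: powr_add mult.left_commute)
    also have "\<dots> \<le> (sqrt H + 1) * (1 + t) powr (- 1 / 2) * wnorm t U"
      by (intro mult_right_mono wnorm_nonneg) auto
    finally have "(LINT \<xi>|lborel. norm (rep_L2 (fourier ?u) \<xi>)) \<le> (sqrt H + 1) * (1 + t) powr (- 1 / 2) * wnorm t U" .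
    then show "AE x in lborel. \<bar>rep_L2 ?u x\<bar> \<le> (sqrt H + 1) * (1 + t) powr (- 1 / 2) * wnorm t U"
      using abs_rep_L2_le_fourier_L1[OF int] by (auto elim!: eventually_mono)
  qed
qed

subsection \<open>Estimates for the power nonlinearity\<close>

text \<open>Mean value theorem, with the intermediate point bounded by \<open>a + b\<close>. The
  endpoint 0 is treated apart because the derivative of the power is taken at positive points
  only.\<close>

lemma powr_diff_le:
  fixes a b p :: real
  assumes p: "1 \<le> p" and ab: "0 \<le> a" "0 \<le> b"
  shows "\<bar>a powr p - b powr p\<bar> \<le> p * \<bar>a - b\<bar> * (a + b) powr (p - 1)"
proof -
  have *: "y powr p - x powr p \<le> p * (y - x) * (x + y) powr (p - 1)" if "0 \<le> x" "x < y" for x y :: real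
  proof (cases "x = 0")
    case True
    have "y powr p = y * y powr (p - 1)" using that by (simp add: powr_mult_base)
    also have "\<dots> \<le> p * (y * y powr (p - 1))"
      using mult_right_mono[OF p, of "y * y powr (p - 1)"] that by simp
    finally show ?thesis using True by (simp add: mult.assoc)
  next
    case False
    have "\<exists>z. x < z \<and> z < y \<and> y powr p - x powr p = (y - x) * (p * z powr (p - 1))"
    proof (rule MVT2[OF that(2)])
      fix z assume "x \<le> z"
      then show "((\<lambda>z. z powr p) has_real_derivative p * z powr (p - 1)) (at z)"
        using False that(1) by (intro has_real_derivative_powr) auto
    qed
    then obtain z where z: "x < z" "z < y" "y powr p - x powr p = (y - x) * (p * z powr (p - 1))" by blast
    have "z powr (p - 1) \<le> (x + y) powr (p - 1)" using z that p by (intro powr_mono2) auto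
    then have "p * (y - x) * z powr (p - 1) \<le> p * (y - x) * (x + y) powr (p - 1)"
      using that p by (intro mult_left_mono) auto
    then show ?thesis unfolding z(3) by (simp add: mult_ac)
  qed
  have mono: "x powr p \<le> y powr p" if "0 \<le> x" "x \<le> y" for x y :: real
    using that p by (intro powr_mono2) auto
  consider "a < b" | "b < a" | "a = b" by linarith
  then show ?thesis
  proof cases
    case 1 then show ?thesis using *[OF ab(1) 1] mono[of a b] ab by (simp add: abs_if)
  next
    case 2 then show ?thesis using *[OF ab(2) 2] mono[of b a] ab by (simp add: abs_if add.commute)
  qed simp
qed

lemma norm_L2_le_AE:
  assumes c: "0 \<le> c" and le: "AE x in lborel. norm (rep_L2 f x) \<le> c * norm (rep_L2 g x)"
  shows "norm f \<le> c * norm g"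
proof (rule power2_le_imp_le)
  have "(norm f)\<^sup>2 \<le> (LINT x|lborel. c\<^sup>2 * (norm (rep_L2 g x))\<^sup>2)"
    unfolding norm_L2_sq[of f]
  proof (rule integral_mono_AE)
    show "AE x in lborel. (norm (rep_L2 f x))\<^sup>2 \<le> c\<^sup>2 * (norm (rep_L2 g x))\<^sup>2"
      using le by eventually_elim (simp flip: power_mult_distrib add: power_mono)
  qed auto
  also have "\<dots> = (c * norm g)\<^sup>2" by (simp add: power_mult_distrib norm_L2_sq)
  finally show "(norm f)\<^sup>2 \<le> (c * norm g)\<^sup>2" .
  show "0 \<le> c * norm g" using c by simp
qed

text \<open>The first conjunct makes \<open>abs_power\<close> meaningful; the second makes its
  \<open>norm_L1\<close> an actual norm rather than the default value 0 of a divergent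
  integral.\<close>

definition power_in_L12 :: "real \<Rightarrow> (real^'n, real) L2 \<Rightarrow> bool" where
  "power_in_L12 p f \<longleftrightarrow> square_integrable (\<lambda>x. \<bar>rep_L2 f x\<bar> powr p) \<and> integrable lborel (\<lambda>x. \<bar>rep_L2 f x\<bar> powr p)"

lemma rep_abs_power: "power_in_L12 p f \<Longrightarrow> AE x in lborel. rep_L2 (abs_power p f) x = \<bar>rep_L2 f x\<bar> powr p"
  unfolding abs_power_def by (rule rep_abs_L2) (simp add: power_in_L12_def)

lemma integrable_rep_abs_power:
  assumes "power_in_L12 p f"
  shows "integrable lborel (rep_L2 (abs_power p f))"
proof -
  have "integrable lborel (\<lambda>x. \<bar>rep_L2 f x\<bar> powr p)" using assms by (simp add: power_in_L12_def)
  then show ?thesis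
    by (subst integrable_cong_AE[where g="\<lambda>x. \<bar>rep_L2 f x\<bar> powr p"]) (use rep_abs_power[OF assms] in auto)
qed

lemma integrable_rep_abs_power_diff:
  assumes "power_in_L12 p f" "power_in_L12 p g"
  shows "integrable lborel (rep_L2 (abs_power p f - abs_power p g))"
proof -
  have "integrable lborel (\<lambda>x. rep_L2 (abs_power p f) x - rep_L2 (abs_power p g) x)"
    using assms by (intro Bochner_Integration.integrable_diff integrable_rep_abs_power)
  then show ?thesis
    by (subst integrable_cong_AE[where g="\<lambda>x. rep_L2 (abs_power p f) x - rep_L2 (abs_power p g) x"])
      (use rep_L2_diff[of "abs_power p f" "abs_power p g"] in auto)
qed

text \<open>What the Duhamel estimates know about the nonlinearity, in either dimension. Both norms
  are controlled with the decay rate of the \<open>L1\<close> norm. At \<open>t = 0\<close>, where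
  \<open>wnorm\<close> is the plain norm, the estimate says that the nonlinearity is locally
  Lipschitz.\<close>

definition power_estimate :: "'n::finite itself \<Rightarrow> real \<Rightarrow> real \<Rightarrow> bool" where
  "power_estimate _ p C \<longleftrightarrow> 0 < C \<and> (\<forall>U::(real^'n, real) L2. power_in_L12 p (bessel_op U)) \<and>
    (\<forall>t\<ge>0. \<forall>U V::(real^'n, real) L2.
      norm (abs_power p (bessel_op U) - abs_power p (bessel_op V)) + norm_L1 (abs_power p (bessel_op U) - abs_power p (bessel_op V))
      \<le> C * (1 + t) powr (- real CARD('n) * (p - 1) / 2) * wnorm t (U - V) * (wnorm t U + wnorm t V) powr (p - 1))"

lemma bessel_op_diff: "bessel_op U - bessel_op V = bessel_op (U - V)"
  by (rule linear_diff[OF bounded_linear.linear[OF bounded_linear_fourier_multiplier[OF symbol_bessel]], symmetric])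

lemma bessel_op_add: "bessel_op U + bessel_op V = bessel_op (U + V)"
  by (rule linear_add[OF bounded_linear.linear[OF bounded_linear_fourier_multiplier[OF symbol_bessel]], symmetric])

text \<open>For the \<open>L1\<close> norm two of the \<open>p\<close> factors go into
  Cauchy-Schwarz, each contributing \<open>(1 + t) powr (- 1 / 4)\<close>, and the other
  \<open>p - 2\<close> into the sup bound, each contributing \<open>(1 + t) powr (- 1 / 2)\<close>;
  this adds up to the exponent \<open>(p - 1) / 2\<close>. In the \<open>L2\<close> norm a single
  factor stays in \<open>L2\<close>, and its surplus \<open>(1 + t) powr (- 1 / 4)\<close> is given
  away.\<close>

lemma power_estimate_dim1:
  assumes n: "CARD('n::finite) = 1" and p: "2 \<le> p"
  shows "\<exists>C. power_estimate TYPE('n) p C"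
proof -
  obtain K where K: "0 < K" and sup: "\<And>t (U :: (real^'n, real) L2). 0 \<le> t \<Longrightarrow>
      AE x in lborel. \<bar>rep_L2 (bessel_op U) x\<bar> \<le> K * (1 + t) powr (- 1 / 2) * wnorm t U"
    using sup_bound_dim1[OF n] by blast
  have split: "x powr (p - 1) = x powr (p - 2) * x" if "0 \<le> x" for x :: real
    using powr_mult_base[OF that, of "p - 2"] by (simp add: mult.commute)
  have split': "x powr p = x powr (p - 1) * x" if "0 \<le> x" for x :: real
    using powr_mult_base[OF that, of "p - 1"] by (simp add: mult.commute)
  have in12: "power_in_L12 p (bessel_op U)" for U :: "(real^'n, real) L2"
  proof -
    let ?u = "rep_L2 (bessel_op U)"
    obtain M where M: "0 \<le> M" "AE x in lborel. \<bar>?u x\<bar> \<le> M"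
      using sup[of 0 U] K wnorm_nonneg[of 0 U] by (auto intro: that[of "K * wnorm 0 U"])
    have "square_integrable (\<lambda>x. \<bar>?u x\<bar> powr p)"
    proof (rule square_integrable_bound[OF _ square_integrable_scaleR[OF square_integrable_rep[of "bessel_op U"], of "M powr (p - 1)"]])
      show "AE x in lborel. norm (\<bar>?u x\<bar> powr p) \<le> norm (M powr (p - 1) *\<^sub>R ?u x)"
        using M(2)
      proof eventually_elim
        case (elim x)
        have "\<bar>?u x\<bar> powr (p - 1) \<le> M powr (p - 1)" using elim p by (intro powr_mono2) auto
        then show ?case using split'[of "\<bar>?u x\<bar>"] by (simp add: abs_mult mult_right_mono)
      qed
    qed measurable
    moreover have "integrable lborel (\<lambda>x. \<bar>?u x\<bar> powr p)"
    proof (rule Bochner_Integration.integrable_bound)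
      show "integrable lborel (\<lambda>x. M powr (p - 2) * (norm (?u x))\<^sup>2)"
        by (intro integrable_mult_right integrable_rep_L2_sq)
      show "AE x in lborel. norm (\<bar>?u x\<bar> powr p) \<le> norm (M powr (p - 2) * (norm (?u x))\<^sup>2)"
        using M(2)
      proof eventually_elim
        case (elim x)
        have "\<bar>?u x\<bar> powr (p - 2) \<le> M powr (p - 2)" using elim p by (intro powr_mono2) auto
        from mult_right_mono[OF this, of "\<bar>?u x\<bar> * \<bar>?u x\<bar>"] show ?case
          using split'[of "\<bar>?u x\<bar>"] split[of "\<bar>?u x\<bar>"] by (simp add: power2_eq_square abs_mult mult.assoc)
      qed
    qed measurable
    ultimately show ?thesis by (simp add: power_in_L12_def)
  qed
  define C where "C = 2 * p * K powr (p - 1) + 2 * p * K powr (p - 2)"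
  have "power_estimate TYPE('n) p C"
    unfolding power_estimate_def
  proof (intro conjI allI impI in12)
    show "0 < C" using K p by (simp add: C_def add_pos_pos)
    fix t :: real and U V :: "(real^'n, real) L2"
    assume t: "0 \<le> t"
    let ?u = "bessel_op U" and ?v = "bessel_op V"
    let ?GU = "abs_power p ?u" and ?GV = "abs_power p ?v"
    define s where "s = wnorm t U + wnorm t V"
    define d where "d = wnorm t (U - V)"
    define \<tau> where "\<tau> = (1 + t) powr (- 1 / 2)"
    define M where "M = K * \<tau> * s"
    have pos: "0 \<le> s" "0 \<le> d" "0 < \<tau>" "0 \<le> M"
      using t K wnorm_nonneg[of t U] wnorm_nonneg[of t V] wnorm_nonneg[of t "U - V"] by (auto simp: s_def d_def \<tau>_def M_def)
    have \<tau>2: "(1 + t) powr (- 1 / 4) * (1 + t) powr (- 1 / 4) = \<tau>"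
      using t by (simp add: \<tau>_def flip: powr_add)
    have \<tau>1: "(1 + t) powr (- 1 / 4) \<le> 1"
      using t powr_mono[of "- 1 / 4" 0 "1 + t"] by simp
    have \<tau>p: "(1 + t) powr (- real CARD('n) * (p - 1) / 2) = \<tau> powr (p - 1)"
      using t n by (simp add: \<tau>_def powr_powr diff_divide_distrib)
    have nuv: "norm (?u - ?v) \<le> (1 + t) powr (- 1 / 4) * d"
      unfolding bessel_op_diff d_def using wnorm_bessel_op(1)[OF t, of "U - V"] n by simp
    have nu: "norm ?u + norm ?v \<le> (1 + t) powr (- 1 / 4) * s"
      using wnorm_bessel_op(1)[OF t, of U] wnorm_bessel_op(1)[OF t, of V] n by (simp add: s_def distrib_left)
    have bound: "AE x in lborel. \<bar>rep_L2 ?u x\<bar> + \<bar>rep_L2 ?v x\<bar> \<le> M"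
      using sup[OF t, of U] sup[OF t, of V] by eventually_elim (simp add: M_def s_def \<tau>_def distrib_left)
    have diff: "AE x in lborel. \<bar>rep_L2 (?GU - ?GV) x\<bar> \<le> p * \<bar>rep_L2 (?u - ?v) x\<bar> * (\<bar>rep_L2 ?u x\<bar> + \<bar>rep_L2 ?v x\<bar>) powr (p - 1)"
      using rep_L2_diff[of ?GU ?GV] rep_L2_diff[of ?u ?v] rep_abs_power[OF in12[of U]] rep_abs_power[OF in12[of V]]
    proof eventually_elim
      case (elim x)
      have "\<bar>rep_L2 (?GU - ?GV) x\<bar> \<le> p * \<bar>\<bar>rep_L2 ?u x\<bar> - \<bar>rep_L2 ?v x\<bar>\<bar> * (\<bar>rep_L2 ?u x\<bar> + \<bar>rep_L2 ?v x\<bar>) powr (p - 1)"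
        unfolding elim using p by (intro powr_diff_le) auto
      also have "\<dots> \<le> p * \<bar>rep_L2 (?u - ?v) x\<bar> * (\<bar>rep_L2 ?u x\<bar> + \<bar>rep_L2 ?v x\<bar>) powr (p - 1)"
        unfolding elim using p by (intro mult_right_mono mult_left_mono) auto
      finally show ?case .
    qed
    have "norm (?GU - ?GV) \<le> (p * M powr (p - 1)) * norm (?u - ?v)"
    proof (rule norm_L2_le_AE)
      show "AE x in lborel. norm (rep_L2 (?GU - ?GV) x) \<le> p * M powr (p - 1) * norm (rep_L2 (?u - ?v) x)"
        using diff bound
      proof eventually_elim
        case (elim x)
        have "(\<bar>rep_L2 ?u x\<bar> + \<bar>rep_L2 ?v x\<bar>) powr (p - 1) \<le> M powr (p - 1)" using elim p by (intro powr_mono2) auto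
        then have "p * \<bar>rep_L2 (?u - ?v) x\<bar> * (\<bar>rep_L2 ?u x\<bar> + \<bar>rep_L2 ?v x\<bar>) powr (p - 1) \<le> p * \<bar>rep_L2 (?u - ?v) x\<bar> * M powr (p - 1)"
          using p by (intro mult_left_mono) auto
        from order_trans[OF elim(1) this] show ?case by (simp add: mult_ac)
      qed
    qed (use p in simp)
    also have "\<dots> \<le> (p * M powr (p - 1)) * d"
      using nuv mult_right_mono[OF \<tau>1 pos(2)] p by (intro mult_left_mono) auto
    finally have L2: "norm (?GU - ?GV) \<le> p * K powr (p - 1) * (\<tau> powr (p - 1) * d * s powr (p - 1))"
      using K pos by (simp add: M_def powr_mult mult_ac)
    let ?h = "\<lambda>x. p * M powr (p - 2) * (\<bar>rep_L2 (?u - ?v) x\<bar> * \<bar>rep_L2 ?u x\<bar> + \<bar>rep_L2 (?u - ?v) x\<bar> * \<bar>rep_L2 ?v x\<bar>)"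
    note I = integral_norm_mult_le_L2[OF square_integrable_rep square_integrable_rep, of "?u - ?v", unfolded real_norm_def abs_rep_L2]
    have "norm_L1 (?GU - ?GV) \<le> (LINT x|lborel. ?h x)"
      unfolding norm_L1_def
    proof (rule integral_mono_AE)
      show "integrable lborel (\<lambda>x. \<bar>rep_L2 (?GU - ?GV) x\<bar>)"
        using integrable_rep_abs_power_diff[OF in12[of U] in12[of V]] by simp
      show "integrable lborel ?h" by (intro integrable_mult_right Bochner_Integration.integrable_add I)
      show "AE x in lborel. \<bar>rep_L2 (?GU - ?GV) x\<bar> \<le> ?h x"
        using diff bound
      proof eventually_elim
        case (elim x)
        let ?m = "\<bar>rep_L2 ?u x\<bar> + \<bar>rep_L2 ?v x\<bar>"
        have "?m powr (p - 2) \<le> M powr (p - 2)" using elim p by (intro powr_mono2) auto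
        then have "p * \<bar>rep_L2 (?u - ?v) x\<bar> * (?m powr (p - 2) * ?m) \<le> p * \<bar>rep_L2 (?u - ?v) x\<bar> * (M powr (p - 2) * ?m)"
          using p by (intro mult_left_mono mult_right_mono) auto
        then show ?case using elim(1) split[of ?m] by (simp add: algebra_simps)
      qed
    qed
    also have "\<dots> = p * M powr (p - 2) * ((LINT x|lborel. \<bar>rep_L2 (?u - ?v) x\<bar> * \<bar>rep_L2 ?u x\<bar>) + (LINT x|lborel. \<bar>rep_L2 (?u - ?v) x\<bar> * \<bar>rep_L2 ?v x\<bar>))"
      by (simp add: I)
    also have "\<dots> \<le> p * M powr (p - 2) * (norm (?u - ?v) * norm ?u + norm (?u - ?v) * norm ?v)"
      using p by (intro mult_left_mono add_mono I) auto
    also have "\<dots> = p * M powr (p - 2) * (norm (?u - ?v) * (norm ?u + norm ?v))" by (simp add: distrib_left)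
    also have "\<dots> \<le> p * M powr (p - 2) * (((1 + t) powr (- 1 / 4) * d) * ((1 + t) powr (- 1 / 4) * s))"
      using p pos by (intro mult_left_mono mult_mono nuv nu) auto
    also have "\<dots> = p * M powr (p - 2) * (((1 + t) powr (- 1 / 4) * (1 + t) powr (- 1 / 4)) * d * s)"
      by (simp only: mult_ac)
    also have "\<dots> = p * K powr (p - 2) * (\<tau> powr (p - 1) * d * s powr (p - 1))"
      unfolding \<tau>2 M_def using K pos split[of \<tau>] split[of s] by (simp add: powr_mult mult_ac)
    finally have L1: "norm_L1 (?GU - ?GV) \<le> p * K powr (p - 2) * (\<tau> powr (p - 1) * d * s powr (p - 1))" .
    have "norm (?GU - ?GV) + norm_L1 (?GU - ?GV) \<le> (p * K powr (p - 1) + p * K powr (p - 2)) * (\<tau> powr (p - 1) * d * s powr (p - 1))"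
      using L1 L2 by (simp add: distrib_right)
    also have "\<dots> \<le> C * (\<tau> powr (p - 1) * d * s powr (p - 1))"
      using p pos by (intro mult_right_mono) (auto simp: C_def)
    finally show "norm (?GU - ?GV) + norm_L1 (?GU - ?GV) \<le>
        C * (1 + t) powr (- real CARD('n) * (p - 1) / 2) * wnorm t (U - V) * (wnorm t U + wnorm t V) powr (p - 1)"
      unfolding \<tau>p d_def s_def by (simp only: mult.assoc)
  qed
  then show ?thesis by blast
qed


section \<open>Sobolev embedding into \<open>L\<^sup>4\<close> in dimension two\<close>

lemma nn_integral_lborel_shift:
  fixes f :: "'a::euclidean_space \<Rightarrow> ennreal"
  assumes [measurable]: "f \<in> borel_measurable borel"
  shows "(\<integral>\<^sup>+x. f (x - c) \<partial>lborel) = (\<integral>\<^sup>+x. f x \<partial>lborel)"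
  using lborel_scale_nn_integral[OF _ assms, of 1 "- c"] by simp

lemma nn_integral_lborel_reflect_shift:
  fixes f :: "'a::euclidean_space \<Rightarrow> ennreal"
  assumes [measurable]: "f \<in> borel_measurable borel"
  shows "(\<integral>\<^sup>+x. f (c - x) \<partial>lborel) = (\<integral>\<^sup>+x. f x \<partial>lborel)"
  using lborel_scale_nn_integral[OF _ assms, of "- 1" c] by simp

lemma integral_lborel_shift:
  fixes f :: "'a::euclidean_space \<Rightarrow> 'b::{banach, second_countable_topology}"
  assumes [measurable]: "f \<in> borel_measurable borel"
  shows "(LINT x|lborel. f (x - c)) = (LINT x|lborel. f x)"
  using lborel_scale_integral[OF _ assms, of 1 "- c"] by simp

text \<open>Convolution of \<open>a\<close> with itself. The square of a transform is, up to a
  constant, the transform of this function, so an \<open>L\<^sup>4\<close> bound on the physical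
  side becomes an \<open>L\<^sup>2\<close> bound on the Fourier side.\<close>

definition self_conv :: "('a::euclidean_space \<Rightarrow> complex) \<Rightarrow> 'a \<Rightarrow> complex" where
  "self_conv a \<zeta> = (LINT \<xi>|lborel. a \<xi> * a (\<zeta> - \<xi>))"

lemma integrable_self_conv_product:
  fixes a :: "'a::euclidean_space \<Rightarrow> complex"
  assumes a: "integrable lborel a"
  shows "integrable (lborel \<Otimes>\<^sub>M lborel) (\<lambda>(\<xi>, \<zeta>). a \<xi> * a (\<zeta> - \<xi>))"
proof -
  have [measurable]: "a \<in> borel_measurable borel" using a by (auto dest: borel_measurable_integrable)
  show ?thesis
  proof (rule lborel_pair.Fubini_integrable)
    have "(LINT \<zeta>|lborel. norm (case (\<xi>, \<zeta>) of (\<xi>, \<zeta>) \<Rightarrow> a \<xi> * a (\<zeta> - \<xi>))) = norm (a \<xi>) * (LINT \<zeta>|lborel. norm (a \<zeta>))" for \<xi>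
      using integral_lborel_shift[of "\<lambda>\<zeta>. norm (a \<zeta>)" \<xi>] by (simp add: norm_mult)
    then show "integrable lborel (\<lambda>\<xi>. LINT \<zeta>|lborel. norm (case (\<xi>, \<zeta>) of (\<xi>, \<zeta>) \<Rightarrow> a \<xi> * a (\<zeta> - \<xi>)))"
      using a by simp
    have "integrable lborel (\<lambda>\<zeta>. a (\<zeta> - \<xi>))" for \<xi>
      using a nn_integral_lborel_shift[of "\<lambda>\<zeta>. ennreal (norm (a \<zeta>))" \<xi>] by (simp add: integrable_iff_bounded)
    then show "AE \<xi> in lborel. integrable lborel (\<lambda>\<zeta>. case (\<xi>, \<zeta>) of (\<xi>, \<zeta>) \<Rightarrow> a \<xi> * a (\<zeta> - \<xi>))"
      by simp
  qed measurable
qed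

lemma fourier_integral_self_conv:
  fixes a :: "real^'n \<Rightarrow> complex"
  assumes a: "integrable lborel a"
  shows "(fourier_integral a x)\<^sup>2 = of_real (fourier_const TYPE('n)) * fourier_integral (self_conv a) x"
proof -
  have [measurable]: "a \<in> borel_measurable borel" using a by (auto dest: borel_measurable_integrable)
  let ?e = "\<lambda>\<xi>. cis (- (\<xi> \<bullet> x))"
  let ?I = "LINT \<xi>|lborel. ?e \<xi> * a \<xi>"
  have "integrable (lborel \<Otimes>\<^sub>M lborel) (\<lambda>(\<xi>, \<zeta>). ?e \<zeta> * (a \<xi> * a (\<zeta> - \<xi>)))"
    by (rule Bochner_Integration.integrable_bound[OF integrable_self_conv_product[OF a]])
      (measurable, auto simp: norm_mult)
  from lborel_pair.Fubini_integral[OF this]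
  have "(LINT \<zeta>|lborel. ?e \<zeta> * self_conv a \<zeta>) = (LINT \<xi>|lborel. LINT \<zeta>|lborel. ?e \<zeta> * (a \<xi> * a (\<zeta> - \<xi>)))"
    by (simp add: self_conv_def)
  also have "\<dots> = (LINT \<xi>|lborel. ?e \<xi> * a \<xi> * ?I)"
  proof (intro Bochner_Integration.integral_cong refl)
    fix \<xi>
    have "(LINT \<zeta>|lborel. ?e \<zeta> * (a \<xi> * a (\<zeta> - \<xi>))) = (LINT \<zeta>|lborel. (?e \<xi> * a \<xi>) * (?e (\<zeta> - \<xi>) * a (\<zeta> - \<xi>)))"
      by (intro Bochner_Integration.integral_cong refl)
        (simp add: cis_mult[symmetric] inner_diff_left mult_ac cis_mult)
    also have "\<dots> = ?e \<xi> * a \<xi> * (LINT \<zeta>|lborel. ?e (\<zeta> - \<xi>) * a (\<zeta> - \<xi>))"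
      by (rule integral_mult_right_zero)
    also have "(LINT \<zeta>|lborel. ?e (\<zeta> - \<xi>) * a (\<zeta> - \<xi>)) = ?I"
      by (rule integral_lborel_shift[of "\<lambda>\<xi>. ?e \<xi> * a \<xi>"]) measurable
    finally show "(LINT \<zeta>|lborel. ?e \<zeta> * (a \<xi> * a (\<zeta> - \<xi>))) = ?e \<xi> * a \<xi> * ?I" .
  qed
  also have "\<dots> = ?I * ?I" by simp
  finally show ?thesis unfolding fourier_integral_def by (simp add: power2_eq_square mult_ac)
qed

text \<open>
  Young's inequality is avoided: \<open>|a| \<le> bessel \<cdot> A\<close> and Cauchy--Schwarz bound the convolution square
  pointwise by \<open>(\<integral>bessel\<^sup>4) \<cdot> (A\<^sup>2 * A\<^sup>2)\<close>.
\<close>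

lemma nn_integral_self_conv_sq:
  fixes a :: "real^'n \<Rightarrow> complex" and A :: "real^'n \<Rightarrow> real"
  assumes a: "integrable lborel a" and [measurable]: "A \<in> borel_measurable borel" and A0: "\<And>\<xi>. 0 \<le> A \<xi>"
    and le: "\<And>\<xi>. norm (a \<xi>) \<le> bessel \<xi> * A \<xi>"
  shows "(\<integral>\<^sup>+\<zeta>. ennreal ((norm (self_conv a \<zeta>))\<^sup>2) \<partial>lborel)
    \<le> (\<integral>\<^sup>+\<xi>. ennreal (bessel \<xi> ^ 4) \<partial>(lborel::(real^'n) measure)) * (\<integral>\<^sup>+\<xi>. ennreal ((A \<xi>)\<^sup>2) \<partial>lborel)\<^sup>2"
proof -
  have [measurable]: "a \<in> borel_measurable borel" using a by (auto dest: borel_measurable_integrable)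
  have [measurable]: "bessel \<in> borel_measurable (borel :: (real^'n) measure)" using symbol_bessel by auto
  let ?H = "\<integral>\<^sup>+\<xi>. ennreal (bessel \<xi> ^ 4) \<partial>(lborel::(real^'n) measure)"
  let ?A = "\<integral>\<^sup>+\<xi>. ennreal ((A \<xi>)\<^sup>2) \<partial>lborel"
  have b0: "0 \<le> bessel \<xi>" for \<xi> :: "real^'n" using bessel_pos[of \<xi>] by simp
  \<comment> \<open>By \<open>2 x y \<le> x\<^sup>2 + y\<^sup>2\<close> and invariance under
    \<open>\<xi> \<mapsto> \<zeta> - \<xi>\<close>; the bound is uniform in
    \<open>\<zeta>\<close>.\<close>
  have H: "(\<integral>\<^sup>+\<xi>. (ennreal (bessel \<xi> * bessel (\<zeta> - \<xi>)))\<^sup>2 \<partial>lborel) \<le> ?H" for \<zeta> :: "real^'n"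
  proof -
    have "(\<integral>\<^sup>+\<xi>. (ennreal (bessel \<xi> * bessel (\<zeta> - \<xi>)))\<^sup>2 \<partial>lborel) \<le>
        (\<integral>\<^sup>+\<xi>. ennreal (1/2) * (ennreal (bessel \<xi> ^ 4) + ennreal (bessel (\<zeta> - \<xi>) ^ 4)) \<partial>lborel)"
    proof (intro nn_integral_mono)
      fix \<xi> :: "real^'n"
      have "(bessel \<xi> * bessel (\<zeta> - \<xi>))\<^sup>2 \<le> 1/2 * (bessel \<xi> ^ 4 + bessel (\<zeta> - \<xi>) ^ 4)"
        using sum_squares_bound[of "(bessel \<xi>)\<^sup>2" "(bessel (\<zeta> - \<xi>))\<^sup>2"] by (simp add: power_mult_distrib flip: power_mult)
      then have "ennreal ((bessel \<xi> * bessel (\<zeta> - \<xi>))\<^sup>2) \<le> ennreal (1/2 * (bessel \<xi> ^ 4 + bessel (\<zeta> - \<xi>) ^ 4))"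
        by (rule ennreal_leI)
      also have "\<dots> = ennreal (1/2) * ennreal (bessel \<xi> ^ 4 + bessel (\<zeta> - \<xi>) ^ 4)"
        by (rule ennreal_mult) auto
      also have "ennreal (bessel \<xi> ^ 4 + bessel (\<zeta> - \<xi>) ^ 4) = ennreal (bessel \<xi> ^ 4) + ennreal (bessel (\<zeta> - \<xi>) ^ 4)"
        by (rule ennreal_plus) auto
      finally show "(ennreal (bessel \<xi> * bessel (\<zeta> - \<xi>)))\<^sup>2 \<le> ennreal (1/2) * (ennreal (bessel \<xi> ^ 4) + ennreal (bessel (\<zeta> - \<xi>) ^ 4))"
        using b0 by (simp only: ennreal_power mult_nonneg_nonneg)
    qed
    also have "\<dots> = ennreal (1/2) * (?H + ?H)"
      using nn_integral_lborel_reflect_shift[of "\<lambda>\<xi>::real^'n. ennreal (bessel \<xi> ^ 4)" \<zeta>]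
      by (subst nn_integral_cmult, measurable, subst nn_integral_add, auto)
    also have "\<dots> = ?H"
    proof -
      have "?H + ?H = ennreal 2 * ?H" by (simp add: mult_2)
      moreover have "ennreal (1/2) * ennreal 2 = 1" by (simp only: ennreal_mult[symmetric], simp)
      ultimately show ?thesis by (simp only: mult.assoc[symmetric] mult_1)
    qed
    finally show ?thesis .
  qed
  have "ennreal ((norm (self_conv a \<zeta>))\<^sup>2) \<le> ?H * (\<integral>\<^sup>+\<xi>. ennreal ((A \<xi>)\<^sup>2) * ennreal ((A (\<zeta> - \<xi>))\<^sup>2) \<partial>lborel)" for \<zeta>
  proof -
    have "ennreal (norm (self_conv a \<zeta>)) \<le> (\<integral>\<^sup>+\<xi>. ennreal (norm (a \<xi> * a (\<zeta> - \<xi>))) \<partial>lborel)"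
      unfolding self_conv_def
      by (cases "integrable lborel (\<lambda>\<xi>. a \<xi> * a (\<zeta> - \<xi>))")
        (auto intro: integral_norm_bound_ennreal simp: not_integrable_integral_eq)
    also have "\<dots> \<le> (\<integral>\<^sup>+\<xi>. ennreal (bessel \<xi> * bessel (\<zeta> - \<xi>)) * ennreal (A \<xi> * A (\<zeta> - \<xi>)) \<partial>lborel)"
    proof (intro nn_integral_mono)
      fix \<xi>
      have "norm (a \<xi>) * norm (a (\<zeta> - \<xi>)) \<le> (bessel \<xi> * A \<xi>) * (bessel (\<zeta> - \<xi>) * A (\<zeta> - \<xi>))"
        using b0 A0 by (intro mult_mono le) auto
      then show "ennreal (norm (a \<xi> * a (\<zeta> - \<xi>))) \<le> ennreal (bessel \<xi> * bessel (\<zeta> - \<xi>)) * ennreal (A \<xi> * A (\<zeta> - \<xi>))"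
        using b0 A0 by (simp add: norm_mult mult_ac flip: ennreal_mult)
    qed
    finally have "(ennreal (norm (self_conv a \<zeta>)))\<^sup>2 \<le> (\<integral>\<^sup>+\<xi>. ennreal (bessel \<xi> * bessel (\<zeta> - \<xi>)) * ennreal (A \<xi> * A (\<zeta> - \<xi>)) \<partial>lborel)\<^sup>2"
      by (rule power_mono) simp
    also have "\<dots> \<le> (\<integral>\<^sup>+\<xi>. (ennreal (bessel \<xi> * bessel (\<zeta> - \<xi>)))\<^sup>2 \<partial>lborel) * (\<integral>\<^sup>+\<xi>. (ennreal (A \<xi> * A (\<zeta> - \<xi>)))\<^sup>2 \<partial>lborel)"
      by (rule Cauchy_Schwarz_nn_integral) measurable
    also have "\<dots> \<le> ?H * (\<integral>\<^sup>+\<xi>. (ennreal (A \<xi> * A (\<zeta> - \<xi>)))\<^sup>2 \<partial>lborel)"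
      by (intro mult_right_mono H) auto
    also have "(\<integral>\<^sup>+\<xi>. (ennreal (A \<xi> * A (\<zeta> - \<xi>)))\<^sup>2 \<partial>lborel) = (\<integral>\<^sup>+\<xi>. ennreal ((A \<xi>)\<^sup>2) * ennreal ((A (\<zeta> - \<xi>))\<^sup>2) \<partial>lborel)"
      using A0 by (intro nn_integral_cong) (simp add: ennreal_power power_mult_distrib flip: ennreal_mult)
    finally show ?thesis by (simp add: ennreal_power)
  qed
  then have "(\<integral>\<^sup>+\<zeta>. ennreal ((norm (self_conv a \<zeta>))\<^sup>2) \<partial>lborel) \<le>
      (\<integral>\<^sup>+\<zeta>. ?H * (\<integral>\<^sup>+\<xi>. ennreal ((A \<xi>)\<^sup>2) * ennreal ((A (\<zeta> - \<xi>))\<^sup>2) \<partial>lborel) \<partial>lborel)"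
    by (intro nn_integral_mono)
  also have "\<dots> = ?H * (\<integral>\<^sup>+\<zeta>. \<integral>\<^sup>+\<xi>. ennreal ((A \<xi>)\<^sup>2) * ennreal ((A (\<zeta> - \<xi>))\<^sup>2) \<partial>lborel \<partial>lborel)"
    by (rule nn_integral_cmult) measurable
  also have "(\<integral>\<^sup>+\<zeta>. \<integral>\<^sup>+\<xi>. ennreal ((A \<xi>)\<^sup>2) * ennreal ((A (\<zeta> - \<xi>))\<^sup>2) \<partial>lborel \<partial>lborel) =
      (\<integral>\<^sup>+\<xi>. \<integral>\<^sup>+\<zeta>. ennreal ((A \<xi>)\<^sup>2) * ennreal ((A (\<zeta> - \<xi>))\<^sup>2) \<partial>lborel \<partial>lborel)"
    by (rule lborel_pair.Fubini') measurable
  also have "\<dots> = (\<integral>\<^sup>+\<xi>. ennreal ((A \<xi>)\<^sup>2) * ?A \<partial>lborel)"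
    using nn_integral_lborel_shift[of "\<lambda>\<zeta>. ennreal ((A \<zeta>)\<^sup>2)"]
    by (intro nn_integral_cong) (subst nn_integral_cmult, auto)
  also have "\<dots> = ?A\<^sup>2" by (subst nn_integral_multc) (auto simp: power2_eq_square)
  finally show ?thesis .
qed

text \<open>The transform contracts the \<open>L2\<close> norm of the self-convolution, which
  carries the convolution bound over to the physical side. The integral of \<open>bessel ^ 4\<close>
  is finite because the dimension is less than 4.\<close>

lemma nn_integral_fourier_integral_pow4:
  fixes a :: "real^'n \<Rightarrow> complex" and A :: "real^'n \<Rightarrow> real"
  assumes n: "CARD('n) = 2" and a: "integrable lborel a" and [measurable]: "A \<in> borel_measurable borel"
    and A0: "\<And>\<xi>. 0 \<le> A \<xi>" and le: "\<And>\<xi>. norm (a \<xi>) \<le> bessel \<xi> * A \<xi>" and A2: "integrable lborel (\<lambda>\<xi>. (A \<xi>)\<^sup>2)"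
  shows "(\<integral>\<^sup>+x. ennreal (norm (fourier_integral a x) ^ 4) \<partial>lborel) \<le>
    ennreal ((LINT \<xi>::real^'n|lborel. bessel \<xi> ^ 4) * (LINT \<xi>|lborel. (A \<xi>)\<^sup>2)\<^sup>2)"
proof -
  have [measurable]: "a \<in> borel_measurable borel" using a by (auto dest: borel_measurable_integrable)
  have b4: "bessel \<xi> ^ 4 = 1 / (1 + (norm \<xi>)\<^sup>2)\<^sup>2" for \<xi> :: "real^'n"
    using bessel_sq[of \<xi>] by (simp add: power_divide power4_eq_xxxx power2_eq_square)
  have Hint: "integrable lborel (\<lambda>\<xi>::real^'n. bessel \<xi> ^ 4)"
    unfolding b4 using bracket_integrable[of 2, where 'n='n] n by simp
  have "(\<integral>\<^sup>+\<zeta>. ennreal ((norm (self_conv a \<zeta>))\<^sup>2) \<partial>lborel)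
    \<le> (\<integral>\<^sup>+\<xi>. ennreal (bessel \<xi> ^ 4) \<partial>(lborel::(real^'n) measure)) * (\<integral>\<^sup>+\<xi>. ennreal ((A \<xi>)\<^sup>2) \<partial>lborel)\<^sup>2"
    by (rule nn_integral_self_conv_sq[OF a _ A0 le]) measurable
  also have "\<dots> = ennreal ((LINT \<xi>::real^'n|lborel. bessel \<xi> ^ 4) * (LINT \<xi>|lborel. (A \<xi>)\<^sup>2)\<^sup>2)"
    by (subst nn_integral_eq_integral[OF Hint], simp, subst nn_integral_eq_integral[OF A2], simp)
      (simp add: ennreal_power integral_nonneg_AE flip: ennreal_mult)
  finally have conv: "(\<integral>\<^sup>+\<zeta>. ennreal ((norm (self_conv a \<zeta>))\<^sup>2) \<partial>lborel) \<le> \<dots>" .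
  have [measurable]: "self_conv a \<in> borel_measurable borel" unfolding self_conv_def[abs_def] by measurable
  have cint: "integrable lborel (self_conv a)"
    using lborel_pair.integrable_snd[OF integrable_self_conv_product[OF a]] by (simp add: self_conv_def[abs_def])
  have cS: "square_integrable (self_conv a)"
    unfolding square_integrable_def
    by (auto intro!: integrableI_bounded order_le_less_trans[OF conv])
  have "(\<integral>\<^sup>+x. ennreal (norm (fourier_integral a x) ^ 4) \<partial>lborel) \<le> (\<integral>\<^sup>+x. ennreal ((norm (fourier_integral (self_conv a) x))\<^sup>2) \<partial>lborel)"
  proof (intro nn_integral_mono ennreal_leI)
    fix x
    have "norm (fourier_integral a x) ^ 2 = fourier_const TYPE('n) * norm (fourier_integral (self_conv a) x)"
      using arg_cong[OF fourier_integral_self_conv[OF a, of x], of norm] by (simp add: norm_mult norm_power)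
    also have "\<dots> \<le> 1 * norm (fourier_integral (self_conv a) x)" by (intro mult_right_mono fourier_const_le_1) auto
    finally have "(norm (fourier_integral a x) ^ 2)\<^sup>2 \<le> (norm (fourier_integral (self_conv a) x))\<^sup>2" by (intro power_mono) auto
    then show "norm (fourier_integral a x) ^ 4 \<le> (norm (fourier_integral (self_conv a) x))\<^sup>2" by (simp flip: power_mult)
  qed
  also have "\<dots> = ennreal ((norm (abs_L2 (fourier_integral (self_conv a))))\<^sup>2)"
    using square_integrable_fourier_integral(1)[OF cint cS]
    unfolding norm_abs_L2_sq[OF square_integrable_fourier_integral(1)[OF cint cS]]
    by (intro nn_integral_eq_integral) (auto simp: square_integrable_def)
  also have "\<dots> \<le> ennreal ((norm (abs_L2 (self_conv a)))\<^sup>2)"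
    by (intro ennreal_leI power_mono square_integrable_fourier_integral[OF cint cS]) auto
  also have "\<dots> = (\<integral>\<^sup>+\<zeta>. ennreal ((norm (self_conv a \<zeta>))\<^sup>2) \<partial>lborel)"
    unfolding norm_abs_L2_sq[OF cS] using cS
    by (intro nn_integral_eq_integral[symmetric]) (auto simp: square_integrable_def)
  also note conv
  finally show ?thesis .
qed

text \<open>In dimension two \<open>bessel\<close> is not square-integrable, so the transform of
  \<open>bessel_op U\<close> may fail to be integrable. Frequency truncations of it are integrable,
  with a bound that does not depend on the cutoff, and Fatou's lemma along an a.e. convergent
  subsequence removes the cutoff.\<close>

lemma sobolev_L4_dim2:
  assumes n: "CARD('n::finite) = 2"
  obtains H :: real where "0 \<le> H" "\<And>U :: (real^'n, real) L2.
      (\<integral>\<^sup>+x. ennreal ((rep_L2 (bessel_op U) x) ^ 4) \<partial>lborel) \<le> ennreal (H * norm U ^ 4)"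
proof
  let ?H = "LINT \<xi>::real^'n|lborel. bessel \<xi> ^ 4"
  show "0 \<le> ?H" by (intro integral_nonneg_AE) auto
  fix U :: "(real^'n, real) L2"
  let ?m = "\<lambda>k \<xi>::real^'n. indicator (cball 0 (real k)) \<xi> :: real"
  let ?u = "\<lambda>k. bessel_op (fourier_multiplier (?m k) U)"
  have m: "symbol (?m k)" for k
    by (rule symbolI[where B=1]) (measurable, auto simp: indicator_def)
  have m1: "symbol (\<lambda>_::real^'n. 1)" by (rule symbolI[where B=1]) auto
  have trunc: "(\<integral>\<^sup>+x. ennreal ((rep_L2 (?u k) x) ^ 4) \<partial>lborel) \<le> ennreal (?H * norm U ^ 4)" for k
  proof -
    let ?a = "\<lambda>\<xi>. indicator (cball 0 (real k)) \<xi> *\<^sub>R (of_real (bessel \<xi>) * cnj (rep_L2 (fourier U) \<xi>))"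
    have [measurable]: "bessel \<in> borel_measurable (borel :: (real^'n) measure)" using symbol_bessel by auto
    have "square_integrable (\<lambda>\<xi>. cnj (of_real (bessel \<xi>) * rep_L2 (fourier U) \<xi>))"
      by (intro square_integrable_cnj square_integrable_symbol_mult symbol_bessel)
    from integrable_truncate[OF this, of "real k"] have aint: "integrable lborel ?a" by simp
    then have [measurable]: "?a \<in> borel_measurable borel" by (auto dest: borel_measurable_integrable)
    have eq: "AE \<xi> in lborel. cnj (rep_L2 (fourier (?u k)) \<xi>) = ?a \<xi>"
      using fourier_multiplier[OF symbol_bessel, of "fourier_multiplier (?m k) U"] fourier_multiplier[OF m[of k], of U]
      by eventually_elim (simp add: scaleR_conv_of_real)
    have "integrable lborel (\<lambda>\<xi>. cnj (rep_L2 (fourier (?u k)) \<xi>))"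
      by (subst integrable_cong_AE[where g="?a"]) (use eq aint in auto)
    then have int: "integrable lborel (rep_L2 (fourier (?u k)))" by simp
    have FI: "fourier_integral (\<lambda>\<xi>. cnj (rep_L2 (fourier (?u k)) \<xi>)) = fourier_integral ?a"
      by (rule fourier_integral_cong_AE[OF _ _ eq]) measurable
    have "(\<integral>\<^sup>+x. ennreal ((rep_L2 (?u k) x) ^ 4) \<partial>lborel) = (\<integral>\<^sup>+x. ennreal (norm (fourier_integral ?a x) ^ 4) \<partial>lborel)"
    proof (intro nn_integral_cong_AE)
      show "AE x in lborel. ennreal ((rep_L2 (?u k) x) ^ 4) = ennreal (norm (fourier_integral ?a x) ^ 4)"
        using L2_of_real_inversion[OF int]
      proof eventually_elim
        case (elim x)
        have "norm (complex_of_real (rep_L2 (?u k) x)) = norm (fourier_integral ?a x)" unfolding elim FI by simp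
        then have "\<bar>rep_L2 (?u k) x\<bar> ^ 4 = norm (fourier_integral ?a x) ^ 4" by simp
        then show ?case by (simp add: power_even_abs)
      qed
    qed
    also have "\<dots> \<le> ennreal (?H * (LINT \<xi>|lborel. (norm (rep_L2 (fourier U) \<xi>))\<^sup>2)\<^sup>2)"
    proof (rule nn_integral_fourier_integral_pow4[OF n aint])
      show "norm (?a \<xi>) \<le> bessel \<xi> * norm (rep_L2 (fourier U) \<xi>)" for \<xi>
        using bessel_pos[of \<xi>] by (auto simp: norm_mult indicator_def)
    qed auto
    also have "(LINT \<xi>|lborel. (norm (rep_L2 (fourier U) \<xi>))\<^sup>2)\<^sup>2 = norm U ^ 4"
      unfolding norm_sq_fourier[symmetric] by (simp flip: power_mult)
    finally show ?thesis .
  qed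
  have "(\<lambda>k. fourier_multiplier (?m k) U) \<longlonglongrightarrow> fourier_multiplier (\<lambda>_. 1) U"
  proof (rule fourier_multiplier_LIMSEQ[OF m m1, where B=1])
    show "\<bar>?m j \<xi>\<bar> \<le> 1" for j \<xi> by (simp add: indicator_def)
    show "(\<lambda>j. ?m j \<xi>) \<longlonglongrightarrow> 1" for \<xi>
    proof (intro tendsto_eventually)
      obtain N where "norm \<xi> \<le> real N" using real_arch_simple by blast
      then show "\<forall>\<^sub>F j in sequentially. ?m j \<xi> = 1"
        by (intro eventually_sequentiallyI[of N]) (auto simp: indicator_def)
    qed
  qed
  moreover have "fourier_multiplier (\<lambda>_. 1) U = U" by (rule fourier_multiplierI[OF m1]) simp
  ultimately have "?u \<longlonglongrightarrow> bessel_op U"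
    using bounded_linear.tendsto[OF bounded_linear_fourier_multiplier[OF symbol_bessel]] by simp
  then obtain r :: "nat \<Rightarrow> nat" where r: "AE x in lborel. (\<lambda>j. rep_L2 (?u (r j)) x) \<longlonglongrightarrow> rep_L2 (bessel_op U) x"
    by (rule L2_tendsto_AE_subseq)
  have "(\<integral>\<^sup>+x. ennreal ((rep_L2 (bessel_op U) x) ^ 4) \<partial>lborel) = (\<integral>\<^sup>+x. liminf (\<lambda>j. ennreal ((rep_L2 (?u (r j)) x) ^ 4)) \<partial>lborel)"
  proof (intro nn_integral_cong_AE)
    show "AE x in lborel. ennreal ((rep_L2 (bessel_op U) x) ^ 4) = liminf (\<lambda>j. ennreal ((rep_L2 (?u (r j)) x) ^ 4))"
      using r by eventually_elim (intro lim_imp_Liminf[symmetric] tendsto_intros, auto)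
  qed
  also have "\<dots> \<le> liminf (\<lambda>j. \<integral>\<^sup>+x. ennreal ((rep_L2 (?u (r j)) x) ^ 4) \<partial>lborel)"
    by (rule nn_integral_liminf) measurable
  also have "\<dots> \<le> ennreal (?H * norm U ^ 4)"
    by (intro Liminf_le always_eventually allI trunc) auto
  finally show "(\<integral>\<^sup>+x. ennreal ((rep_L2 (bessel_op U) x) ^ 4) \<partial>lborel) \<le> ennreal (?H * norm U ^ 4)" .
qed

text \<open>The difference of squares factors as \<open>(u - v) (u + v)\<close>: Cauchy-Schwarz
  bounds its \<open>L1\<close> norm, and the \<open>L\<^sup>4\<close> embedding bounds its
  \<open>L2\<close> norm. Each of the two factors contributes
  \<open>(1 + t) powr (- 1 / 2)\<close>.\<close>

lemma power_estimate_dim2: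
  assumes n: "CARD('n::finite) = 2"
  shows "\<exists>C. power_estimate TYPE('n) 2 C"
proof -
  obtain H where H: "0 \<le> H" and L4: "\<And>U :: (real^'n, real) L2.
      (\<integral>\<^sup>+x. ennreal ((rep_L2 (bessel_op U) x) ^ 4) \<partial>lborel) \<le> ennreal (H * norm U ^ 4)"
    using sobolev_L4_dim2[OF n] by blast
  have S: "square_integrable (\<lambda>x. (rep_L2 (bessel_op U) x)\<^sup>2)"
    and S': "norm (abs_L2 (\<lambda>x. (rep_L2 (bessel_op U) x)\<^sup>2)) \<le> sqrt H * (norm U)\<^sup>2" for U :: "(real^'n, real) L2"
  proof -
    have e: "(norm ((rep_L2 (bessel_op U) x)\<^sup>2))\<^sup>2 = rep_L2 (bessel_op U) x ^ 4" for x by (simp flip: power_mult)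
    show S: "square_integrable (\<lambda>x. (rep_L2 (bessel_op U) x)\<^sup>2)"
      unfolding square_integrable_def e
      by (auto intro!: integrableI_bounded order_le_less_trans[OF L4[of U]])
    have "ennreal ((norm (abs_L2 (\<lambda>x. (rep_L2 (bessel_op U) x)\<^sup>2)))\<^sup>2) = (\<integral>\<^sup>+x. ennreal ((rep_L2 (bessel_op U) x) ^ 4) \<partial>lborel)"
      unfolding norm_abs_L2_sq[OF S] e using S
      by (intro nn_integral_eq_integral[symmetric]) (auto simp: square_integrable_def simp flip: power_mult)
    also note L4[of U]
    also have "H * norm U ^ 4 = (sqrt H * (norm U)\<^sup>2)\<^sup>2" using H by (simp add: power_mult_distrib flip: power_mult)
    finally have "(norm (abs_L2 (\<lambda>x. (rep_L2 (bessel_op U) x)\<^sup>2)))\<^sup>2 \<le> (sqrt H * (norm U)\<^sup>2)\<^sup>2"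
      by (subst (asm) ennreal_le_iff) auto
    then show "norm (abs_L2 (\<lambda>x. (rep_L2 (bessel_op U) x)\<^sup>2)) \<le> sqrt H * (norm U)\<^sup>2"
      using H by (rule_tac power2_le_imp_le) auto
  qed
  have sq: "\<bar>x\<bar> powr 2 = x\<^sup>2" for x :: real by (cases "x = 0") (auto simp: powr_numeral)
  have in12: "power_in_L12 2 (bessel_op U)" for U :: "(real^'n, real) L2"
    using S[of U] integrable_rep_L2_sq[of "bessel_op U"] by (simp add: power_in_L12_def sq)
  have "power_estimate TYPE('n) 2 (sqrt H + 1)"
    unfolding power_estimate_def
  proof (intro conjI allI impI in12)
    show "0 < sqrt H + 1" using H by (simp add: add_nonneg_pos)
    fix t :: real and U V :: "(real^'n, real) L2"
    assume t: "0 \<le> t"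
    let ?u = "bessel_op U" and ?v = "bessel_op V"
    let ?G = "abs_power 2 ?u - abs_power 2 ?v"
    let ?f = "rep_L2 (bessel_op (U - V))" and ?g = "rep_L2 (bessel_op (U + V))"
    define s where "s = wnorm t U + wnorm t V"
    define d where "d = wnorm t (U - V)"
    define \<tau> where "\<tau> = (1 + t) powr (- 1 / 2)"
    have pos: "0 \<le> s" "0 \<le> d" "0 < \<tau>"
      using t wnorm_nonneg[of t U] wnorm_nonneg[of t V] wnorm_nonneg[of t "U - V"] by (auto simp: s_def d_def \<tau>_def)
    have s': "wnorm t (U + V) \<le> s" using wnorm_triangle[OF t] by (simp add: s_def)
    have n1: "norm (U - V) \<le> \<tau> * d" "norm (bessel_op (U - V)) \<le> \<tau> * d"
      using wnorm_bessel_op[OF t, of "U - V"] n by (auto simp: \<tau>_def d_def)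
    have "\<tau> * wnorm t (U + V) \<le> \<tau> * s" using pos s' by (intro mult_left_mono) auto
    then have n2: "norm (U + V) \<le> \<tau> * s" "norm (bessel_op (U + V)) \<le> \<tau> * s"
      using wnorm_bessel_op[OF t, of "U + V"] n by (auto simp: \<tau>_def)
    have G: "AE x in lborel. rep_L2 ?G x = ?f x * ?g x"
      using rep_L2_diff[of "abs_power 2 ?u" "abs_power 2 ?v"] rep_L2_diff[of ?u ?v] rep_L2_add[of ?u ?v]
        rep_abs_power[OF in12[of U]] rep_abs_power[OF in12[of V]]
      unfolding bessel_op_diff bessel_op_add
    proof eventually_elim
      case (elim x)
      show ?case unfolding elim by (simp add: sq power2_eq_square algebra_simps)
    qed
    have "norm_L1 ?G = (LINT x|lborel. norm (?f x) * norm (?g x))"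
      unfolding norm_L1_def using G by (intro integral_cong_AE) (auto simp: abs_mult)
    also have "\<dots> \<le> norm (bessel_op (U - V)) * norm (bessel_op (U + V))"
      using integral_norm_mult_le_L2(2)[OF square_integrable_rep square_integrable_rep, of "bessel_op (U - V)" "bessel_op (U + V)"]
      unfolding abs_rep_L2 .
    also have "\<dots> \<le> (\<tau> * d) * (\<tau> * s)" using pos by (intro mult_mono n1 n2) auto
    finally have L1: "norm_L1 ?G \<le> \<tau> * \<tau> * d * s" by (simp only: mult_ac)
    have "(norm ?G)\<^sup>2 = (LINT x|lborel. norm ((?f x)\<^sup>2) * norm ((?g x)\<^sup>2))"
      unfolding norm_L2_sq using G by (intro integral_cong_AE) (auto simp: power_mult_distrib)
    also have "\<dots> \<le> norm (abs_L2 (\<lambda>x. (?f x)\<^sup>2)) * norm (abs_L2 (\<lambda>x. (?g x)\<^sup>2))"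
      by (rule integral_norm_mult_le_L2(2)[OF S S])
    also have "\<dots> \<le> (sqrt H * (norm (U - V))\<^sup>2) * (sqrt H * (norm (U + V))\<^sup>2)"
      using H by (intro mult_mono S') auto
    also have "\<dots> \<le> (sqrt H * (\<tau> * d)\<^sup>2) * (sqrt H * (\<tau> * s)\<^sup>2)"
      using H by (intro mult_mono mult_left_mono power_mono n1 n2) auto
    also have "\<dots> = (sqrt H * (\<tau> * \<tau> * d * s))\<^sup>2" by (simp add: power_mult_distrib power2_eq_square mult_ac)
    finally have "(norm ?G)\<^sup>2 \<le> (sqrt H * (\<tau> * \<tau> * d * s))\<^sup>2" .
    then have "norm ?G \<le> sqrt H * (\<tau> * \<tau> * d * s)"
      using H pos by (rule_tac power2_le_imp_le) auto
    with L1 have "norm ?G + norm_L1 ?G \<le> (sqrt H + 1) * (\<tau> * \<tau> * d * s)" by (simp add: distrib_right)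
    moreover have "(1 + t) powr (- real CARD('n) * (2 - 1) / 2) = \<tau> * \<tau>"
      using t n by (simp add: \<tau>_def flip: powr_add)
    moreover have "s powr (2 - 1) = s" using pos by simp
    ultimately show "norm ?G + norm_L1 ?G \<le>
        (sqrt H + 1) * (1 + t) powr (- real CARD('n) * (2 - 1) / 2) * wnorm t (U - V) * (wnorm t U + wnorm t V) powr (2 - 1)"
      unfolding d_def[symmetric] s_def[symmetric] by (simp only: mult.assoc)
  qed
  then show ?thesis by blast
qed

subsection \<open>The Duhamel operator\<close>

text \<open>The uniform bound \<open>B\<close> handles the change of the argument, strong continuity
  the change of the parameter; thus both may vary at once, as they do in the Duhamel
  integrand.\<close>

lemma continuous_on_multiplier_family:
  fixes m :: "real \<Rightarrow> real^'n \<Rightarrow> real" and f :: "'x::metric_space \<Rightarrow> (real^'n, real) L2"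
  assumes m: "\<And>t. 0 \<le> t \<Longrightarrow> symbol (m t)" and B: "\<And>t \<xi>. 0 \<le> t \<Longrightarrow> \<bar>m t \<xi>\<bar> \<le> B"
    and cont: "\<And>t \<xi>. isCont (\<lambda>t. m t \<xi>) t"
    and a: "continuous_on X a" "\<And>x. x \<in> X \<Longrightarrow> 0 \<le> a x" and f: "continuous_on X f"
  shows "continuous_on X (\<lambda>x. fourier_multiplier (m (a x)) (f x))"
  unfolding continuous_on_sequentially
proof (intro allI ballI impI)
  fix x :: "nat \<Rightarrow> 'x" and y
  assume "y \<in> X" and "(\<forall>n. x n \<in> X) \<and> x \<longlonglongrightarrow> y"
  then have x: "y \<in> X" "\<And>n. x n \<in> X" "x \<longlonglongrightarrow> y" by auto
  have fx: "(\<lambda>n. f (x n)) \<longlonglongrightarrow> f y" and ax: "(\<lambda>n. a (x n)) \<longlonglongrightarrow> a y"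
    using f a(1) x unfolding continuous_on_sequentially by (auto simp: o_def)
  note lin = bounded_linear.linear[OF bounded_linear_fourier_multiplier[OF m], THEN linear_diff]
  have lim0: "(\<lambda>n. B * norm (f (x n) - f y)) \<longlonglongrightarrow> 0"
    using fx by (intro tendsto_mult_right_zero tendsto_norm_zero LIM_zero)
  have le: "norm (fourier_multiplier (m (a (x n))) (f (x n)) - fourier_multiplier (m (a (x n))) (f y)) \<le> B * norm (f (x n) - f y)" for n
    using norm_fourier_multiplier_le[OF m[OF a(2)[OF x(2)]] B[OF a(2)[OF x(2)]], of n "f (x n) - f y"]
    by (simp add: lin[OF a(2)[OF x(2)]])
  have 1: "(\<lambda>n. fourier_multiplier (m (a (x n))) (f (x n)) - fourier_multiplier (m (a (x n))) (f y)) \<longlonglongrightarrow> 0"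
    by (rule Lim_null_comparison[OF always_eventually[OF allI[OF le]] lim0])
  have 2: "(\<lambda>n. fourier_multiplier (m (a (x n))) (f y)) \<longlonglongrightarrow> fourier_multiplier (m (a y)) (f y)"
  proof (rule fourier_multiplier_LIMSEQ[where B=B])
    show "(\<lambda>n. m (a (x n)) \<xi>) \<longlonglongrightarrow> m (a y) \<xi>" for \<xi>
      by (rule isCont_tendsto_compose[OF cont ax])
  qed (use m B a(2) x in auto)
  show "((\<lambda>x. fourier_multiplier (m (a x)) (f x)) \<circ> x) \<longlonglongrightarrow> fourier_multiplier (m (a y)) (f y)"
    using tendsto_add[OF 1 2] by (simp add: o_def)
qed

lemmas continuous_on_wave1 = continuous_on_multiplier_family[OF symbol_wave(1) wave_symbol_bounded(2) isCont_wave_symbols(1)]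
lemmas continuous_on_wave2 = continuous_on_multiplier_family[OF symbol_wave(2) wave_symbol_bounded(1) isCont_wave_symbols(2)]

lemma fourier_multiplier_one [simp]: "fourier_multiplier (\<lambda>_. 1) U = U"
  by (intro fourier_multiplierI symbolI[where B=1]) auto

lemma fourier_multiplier_0 [simp]: "fourier_multiplier (\<lambda>_. 0) (U :: (real^'n, real) L2) = 0"
proof -
  have "fourier (0 :: (real^'n, real) L2) = 0" by (rule linear_0[OF bounded_linear.linear[OF bounded_linear_fourier]])
  then show ?thesis using rep_L2_zero by (intro fourier_multiplierI symbolI[where B=0]) auto
qed

lemma wnorm_0 [simp]: "wnorm 0 U = norm (U :: (real^'n, real) L2)"
proof -
  have "time_weight 0 = (\<lambda>_::real^'n. 1)"
  proof
    fix \<xi> :: "real^'n"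
    have "0 < 1 + (norm \<xi>)\<^sup>2" by (simp add: add_pos_nonneg)
    then show "time_weight 0 \<xi> = 1" by (simp add: time_weight_def)
  qed
  then show ?thesis by (simp add: wnorm_def)
qed

definition nonlinearity :: "real \<Rightarrow> (real^'n, real) L2 \<Rightarrow> (real^'n, real) L2" where
  "nonlinearity p V = abs_power p (bessel_op V)"

lemma norm_L1_nonneg: "0 \<le> norm_L1 f"
  by (simp add: norm_L1_def)

lemma nonlinearity_lipschitz:
  assumes pe: "power_estimate TYPE('n::finite) p C"
  shows "norm (nonlinearity p U - nonlinearity p V) \<le> C * norm (U - V) * (norm U + norm (V :: (real^'n, real) L2)) powr (p - 1)"
proof -
  have "norm (nonlinearity p U - nonlinearity p V) + norm_L1 (nonlinearity p U - nonlinearity p V)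
      \<le> C * (1 + 0) powr (- real CARD('n) * (p - 1) / 2) * wnorm 0 (U - V) * (wnorm 0 U + wnorm 0 V) powr (p - 1)"
    using pe unfolding power_estimate_def nonlinearity_def by blast
  then show ?thesis using norm_L1_nonneg[of "nonlinearity p U - nonlinearity p V"] by simp
qed

lemma continuous_on_nonlinearity:
  fixes V :: "'x::metric_space \<Rightarrow> (real^'n, real) L2"
  assumes pe: "power_estimate TYPE('n) p C" and p: "1 \<le> p" and V: "continuous_on X V"
  shows "continuous_on X (\<lambda>x. nonlinearity p (V x))"
  unfolding continuous_on_sequentially
proof (intro allI ballI impI)
  fix x :: "nat \<Rightarrow> 'x" and y
  assume "y \<in> X" and "(\<forall>n. x n \<in> X) \<and> x \<longlonglongrightarrow> y"
  then have Vx: "(\<lambda>n. V (x n)) \<longlonglongrightarrow> V y" using V unfolding continuous_on_sequentially by (auto simp: o_def)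
  have C: "0 < C" using pe by (simp add: power_estimate_def)
  obtain B where B: "\<And>n. norm (V (x n)) \<le> B" using convergent_imp_Bseq[OF convergentI[OF Vx]] by (auto simp: Bseq_def)
  have le: "norm (nonlinearity p (V (x n)) - nonlinearity p (V y)) \<le> C * norm (V (x n) - V y) * (B + norm (V y)) powr (p - 1)" for n
  proof -
    have "(norm (V (x n)) + norm (V y)) powr (p - 1) \<le> (B + norm (V y)) powr (p - 1)"
      using B[of n] p by (intro powr_mono2) auto
    then have "C * norm (V (x n) - V y) * (norm (V (x n)) + norm (V y)) powr (p - 1) \<le> C * norm (V (x n) - V y) * (B + norm (V y)) powr (p - 1)"
      using C by (intro mult_left_mono) auto
    with nonlinearity_lipschitz[OF pe] show ?thesis by (rule order_trans)
  qed
  have lim0: "(\<lambda>n. C * norm (V (x n) - V y) * (B + norm (V y)) powr (p - 1)) \<longlonglongrightarrow> 0"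
    using Vx by (intro tendsto_mult_left_zero tendsto_mult_right_zero tendsto_norm_zero LIM_zero)
  have "(\<lambda>n. nonlinearity p (V (x n)) - nonlinearity p (V y)) \<longlonglongrightarrow> 0"
    by (rule Lim_null_comparison[OF always_eventually[OF allI[OF le]] lim0])
  then show "((\<lambda>x. nonlinearity p (V x)) \<circ> x) \<longlonglongrightarrow> nonlinearity p (V y)" by (simp add: o_def LIM_zero_iff)
qed

definition duhamel :: "real \<Rightarrow> (real \<Rightarrow> (real^'n, real) L2) \<Rightarrow> real \<Rightarrow> (real^'n, real) L2" where
  "duhamel p V t = integral {0..t} (\<lambda>s. fourier_multiplier (wave_symbol2 (t - s)) (nonlinearity p (V s)))"

definition free_wave :: "real \<Rightarrow> (real^'n, real) L2 \<Rightarrow> (real^'n, real) L2 \<Rightarrow> real \<Rightarrow> (real^'n, real) L2" where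
  "free_wave \<epsilon> U0 u1 t = \<epsilon> *\<^sub>R fourier_multiplier (wave_symbol1 t) U0 + \<epsilon> *\<^sub>R fourier_multiplier (wave_symbol2 t) u1"

lemma continuous_on_duhamel_integrand:
  fixes V :: "real \<Rightarrow> (real^'n, real) L2"
  assumes pe: "power_estimate TYPE('n) p C" and p: "1 \<le> p" and V: "continuous_on {0..t} V"
  shows "continuous_on {0..t} (\<lambda>s. fourier_multiplier (wave_symbol2 (t - s)) (nonlinearity p (V s)))"
  by (intro continuous_on_wave2 continuous_on_nonlinearity[OF pe p V] continuous_intros) auto

lemma wave_symbol_at_0 [simp]: "wave_symbol2 0 \<xi> = 0" "wave_symbol1 0 \<xi> = 1" "damped_wave_symbol 0 \<xi> = 0"
  by (simp_all add: wave_symbol2_def wave_symbol1_def damped_wave_symbol_eq wave_sin_def wave_cos_def)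

text \<open>Since the kernel vanishes at time 0, the integral may be taken over a fixed interval.\<close>

lemma continuous_on_duhamel:
  fixes V :: "real \<Rightarrow> (real^'n, real) L2"
  assumes pe: "power_estimate TYPE('n) p C" and p: "1 \<le> p" and V: "continuous_on {0..T} V"
  shows "continuous_on {0..T} (duhamel p V)"
proof -
  let ?g = "\<lambda>t s. fourier_multiplier (wave_symbol2 (max 0 (t - s))) (nonlinearity p (V s))"
  have "continuous_on ({0..T} \<times> cbox 0 T) (\<lambda>x. V (snd x))"
    by (rule continuous_on_compose2[OF V]) (auto intro!: continuous_intros)
  then have c: "continuous_on ({0..T} \<times> cbox 0 T) (\<lambda>x. ?g (fst x) (snd x))"
    by (intro continuous_on_wave2 continuous_on_nonlinearity[OF pe p] continuous_intros) auto
  then have "continuous_on {0..T} (\<lambda>t. integral (cbox 0 T) (?g t))"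
    by (intro integral_continuous_on_param) (simp add: split_beta)
  moreover have "integral (cbox 0 T) (?g t) = duhamel p V t" if t: "t \<in> {0..T}" for t
  proof -
    have ct: "continuous_on {0..T} (?g t)"
      by (intro continuous_on_wave2 continuous_on_nonlinearity[OF pe p V] continuous_intros) auto
    have z: "wave_symbol2 0 = (\<lambda>_::real^'n. 0)" by (simp add: fun_eq_iff)
    have "integral {0..T} (?g t) = integral {0..t} (?g t) + integral {t..T} (?g t)"
      using t by (intro Henstock_Kurzweil_Integration.integral_combine[symmetric] integrable_continuous_interval ct) auto
    also have "integral {t..T} (?g t) = integral {t..T} (\<lambda>_. 0)"
    proof (intro Henstock_Kurzweil_Integration.integral_cong)
      fix s assume "s \<in> {t..T}"
      then have "max 0 (t - s) = 0" by auto
      then show "?g t s = 0" by (simp add: z)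
    qed
    also have "integral {0..t} (?g t) = duhamel p V t"
      unfolding duhamel_def by (intro Henstock_Kurzweil_Integration.integral_cong) (simp add: max_def)
    finally show ?thesis by simp
  qed
  ultimately show ?thesis by (rule continuous_on_eq)
qed

lemma continuous_on_free_wave: "continuous_on {0..T} (free_wave \<epsilon> U0 u1)"
  unfolding free_wave_def[abs_def]
  by (intro continuous_intros continuous_on_wave1 continuous_on_wave2) auto

text \<open>The weighted norm is the norm after a bounded multiplier, and such a multiplier commutes
  with the integral.\<close>

lemma wnorm_integral_le:
  fixes f :: "real \<Rightarrow> (real^'n, real) L2"
  assumes t: "0 \<le> t" and f: "continuous_on {0..t} f" and k: "k integrable_on {0..t}"
    and le: "\<And>s. s \<in> {0..t} \<Longrightarrow> wnorm t (f s) \<le> k s"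
  shows "wnorm t (integral {0..t} f) \<le> integral {0..t} k"
proof -
  let ?c = "(1 + t) powr (real CARD('n) / 4)" and ?M = "fourier_multiplier (time_weight t)"
  note bl = bounded_linear_fourier_multiplier[OF symbol_time_weight[OF t]]
  note fi = integrable_continuous_interval[OF f]
  have int: "(\<lambda>s. ?M (f s)) integrable_on {0..t}" using integrable_linear[OF fi bl] by (simp add: o_def)
  have c: "?c > 0" using t by simp
  have "wnorm t (integral {0..t} f) = norm (integral {0..t} (\<lambda>s. ?c *\<^sub>R ?M (f s)))"
    using integral_linear[OF fi bl] c by (simp add: wnorm_def o_def)
  also have "\<dots> \<le> integral {0..t} k"
  proof (rule integral_norm_bound_integral)
    show "(\<lambda>s. ?c *\<^sub>R ?M (f s)) integrable_on {0..t}" using int by (rule integrable_cmul)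
    show "norm (?c *\<^sub>R ?M (f s)) \<le> k s" if "s \<in> {0..t}" for s
      using le[OF that] c by (simp add: wnorm_def)
  qed (rule k)
  finally show ?thesis .
qed

text \<open>The form in which \<open>wnorm_decay\<close> takes the kernel, with
  \<open>r = 1 + t\<close>; 23 is the least integer whose square exceeds 512.\<close>

lemma wave_sq_bounds:
  assumes "0 \<le> t"
  shows "(wave_symbol1 t \<xi>)\<^sup>2 \<le> 23\<^sup>2 * (exp (- 2 * (1 + t) * (norm \<xi>)\<^sup>2) + exp (- (1 + t - 1) / 4))"
    and "(wave_symbol2 t \<xi>)\<^sup>2 \<le> 23\<^sup>2 * (exp (- 2 * (1 + t) * (norm \<xi>)\<^sup>2) + exp (- (1 + t - 1) / 4))"
proof -
  have "512 * (exp (- 2 * (1 + t) * (norm \<xi>)\<^sup>2) + exp (- t / 4)) \<le> 23\<^sup>2 * (exp (- 2 * (1 + t) * (norm \<xi>)\<^sup>2) + exp (- (1 + t - 1) / 4))"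
    by (rule order_trans[of _ "529 * (exp (- 2 * (1 + t) * (norm \<xi>)\<^sup>2) + exp (- t / 4))"])
      (intro mult_right_mono add_nonneg_nonneg, auto)
  then show "(wave_symbol1 t \<xi>)\<^sup>2 \<le> 23\<^sup>2 * (exp (- 2 * (1 + t) * (norm \<xi>)\<^sup>2) + exp (- (1 + t - 1) / 4))"
    and "(wave_symbol2 t \<xi>)\<^sup>2 \<le> 23\<^sup>2 * (exp (- 2 * (1 + t) * (norm \<xi>)\<^sup>2) + exp (- (1 + t - 1) / 4))"
    using wave_symbol_sq_decay[OF assms, of \<xi>] by (auto elim: order_trans)
qed

lemma fourier_sq_le_norm_L1:
  fixes f :: "(real^'n, real) L2"
  assumes "integrable lborel (rep_L2 f)"
  shows "AE \<xi> in lborel. (norm (rep_L2 (fourier f) \<xi>))\<^sup>2 \<le> (norm_L1 f)\<^sup>2"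
  using rep_fourier_of_integrable[OF assms]
proof eventually_elim
  case (elim \<xi>)
  have "norm (rep_L2 (fourier f) \<xi>) \<le> 1 * norm_L1 f"
    by (rule order_trans[OF elim mult_right_mono[OF fourier_const_le_1 norm_L1_nonneg]])
  then show ?case by (intro power_mono) auto
qed

text \<open>A source released at time \<open>s\<close> has evolved for \<open>t - s\<close>, hence
  \<open>r = 1 + (t - s)\<close>; the constant 184 is \<open>8 * 23\<close>.\<close>

lemma wnorm_wave2_le:
  fixes f :: "(real^'n, real) L2"
  assumes n: "CARD('n) \<le> 2" and s: "0 \<le> s" "s \<le> t" and f: "integrable lborel (rep_L2 f)"
  shows "wnorm t (fourier_multiplier (wave_symbol2 (t - s)) f)
    \<le> 184 * ((1 + t) / (1 + (t - s))) powr (real CARD('n) / 4 + 1 / 2) * (norm f + norm_L1 f)"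
proof -
  have "wnorm t (fourier_multiplier (wave_symbol2 (t - s)) f)
    \<le> 8 * 23 * ((1 + t) / (1 + (t - s))) powr (real CARD('n) / 4 + 1 / 2) * (norm_L1 f + norm f)"
  proof (rule wnorm_decay[OF n])
    show "AE \<xi> in lborel. (norm (rep_L2 (fourier f) \<xi>))\<^sup>2 \<le> (norm_L1 f)\<^sup>2 * (1 + (norm \<xi>)\<^sup>2)"
      using fourier_sq_le_norm_L1[OF f]
    proof eventually_elim
      case (elim \<xi>)
      also have "(norm_L1 f)\<^sup>2 * 1 \<le> (norm_L1 f)\<^sup>2 * (1 + (norm \<xi>)\<^sup>2)" by (intro mult_left_mono) auto
      finally show ?case by simp
    qed
    show "(wave_symbol2 (t - s) \<xi>)\<^sup>2 \<le> 23\<^sup>2 * (exp (- 2 * (1 + (t - s)) * (norm \<xi>)\<^sup>2) + exp (- (1 + (t - s) - 1) / 4))" for \<xi> :: "real^'n"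
      using s by (intro wave_sq_bounds) simp
  qed (use s in \<open>auto intro: symbol_wave norm_L1_nonneg\<close>)
  then show ?thesis by (simp add: add.commute)
qed

text \<open>Integrability is assumed of \<open>bessel_op U\<close>, whose transform is therefore
  bounded; that of \<open>U\<close> itself grows at most like
  \<open>sqrt (1 + (norm \<xi>)\<^sup>2)\<close>.\<close>

lemma wnorm_wave1_le:
  fixes U :: "(real^'n, real) L2"
  assumes n: "CARD('n) \<le> 2" and t: "0 \<le> t" and f: "integrable lborel (rep_L2 (bessel_op U))"
  shows "wnorm t (fourier_multiplier (wave_symbol1 t) U) \<le> 184 * (norm U + norm_L1 (bessel_op U))"
proof -
  have "wnorm t (fourier_multiplier (wave_symbol1 t) U)
    \<le> 8 * 23 * ((1 + t) / (1 + t)) powr (real CARD('n) / 4 + 1 / 2) * (norm_L1 (bessel_op U) + norm U)"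
  proof (rule wnorm_decay[OF n])
    show "AE \<xi> in lborel. (norm (rep_L2 (fourier U) \<xi>))\<^sup>2 \<le> (norm_L1 (bessel_op U))\<^sup>2 * (1 + (norm \<xi>)\<^sup>2)"
      using fourier_sq_le_norm_L1[OF f] fourier_multiplier[OF symbol_bessel, of U]
    proof eventually_elim
      case (elim \<xi>)
      have p: "0 < 1 + (norm \<xi>)\<^sup>2" by (simp add: add_pos_nonneg)
      have "(norm (rep_L2 (fourier U) \<xi>))\<^sup>2 / (1 + (norm \<xi>)\<^sup>2) \<le> (norm_L1 (bessel_op U))\<^sup>2"
        using elim(1) unfolding elim(2) by (simp add: norm_mult power_mult_distrib bessel_sq)
      then show ?case using p by (simp add: divide_le_eq)
    qed
    show "(wave_symbol1 t \<xi>)\<^sup>2 \<le> 23\<^sup>2 * (exp (- 2 * (1 + t) * (norm \<xi>)\<^sup>2) + exp (- (1 + t - 1) / 4))" for \<xi> :: "real^'n"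
      by (rule wave_sq_bounds(1)[OF t])
  qed (use t in \<open>auto intro: symbol_wave norm_L1_nonneg\<close>)
  then show ?thesis using t by (simp add: add.commute)
qed

lemma wnorm_free_wave_le:
  fixes U0 u1 :: "(real^'n, real) L2"
  assumes n: "CARD('n) \<le> 2" and t: "0 \<le> t" and \<epsilon>: "0 \<le> \<epsilon>"
    and U0: "integrable lborel (rep_L2 (bessel_op U0))" and u1: "integrable lborel (rep_L2 u1)"
  shows "wnorm t (free_wave \<epsilon> U0 u1 t) \<le> 184 * \<epsilon> * (norm U0 + norm_L1 (bessel_op U0) + norm u1 + norm_L1 u1)"
proof -
  have "wnorm t (free_wave \<epsilon> U0 u1 t) \<le> wnorm t (\<epsilon> *\<^sub>R fourier_multiplier (wave_symbol1 t) U0) + wnorm t (\<epsilon> *\<^sub>R fourier_multiplier (wave_symbol2 t) u1)"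
    unfolding free_wave_def by (rule wnorm_triangle[OF t])
  also have "\<dots> = \<epsilon> * (wnorm t (fourier_multiplier (wave_symbol1 t) U0) + wnorm t (fourier_multiplier (wave_symbol2 (t - 0)) u1))"
    using \<epsilon> by (simp add: wnorm_scaleR[OF t] distrib_left)
  also have "\<dots> \<le> \<epsilon> * (184 * (norm U0 + norm_L1 (bessel_op U0)) + 184 * (norm u1 + norm_L1 u1))"
    using wnorm_wave2_le[OF n order_refl t u1] t
    by (intro mult_left_mono add_mono wnorm_wave1_le[OF n t U0] \<epsilon>) simp
  finally show ?thesis by (simp add: algebra_simps)
qed

text \<open>The three factors are the loss from measuring at time \<open>t\<close> what was released
  at time \<open>s\<close>, the decay of the nonlinearity, and the size that the radius
  \<open>\<omega>\<close> allows.\<close>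

definition decay_kernel :: "real \<Rightarrow> real \<Rightarrow> real \<Rightarrow> real \<Rightarrow> (real \<Rightarrow> real) \<Rightarrow> real \<Rightarrow> real" where
  "decay_kernel a \<gamma> p t \<omega> s = ((1 + t) / (1 + (t - s))) powr a * (1 + s) powr (- \<gamma>) * \<omega> s powr p"

text \<open>Distances are relative to the radius: the Lipschitz factor
  \<open>(2 * \<omega> s) powr (p - 1)\<close> times \<open>\<delta> * \<omega> s\<close> is
  \<open>\<delta> * 2 powr (p - 1) * \<omega> s powr p\<close>. One and the same integral therefore
  governs the size of the Duhamel term and the contraction.\<close>

lemma wnorm_duhamel_diff_le:
  fixes V W :: "real \<Rightarrow> (real^'n, real) L2"
  assumes n: "CARD('n) \<le> 2" and pe: "power_estimate TYPE('n) p C" and p: "1 \<le> p"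
    and t: "0 \<le> t" and V: "continuous_on {0..t} V" and W: "continuous_on {0..t} W"
    and \<omega>: "continuous_on {0..t} \<omega>" "\<And>s. s \<in> {0..t} \<Longrightarrow> 0 < \<omega> s"
    and Vle: "\<And>s. s \<in> {0..t} \<Longrightarrow> wnorm s (V s) \<le> \<omega> s" and Wle: "\<And>s. s \<in> {0..t} \<Longrightarrow> wnorm s (W s) \<le> \<omega> s"
    and \<delta>: "0 \<le> \<delta>" "\<And>s. s \<in> {0..t} \<Longrightarrow> wnorm s (V s - W s) \<le> \<delta> * \<omega> s"
  shows "wnorm t (duhamel p V t - duhamel p W t) \<le> \<delta> * (184 * C * 2 powr (p - 1) *
    integral {0..t} (decay_kernel (real CARD('n) / 4 + 1 / 2) (real CARD('n) * (p - 1) / 2) p t \<omega>))"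
proof -
  let ?a = "real CARD('n) / 4 + 1 / 2" and ?\<gamma> = "real CARD('n) * (p - 1) / 2"
  let ?k = "decay_kernel ?a ?\<gamma> p t \<omega>"
  let ?f = "\<lambda>V s. fourier_multiplier (wave_symbol2 (t - s)) (nonlinearity p (V s))"
  let ?c = "\<delta> * (184 * C * 2 powr (p - 1))"
  have C: "0 < C" using pe by (simp add: power_estimate_def)
  note cV = continuous_on_duhamel_integrand[OF pe p V] and cW = continuous_on_duhamel_integrand[OF pe p W]
  have "continuous_on {0..t} ?k"
    unfolding decay_kernel_def using t \<omega> by (intro continuous_intros) (auto simp: less_imp_neq[symmetric])
  then have kint: "?k integrable_on {0..t}" by (rule integrable_continuous_interval)
  have eq: "duhamel p V t - duhamel p W t = integral {0..t} (\<lambda>s. ?f V s - ?f W s)"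
    unfolding duhamel_def
    by (intro Henstock_Kurzweil_Integration.integral_diff[symmetric] integrable_continuous_interval cV cW)
  have "wnorm t (duhamel p V t - duhamel p W t) \<le> integral {0..t} (\<lambda>s. ?c * ?k s)"
    unfolding eq
  proof (rule wnorm_integral_le[OF t])
    show "continuous_on {0..t} (\<lambda>s. ?f V s - ?f W s)" by (intro continuous_intros cV cW)
    show "(\<lambda>s. ?c * ?k s) integrable_on {0..t}" using integrable_on_cmult_left[OF kint, of ?c] by simp
    fix s assume s: "s \<in> {0..t}"
    let ?d = "nonlinearity p (V s) - nonlinearity p (W s)"
    have s': "0 \<le> t - s" "0 \<le> s" using s by auto
    have int: "integrable lborel (rep_L2 ?d)"
      using pe unfolding nonlinearity_def power_estimate_def by (intro integrable_rep_abs_power_diff) auto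
    have "norm ?d + norm_L1 ?d \<le> C * (1 + s) powr (- real CARD('n) * (p - 1) / 2) * wnorm s (V s - W s) * (wnorm s (V s) + wnorm s (W s)) powr (p - 1)"
      using pe s unfolding power_estimate_def nonlinearity_def by auto
    also have "\<dots> \<le> C * (1 + s) powr (- real CARD('n) * (p - 1) / 2) * (\<delta> * \<omega> s) * (2 * \<omega> s) powr (p - 1)"
      using C Vle[OF s] Wle[OF s] \<delta>(1) \<delta>(2)[OF s] \<omega>(2)[OF s] wnorm_nonneg[of s "V s"] wnorm_nonneg[of s "W s"] p
      by (intro mult_mono mult_left_mono powr_mono2 mult_nonneg_nonneg wnorm_nonneg) auto
    also have "\<dots> = \<delta> * C * 2 powr (p - 1) * ((1 + s) powr (- ?\<gamma>) * \<omega> s powr p)"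
      using powr_mult_base[of "\<omega> s" "p - 1"] \<omega>(2)[OF s] by (simp add: powr_mult mult_ac)
    finally have d: "norm ?d + norm_L1 ?d \<le> \<delta> * C * 2 powr (p - 1) * ((1 + s) powr (- ?\<gamma>) * \<omega> s powr p)" .
    have "?f V s - ?f W s = fourier_multiplier (wave_symbol2 (t - s)) ?d"
      by (rule linear_diff[OF bounded_linear.linear[OF bounded_linear_fourier_multiplier[OF symbol_wave(2)[OF s'(1)]]], symmetric])
    then have "wnorm t (?f V s - ?f W s) \<le> 184 * ((1 + t) / (1 + (t - s))) powr ?a * (norm ?d + norm_L1 ?d)"
      using wnorm_wave2_le[OF n s'(2) _ int] s by simp
    also have "\<dots> \<le> 184 * ((1 + t) / (1 + (t - s))) powr ?a * (\<delta> * C * 2 powr (p - 1) * ((1 + s) powr (- ?\<gamma>) * \<omega> s powr p))"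
      by (intro mult_left_mono d) auto
    also have "\<dots> = ?c * ?k s" by (simp only: decay_kernel_def mult_ac)
    finally show "wnorm t (?f V s - ?f W s) \<le> ?c * ?k s" .
  qed
  also have "\<dots> = ?c * integral {0..t} ?k" by (rule Henstock_Kurzweil_Integration.integral_mult_right)
  finally show ?thesis by (simp only: mult.assoc)
qed

subsection \<open>Fixed points and mild solutions\<close>

text \<open>Iterating the inequality \<open>k\<close> times bounds \<open>D t\<close> by
  \<open>M * ((L * t) ^ k / fact k)\<close>, which tends to 0.\<close>

lemma gronwall_zero:
  fixes D :: "real \<Rightarrow> real"
  assumes D: "continuous_on {0..\<tau>} D" and D0: "\<And>t. t \<in> {0..\<tau>} \<Longrightarrow> 0 \<le> D t" and L: "0 \<le> L"
    and le: "\<And>t. t \<in> {0..\<tau>} \<Longrightarrow> D t \<le> L * integral {0..t} D" and t: "t \<in> {0..\<tau>}"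
  shows "D t = 0"
proof -
  have "bounded (D ` {0..\<tau>})" by (intro compact_imp_bounded compact_continuous_image D compact_Icc)
  then obtain M where "\<forall>x\<in>D ` {0..\<tau>}. norm x \<le> M" unfolding bounded_iff by blast
  then have M: "D t \<le> M" if "t \<in> {0..\<tau>}" for t
    using that by (metis abs_ge_self image_eqI order_trans real_norm_def)
  have "\<forall>t\<in>{0..\<tau>}. D t \<le> M * ((L * t) ^ k / fact k)" for k
  proof (induction k)
    case 0
    show ?case using M by (intro ballI) simp
  next
    case (Suc k)
    show ?case
    proof
      fix t assume t: "t \<in> {0..\<tau>}"
      let ?c = "M * L ^ k / fact k"
      have "((\<lambda>s. s ^ k) has_integral t ^ Suc k / Suc k - 0 ^ Suc k / Suc k) {0..t}"
        using t by (intro fundamental_theorem_of_calculus)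
          (auto intro!: derivative_eq_intros simp: has_real_derivative_iff_has_vector_derivative[symmetric] field_simps simp del: of_nat_Suc power_Suc)
      then have P: "((\<lambda>s. ?c * s ^ k) has_integral ?c * (t ^ Suc k / Suc k)) {0..t}"
        by (intro has_integral_mult_right) simp
      have "integral {0..t} D \<le> ?c * (t ^ Suc k / Suc k)"
      proof (rule has_integral_le[OF integrable_integral P])
        show "D integrable_on {0..t}"
          using t by (intro integrable_continuous_interval continuous_on_subset[OF D]) auto
        show "D s \<le> ?c * s ^ k" if "s \<in> {0..t}" for s
        proof -
          have "s \<in> {0..\<tau>}" using that t by auto
          from bspec[OF Suc.IH this] show ?thesis by (simp add: power_mult_distrib mult.assoc)
        qed
      qed
      with le[OF t] L have "D t \<le> L * (?c * (t ^ Suc k / Suc k))"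
        by (meson mult_left_mono order_trans)
      then show "D t \<le> M * ((L * t) ^ Suc k / fact (Suc k))"
        by (simp add: power_mult_distrib mult_ac divide_simps)
    qed
  qed
  then have "D t \<le> M * ((L * t) ^ k / fact k)" for k using t by auto
  moreover have "(\<lambda>k. M * ((L * t) ^ k / fact k)) \<longlonglongrightarrow> M * 0"
    using summable_LIMSEQ_zero[OF summable_exp[of "L * t"]] by (intro tendsto_intros) (simp add: divide_inverse mult.commute)
  ultimately have "D t \<le> 0" by (intro LIMSEQ_le_const[of _ "M * 0", simplified]) auto
  then show ?thesis using D0[OF t] by simp
qed

lemma tendsto_wnorm:
  assumes "0 \<le> t" and "f \<longlonglongrightarrow> g"
  shows "(\<lambda>k. wnorm t (f k)) \<longlonglongrightarrow> wnorm t g"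
  unfolding wnorm_def
  by (intro tendsto_intros bounded_linear.tendsto[OF bounded_linear_fourier_multiplier[OF symbol_time_weight]] assms)

text \<open>Contraction is relative to the radii: each map halves \<open>\<delta>\<close>. With
  \<open>\<delta> = 1\<close> and the zero curve as second argument, this and \<open>init\<close>
  show that the balls are preserved. Since \<open>wnorm\<close> dominates the norm and the radii are
  bounded by \<open>M\<close>, the iterates converge uniformly in time and the limits are
  continuous.\<close>

lemma picard_iteration:
  fixes \<Phi> \<Psi> :: "(real \<Rightarrow> (real^'n, real) L2) \<Rightarrow> real \<Rightarrow> (real^'n, real) L2" and a b :: "real \<Rightarrow> real"
  assumes cont: "\<And>V. continuous_on {0..T} V \<Longrightarrow> continuous_on {0..T} (\<Phi> V)"
      "\<And>V. continuous_on {0..T} V \<Longrightarrow> continuous_on {0..T} (\<Psi> V)"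
    and \<Phi>: "\<And>V W \<delta> t. continuous_on {0..T} V \<Longrightarrow> continuous_on {0..T} W \<Longrightarrow>
      (\<And>s. s \<in> {0..T} \<Longrightarrow> wnorm s (V s) \<le> b s) \<Longrightarrow> (\<And>s. s \<in> {0..T} \<Longrightarrow> wnorm s (W s) \<le> b s) \<Longrightarrow> 0 \<le> \<delta> \<Longrightarrow>
      (\<And>s. s \<in> {0..T} \<Longrightarrow> wnorm s (V s - W s) \<le> \<delta> * b s) \<Longrightarrow> t \<in> {0..T} \<Longrightarrow> wnorm t (\<Phi> V t - \<Phi> W t) \<le> \<delta> / 2 * a t"
    and \<Psi>: "\<And>V W \<delta> t. continuous_on {0..T} V \<Longrightarrow> continuous_on {0..T} W \<Longrightarrow>
      (\<And>s. s \<in> {0..T} \<Longrightarrow> wnorm s (V s) \<le> a s) \<Longrightarrow> (\<And>s. s \<in> {0..T} \<Longrightarrow> wnorm s (W s) \<le> a s) \<Longrightarrow> 0 \<le> \<delta> \<Longrightarrow>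
      (\<And>s. s \<in> {0..T} \<Longrightarrow> wnorm s (V s - W s) \<le> \<delta> * a s) \<Longrightarrow> t \<in> {0..T} \<Longrightarrow> wnorm t (\<Psi> V t - \<Psi> W t) \<le> \<delta> / 2 * b t"
    and init: "\<And>t. t \<in> {0..T} \<Longrightarrow> wnorm t (\<Phi> (\<lambda>_. 0) t) \<le> a t / 2" "\<And>t. t \<in> {0..T} \<Longrightarrow> wnorm t (\<Psi> (\<lambda>_. 0) t) \<le> b t / 2"
    and ab: "\<And>t. t \<in> {0..T} \<Longrightarrow> 0 \<le> a t" "\<And>t. t \<in> {0..T} \<Longrightarrow> 0 \<le> b t"
      "\<And>t. t \<in> {0..T} \<Longrightarrow> a t \<le> M" "\<And>t. t \<in> {0..T} \<Longrightarrow> b t \<le> M"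
  obtains U V where "continuous_on {0..T} U" "continuous_on {0..T} V"
    "\<And>t. t \<in> {0..T} \<Longrightarrow> U t = \<Phi> V t" "\<And>t. t \<in> {0..T} \<Longrightarrow> V t = \<Psi> U t"
proof -
  define X where "X = rec_nat (\<lambda>_::real. 0 :: (real^'n, real) L2, \<lambda>_::real. 0 :: (real^'n, real) L2) (\<lambda>_ (u, v). (\<Phi> v, \<Psi> u))"
  define u v where "u k = fst (X k)" and "v k = snd (X k)" for k
  have u0: "u 0 = (\<lambda>_. 0)" "v 0 = (\<lambda>_. 0)" and uS: "u (Suc k) = \<Phi> (v k)" "v (Suc k) = \<Psi> (u k)" for k
    by (simp_all add: u_def v_def X_def split_beta)
  have w0: "wnorm t 0 = (0::real)" if "t \<in> {0..T}" for t
    using wnorm_scaleR[of t 0 0] that by simp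
  have step: "wnorm t x \<le> c"
    if "wnorm t (x - y) \<le> 1 / 2 * c" "wnorm t y \<le> c / 2" "t \<in> {0..T}" for x y :: "(real^'n, real) L2" and t c
  proof -
    have "wnorm t x \<le> wnorm t (x - y) + wnorm t y"
      using wnorm_triangle[of t "x - y" y] that(3) by simp
    also have "\<dots> \<le> 1 / 2 * c + c / 2" by (intro add_mono that)
    finally show ?thesis by simp
  qed
  have inv: "continuous_on {0..T} (u k) \<and> continuous_on {0..T} (v k) \<and>
      (\<forall>t\<in>{0..T}. wnorm t (u k t) \<le> a t \<and> wnorm t (v k t) \<le> b t)" for k
  proof (induction k)
    case 0
    then show ?case using ab by (simp add: u0 w0)
  next
    case (Suc k)
    then have cu: "continuous_on {0..T} (u k)" and cv: "continuous_on {0..T} (v k)"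
      and bu: "\<And>s. s \<in> {0..T} \<Longrightarrow> wnorm s (u k s) \<le> a s" and bv: "\<And>s. s \<in> {0..T} \<Longrightarrow> wnorm s (v k s) \<le> b s" by auto
    show ?case
      unfolding uS
    proof (intro conjI ballI cont cu cv)
      fix t assume t: "t \<in> {0..T}"
      have "wnorm t (\<Phi> (v k) t - \<Phi> (\<lambda>_. 0) t) \<le> 1 / 2 * a t"
        by (rule \<Phi>[OF cv continuous_on_const bv _ _ _ t]) (simp_all add: w0 ab bv)
      then show "wnorm t (\<Phi> (v k) t) \<le> a t" by (rule step[OF _ init(1)[OF t] t])
      have "wnorm t (\<Psi> (u k) t - \<Psi> (\<lambda>_. 0) t) \<le> 1 / 2 * b t"
        by (rule \<Psi>[OF cu continuous_on_const bu _ _ _ t]) (simp_all add: w0 ab bu)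
      then show "wnorm t (\<Psi> (u k) t) \<le> b t" by (rule step[OF _ init(2)[OF t] t])
    qed
  qed
  then have c: "continuous_on {0..T} (u k)" "continuous_on {0..T} (v k)"
    and ub: "\<And>t. t \<in> {0..T} \<Longrightarrow> wnorm t (u k t) \<le> a t" "\<And>t. t \<in> {0..T} \<Longrightarrow> wnorm t (v k t) \<le> b t" for k
    by auto
  have diff: "\<forall>t\<in>{0..T}. wnorm t (u (Suc k) t - u k t) \<le> (1/2)^k * a t \<and> wnorm t (v (Suc k) t - v k t) \<le> (1/2)^k * b t" for k
  proof (induction k)
    case 0
    show ?case
    proof
      fix t assume t: "t \<in> {0..T}"
      show "wnorm t (u (Suc 0) t - u 0 t) \<le> (1/2)^0 * a t \<and> wnorm t (v (Suc 0) t - v 0 t) \<le> (1/2)^0 * b t"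
        using init[OF t] ab[OF t] by (simp add: u0 uS)
    qed
  next
    case (Suc k)
    show ?case
    proof (intro ballI conjI)
      fix t assume t: "t \<in> {0..T}"
      have "wnorm t (\<Phi> (v (Suc k)) t - \<Phi> (v k) t) \<le> (1/2)^k / 2 * a t"
        by (rule \<Phi>[OF c(2) c(2) ub(2) ub(2) _ _ t]) (use Suc in auto)
      then show "wnorm t (u (Suc (Suc k)) t - u (Suc k) t) \<le> (1/2)^Suc k * a t" by (simp add: uS)
      have "wnorm t (\<Psi> (u (Suc k)) t - \<Psi> (u k) t) \<le> (1/2)^k / 2 * b t"
        by (rule \<Psi>[OF c(1) c(1) ub(1) ub(1) _ _ t]) (use Suc in auto)
      then show "wnorm t (v (Suc (Suc k)) t - v (Suc k) t) \<le> (1/2)^Suc k * b t" by (simp add: uS)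
    qed
  qed
  \<comment> \<open>The factor 2 is the sum of the geometric series. The distance to the limit is
    recorded relative to the radius \<open>c\<close>, so that it can be fed back into the
    contraction.\<close>
  have lim: "\<exists>W. continuous_on {0..T} W \<and> (\<forall>t\<in>{0..T}. (\<lambda>k. w k t) \<longlonglongrightarrow> W t \<and> wnorm t (W t) \<le> c t \<and>
      (\<forall>k. wnorm t (W t - w k t) \<le> 2 * (1/2)^k * c t))"
    if w0: "w 0 = (\<lambda>_. 0)" and wc: "\<And>k. continuous_on {0..T} (w k)"
      and wd: "\<And>k t. t \<in> {0..T} \<Longrightarrow> wnorm t (w (Suc k) t - w k t) \<le> (1/2)^k * c t"
      and wb: "\<And>k t. t \<in> {0..T} \<Longrightarrow> wnorm t (w k t) \<le> c t" and cM: "\<And>t. t \<in> {0..T} \<Longrightarrow> c t \<le> M"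
    for w :: "nat \<Rightarrow> real \<Rightarrow> (real^'n, real) L2" and c
  proof -
    define W where "W t = (\<Sum>k. w (Suc k) t - w k t)" for t
    have "uniform_limit {0..T} (\<lambda>n t. \<Sum>k<n. w (Suc k) t - w k t) W sequentially"
      unfolding W_def
    proof (rule Weierstrass_m_test)
      show "norm (w (Suc k) t - w k t) \<le> (1/2)^k * M" if "t \<in> {0..T}" for k t
      proof -
        have "norm (w (Suc k) t - w k t) \<le> wnorm t (w (Suc k) t - w k t)" using that by (intro norm_le_wnorm) auto
        also have "\<dots> \<le> (1/2)^k * c t" by (rule wd[OF that])
        also have "\<dots> \<le> (1/2)^k * M" by (intro mult_left_mono cM that) auto
        finally show ?thesis .
      qed
      show "summable (\<lambda>k. (1/2)^k * M)" by (intro summable_mult2 summable_geometric) auto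
    qed
    moreover have "(\<Sum>k<n. w (Suc k) t - w k t) = w n t" for n t
      using sum_lessThan_telescope[of "\<lambda>k. w k t" n] by (simp add: w0)
    ultimately have ul: "uniform_limit {0..T} w W sequentially" by simp
    have Wc: "continuous_on {0..T} W"
      by (rule uniform_limit_theorem[OF _ ul]) (auto simp: wc)
    have "(\<lambda>k. w k t) \<longlonglongrightarrow> W t \<and> wnorm t (W t) \<le> c t \<and> (\<forall>k. wnorm t (W t - w k t) \<le> 2 * (1/2)^k * c t)"
      if t: "t \<in> {0..T}" for t
    proof -
      have t0: "0 \<le> t" using t by simp
      have c0: "0 \<le> c t" using wb[OF t, of 0] wnorm_nonneg[of t "w 0 t"] by linarith
      have l: "(\<lambda>k. w k t) \<longlonglongrightarrow> W t" by (rule tendsto_uniform_limitI[OF ul t])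
      have "wnorm t (W t) \<le> c t"
        by (rule LIMSEQ_le_const2[OF tendsto_wnorm[OF t0 l]]) (use wb[OF t] in auto)
      moreover have "wnorm t (W t - w k t) \<le> 2 * (1/2)^k * c t" for k
      proof -
        have ind: "wnorm t (w (k + i) t - w k t) \<le> (2 * (1/2)^k - 2 * (1/2)^(k + i)) * c t" for i
        proof (induction i)
          case 0
          then show ?case using wnorm_scaleR[OF t0, of 0 "0 :: (real^'n, real) L2"] by simp
        next
          case (Suc i)
          have "wnorm t (w (k + Suc i) t - w k t) \<le> wnorm t (w (Suc (k + i)) t - w (k + i) t) + wnorm t (w (k + i) t - w k t)"
            using wnorm_triangle[OF t0, of "w (Suc (k + i)) t - w (k + i) t" "w (k + i) t - w k t"] by simp
          also have "\<dots> \<le> (1/2)^(k + i) * c t + (2 * (1/2)^k - 2 * (1/2)^(k + i)) * c t"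
            by (intro add_mono wd[OF t] Suc)
          also have "\<dots> = (2 * (1/2)^k - 2 * (1/2)^(k + Suc i)) * c t" by (simp add: algebra_simps)
          finally show ?case .
        qed
        have le: "(2 * (1/2)^k - 2 * (1/2)^(k + i)) * c t \<le> 2 * (1/2)^k * c t" for i
          using c0 by (intro mult_right_mono) auto
        have bd: "wnorm t (w (i + k) t - w k t) \<le> 2 * (1/2)^k * c t" for i
          using order_trans[OF ind[of i] le[of i]] by (simp only: add.commute[of i])
        have "(\<lambda>i. w (i + k) t - w k t) \<longlonglongrightarrow> W t - w k t"
          by (intro tendsto_intros LIMSEQ_ignore_initial_segment l)
        from tendsto_wnorm[OF t0 this] show ?thesis by (rule LIMSEQ_le_const2) (use bd in blast)
      qed
      ultimately show ?thesis using l by blast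
    qed
    with Wc show ?thesis by blast
  qed
  have du: "wnorm t (u (Suc k) t - u k t) \<le> (1/2)^k * a t" "wnorm t (v (Suc k) t - v k t) \<le> (1/2)^k * b t"
    if "t \<in> {0..T}" for k t using diff[of k] that by auto
  obtain U where U: "continuous_on {0..T} U" "\<And>t. t \<in> {0..T} \<Longrightarrow> (\<lambda>k. u k t) \<longlonglongrightarrow> U t"
      "\<And>t. t \<in> {0..T} \<Longrightarrow> wnorm t (U t) \<le> a t" "\<And>t k. t \<in> {0..T} \<Longrightarrow> wnorm t (U t - u k t) \<le> 2 * (1/2)^k * a t"
    using lim[of u a, OF u0(1) c(1) du(1) ub(1) ab(3)] by blast
  obtain V where V: "continuous_on {0..T} V" "\<And>t. t \<in> {0..T} \<Longrightarrow> (\<lambda>k. v k t) \<longlonglongrightarrow> V t"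
      "\<And>t. t \<in> {0..T} \<Longrightarrow> wnorm t (V t) \<le> b t" "\<And>t k. t \<in> {0..T} \<Longrightarrow> wnorm t (V t - v k t) \<le> 2 * (1/2)^k * b t"
    using lim[of v b, OF u0(2) c(2) du(2) ub(2) ab(4)] by blast
  \<comment> \<open>The passage to the limit in the equations uses the contraction once more,
    between the limit and the \<open>k\<close>-th iterate: the next iterates must then converge to
    the image of the limit.\<close>
  have fix_lim: "W = F" if t: "t \<in> {0..T}" and W: "(\<lambda>k. w k t) \<longlonglongrightarrow> W" and F: "\<And>k. wnorm t (F - w (Suc k) t) \<le> 2 * (1/2)^k / 2 * c"
    for t W F c and w :: "nat \<Rightarrow> real \<Rightarrow> (real^'n, real) L2"
  proof -
    have le: "norm (F - w (Suc k) t) \<le> (1/2)^k * c" for k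
      using norm_le_wnorm[of t "F - w (Suc k) t"] F[of k] t by simp
    have lim0: "(\<lambda>k. (1/2)^k * c) \<longlonglongrightarrow> 0" by (intro tendsto_mult_left_zero LIMSEQ_realpow_zero) auto
    have "(\<lambda>k. F - w (Suc k) t) \<longlonglongrightarrow> 0"
      by (rule Lim_null_comparison[OF always_eventually[OF allI[OF le]] lim0])
    from tendsto_diff[OF tendsto_const[of F] this] have "(\<lambda>k. w (Suc k) t) \<longlonglongrightarrow> F" by simp
    with LIMSEQ_Suc[OF W] show ?thesis by (rule LIMSEQ_unique)
  qed
  show ?thesis
  proof (rule that[OF U(1) V(1)])
    fix t assume t: "t \<in> {0..T}"
    show "U t = \<Phi> V t"
    proof (rule fix_lim[of t u, OF t U(2)[OF t]])
      show "wnorm t (\<Phi> V t - u (Suc k) t) \<le> 2 * (1/2)^k / 2 * a t" for k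
        unfolding uS by (rule \<Phi>[OF V(1) c(2) V(3) ub(2) _ V(4) t]) simp_all
    qed
    show "V t = \<Psi> U t"
    proof (rule fix_lim[of t v, OF t V(2)[OF t]])
      show "wnorm t (\<Psi> U t - v (Suc k) t) \<le> 2 * (1/2)^k / 2 * b t" for k
        unfolding uS by (rule \<Psi>[OF U(1) c(1) U(3) ub(1) _ U(4) t]) simp_all
    qed
  qed
qed

section \<open>Mild solutions as fixed points\<close>

lemma damped_wave_op_bessel:
  assumes "0 \<le> t"
  shows "damped_wave_op t f = bessel_op (fourier_multiplier (wave_symbol2 t) f)"
  unfolding damped_wave_op_def fourier_multiplier_mult[OF symbol_bessel symbol_wave(2)[OF assms]]
  by (simp add: bessel_wave_symbol2[abs_def])

lemma dt_plus_one_bessel: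
  assumes "0 \<le> t"
  shows "dt_plus_one_damped_wave_op t (bessel_op U) = bessel_op (fourier_multiplier (wave_symbol1 t) U)"
  unfolding dt_plus_one_damped_wave_op_eq
  by (simp add: fourier_multiplier_mult symbol_bessel symbol_wave assms mult.commute)

lemma bessel_op_scaleR: "bessel_op (c *\<^sub>R U) = c *\<^sub>R bessel_op U"
  by (rule linear_scale[OF bounded_linear.linear[OF bounded_linear_fourier_multiplier[OF symbol_bessel]]])

lemma integral_damped_wave_op:
  fixes V :: "real \<Rightarrow> (real^'n, real) L2"
  assumes pe: "power_estimate TYPE('n) p C" and p: "1 \<le> p" and V: "continuous_on {0..t} V"
  shows "(\<lambda>\<tau>. damped_wave_op (t - \<tau>) (abs_power p (bessel_op (V \<tau>)))) integrable_on {0..t}"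
    and "integral {0..t} (\<lambda>\<tau>. damped_wave_op (t - \<tau>) (abs_power p (bessel_op (V \<tau>)))) = bessel_op (duhamel p V t)"
proof -
  let ?f = "\<lambda>s. fourier_multiplier (wave_symbol2 (t - s)) (nonlinearity p (V s))"
  have eq: "damped_wave_op (t - s) (abs_power p (bessel_op (V s))) = bessel_op (?f s)" if "s \<in> {0..t}" for s
    using that by (simp add: damped_wave_op_bessel nonlinearity_def)
  note fi = integrable_continuous_interval[OF continuous_on_duhamel_integrand[OF pe p V]]
  note bl = bounded_linear_fourier_multiplier[OF symbol_bessel]
  have "(\<lambda>s. bessel_op (?f s)) integrable_on {0..t}" using integrable_linear[OF fi bl] by (simp add: o_def)
  then show "(\<lambda>\<tau>. damped_wave_op (t - \<tau>) (abs_power p (bessel_op (V \<tau>)))) integrable_on {0..t}"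
    by (rule integrable_eq) (simp add: eq)
  have "integral {0..t} (\<lambda>\<tau>. damped_wave_op (t - \<tau>) (abs_power p (bessel_op (V \<tau>)))) = integral {0..t} (\<lambda>s. bessel_op (?f s))"
    by (intro Henstock_Kurzweil_Integration.integral_cong eq)
  also have "\<dots> = bessel_op (duhamel p V t)"
    using integral_linear[OF fi bl] by (simp add: o_def duhamel_def)
  finally show "integral {0..t} (\<lambda>\<tau>. damped_wave_op (t - \<tau>) (abs_power p (bessel_op (V \<tau>)))) = bessel_op (duhamel p V t)" .
qed

text \<open>Each term of the Duhamel formula is \<open>bessel_op\<close> of an \<open>L2\<close>
  expression, and injectivity of \<open>bessel_op\<close> cancels it. The integrability clause
  follows from continuity of \<open>V\<close>.\<close>

lemma satisfies_duhamel_iff: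
  fixes U V :: "real \<Rightarrow> (real^'n, real) L2"
  assumes pe: "power_estimate TYPE('n) p C" and p: "1 \<le> p" and V: "continuous_on {0..<T} V"
  shows "satisfies_duhamel p \<epsilon> (bessel_op U0) u1 T (\<lambda>t. bessel_op (U t)) (\<lambda>t. bessel_op (V t)) \<longleftrightarrow>
    (\<forall>t\<in>{0..<T}. U t = free_wave \<epsilon> U0 u1 t + duhamel p V t)"
proof -
  have "(bessel_op (U t) = \<epsilon> *\<^sub>R dt_plus_one_damped_wave_op t (bessel_op U0) + \<epsilon> *\<^sub>R damped_wave_op t u1
         + integral {0..t} (\<lambda>\<tau>. damped_wave_op (t - \<tau>) (abs_power p (bessel_op (V \<tau>))))) \<longleftrightarrow>
      U t = free_wave \<epsilon> U0 u1 t + duhamel p V t"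
    and "(\<lambda>\<tau>. damped_wave_op (t - \<tau>) (abs_power p (bessel_op (V \<tau>)))) integrable_on {0..t}"
    if t: "t \<in> {0..<T}" for t
  proof -
    have Vt: "continuous_on {0..t} V" using t by (intro continuous_on_subset[OF V]) auto
    have t0: "0 \<le> t" using t by simp
    show "(\<lambda>\<tau>. damped_wave_op (t - \<tau>) (abs_power p (bessel_op (V \<tau>)))) integrable_on {0..t}"
      by (rule integral_damped_wave_op(1)[OF pe p Vt])
    have "\<epsilon> *\<^sub>R dt_plus_one_damped_wave_op t (bessel_op U0) + \<epsilon> *\<^sub>R damped_wave_op t u1
         + integral {0..t} (\<lambda>\<tau>. damped_wave_op (t - \<tau>) (abs_power p (bessel_op (V \<tau>)))) =
        bessel_op (free_wave \<epsilon> U0 u1 t + duhamel p V t)"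
      by (simp add: integral_damped_wave_op(2)[OF pe p Vt] dt_plus_one_bessel[OF t0] damped_wave_op_bessel[OF t0]
          free_wave_def bessel_op_scaleR flip: bessel_op_add)
    then show "(bessel_op (U t) = \<epsilon> *\<^sub>R dt_plus_one_damped_wave_op t (bessel_op U0) + \<epsilon> *\<^sub>R damped_wave_op t u1
         + integral {0..t} (\<lambda>\<tau>. damped_wave_op (t - \<tau>) (abs_power p (bessel_op (V \<tau>))))) \<longleftrightarrow>
      U t = free_wave \<epsilon> U0 u1 t + duhamel p V t"
      using bessel_op_inj by metis
  qed
  then show ?thesis unfolding satisfies_duhamel_def by auto
qed

lemma continuous_on_H1_bessel_op:
  "continuous_on_H1 I (\<lambda>t. bessel_op (U t)) \<longleftrightarrow> continuous_on I U"
proof -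
  have "((\<lambda>s. norm (U s - U t)) \<longlongrightarrow> 0) (at t within I) \<longleftrightarrow> (U \<longlongrightarrow> U t) (at t within I)" for t
    by (simp add: tendsto_norm_zero_iff LIM_zero_iff)
  then show ?thesis
    unfolding continuous_on_H1_def continuous_on_def
    by (simp add: bessel_op_H1 bessel_op_diff norm_H1_bessel_op)
qed

lemma fourier_multiplier_scaleR:
  fixes f :: "(real^'n, real) L2"
  assumes m: "symbol m"
  shows "c *\<^sub>R fourier_multiplier m f = fourier_multiplier (\<lambda>\<xi>. c * m \<xi>) f"
proof -
  have c: "symbol (\<lambda>_::real^'n. c)" by (rule symbolI[where B="\<bar>c\<bar>"]) auto
  have "fourier (c *\<^sub>R fourier_multiplier m f) = c *\<^sub>R fourier (fourier_multiplier m f)"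
    by (rule linear_scale[OF bounded_linear.linear[OF bounded_linear_fourier]])
  then show ?thesis
    using rep_L2_scaleR[of c "fourier (fourier_multiplier m f)"] fourier_multiplier[OF m, of f]
    by (intro fourier_multiplierI[OF symbol_times[OF c m], symmetric]) (auto simp: scaleR_conv_of_real)
qed

text \<open>Mean value theorem in time. The factor \<open>bessel \<xi>\<close> reduces the
  \<open>(norm \<xi>)\<^sup>2\<close> of the derivative to
  \<open>sqrt (1 + (norm \<xi>)\<^sup>2)\<close>, which is the weight in the bounded symbol
  \<open>wave_symbol2\<close>. This dominates the difference quotients of the part driven by
  \<open>U0\<close>.\<close>

lemma abs_wave_symbol1_minus_1_le:
  assumes t: "0 < t"
  shows "bessel \<xi> * \<bar>wave_symbol1 t \<xi> - 1\<bar> \<le> 32 * t"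
proof -
  have "\<exists>z. 0 < z \<and> z < t \<and> wave_symbol1 t \<xi> - wave_symbol1 0 \<xi> = (t - 0) * (- (norm \<xi>)\<^sup>2 * damped_wave_symbol z \<xi>)"
    by (rule MVT2[OF t]) (rule DERIV_wave_symbol1)
  then obtain z where z: "0 < z" "wave_symbol1 t \<xi> - 1 = - (t * ((norm \<xi>)\<^sup>2 * damped_wave_symbol z \<xi>))" by auto
  have p: "0 < 1 + (norm \<xi>)\<^sup>2" by (simp add: add_pos_nonneg)
  have "bessel \<xi> * (norm \<xi>)\<^sup>2 \<le> bessel \<xi> * (1 + (norm \<xi>)\<^sup>2)"
    using bessel_pos[of \<xi>] by (intro mult_left_mono) auto
  also have "\<dots> = sqrt (1 + (norm \<xi>)\<^sup>2)" using p by (simp add: bessel_def real_div_sqrt)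
  finally have "bessel \<xi> * (norm \<xi>)\<^sup>2 * \<bar>damped_wave_symbol z \<xi>\<bar> \<le> sqrt (1 + (norm \<xi>)\<^sup>2) * \<bar>damped_wave_symbol z \<xi>\<bar>"
    by (intro mult_right_mono) auto
  also have "\<dots> \<le> 32" using wave_symbol_bounded(1)[of z \<xi>] z(1) p by (simp add: wave_symbol2_def abs_mult)
  finally have "t * (bessel \<xi> * (norm \<xi>)\<^sup>2 * \<bar>damped_wave_symbol z \<xi>\<bar>) \<le> t * 32" using t by (intro mult_left_mono) auto
  then show ?thesis unfolding z(2) using t by (simp add: abs_mult mult_ac)
qed

lemma difference_quotient_LIMSEQ:
  assumes "(f has_real_derivative d) (at 0)" and "f 0 = c" and X: "\<And>j. 0 < X j" "X \<longlonglongrightarrow> (0::real)"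
  shows "(\<lambda>j. (1 / X j) * (f (X j) - c)) \<longlonglongrightarrow> d"
proof -
  have "((\<lambda>h. (f (0 + h) - f 0) / h) \<longlongrightarrow> d) (at 0)" using assms(1) by (simp add: DERIV_def)
  moreover have "filterlim X (at 0) sequentially" unfolding filterlim_at using X by (auto simp: less_imp_neq[symmetric])
  ultimately have "(\<lambda>j. (f (0 + X j) - f 0) / X j) \<longlonglongrightarrow> d" by (rule filterlim_compose)
  then show ?thesis using assms(2) by simp
qed

text \<open>The difference quotient at 0 has three contributions: that of \<open>U0\<close> tends to
  0, because \<open>wave_symbol1\<close> has derivative 0 there; that of \<open>u1\<close> tends to
  \<open>\<epsilon> *\<^sub>R u1\<close>; and the Duhamel term is quadratic in time. The quotients
  are formed after applying \<open>bessel_op\<close>, where their symbols stay bounded.\<close>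

lemma initial_velocity:
  fixes V :: "real \<Rightarrow> (real^'n, real) L2"
  assumes pe: "power_estimate TYPE('n) p C" and p: "1 \<le> p" and V: "continuous_on {0..T} V" and T: "0 < T"
    and U: "\<And>t. t \<in> {0..<T} \<Longrightarrow> U t = free_wave \<epsilon> U0 u1 t + duhamel p V t"
  shows "((\<lambda>t. bessel_op (U t)) has_vector_derivative \<epsilon> *\<^sub>R u1) (at 0 within {0..<T})"
    and "bessel_op (U 0) = \<epsilon> *\<^sub>R bessel_op U0"
proof -
  have w0: "wave_symbol1 0 = (\<lambda>_::real^'n. 1)" "wave_symbol2 0 = (\<lambda>_::real^'n. 0)" by (auto simp: fun_eq_iff)
  show init: "bessel_op (U 0) = \<epsilon> *\<^sub>R bessel_op U0"
    using U[of 0] T by (simp add: free_wave_def duhamel_def w0 bessel_op_scaleR)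
  let ?G = "\<lambda>s. nonlinearity p (V s)"
  have "bounded (?G ` {0..T})"
    by (intro compact_imp_bounded compact_continuous_image continuous_on_nonlinearity[OF pe p V] compact_Icc)
  then obtain B where "\<forall>x\<in>?G ` {0..T}. norm x \<le> B" unfolding bounded_iff by blast
  then have B: "norm (?G s) \<le> B" if "s \<in> {0..T}" for s using that by blast
  \<comment> \<open>One factor \<open>t\<close> is the length of the interval, the other the bound
    on the symbol for small times.\<close>
  have duh: "norm (bessel_op (duhamel p V t)) \<le> B * t * t" if t: "t \<in> {0..<T}" for t
  proof -
    have Vt: "continuous_on {0..t} V" using t by (intro continuous_on_subset[OF V]) auto
    have "norm (integral {0..t} (\<lambda>\<tau>. damped_wave_op (t - \<tau>) (abs_power p (bessel_op (V \<tau>))))) \<le> integral {0..t} (\<lambda>_. t * B)"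
    proof (rule integral_norm_bound_integral[OF integral_damped_wave_op(1)[OF pe p Vt]])
      fix s assume s: "s \<in> {0..t}"
      have "\<bar>damped_wave_symbol (t - s) \<xi>\<bar> \<le> t" for \<xi> :: "real^'n"
        using abs_damped_wave_symbol_le[of "t - s" \<xi>] s by simp
      then have "norm (damped_wave_op (t - s) (abs_power p (bessel_op (V s)))) \<le> t * norm (?G s)"
        using s unfolding damped_wave_op_def nonlinearity_def by (intro norm_fourier_multiplier_le symbol_wave) auto
      also have "\<dots> \<le> t * B" using s t by (intro mult_left_mono B) auto
      finally show "norm (damped_wave_op (t - s) (abs_power p (bessel_op (V s)))) \<le> t * B" .
    qed (rule integrable_const_ivl)
    then show ?thesis unfolding integral_damped_wave_op(2)[OF pe p Vt] using t by (simp add: mult_ac)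
  qed
  show "((\<lambda>t. bessel_op (U t)) has_vector_derivative \<epsilon> *\<^sub>R u1) (at 0 within {0..<T})"
    unfolding has_vector_derivative_def has_derivative_within
  proof (intro conjI bounded_linear_scaleR_left)
    show "((\<lambda>y. (1 / norm (y - 0)) *\<^sub>R (bessel_op (U y) - (bessel_op (U 0) + (y - 0) *\<^sub>R \<epsilon> *\<^sub>R u1))) \<longlongrightarrow> 0) (at 0 within {0..<T})"
      unfolding tendsto_at_iff_sequentially
    proof (intro allI impI)
      fix X assume "\<forall>i. X i \<in> {0..<T} - {0}" and X0: "X \<longlonglongrightarrow> (0::real)"
      then have X: "\<And>i. 0 < X i" "\<And>i. X i \<in> {0..<T}" by (auto simp: less_le)
      have X': "0 \<le> X i" for i using X(1)[of i] by simp
      have sb: "symbol (\<lambda>\<xi>. wave_symbol1 (X j) \<xi> * bessel \<xi> - bessel \<xi>)" for j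
        by (intro symbol_diff symbol_times symbol_wave symbol_bessel X')
      have sk: "symbol (\<lambda>\<xi>. damped_wave_symbol (X j) \<xi> :: real)" for j by (intro symbol_wave X')
      have sc: "symbol (\<lambda>\<xi>::real^'n. c)" for c by (rule symbolI[where B="\<bar>c\<bar>"]) auto
      let ?A = "\<lambda>j \<xi>. (1 / X j) * (wave_symbol1 (X j) \<xi> * bessel \<xi> - bessel \<xi>)"
      let ?K = "\<lambda>j \<xi>. (1 / X j) * damped_wave_symbol (X j) \<xi>"
      have "(\<lambda>j. fourier_multiplier (?A j) U0) \<longlonglongrightarrow> fourier_multiplier (\<lambda>_. 0) U0"
      proof (rule fourier_multiplier_LIMSEQ[OF symbol_times[OF sc sb] sc, where B=32])
        fix \<xi> :: "real^'n"
        have "\<bar>?A j \<xi>\<bar> = (1 / X j) * (bessel \<xi> * \<bar>wave_symbol1 (X j) \<xi> - 1\<bar>)" for j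
        proof -
          have "?A j \<xi> = (1 / X j) * (bessel \<xi> * (wave_symbol1 (X j) \<xi> - 1))" by (simp add: algebra_simps)
          then show ?thesis using X(1)[of j] bessel_pos[of \<xi>] by (simp only: abs_mult) simp
        qed
        also have "\<dots> j \<le> (1 / X j) * (32 * X j)" for j
          using X(1)[of j] by (intro mult_left_mono abs_wave_symbol1_minus_1_le) auto
        also have "\<dots> j = 32" for j using X(1)[of j] by simp
        finally show "\<bar>?A j \<xi>\<bar> \<le> 32" for j .
        have "((\<lambda>t. wave_symbol1 t \<xi>) has_real_derivative 0) (at 0)"
          using DERIV_wave_symbol1[of \<xi> 0 UNIV] by simp
        from difference_quotient_LIMSEQ[OF this _ X(1) X0, of 1]
        have "(\<lambda>j. bessel \<xi> * ((1 / X j) * (wave_symbol1 (X j) \<xi> - 1))) \<longlonglongrightarrow> bessel \<xi> * 0" by (intro tendsto_intros) simp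
        then show "(\<lambda>j. ?A j \<xi>) \<longlonglongrightarrow> 0" by (simp add: algebra_simps)
      qed
      moreover have "fourier_multiplier (?A j) U0 = (1 / X j) *\<^sub>R (bessel_op (fourier_multiplier (wave_symbol1 (X j)) U0) - bessel_op U0)" for j
        unfolding fourier_multiplier_scaleR[OF sb, symmetric] fourier_multiplier_mult[OF symbol_bessel symbol_wave(1)[OF X']]
          fourier_multiplier_diff[OF symbol_times[OF symbol_wave(1)[OF X'] symbol_bessel] symbol_bessel, symmetric]
        by (simp only: mult.commute)
      ultimately have 1: "(\<lambda>j. (1 / X j) *\<^sub>R (bessel_op (fourier_multiplier (wave_symbol1 (X j)) U0) - bessel_op U0)) \<longlonglongrightarrow> 0" by simp
      have "(\<lambda>j. fourier_multiplier (?K j) u1) \<longlonglongrightarrow> fourier_multiplier (\<lambda>_. 1) u1"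
      proof (rule fourier_multiplier_LIMSEQ[OF symbol_times[OF sc sk] sc, where B=1])
        fix \<xi> :: "real^'n"
        show "\<bar>?K j \<xi>\<bar> \<le> 1" for j
          using abs_damped_wave_symbol_le[OF X'[of j], of \<xi>] X(1)[of j] by (simp add: abs_mult)
        have "((\<lambda>t. damped_wave_symbol t \<xi>) has_real_derivative 1) (at 0)"
          using DERIV_damped_wave_symbol[of \<xi> 0 UNIV] by simp
        from difference_quotient_LIMSEQ[OF this _ X(1) X0, of 0] show "(\<lambda>j. ?K j \<xi>) \<longlonglongrightarrow> 1" by simp
      qed
      moreover have "fourier_multiplier (?K j) u1 = (1 / X j) *\<^sub>R bessel_op (fourier_multiplier (wave_symbol2 (X j)) u1)" for j
        unfolding fourier_multiplier_scaleR[OF sk, symmetric]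
        using damped_wave_op_bessel[OF X'[of j], of u1] by (simp add: damped_wave_op_def)
      ultimately have "(\<lambda>j. (1 / X j) *\<^sub>R bessel_op (fourier_multiplier (wave_symbol2 (X j)) u1) - u1) \<longlonglongrightarrow> 0"
        by (simp add: LIM_zero)
      then have 2: "(\<lambda>j. (1 / X j) *\<^sub>R (bessel_op (fourier_multiplier (wave_symbol2 (X j)) u1) - X j *\<^sub>R u1)) \<longlonglongrightarrow> 0"
        using X(1) by (simp add: scaleR_diff_right less_imp_neq[symmetric])
      have 3: "(\<lambda>j. (1 / X j) *\<^sub>R bessel_op (duhamel p V (X j))) \<longlonglongrightarrow> 0"
      proof (rule Lim_null_comparison[OF always_eventually[OF allI]])
        show "norm ((1 / X j) *\<^sub>R bessel_op (duhamel p V (X j))) \<le> B * X j" for j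
          using duh[OF X(2)[of j]] X(1)[of j] by (simp add: divide_le_eq)
        show "(\<lambda>j. B * X j) \<longlonglongrightarrow> 0" using X0 by (rule tendsto_mult_right_zero)
      qed
      have "(\<lambda>j. \<epsilon> *\<^sub>R (1 / X j) *\<^sub>R (bessel_op (fourier_multiplier (wave_symbol1 (X j)) U0) - bessel_op U0)
          + \<epsilon> *\<^sub>R (1 / X j) *\<^sub>R (bessel_op (fourier_multiplier (wave_symbol2 (X j)) u1) - X j *\<^sub>R u1)
          + (1 / X j) *\<^sub>R bessel_op (duhamel p V (X j))) \<longlonglongrightarrow> \<epsilon> *\<^sub>R 0 + \<epsilon> *\<^sub>R 0 + 0"
        by (intro tendsto_intros 1 2 3)
      moreover have "(1 / norm (X j - 0)) *\<^sub>R (bessel_op (U (X j)) - (bessel_op (U 0) + (X j - 0) *\<^sub>R \<epsilon> *\<^sub>R u1)) =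
          \<epsilon> *\<^sub>R (1 / X j) *\<^sub>R (bessel_op (fourier_multiplier (wave_symbol1 (X j)) U0) - bessel_op U0)
          + \<epsilon> *\<^sub>R (1 / X j) *\<^sub>R (bessel_op (fourier_multiplier (wave_symbol2 (X j)) u1) - X j *\<^sub>R u1)
          + (1 / X j) *\<^sub>R bessel_op (duhamel p V (X j))" for j
        using X(1)[of j] unfolding U[OF X(2)] init free_wave_def bessel_op_add[symmetric] bessel_op_scaleR
        by (simp add: algebra_simps)
      ultimately show "((\<lambda>y. (1 / norm (y - 0)) *\<^sub>R (bessel_op (U y) - (bessel_op (U 0) + (y - 0) *\<^sub>R \<epsilon> *\<^sub>R u1))) \<circ> X) \<longlonglongrightarrow> 0"
        by (simp only: o_def) simp
    qed
  qed
qed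

text \<open>The unweighted version, for uniqueness: a competing solution is merely continuous, so
  that a bound \<open>R\<close> on a compact interval is all there is.\<close>

lemma norm_duhamel_diff_le:
  fixes V W :: "real \<Rightarrow> (real^'n, real) L2"
  assumes pe: "power_estimate TYPE('n) p C" and p: "1 \<le> p"
    and V: "continuous_on {0..t} V" and W: "continuous_on {0..t} W"
    and R: "\<And>s. s \<in> {0..t} \<Longrightarrow> norm (V s) \<le> R" "\<And>s. s \<in> {0..t} \<Longrightarrow> norm (W s) \<le> R"
  shows "norm (duhamel p V t - duhamel p W t) \<le> 32 * C * (2 * R) powr (p - 1) * integral {0..t} (\<lambda>s. norm (V s - W s))"
proof -
  let ?f = "\<lambda>V s. fourier_multiplier (wave_symbol2 (t - s)) (nonlinearity p (V s))"
  let ?c = "32 * C * (2 * R) powr (p - 1)"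
  have C: "0 < C" using pe by (simp add: power_estimate_def)
  note cV = continuous_on_duhamel_integrand[OF pe p V] and cW = continuous_on_duhamel_integrand[OF pe p W]
  have eq: "duhamel p V t - duhamel p W t = integral {0..t} (\<lambda>s. ?f V s - ?f W s)"
    unfolding duhamel_def
    by (intro Henstock_Kurzweil_Integration.integral_diff[symmetric] integrable_continuous_interval cV cW)
  have "norm (duhamel p V t - duhamel p W t) \<le> integral {0..t} (\<lambda>s. ?c * norm (V s - W s))"
    unfolding eq
  proof (rule integral_norm_bound_integral)
    show "(\<lambda>s. ?f V s - ?f W s) integrable_on {0..t}" "(\<lambda>s. ?c * norm (V s - W s)) integrable_on {0..t}"
      by (intro integrable_continuous_interval continuous_intros cV cW V W)+
    fix s assume s: "s \<in> {0..t}"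
    then have s': "0 \<le> t - s" by simp
    have "?f V s - ?f W s = fourier_multiplier (wave_symbol2 (t - s)) (nonlinearity p (V s) - nonlinearity p (W s))"
      by (rule linear_diff[OF bounded_linear.linear[OF bounded_linear_fourier_multiplier[OF symbol_wave(2)[OF s']]], symmetric])
    then have "norm (?f V s - ?f W s) \<le> 32 * norm (nonlinearity p (V s) - nonlinearity p (W s))"
      using norm_fourier_multiplier_le[OF symbol_wave(2)[OF s'] wave_symbol_bounded(1)[OF s']] by simp
    also have "\<dots> \<le> 32 * (C * norm (V s - W s) * (norm (V s) + norm (W s)) powr (p - 1))"
      by (intro mult_left_mono nonlinearity_lipschitz[OF pe]) auto
    also have "\<dots> \<le> 32 * (C * norm (V s - W s) * (2 * R) powr (p - 1))"
      using C R[OF s] p by (intro mult_left_mono powr_mono2) auto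
    finally show "norm (?f V s - ?f W s) \<le> ?c * norm (V s - W s)" by (simp only: mult_ac)
  qed
  also have "\<dots> = ?c * integral {0..t} (\<lambda>s. norm (V s - W s))"
    by (rule Henstock_Kurzweil_Integration.integral_mult_right)
  finally show ?thesis .
qed

text \<open>On \<open>{0..\<tau>}\<close> the four curves share a bound \<open>R\<close>, so both
  Duhamel maps are Lipschitz there and Gronwall applies to the sum of the two distances.\<close>

lemma fixpoint_unique:
  fixes U V U' V' :: "real \<Rightarrow> (real^'n, real) L2"
  assumes pe: "power_estimate TYPE('n) p C" "power_estimate TYPE('n) q C'" and p: "1 \<le> p" "1 \<le> q"
    and c: "continuous_on {0..<T} U" "continuous_on {0..<T} V" "continuous_on {0..<T} U'" "continuous_on {0..<T} V'"
    and U: "\<And>t. t \<in> {0..<T} \<Longrightarrow> U t = F t + duhamel p V t" and V: "\<And>t. t \<in> {0..<T} \<Longrightarrow> V t = G t + duhamel q U t"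
    and U': "\<And>t. t \<in> {0..<T} \<Longrightarrow> U' t = F t + duhamel p V' t" and V': "\<And>t. t \<in> {0..<T} \<Longrightarrow> V' t = G t + duhamel q U' t"
    and \<tau>: "\<tau> \<in> {0..<T}"
  shows "U' \<tau> = U \<tau> \<and> V' \<tau> = V \<tau>"
proof -
  have sub: "{0..t} \<subseteq> {0..<T}" if "t \<in> {0..\<tau>}" for t using that \<tau> by auto
  have \<tau>0: "\<tau> \<in> {0..\<tau>}" using \<tau> by auto
  note ct = continuous_on_subset[OF c(1) sub] continuous_on_subset[OF c(2) sub] continuous_on_subset[OF c(3) sub] continuous_on_subset[OF c(4) sub]
  have bd: "\<exists>R. \<forall>s\<in>{0..\<tau>}. norm (f s) \<le> R" if "continuous_on {0..\<tau>} f" for f :: "real \<Rightarrow> (real^'n, real) L2"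
    using compact_imp_bounded[OF compact_continuous_image[OF that compact_Icc]] by (auto simp: bounded_iff)
  obtain R1 R2 R3 R4 where R: "\<And>s. s \<in> {0..\<tau>} \<Longrightarrow> norm (U s) \<le> R1" "\<And>s. s \<in> {0..\<tau>} \<Longrightarrow> norm (V s) \<le> R2"
      "\<And>s. s \<in> {0..\<tau>} \<Longrightarrow> norm (U' s) \<le> R3" "\<And>s. s \<in> {0..\<tau>} \<Longrightarrow> norm (V' s) \<le> R4"
    using bd[OF ct(1)[OF \<tau>0]] bd[OF ct(2)[OF \<tau>0]] bd[OF ct(3)[OF \<tau>0]] bd[OF ct(4)[OF \<tau>0]] by metis
  define R where "R = max (max R1 R2) (max R3 R4)"
  have RR: "norm (U s) \<le> R" "norm (V s) \<le> R" "norm (U' s) \<le> R" "norm (V' s) \<le> R" if "s \<in> {0..\<tau>}" for s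
    unfolding R_def using R[OF that] by (simp_all add: le_max_iff_disj)
  define D where "D t = norm (U t - U' t) + norm (V t - V' t)" for t
  define A B where "A = 32 * C * (2 * R) powr (p - 1)" and "B = 32 * C' * (2 * R) powr (q - 1)"
  have AB: "0 \<le> A" "0 \<le> B" using pe by (auto simp: A_def B_def power_estimate_def)
  have "D \<tau> = 0"
  proof (rule gronwall_zero[where L="A + B", OF _ _ _ _ \<tau>0])
    show "continuous_on {0..\<tau>} D" unfolding D_def by (intro continuous_intros ct[OF \<tau>0])
    fix t assume t: "t \<in> {0..\<tau>}"
    have tT: "t \<in> {0..<T}" using t \<tau> by auto
    have s\<tau>: "s \<in> {0..\<tau>}" if "s \<in> {0..t}" for s using that t by auto
    let ?u = "integral {0..t} (\<lambda>s. norm (U s - U' s))" and ?v = "integral {0..t} (\<lambda>s. norm (V s - V' s))"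
    have i: "(\<lambda>s. norm (U s - U' s)) integrable_on {0..t}" "(\<lambda>s. norm (V s - V' s)) integrable_on {0..t}"
      by (intro integrable_continuous_interval continuous_intros ct[OF t])+
    have pos: "0 \<le> ?u" "0 \<le> ?v" by (intro Henstock_Kurzweil_Integration.integral_nonneg i, simp)+
    have "norm (duhamel p V t - duhamel p V' t) \<le> A * ?v"
      unfolding A_def by (rule norm_duhamel_diff_le[OF pe(1) p(1) ct(2)[OF t] ct(4)[OF t]]) (auto intro!: RR s\<tau>)
    moreover have "norm (duhamel q U t - duhamel q U' t) \<le> B * ?u"
      unfolding B_def by (rule norm_duhamel_diff_le[OF pe(2) p(2) ct(1)[OF t] ct(3)[OF t]]) (auto intro!: RR s\<tau>)
    ultimately have "D t \<le> A * ?v + B * ?u"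
      unfolding D_def U[OF tT] U'[OF tT] V[OF tT] V'[OF tT] by simp
    also have "\<dots> \<le> (A + B) * (?u + ?v)"
      using mult_nonneg_nonneg[OF AB(1) pos(1)] mult_nonneg_nonneg[OF AB(2) pos(2)] by (simp add: algebra_simps)
    also have "?u + ?v = integral {0..t} D"
      unfolding D_def by (intro Henstock_Kurzweil_Integration.integral_add[symmetric] i)
    finally show "D t \<le> (A + B) * integral {0..t} D" .
  qed (use AB in \<open>auto simp: D_def\<close>)
  then have "norm (U \<tau> - U' \<tau>) + norm (V \<tau> - V' \<tau>) = 0" by (simp add: D_def)
  then have "norm (U \<tau> - U' \<tau>) = 0" "norm (V \<tau> - V' \<tau>) = 0"
    by (simp_all add: add_nonneg_eq_0_iff)
  then show ?thesis by simp
qed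

lemma satisfies_duhamel_cong:
  assumes "\<And>t. t \<in> {0..<T} \<Longrightarrow> w t = w' t" "\<And>t. t \<in> {0..<T} \<Longrightarrow> z t = z' t"
  shows "satisfies_duhamel p \<epsilon> w0 w1 T w z \<longleftrightarrow> satisfies_duhamel p \<epsilon> w0 w1 T w' z'"
proof -
  have "(\<lambda>\<tau>. damped_wave_op (t - \<tau>) (abs_power p (z \<tau>))) integrable_on {0..t} \<longleftrightarrow>
      (\<lambda>\<tau>. damped_wave_op (t - \<tau>) (abs_power p (z' \<tau>))) integrable_on {0..t}"
    "integral {0..t} (\<lambda>\<tau>. damped_wave_op (t - \<tau>) (abs_power p (z \<tau>))) = integral {0..t} (\<lambda>\<tau>. damped_wave_op (t - \<tau>) (abs_power p (z' \<tau>)))"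
    if "t \<in> {0..<T}" for t
    using that assms(2) by (auto intro!: integrable_cong Henstock_Kurzweil_Integration.integral_cong)
  then show ?thesis unfolding satisfies_duhamel_def using assms(1) by simp
qed

lemma continuous_on_H1_cong:
  assumes eq: "\<And>t. t \<in> I \<Longrightarrow> u t = v t" and u: "continuous_on_H1 I u"
  shows "continuous_on_H1 I v"
  unfolding continuous_on_H1_def
proof (intro conjI ballI)
  fix t assume t: "t \<in> I"
  show "v t \<in> H1" using u eq[OF t] t by (auto simp: continuous_on_H1_def)
  have "((\<lambda>s. norm_H1 (u s - u t)) \<longlongrightarrow> 0) (at t within I)" using u t by (simp add: continuous_on_H1_def)
  moreover have "\<forall>\<^sub>F s in at t within I. norm_H1 (u s - u t) = norm_H1 (v s - v t)"
    using eq t by (simp add: eventually_at_filter)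
  ultimately show "((\<lambda>s. norm_H1 (v s - v t)) \<longlongrightarrow> 0) (at t within I)" by (rule Lim_transform_eventually)
qed

lemma continuous_on_H1_imp_bessel_op:
  assumes u: "continuous_on_H1 I u"
  obtains U where "continuous_on I U" "\<And>t. t \<in> I \<Longrightarrow> u t = bessel_op (U t)"
proof -
  have "\<forall>t\<in>I. \<exists>U. u t = bessel_op U" using u H1_eq_bessel_op by (metis continuous_on_H1_def)
  then obtain U where U: "\<And>t. t \<in> I \<Longrightarrow> u t = bessel_op (U t)" by metis
  have "continuous_on I U"
    using continuous_on_H1_cong[OF U u] by (simp add: continuous_on_H1_bessel_op)
  with U show ?thesis using that by blast
qed

text \<open>Any competing mild solution lifts through \<open>bessel_op\<close> to a continuous
  \<open>L2\<close>-valued solution of the same fixed-point equations, so uniqueness reduces to that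
  of fixed points.\<close>

lemma unique_mild_solution_of_fixpoint:
  fixes U V :: "real \<Rightarrow> (real^'n, real) L2"
  assumes pe: "power_estimate TYPE('n) p C" "power_estimate TYPE('n) q C'" and p: "1 \<le> p" "1 \<le> q" and T: "0 < T"
    and cont: "continuous_on {0..T} U" "continuous_on {0..T} V"
    and U: "\<And>t. t \<in> {0..T} \<Longrightarrow> U t = free_wave \<epsilon> U0 u1 t + duhamel p V t"
    and V: "\<And>t. t \<in> {0..T} \<Longrightarrow> V t = free_wave \<epsilon> V0 v1 t + duhamel q U t"
  shows "unique_mild_solution_exists p q \<epsilon> (bessel_op U0) u1 (bessel_op V0) v1 T"
  unfolding unique_mild_solution_exists_def
proof (intro exI conjI allI impI)
  have c: "continuous_on {0..<T} U" "continuous_on {0..<T} V"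
    by (rule continuous_on_subset[OF cont(1)], force, rule continuous_on_subset[OF cont(2)], force)
  show "mild_solution p q \<epsilon> (bessel_op U0) u1 (bessel_op V0) v1 T (\<lambda>t. bessel_op (U t)) (\<lambda>t. bessel_op (V t))"
    unfolding mild_solution_def continuous_on_H1_bessel_op satisfies_duhamel_iff[OF pe(1) p(1) c(2)] satisfies_duhamel_iff[OF pe(2) p(2) c(1)]
    using c U V initial_velocity[OF pe(1) p(1) cont(2) T, where U=U and \<epsilon>=\<epsilon> and ?U0.0=U0 and ?u1.0=u1] initial_velocity[OF pe(2) p(2) cont(1) T, where U=V and \<epsilon>=\<epsilon> and ?U0.0=V0 and ?u1.0=v1]
    by simp
  fix u' v'
  assume "mild_solution p q \<epsilon> (bessel_op U0) u1 (bessel_op V0) v1 T u' v'"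
  then have m: "continuous_on_H1 {0..<T} u'" "continuous_on_H1 {0..<T} v'"
      "satisfies_duhamel p \<epsilon> (bessel_op U0) u1 T u' v'" "satisfies_duhamel q \<epsilon> (bessel_op V0) v1 T v' u'"
    by (auto simp: mild_solution_def)
  obtain U' where U': "continuous_on {0..<T} U'" "\<And>t. t \<in> {0..<T} \<Longrightarrow> u' t = bessel_op (U' t)"
    using continuous_on_H1_imp_bessel_op[OF m(1)] by blast
  obtain V' where V': "continuous_on {0..<T} V'" "\<And>t. t \<in> {0..<T} \<Longrightarrow> v' t = bessel_op (V' t)"
    using continuous_on_H1_imp_bessel_op[OF m(2)] by blast
  have s1: "satisfies_duhamel p \<epsilon> (bessel_op U0) u1 T (\<lambda>t. bessel_op (U' t)) (\<lambda>t. bessel_op (V' t))"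
    using m(3) satisfies_duhamel_cong[of T u' "\<lambda>t. bessel_op (U' t)" v' "\<lambda>t. bessel_op (V' t)"] U'(2) V'(2) by simp
  have s2: "satisfies_duhamel q \<epsilon> (bessel_op V0) v1 T (\<lambda>t. bessel_op (V' t)) (\<lambda>t. bessel_op (U' t))"
    using m(4) satisfies_duhamel_cong[of T v' "\<lambda>t. bessel_op (V' t)" u' "\<lambda>t. bessel_op (U' t)"] U'(2) V'(2) by simp
  have e: "\<And>t. t \<in> {0..<T} \<Longrightarrow> U' t = free_wave \<epsilon> U0 u1 t + duhamel p V' t"
      "\<And>t. t \<in> {0..<T} \<Longrightarrow> V' t = free_wave \<epsilon> V0 v1 t + duhamel q U' t"
    using s1 s2 unfolding satisfies_duhamel_iff[OF pe(1) p(1) V'(1)] satisfies_duhamel_iff[OF pe(2) p(2) U'(1)] by auto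
  show "\<forall>t\<in>{0..<T}. u' t = bessel_op (U t) \<and> v' t = bessel_op (V t)"
  proof
    fix t assume t: "t \<in> {0..<T}"
    have "U' t = U t \<and> V' t = V t"
      by (rule fixpoint_unique[OF pe p c U'(1) V'(1) _ _ e t]) (auto intro: U V)
    then show "u' t = bessel_op (U t) \<and> v' t = bessel_op (V t)" using U'(2) V'(2) t by simp
  qed
qed

lemma duhamel_0:
  assumes pe: "power_estimate TYPE('n) p C" and t: "0 \<le> t"
  shows "duhamel p (\<lambda>_. 0 :: (real^'n, real) L2) t = 0"
proof -
  have b0: "bessel_op 0 = (0 :: (real^'n, real) L2)"
    by (rule linear_0[OF bounded_linear.linear[OF bounded_linear_fourier_multiplier[OF symbol_bessel]]])
  have "power_in_L12 p (bessel_op (0 :: (real^'n, real) L2))" using pe by (simp add: power_estimate_def)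
  from rep_abs_power[OF this] have "AE x in lborel. rep_L2 (nonlinearity p (0 :: (real^'n, real) L2)) x = 0"
    using rep_L2_zero unfolding nonlinearity_def b0 by eventually_elim simp
  then have n0: "nonlinearity p (0 :: (real^'n, real) L2) = 0"
    using rep_L2_zero[where 'a="real^'n" and 'b=real] by (intro L2_eqI) auto
  have "duhamel p (\<lambda>_. 0 :: (real^'n, real) L2) t = integral {0..t} (\<lambda>_. 0)"
    unfolding duhamel_def n0
    by (intro Henstock_Kurzweil_Integration.integral_cong linear_0[OF bounded_linear.linear[OF bounded_linear_fourier_multiplier[OF symbol_wave(2)]]]) simp
  then show ?thesis by simp
qed

text \<open>The constant 368 is twice the 184 of the linear estimate; the factor 2 becomes the
  contraction rate one half.\<close>

lemma wnorm_duhamel_contraction: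
  fixes V W :: "real \<Rightarrow> (real^'n, real) L2"
  assumes n: "CARD('n) \<le> 2" and pe: "power_estimate TYPE('n) p C" and p: "1 \<le> p"
    and VW: "continuous_on {0..T} V" "continuous_on {0..T} W" and b: "continuous_on {0..T} b" "\<And>s. s \<in> {0..T} \<Longrightarrow> 0 < b s"
    and le: "\<And>s. s \<in> {0..T} \<Longrightarrow> wnorm s (V s) \<le> b s" "\<And>s. s \<in> {0..T} \<Longrightarrow> wnorm s (W s) \<le> b s"
    and \<delta>: "0 \<le> \<delta>" "\<And>s. s \<in> {0..T} \<Longrightarrow> wnorm s (V s - W s) \<le> \<delta> * b s" and t: "t \<in> {0..T}"
    and small: "368 * C * 2 powr (p - 1) * integral {0..t} (decay_kernel (real CARD('n) / 4 + 1 / 2) (real CARD('n) * (p - 1) / 2) p t b) \<le> A"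
  shows "wnorm t ((F + duhamel p V t) - (F + duhamel p W t)) \<le> \<delta> / 2 * A"
proof -
  let ?I = "integral {0..t} (decay_kernel (real CARD('n) / 4 + 1 / 2) (real CARD('n) * (p - 1) / 2) p t b)"
  have sub: "{0..t} \<subseteq> {0..T}" using t by auto
  have s: "s \<in> {0..T}" if "s \<in> {0..t}" for s using that sub by blast
  have "wnorm t (duhamel p V t - duhamel p W t) \<le> \<delta> * (184 * C * 2 powr (p - 1) * ?I)"
    by (rule wnorm_duhamel_diff_le[OF n pe p _ continuous_on_subset[OF VW(1) sub] continuous_on_subset[OF VW(2) sub]
          continuous_on_subset[OF b(1) sub] b(2) le(1) le(2) \<delta>(1) \<delta>(2)]) (use t s in auto)
  also have "184 * C * 2 powr (p - 1) * ?I \<le> A / 2" using small by simp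
  then have "\<delta> * (184 * C * 2 powr (p - 1) * ?I) \<le> \<delta> * (A / 2)" using \<delta>(1) by (rule mult_left_mono)
  finally show ?thesis by simp
qed

text \<open>What remains of the problem is scalar: radii \<open>a\<close> and \<open>b\<close>
  subject to four inequalities. Half of each radius is reserved for the free wave, hence 368 rather
  than 184 in front of the data norm.\<close>

lemma lifespan_ge:
  fixes u0 u1 v0 v1 :: "(real^'n, real) L2"
  assumes n: "CARD('n) \<le> 2" and pe: "power_estimate TYPE('n) p C" "power_estimate TYPE('n) q C'" and p: "1 \<le> p" "1 \<le> q"
    and data: "((u0, u1), (v0, v1)) \<in> data_space" and \<epsilon>: "0 \<le> \<epsilon>" and T: "0 < T"
    and ab: "continuous_on {0..T} a" "continuous_on {0..T} b" "\<And>t. t \<in> {0..T} \<Longrightarrow> 0 < a t" "\<And>t. t \<in> {0..T} \<Longrightarrow> 0 < b t"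
    and a0: "\<And>t. t \<in> {0..T} \<Longrightarrow> 368 * \<epsilon> * data_norm u0 u1 v0 v1 \<le> a t"
    and b0: "\<And>t. t \<in> {0..T} \<Longrightarrow> 368 * \<epsilon> * data_norm u0 u1 v0 v1 \<le> b t"
    and a1: "\<And>t. t \<in> {0..T} \<Longrightarrow> 368 * C * 2 powr (p - 1) *
      integral {0..t} (decay_kernel (real CARD('n) / 4 + 1 / 2) (real CARD('n) * (p - 1) / 2) p t b) \<le> a t"
    and b1: "\<And>t. t \<in> {0..T} \<Longrightarrow> 368 * C' * 2 powr (q - 1) *
      integral {0..t} (decay_kernel (real CARD('n) / 4 + 1 / 2) (real CARD('n) * (q - 1) / 2) q t a) \<le> b t"
  shows "ereal T \<le> lifespan p q \<epsilon> u0 u1 v0 v1"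
proof -
  have d: "u0 \<in> H1" "v0 \<in> H1" "integrable lborel (rep_L2 u0)" "integrable lborel (rep_L2 u1)"
      "integrable lborel (rep_L2 v0)" "integrable lborel (rep_L2 v1)"
    using data by (auto simp: data_space_def L2_Int_L1_def)
  obtain U0 V0 where UV0: "u0 = bessel_op U0" "v0 = bessel_op V0" using d(1,2) H1_eq_bessel_op by metis
  let ?J = "data_norm u0 u1 v0 v1"
  have J: "norm U0 + norm_L1 u0 + norm u1 + norm_L1 u1 \<le> ?J" "norm V0 + norm_L1 v0 + norm v1 + norm_L1 v1 \<le> ?J"
    unfolding data_norm_def UV0 norm_H1_bessel_op
    using norm_L1_nonneg[of "bessel_op U0"] norm_L1_nonneg[of u1] norm_L1_nonneg[of "bessel_op V0"] norm_L1_nonneg[of v1] by simp_all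
  have free: "wnorm t (free_wave \<epsilon> U0 u1 t) \<le> 184 * \<epsilon> * ?J" "wnorm t (free_wave \<epsilon> V0 v1 t) \<le> 184 * \<epsilon> * ?J" if "0 \<le> t" for t
  proof -
    have "184 * \<epsilon> * (norm U0 + norm_L1 u0 + norm u1 + norm_L1 u1) \<le> 184 * \<epsilon> * ?J" using \<epsilon> by (intro mult_left_mono J) auto
    with wnorm_free_wave_le[OF n that \<epsilon> _ d(4), of U0] d(3)
    show "wnorm t (free_wave \<epsilon> U0 u1 t) \<le> 184 * \<epsilon> * ?J" unfolding UV0 by (auto intro: order_trans)
    have "184 * \<epsilon> * (norm V0 + norm_L1 v0 + norm v1 + norm_L1 v1) \<le> 184 * \<epsilon> * ?J" using \<epsilon> by (intro mult_left_mono J) auto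
    with wnorm_free_wave_le[OF n that \<epsilon> _ d(6), of V0] d(5)
    show "wnorm t (free_wave \<epsilon> V0 v1 t) \<le> 184 * \<epsilon> * ?J" unfolding UV0 by (auto intro: order_trans)
  qed
  have "bounded (a ` {0..T})" "bounded (b ` {0..T})"
    by (intro compact_imp_bounded compact_continuous_image ab compact_Icc)+
  then obtain M1 M2 where "\<forall>x\<in>a ` {0..T}. norm x \<le> M1" "\<forall>x\<in>b ` {0..T}. norm x \<le> M2" unfolding bounded_iff by blast
  then have M: "a t \<le> max M1 M2" "b t \<le> max M1 M2" if "t \<in> {0..T}" for t
  proof -
    have "norm (a t) \<le> M1" "norm (b t) \<le> M2"
      using that \<open>\<forall>x\<in>a ` {0..T}. norm x \<le> M1\<close> \<open>\<forall>x\<in>b ` {0..T}. norm x \<le> M2\<close> by blast+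
    then show "a t \<le> max M1 M2" "b t \<le> max M1 M2" by auto
  qed
  let ?\<Phi> = "\<lambda>V t. free_wave \<epsilon> U0 u1 t + duhamel p V t" and ?\<Psi> = "\<lambda>U t. free_wave \<epsilon> V0 v1 t + duhamel q U t"
  obtain U V where "continuous_on {0..T} U" "continuous_on {0..T} V"
      "\<And>t. t \<in> {0..T} \<Longrightarrow> U t = ?\<Phi> V t" "\<And>t. t \<in> {0..T} \<Longrightarrow> V t = ?\<Psi> U t"
  proof (rule picard_iteration[of T ?\<Phi> ?\<Psi> b a "max M1 M2"])
    show "continuous_on {0..T} (?\<Phi> V)" "continuous_on {0..T} (?\<Psi> V)" if "continuous_on {0..T} V" for V
      by (intro continuous_on_add continuous_on_free_wave continuous_on_duhamel[OF pe(1) p(1) that] continuous_on_duhamel[OF pe(2) p(2) that])+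
    show "wnorm t (?\<Phi> (\<lambda>_. 0) t) \<le> a t / 2" "wnorm t (?\<Psi> (\<lambda>_. 0) t) \<le> b t / 2" if "t \<in> {0..T}" for t
      using free[of t] a0[OF that] b0[OF that] that by (simp_all add: duhamel_0[OF pe(1)] duhamel_0[OF pe(2)])
    show "wnorm t (?\<Phi> V t - ?\<Phi> W t) \<le> \<delta> / 2 * a t"
      if "continuous_on {0..T} V" "continuous_on {0..T} W" "\<And>s. s \<in> {0..T} \<Longrightarrow> wnorm s (V s) \<le> b s" "\<And>s. s \<in> {0..T} \<Longrightarrow> wnorm s (W s) \<le> b s"
        "0 \<le> \<delta>" "\<And>s. s \<in> {0..T} \<Longrightarrow> wnorm s (V s - W s) \<le> \<delta> * b s" "t \<in> {0..T}" for V W \<delta> t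
      by (rule wnorm_duhamel_contraction[where b=b, OF n pe(1) p(1) that(1,2) ab(2,4) that(3-7) a1[OF that(7)]])
    show "wnorm t (?\<Psi> V t - ?\<Psi> W t) \<le> \<delta> / 2 * b t"
      if "continuous_on {0..T} V" "continuous_on {0..T} W" "\<And>s. s \<in> {0..T} \<Longrightarrow> wnorm s (V s) \<le> a s" "\<And>s. s \<in> {0..T} \<Longrightarrow> wnorm s (W s) \<le> a s"
        "0 \<le> \<delta>" "\<And>s. s \<in> {0..T} \<Longrightarrow> wnorm s (V s - W s) \<le> \<delta> * a s" "t \<in> {0..T}" for V W \<delta> t
      by (rule wnorm_duhamel_contraction[where b=a, OF n pe(2) p(2) that(1,2) ab(1,3) that(3-7) b1[OF that(7)]])
  qed (use M ab in \<open>auto intro: less_imp_le\<close>)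
  then have "unique_mild_solution_exists p q \<epsilon> u0 u1 v0 v1 T"
    unfolding UV0 by (intro unique_mild_solution_of_fixpoint[OF pe p T])
  then show ?thesis unfolding lifespan_def using T by (intro Sup_upper) auto
qed

text \<open>The system is symmetric under exchange of its components, so that \<open>p < q\<close>
  may be assumed off the diagonal.\<close>

lemma lifespan_swap:
  fixes u0 u1 v0 v1 :: "(real^'n, real) L2"
  shows "lifespan p q \<epsilon> u0 u1 v0 v1 = lifespan q p \<epsilon> v0 v1 u0 u1"
proof -
  have *: "mild_solution p q \<epsilon> u0 u1 v0 v1 T u v \<longleftrightarrow> mild_solution q p \<epsilon> v0 v1 u0 u1 T v u" for p q T and u0 u1 v0 v1 :: "(real^'n, real) L2" and u v
    by (auto simp: mild_solution_def)
  have imp: "unique_mild_solution_exists q p \<epsilon> v0 v1 u0 u1 T" if u: "unique_mild_solution_exists p q \<epsilon> u0 u1 v0 v1 T" for p q T and u0 u1 v0 v1 :: "(real^'n, real) L2"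
  proof -
    obtain u v where m: "mild_solution p q \<epsilon> u0 u1 v0 v1 T u v"
      and e: "\<And>u' v'. mild_solution p q \<epsilon> u0 u1 v0 v1 T u' v' \<Longrightarrow> \<forall>t\<in>{0..<T}. u' t = u t \<and> v' t = v t"
      using u unfolding unique_mild_solution_exists_def by blast
    show ?thesis
      unfolding unique_mild_solution_exists_def
    proof (intro exI conjI allI impI)
      show "mild_solution q p \<epsilon> v0 v1 u0 u1 T v u" using m by (simp only: *[symmetric])
      fix v' u' assume "mild_solution q p \<epsilon> v0 v1 u0 u1 T v' u'"
      then have "mild_solution p q \<epsilon> u0 u1 v0 v1 T u' v'" by (simp only: *)
      from e[OF this] show "\<forall>t\<in>{0..<T}. v' t = v t \<and> u' t = u t" by blast
    qed
  qed
  have "unique_mild_solution_exists p q \<epsilon> u0 u1 v0 v1 T \<longleftrightarrow> unique_mild_solution_exists q p \<epsilon> v0 v1 u0 u1 T" for T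
    using imp by blast
  then show ?thesis by (simp add: lifespan_def)
qed

subsection \<open>Lifespan bounds\<close>

lemma integral_powr_shift:
  fixes \<beta> :: real
  assumes t: "0 \<le> t" and \<beta>: "\<beta> \<noteq> 1"
  shows "((\<lambda>s. (1 + s) powr (- \<beta>)) has_integral (((1 + t) powr (1 - \<beta>) - 1) / (1 - \<beta>))) {0..t}"
proof -
  have "((\<lambda>s. (1 + s) powr (- \<beta>)) has_integral ((1 + t) powr (1 - \<beta>) / (1 - \<beta>) - (1 + 0) powr (1 - \<beta>) / (1 - \<beta>))) {0..t}"
  proof (rule fundamental_theorem_of_calculus[OF t])
    fix s assume s: "s \<in> {0..t}"
    have "((\<lambda>s. (1 + s) powr (1 - \<beta>) / (1 - \<beta>)) has_real_derivative (1 + s) powr (- \<beta>)) (at s within {0..t})"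
      using s \<beta> by (auto intro!: derivative_eq_intros)
    then show "((\<lambda>s. (1 + s) powr (1 - \<beta>) / (1 - \<beta>)) has_vector_derivative (1 + s) powr (- \<beta>)) (at s within {0..t})"
      by (simp add: has_real_derivative_iff_has_vector_derivative)
  qed
  then show ?thesis by (simp add: diff_divide_distrib)
qed

lemma integral_powr_reflect:
  assumes t: "0 \<le> (t::real)"
  shows "((\<lambda>s. (1 + (t - s)) powr (- 3 / 4)) has_integral 4 * ((1 + t) powr (1 / 4) - 1)) {0..t}"
proof -
  have "((\<lambda>s. (1 + (t - s)) powr (- 3 / 4)) has_integral - 4 * (1 + (t - t)) powr (1 / 4) - - 4 * (1 + (t - 0)) powr (1 / 4)) {0..t}"
  proof (rule fundamental_theorem_of_calculus[OF t])
    fix s assume s: "s \<in> {0..t}"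
    have "((\<lambda>s. - 4 * (1 + (t - s)) powr (1 / 4)) has_real_derivative (1 + (t - s)) powr (- 3 / 4)) (at s within {0..t})"
      using s by (auto intro!: derivative_eq_intros)
    then show "((\<lambda>s. - 4 * (1 + (t - s)) powr (1 / 4)) has_vector_derivative (1 + (t - s)) powr (- 3 / 4)) (at s within {0..t})"
      by (simp add: has_real_derivative_iff_has_vector_derivative)
  qed
  then show ?thesis by (simp add: algebra_simps)
qed

lemma integral_inverse_shift:
  assumes t: "0 \<le> (t::real)"
  shows "((\<lambda>s. 1 / (1 + s)) has_integral ln (1 + t)) {0..t}" "((\<lambda>s. 1 / (1 + (t - s))) has_integral ln (1 + t)) {0..t}"
proof -
  have "((\<lambda>s. 1 / (1 + s)) has_integral ln (1 + t) - ln (1 + 0)) {0..t}"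
  proof (rule fundamental_theorem_of_calculus[OF t])
    fix s assume s: "s \<in> {0..t}"
    have "((\<lambda>s. ln (1 + s)) has_real_derivative 1 / (1 + s)) (at s within {0..t})"
      using s by (auto intro!: derivative_eq_intros)
    then show "((\<lambda>s. ln (1 + s)) has_vector_derivative 1 / (1 + s)) (at s within {0..t})"
      by (simp add: has_real_derivative_iff_has_vector_derivative)
  qed
  then show "((\<lambda>s. 1 / (1 + s)) has_integral ln (1 + t)) {0..t}" by simp
  have "((\<lambda>s. 1 / (1 + (t - s))) has_integral - ln (1 + (t - t)) - - ln (1 + (t - 0))) {0..t}"
  proof (rule fundamental_theorem_of_calculus[OF t])
    fix s assume s: "s \<in> {0..t}"
    have "((\<lambda>s. - ln (1 + (t - s))) has_real_derivative 1 / (1 + (t - s))) (at s within {0..t})"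
      using s by (auto intro!: derivative_eq_intros)
    then show "((\<lambda>s. - ln (1 + (t - s))) has_vector_derivative 1 / (1 + (t - s))) (at s within {0..t})"
      by (simp add: has_real_derivative_iff_has_vector_derivative)
  qed
  then show "((\<lambda>s. 1 / (1 + (t - s))) has_integral ln (1 + t)) {0..t}" by simp
qed

abbreviation time_kernel :: "real \<Rightarrow> real \<Rightarrow> real \<Rightarrow> real \<Rightarrow> real" where
  "time_kernel a \<beta> t s \<equiv> ((1 + t) / (1 + (t - s))) powr a * (1 + s) powr (- \<beta>)"

lemma continuous_on_time_kernel: "continuous_on {0..t} (time_kernel a \<beta> t)" if "0 \<le> t" for t :: real
  using that by (intro continuous_intros) auto

lemma integrable_time_kernel: "0 \<le> t \<Longrightarrow> time_kernel a \<beta> t integrable_on {0..t}"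
  by (intro integrable_continuous_interval continuous_on_time_kernel)

text \<open>The ratio is at least 1, so replacing \<open>a\<close> by 1 only enlarges the kernel;
  partial fractions do the rest. The exponent \<open>n / 4 + 1 / 2\<close> is 3/4 in dimension one
  and the borderline value 1 in dimension two.\<close>

lemma time_kernel_log:
  assumes t: "0 \<le> t" and a: "a \<le> 1"
  shows "integral {0..t} (time_kernel a 1 t) \<le> 2 * ln (1 + t)"
proof -
  have I: "((\<lambda>s. 1 / (1 + s) + 1 / (1 + (t - s))) has_integral ln (1 + t) + ln (1 + t)) {0..t}"
    by (intro has_integral_add integral_inverse_shift t)
  have "integral {0..t} (time_kernel a 1 t) \<le> ln (1 + t) + ln (1 + t)"
  proof (rule has_integral_le[OF integrable_integral[OF integrable_time_kernel[OF t]] I])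
    fix s assume s: "s \<in> {0..t}"
    let ?x = "(1 + t) / (1 + (t - s))"
    have "1 \<le> ?x" using s by simp
    then have "?x powr a \<le> ?x powr 1" using a by (intro powr_mono)
    also have "?x powr 1 = ?x" using s by (intro powr_one) simp
    finally have "?x powr a \<le> ?x" .
    then have "time_kernel a 1 t s \<le> ?x * (1 + s) powr (- 1)" by (rule mult_right_mono) simp
    also have "\<dots> = ?x * (1 / (1 + s))" using s by (simp add: powr_minus_divide)
    also have "\<dots> \<le> ((1 + s) + (1 + (t - s))) / ((1 + (t - s)) * (1 + s))"
      using s by (simp add: divide_right_mono)
    also have "\<dots> = 1 / (1 + s) + 1 / (1 + (t - s))" 
    proof -
      have "(A + B) / (B * A) = 1 / A + 1 / B" if "A \<noteq> 0" "B \<noteq> 0" for A B :: real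
        using that by (simp add: add_divide_distrib)
      from this[of "1 + s" "1 + (t - s)"] show ?thesis using s by simp
    qed
    finally show "time_kernel a 1 t s \<le> 1 / (1 + s) + 1 / (1 + (t - s))" .
  qed
  then show ?thesis by simp
qed

text \<open>
  For \<open>s \<le> t/2\<close> the first factor is bounded, for \<open>s \<ge> t/2\<close> the second one is comparable with its
  value at \<open>t\<close>; adding the two bounds avoids splitting the integral.
\<close>

lemma time_kernel_le:
  assumes s: "0 \<le> s" "s \<le> t" and \<beta>: "0 \<le> \<beta>"
  shows "time_kernel (3 / 4) \<beta> t s \<le> 2 * (1 + s) powr (- \<beta>) + 2 powr \<beta> * (1 + t) powr (3 / 4 - \<beta>) * (1 + (t - s)) powr (- 3 / 4)"
proof (cases "1 + t \<le> 2 * (1 + (t - s))")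
  case True
  have "((1 + t) / (1 + (t - s))) powr (3 / 4) \<le> 2 powr (3 / 4)"
    using True s by (intro powr_mono2) (auto simp: divide_le_eq)
  also have "\<dots> \<le> 2 powr 1" by (intro powr_mono) auto
  finally have "time_kernel (3 / 4) \<beta> t s \<le> 2 * (1 + s) powr (- \<beta>)" by (intro mult_right_mono) auto
  then show ?thesis by (simp add: add_increasing2)
next
  case False
  then have "1 + t \<le> 2 * (1 + s)" using s by simp
  then have "(2 * (1 + s)) powr (- \<beta>) \<le> (1 + t) powr (- \<beta>)" using s \<beta> by (intro powr_mono2') auto
  then have "2 powr \<beta> * (2 * (1 + s)) powr (- \<beta>) \<le> 2 powr \<beta> * (1 + t) powr (- \<beta>)" by (intro mult_left_mono) auto
  moreover have "2 powr \<beta> * (2 * (1 + s)) powr (- \<beta>) = (1 + s) powr (- \<beta>)"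

  proof -
    have "(2 * (1 + s)) powr (- \<beta>) = 2 powr (- \<beta>) * (1 + s) powr (- \<beta>)" by (rule powr_mult)
    moreover have "2 powr \<beta> * 2 powr (- \<beta>) = (1::real)" by (simp flip: powr_add)
    ultimately show ?thesis by (simp flip: mult.assoc)
  qed
  ultimately have le: "(1 + s) powr (- \<beta>) \<le> 2 powr \<beta> * (1 + t) powr (- \<beta>)" by argo
  have "time_kernel (3 / 4) \<beta> t s = (1 + t) powr (3 / 4) * (1 + (t - s)) powr (- 3 / 4) * (1 + s) powr (- \<beta>)"
    using s by (simp add: powr_divide powr_minus_divide)
  also have "\<dots> \<le> (1 + t) powr (3 / 4) * (1 + (t - s)) powr (- 3 / 4) * (2 powr \<beta> * (1 + t) powr (- \<beta>))"
    by (intro mult_left_mono le) auto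
  also have "\<dots> = 2 powr \<beta> * ((1 + t) powr (3 / 4) * (1 + t) powr (- \<beta>)) * (1 + (t - s)) powr (- 3 / 4)"
    by (simp only: mult_ac)
  also have "(1 + t) powr (3 / 4) * (1 + t) powr (- \<beta>) = (1 + t) powr (3 / 4 - \<beta>)" by (simp flip: powr_add)
  finally show ?thesis by (simp add: add_increasing)
qed

lemma time_kernel_integral_le:
  assumes t: "0 \<le> t" and \<beta>: "0 \<le> \<beta>" "\<beta> \<noteq> 1"
  shows "integral {0..t} (time_kernel (3 / 4) \<beta> t) \<le> 2 * (((1 + t) powr (1 - \<beta>) - 1) / (1 - \<beta>)) + 4 * 2 powr \<beta> * (1 + t) powr (1 - \<beta>)"
proof -
  let ?c = "2 powr \<beta> * (1 + t) powr (3 / 4 - \<beta>)"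
  have I: "((\<lambda>s. 2 * (1 + s) powr (- \<beta>) + ?c * (1 + (t - s)) powr (- 3 / 4)) has_integral
      2 * (((1 + t) powr (1 - \<beta>) - 1) / (1 - \<beta>)) + ?c * (4 * ((1 + t) powr (1 / 4) - 1))) {0..t}"
    by (intro has_integral_add has_integral_mult_right integral_powr_shift integral_powr_reflect t \<beta>)
  have "integral {0..t} (time_kernel (3 / 4) \<beta> t) \<le> 2 * (((1 + t) powr (1 - \<beta>) - 1) / (1 - \<beta>)) + ?c * (4 * ((1 + t) powr (1 / 4) - 1))"
    by (rule has_integral_le[OF integrable_integral[OF integrable_time_kernel[OF t]] I], rule time_kernel_le) (use \<beta> in auto)
  also have "?c * (4 * ((1 + t) powr (1 / 4) - 1)) \<le> ?c * (4 * (1 + t) powr (1 / 4))"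
    by (intro mult_left_mono) auto
  also have "\<dots> = 4 * 2 powr \<beta> * ((1 + t) powr (3 / 4 - \<beta>) * (1 + t) powr (1 / 4))" by (simp only: mult_ac)
  also have "(1 + t) powr (3 / 4 - \<beta>) * (1 + t) powr (1 / 4) = (1 + t) powr (1 - \<beta>)" by (simp flip: powr_add)
  finally show ?thesis by simp
qed

lemma ln_1_plus_exp_le:
  assumes "0 \<le> y"
  shows "ln (1 + exp y) \<le> 1 + (y::real)"
proof -
  have "1 + exp y \<le> exp 1 * exp y"
  proof -
    have "1 \<le> exp y" using assms by simp
    moreover have "2 * exp y \<le> exp 1 * exp y" using exp_ge_add_one_self[of 1] by (intro mult_right_mono) auto
    ultimately show ?thesis by linarith
  qed
  then have "ln (1 + exp y) \<le> ln (exp 1 * exp y)" by (intro ln_mono) (auto intro: add_pos_pos)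
  also have "\<dots> = 1 + y" by (simp add: exp_add[symmetric])
  finally show ?thesis .
qed

lemma data_norm_nonneg: "0 \<le> data_norm u0 u1 v0 v1"
  unfolding data_norm_def norm_H1_def
  by (intro add_nonneg_nonneg norm_L1_nonneg real_sqrt_ge_zero integral_nonneg_AE) (auto simp: add_nonneg_nonneg)

text \<open>With constant radii \<open>L * \<epsilon>\<close> the scalar condition asks that
  \<open>(L * \<epsilon>) powr (p - 1) * ln (1 + t)\<close> be small, whence the exponent
  \<open>p - 1\<close>. The value of \<open>c\<close> makes the product of all constants 1. The
  condition \<open>\<epsilon> powr (p - 1) \<le> c\<close> makes
  \<open>y = c * \<epsilon> powr (- (p - 1))\<close> at least 1, so that
  \<open>ln (1 + exp y) \<le> 1 + y \<le> 2 * y\<close>.\<close>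

lemma lifespan_diagonal:
  fixes u0 u1 v0 v1 :: "(real^'n, real) L2"
  assumes n: "CARD('n) \<le> 2" and pe: "power_estimate TYPE('n) p C" and p: "1 < p" "real CARD('n) * (p - 1) / 2 = 1"
    and data: "((u0, u1), (v0, v1)) \<in> data_space"
    and L: "L = 368 * (data_norm u0 u1 v0 v1 + 1)" and c: "c = 1 / (4 * (368 * C * 2 powr (p - 1)) * L powr (p - 1))"
    and \<epsilon>: "0 < \<epsilon>" "\<epsilon> powr (p - 1) \<le> c"
  shows "ereal (exp (c * \<epsilon> powr (- (p - 1)))) \<le> lifespan p p \<epsilon> u0 u1 v0 v1"
proof -
  let ?K = "368 * C * 2 powr (p - 1)" and ?T = "exp (c * \<epsilon> powr (- (p - 1)))"
  let ?a = "real CARD('n) / 4 + 1 / 2"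
  have C: "0 < C" using pe by (simp add: power_estimate_def)
  have L0: "0 < L" using data_norm_nonneg[of u0 u1 v0 v1] by (simp add: L)
  have a1: "?a \<le> 1" using n by simp
  have y1: "1 \<le> c * \<epsilon> powr (- (p - 1))"

  proof -
    have "1 = \<epsilon> powr (p - 1) * \<epsilon> powr (- (p - 1))" using \<epsilon> by (simp flip: powr_add)
    also have "\<dots> \<le> c * \<epsilon> powr (- (p - 1))" using \<epsilon>(2) by (rule mult_right_mono) simp
    finally show ?thesis .
  qed
  have small: "?K * integral {0..t} (decay_kernel ?a (real CARD('n) * (p - 1) / 2) p t (\<lambda>_. L * \<epsilon>)) \<le> L * \<epsilon>" if t: "t \<in> {0..?T}" for t
  proof -
    have t0: "0 \<le> t" using t by simp
    have "integral {0..t} (decay_kernel ?a (real CARD('n) * (p - 1) / 2) p t (\<lambda>_. L * \<epsilon>)) = integral {0..t} (\<lambda>s. time_kernel ?a 1 t s * (L * \<epsilon>) powr p)"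
      unfolding p(2) decay_kernel_def ..
    also have "\<dots> = integral {0..t} (time_kernel ?a 1 t) * (L * \<epsilon>) powr p"
      by (rule Henstock_Kurzweil_Integration.integral_mult_left)
    also have "\<dots> \<le> (2 * ln (1 + t)) * (L * \<epsilon>) powr p"
      by (intro mult_right_mono time_kernel_log t0 a1) auto
    also have "\<dots> \<le> (4 * (c * \<epsilon> powr (- (p - 1)))) * (L * \<epsilon>) powr p"
    proof (intro mult_right_mono)
      have "ln (1 + t) \<le> ln (1 + ?T)" using t by (intro ln_mono) auto
      also have "\<dots> \<le> 1 + c * \<epsilon> powr (- (p - 1))" using y1 by (intro ln_1_plus_exp_le) auto
      finally show "2 * ln (1 + t) \<le> 4 * (c * \<epsilon> powr (- (p - 1)))" using y1 by linarith
    qed auto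
    finally have "?K * integral {0..t} (decay_kernel ?a (real CARD('n) * (p - 1) / 2) p t (\<lambda>_. L * \<epsilon>)) \<le> ?K * ((4 * (c * \<epsilon> powr (- (p - 1)))) * (L * \<epsilon>) powr p)"
      using C by (intro mult_left_mono) auto
    also have "(L * \<epsilon>) powr p = L powr (p - 1) * \<epsilon> powr (p - 1) * (L * \<epsilon>)"
      using L0 \<epsilon> powr_mult_base[of "L * \<epsilon>" "p - 1"] by (simp add: powr_mult mult_ac)
    also have "?K * ((4 * (c * \<epsilon> powr (- (p - 1)))) * (L powr (p - 1) * \<epsilon> powr (p - 1) * (L * \<epsilon>))) =
        c * (4 * ?K * L powr (p - 1)) * (\<epsilon> powr (- (p - 1)) * \<epsilon> powr (p - 1)) * (L * \<epsilon>)" by (simp only: mult_ac)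
    also have "c * (4 * ?K * L powr (p - 1)) = 1" using C L0 by (simp add: c)
    also have "\<epsilon> powr (- (p - 1)) * \<epsilon> powr (p - 1) = 1" using \<epsilon> by (simp flip: powr_add)
    finally show ?thesis by simp
  qed
  have J: "368 * \<epsilon> * data_norm u0 u1 v0 v1 \<le> L * \<epsilon>"
    using \<epsilon> by (simp add: L algebra_simps)
  show ?thesis
    by (rule lifespan_ge[OF n pe pe _ _ data, where a="\<lambda>_. L * \<epsilon>" and b="\<lambda>_. L * \<epsilon>"])
      (use p \<epsilon> L0 J small in auto)
qed

text \<open>
  Here \<open>u\<close> is allowed to grow like \<open>\<epsilon>\<^bsup>p\<^esup> (1 + t)\<^bsup>\<sigma>\<^esup>\<close>, relative to the linear decay, with \<open>\<sigma> = (3 - p)/2\<close>; criticality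
  makes the feedback on \<open>v\<close> logarithmic, of size \<open>\<epsilon>\<^bsup>p * q\<^esup> ln (1 + t)\<close>. Up to the time
  \<open>exp (c \<epsilon>\<^bsup>-2 * q\<^esup>)\<close> this is \<open>O(\<epsilon>\<^bsup>3\<^esup>)\<close> because \<open>p * q = 2 * q + 3\<close>, so every constant \<open>c\<close> is admissible.
\<close>

lemma lifespan_off_diagonal:
  fixes u0 u1 v0 v1 :: "(real^'n, real) L2"
  assumes n: "CARD('n) = 1" and pe: "power_estimate TYPE('n) p C" "power_estimate TYPE('n) q C'"
    and pq: "2 \<le> p" "p < q" "p * q = 2 * q + 3" and data: "((u0, u1), (v0, v1)) \<in> data_space" and c: "0 < c"
  shows "\<exists>\<epsilon>0>0. \<forall>\<epsilon>\<in>{0<..\<epsilon>0}. ereal (exp (c * \<epsilon> powr (- (2 * q)))) \<le> lifespan p q \<epsilon> u0 u1 v0 v1"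
proof -
  \<comment> \<open>Criticality places \<open>p\<close> and \<open>q\<close> on either side of 3,
    the critical exponent \<open>1 + 2 / n\<close> of the single equation in dimension one.\<close>
  have q3: "3 < q"
  proof (rule ccontr)
    assume "\<not> 3 < q"
    then have "p < 3" using pq by simp
    then have "p * q < 3 * q" using pq by (intro mult_strict_right_mono) auto
    then have "3 < q" using pq by simp
    with \<open>\<not> 3 < q\<close> show False by simp
  qed
  have p3: "p < 3"
  proof (rule ccontr)
    assume "\<not> p < 3"
    then have "3 * q \<le> p * q" using q3 by (intro mult_right_mono) auto
    then show False using pq q3 by simp
  qed
  define \<sigma> where "\<sigma> = (3 - p) / 2"
  have \<sigma>: "0 < \<sigma>" "\<sigma> \<le> 1 / 2" "(p - 1) / 2 = 1 - \<sigma>" using p3 pq by (auto simp: \<sigma>_def field_simps)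
  \<comment> \<open>The \<open>q\<close>-th power of the growth of \<open>u\<close> against the
    decay of the nonlinearity leaves exactly the exponent 1. Criticality enters here and makes the
    feedback logarithmic.\<close>
  have q\<sigma>: "(q - 1) / 2 - \<sigma> * q = 1" using pq(3) by (simp add: \<sigma>_def field_simps)
  have C: "0 < C" "0 < C'" using pe by (simp_all add: power_estimate_def)
  let ?J = "data_norm u0 u1 v0 v1"
  define L where "L = 368 * (?J + 1)"
  have L0: "0 < L" using data_norm_nonneg[of u0 u1 v0 v1] by (simp add: L_def)
  define \<kappa> \<kappa>' where "\<kappa> = 368 * C * 2 powr (p - 1)" and "\<kappa>' = 368 * C' * 2 powr (q - 1)"
  have \<kappa>: "0 < \<kappa>" "0 < \<kappa>'" using C by (simp_all add: \<kappa>_def \<kappa>'_def)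
  define K1 where "K1 = 2 / \<sigma> + 8"
  define K2 where "K2 = 4 / (q - 3) + 4 * 2 powr ((q - 1) / 2)"
  have K: "0 < K1" "0 < K2" using \<sigma> q3 by (simp_all add: K1_def K2_def add_pos_pos)
  \<comment> \<open>The coefficient that the Duhamel integral of \<open>v\<close>, with radius
    \<open>L * \<epsilon>\<close>, puts in front of
    \<open>\<epsilon> powr p * (1 + t) powr \<sigma>\<close> once a factor \<open>L\<close> is taken
    out.\<close>
  define D where "D = \<kappa> * K1 * L powr (p - 1)"
  have D0: "0 < D" using \<kappa> K L0 by (simp add: D_def)
  \<comment> \<open>All constants of the estimate for \<open>v\<close>, which ends in
    \<open>(\<epsilon> * X) * (L * \<epsilon>)\<close>. The constant \<open>c\<close> is among them,
    so a larger \<open>c\<close> is met by a smaller \<open>\<epsilon>0\<close>.\<close>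
  define X where "X = \<kappa>' * 2 powr q * L powr (q - 1) * (K2 + 2 * D powr q * (1 + c))"
  have X0: "0 < X" using \<kappa> K L0 D0 c by (simp add: X_def add_pos_pos)
  define \<epsilon>0 where "\<epsilon>0 = min 1 (1 / X)"
  have k1: "integral {0..t} (time_kernel (3 / 4) (1 - \<sigma>) t) \<le> K1 * (1 + t) powr \<sigma>" if t: "0 \<le> t" for t
  proof -
    have "integral {0..t} (time_kernel (3 / 4) (1 - \<sigma>) t) \<le> 2 * (((1 + t) powr \<sigma> - 1) / \<sigma>) + 4 * 2 powr (1 - \<sigma>) * (1 + t) powr \<sigma>"
      using time_kernel_integral_le[OF t, of "1 - \<sigma>"] \<sigma> by simp
    also have "\<dots> \<le> 2 * ((1 + t) powr \<sigma> / \<sigma>) + 4 * 2 * (1 + t) powr \<sigma>"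
    proof (intro add_mono mult_left_mono mult_right_mono)
      show "((1 + t) powr \<sigma> - 1) / \<sigma> \<le> (1 + t) powr \<sigma> / \<sigma>" using \<sigma> by (intro divide_right_mono) auto
      show "2 powr (1 - \<sigma>) \<le> (2::real)" using powr_mono[of "1 - \<sigma>" 1 "2::real"] \<sigma> by simp
    qed auto
    also have "\<dots> = K1 * (1 + t) powr \<sigma>" by (simp add: K1_def algebra_simps)
    finally show ?thesis .
  qed
  have k2: "integral {0..t} (time_kernel (3 / 4) ((q - 1) / 2) t) \<le> K2" if t: "0 \<le> t" for t
  proof -
    let ?\<beta> = "(q - 1) / 2"
    have \<beta>: "1 < ?\<beta>" using q3 by simp
    have "(1 + t) powr (1 - ?\<beta>) \<le> (1 + t) powr 0" using t \<beta> by (intro powr_mono) auto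
    then have le: "(1 + t) powr (1 - ?\<beta>) \<le> 1" using t by simp
    have e: "((1 + t) powr (1 - ?\<beta>) - 1) / (1 - ?\<beta>) = (1 - (1 + t) powr (1 - ?\<beta>)) / ((q - 3) / 2)"
      using q3 by (simp add: field_simps)
    have "integral {0..t} (time_kernel (3 / 4) ?\<beta> t) \<le> 2 * (((1 + t) powr (1 - ?\<beta>) - 1) / (1 - ?\<beta>)) + 4 * 2 powr ?\<beta> * (1 + t) powr (1 - ?\<beta>)"
      using \<beta> by (intro time_kernel_integral_le[OF t]) auto
    also have "\<dots> \<le> 2 * (1 / ((q - 3) / 2)) + 4 * 2 powr ?\<beta> * 1"
      unfolding e using q3 le by (intro add_mono mult_left_mono divide_right_mono) auto
    also have "\<dots> = K2" by (simp add: K2_def)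
    finally show ?thesis .
  qed
  have main: "ereal (exp (c * \<epsilon> powr (- (2 * q)))) \<le> lifespan p q \<epsilon> u0 u1 v0 v1" if \<epsilon>: "0 < \<epsilon>" "\<epsilon> \<le> \<epsilon>0" for \<epsilon>
  proof -
    let ?y = "c * \<epsilon> powr (- (2 * q))"
    have \<epsilon>1: "\<epsilon> \<le> 1" "\<epsilon> * X \<le> 1" using \<epsilon> X0 by (auto simp: \<epsilon>0_def le_divide_eq)
    have y0: "0 \<le> ?y" using c by simp
    define a where "a t = L * (\<epsilon> + D * \<epsilon> powr p * (1 + t) powr \<sigma>)" for t
    have a_pos: "0 < a t" if "0 \<le> t" for t using L0 D0 \<epsilon> that by (simp add: a_def add_pos_nonneg)
    have a_ge: "L * \<epsilon> \<le> a t" if "0 \<le> t" for t using L0 D0 \<epsilon> by (simp add: a_def distrib_left)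
    have J: "368 * \<epsilon> * ?J \<le> L * \<epsilon>" using \<epsilon> by (simp add: L_def algebra_simps)
    have a34: "real CARD('n) / 4 + 1 / 2 = 3 / 4" using n by simp
    show ?thesis
    proof (rule lifespan_ge[OF _ pe _ _ data, where a=a and b="\<lambda>_. L * \<epsilon>"])
      show "continuous_on {0..exp ?y} a" unfolding a_def by (intro continuous_intros) auto
      fix t assume t: "t \<in> {0..exp ?y}"
      then have t0: "0 \<le> t" by simp
      show "0 < a t" by (rule a_pos[OF t0])
      show "368 * \<epsilon> * ?J \<le> a t" using J a_ge[OF t0] by linarith
      have "integral {0..t} (decay_kernel (3 / 4) ((p - 1) / 2) p t (\<lambda>_. L * \<epsilon>)) = integral {0..t} (\<lambda>s. time_kernel (3 / 4) (1 - \<sigma>) t s * (L * \<epsilon>) powr p)"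
        unfolding decay_kernel_def \<sigma>(3) ..
      also have "\<dots> = integral {0..t} (time_kernel (3 / 4) (1 - \<sigma>) t) * (L * \<epsilon>) powr p"
        by (rule Henstock_Kurzweil_Integration.integral_mult_left)
      also have "\<dots> \<le> (K1 * (1 + t) powr \<sigma>) * (L * \<epsilon>) powr p" by (intro mult_right_mono k1 t0) auto
      finally have "\<kappa> * integral {0..t} (decay_kernel (3 / 4) ((p - 1) / 2) p t (\<lambda>_. L * \<epsilon>)) \<le> \<kappa> * ((K1 * (1 + t) powr \<sigma>) * (L * \<epsilon>) powr p)"
        using \<kappa> by (intro mult_left_mono) auto
      also have "(L * \<epsilon>) powr p = L * L powr (p - 1) * \<epsilon> powr p"
        using L0 \<epsilon> powr_mult_base[of L "p - 1"] by (simp add: powr_mult)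
      also have "\<kappa> * ((K1 * (1 + t) powr \<sigma>) * (L * L powr (p - 1) * \<epsilon> powr p)) = L * (D * \<epsilon> powr p * (1 + t) powr \<sigma>)"
        by (simp only: D_def mult_ac)
      also have "\<dots> \<le> a t" using L0 \<epsilon> by (simp add: a_def distrib_left)
      finally show "368 * C * 2 powr (p - 1) * integral {0..t} (decay_kernel (real CARD('n) / 4 + 1 / 2) (real CARD('n) * (p - 1) / 2) p t (\<lambda>_. L * \<epsilon>)) \<le> a t"
        unfolding a34 n \<kappa>_def by simp
      let ?E = "2 powr q * L powr q * \<epsilon> powr q" and ?G = "2 powr q * L powr q * (D powr q * \<epsilon> powr (p * q))"
      \<comment> \<open>The power of the sum is split with the factor \<open>2 powr q\<close>. The
        part of size \<epsilon> keeps the integrable exponent \<open>(q - 1) / 2 > 1\<close>; the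
        growing part ends up with the exponent 1.\<close>
      have dk: "decay_kernel (3 / 4) ((q - 1) / 2) q t a s \<le> ?E * time_kernel (3 / 4) ((q - 1) / 2) t s + ?G * time_kernel (3 / 4) 1 t s"
        if s: "s \<in> {0..t}" for s
      proof -
        let ?x = "\<epsilon>" and ?z = "D * \<epsilon> powr p * (1 + s) powr \<sigma>"
        have z0: "0 \<le> ?z" using D0 by simp
        have "(?x + ?z) powr q \<le> (2 * max ?x ?z) powr q" using q3 \<epsilon> z0 by (intro powr_mono2) auto
        also have "\<dots> = 2 powr q * (max ?x ?z) powr q" using \<epsilon> by (simp add: powr_mult)
        also have "\<dots> \<le> 2 powr q * (?x powr q + ?z powr q)" by (intro mult_left_mono) (auto simp: max_def)
        finally have "a s powr q \<le> L powr q * (2 powr q * (?x powr q + ?z powr q))"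
          unfolding a_def using L0 \<epsilon> z0 by (simp add: powr_mult mult_left_mono)
        also have "?z powr q = D powr q * \<epsilon> powr (p * q) * (1 + s) powr (\<sigma> * q)"
          using D0 \<epsilon> by (simp add: powr_mult powr_powr)
        finally have "decay_kernel (3 / 4) ((q - 1) / 2) q t a s \<le>
            time_kernel (3 / 4) ((q - 1) / 2) t s * (L powr q * (2 powr q * (\<epsilon> powr q + D powr q * \<epsilon> powr (p * q) * (1 + s) powr (\<sigma> * q))))"
          unfolding decay_kernel_def by (intro mult_left_mono) auto
        also have "\<dots> = ?E * time_kernel (3 / 4) ((q - 1) / 2) t s +
            ?G * (((1 + t) / (1 + (t - s))) powr (3 / 4) * ((1 + s) powr (- ((q - 1) / 2)) * (1 + s) powr (\<sigma> * q)))"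
          by (simp only: distrib_left mult_ac)
        also have "(1 + s) powr (- ((q - 1) / 2)) * (1 + s) powr (\<sigma> * q) = (1 + s) powr (- 1)"

        proof -
          have "- ((q - 1) / 2) + \<sigma> * q = - 1" using q\<sigma> by (simp add: field_simps)
          then show ?thesis by (simp only: powr_add[symmetric])
        qed
        finally show ?thesis .
      qed
      have i: "(\<lambda>s. ?E * time_kernel (3 / 4) ((q - 1) / 2) t s + ?G * time_kernel (3 / 4) 1 t s) integrable_on {0..t}"
        by (intro integrable_continuous_interval continuous_on_add continuous_on_mult_left continuous_on_time_kernel t0)
      have i': "decay_kernel (3 / 4) ((q - 1) / 2) q t a integrable_on {0..t}"
      proof (rule integrable_continuous_interval)
        show "continuous_on {0..t} (decay_kernel (3 / 4) ((q - 1) / 2) q t a)"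
          unfolding decay_kernel_def a_def using t0 L0 D0 \<epsilon> by (intro continuous_intros) (auto simp: add_pos_nonneg less_imp_neq[symmetric])
      qed
      have "integral {0..t} (decay_kernel (3 / 4) ((q - 1) / 2) q t a) \<le>
          integral {0..t} (\<lambda>s. ?E * time_kernel (3 / 4) ((q - 1) / 2) t s + ?G * time_kernel (3 / 4) 1 t s)"
        by (rule integral_le[OF i' i dk])
      also have "\<dots> = ?E * integral {0..t} (time_kernel (3 / 4) ((q - 1) / 2) t) + ?G * integral {0..t} (time_kernel (3 / 4) 1 t)"
        by (intro integral_unique has_integral_add has_integral_mult_right integrable_integral integrable_time_kernel t0)
      also have "\<dots> \<le> ?E * K2 + ?G * (2 * (1 + ?y))"
      proof (intro add_mono mult_left_mono)
        show "integral {0..t} (time_kernel (3 / 4) ((q - 1) / 2) t) \<le> K2" by (rule k2[OF t0])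
        have "integral {0..t} (time_kernel (3 / 4) 1 t) \<le> 2 * ln (1 + t)" by (rule time_kernel_log[OF t0]) simp
        also have "ln (1 + t) \<le> ln (1 + exp ?y)" using t by (intro ln_mono) auto
        also have "\<dots> \<le> 1 + ?y" by (rule ln_1_plus_exp_le[OF y0])
        finally show "integral {0..t} (time_kernel (3 / 4) 1 t) \<le> 2 * (1 + ?y)" by simp
      qed auto
      also have "\<dots> = 2 powr q * L powr q * (\<epsilon> powr q * K2 + 2 * D powr q * (\<epsilon> powr (p * q) + c * (\<epsilon> powr (p * q) * \<epsilon> powr (- (2 * q)))))"
        by (simp add: algebra_simps)
      also have "\<epsilon> powr (p * q) * \<epsilon> powr (- (2 * q)) = \<epsilon> powr 3"
        using pq(3) by (simp flip: powr_add)
      \<comment> \<open>All exponents are at least 2 and \<open>\<epsilon> \<le> 1\<close>. Of the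
        two factors kept, one belongs to the radius \<open>L * \<epsilon>\<close> and the other
        makes \<open>\<epsilon> * X \<le> 1\<close> possible.\<close>
      also have "\<epsilon> powr q * K2 + 2 * D powr q * (\<epsilon> powr (p * q) + c * \<epsilon> powr 3) \<le> (\<epsilon> * \<epsilon>) * K2 + 2 * D powr q * (\<epsilon> * \<epsilon> + c * (\<epsilon> * \<epsilon>))"
      proof -
        have two: "\<epsilon> powr r \<le> \<epsilon> * \<epsilon>" if "2 \<le> r" for r
          using powr_mono'[OF that, of \<epsilon>] \<epsilon> \<epsilon>1 by (simp add: power2_eq_square)
        have "2 \<le> p * q" using pq q3 by simp
        then show ?thesis
          using K c q3 by (intro add_mono mult_left_mono mult_right_mono two) auto
      qed
      finally have "integral {0..t} (decay_kernel (3 / 4) ((q - 1) / 2) q t a) \<le>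
          2 powr q * L powr q * ((\<epsilon> * \<epsilon>) * K2 + 2 * D powr q * (\<epsilon> * \<epsilon> + c * (\<epsilon> * \<epsilon>)))"
        by (simp add: mult_left_mono)
      then have "\<kappa>' * integral {0..t} (decay_kernel (3 / 4) ((q - 1) / 2) q t a) \<le>
          \<kappa>' * (2 powr q * L powr q * ((\<epsilon> * \<epsilon>) * K2 + 2 * D powr q * (\<epsilon> * \<epsilon> + c * (\<epsilon> * \<epsilon>))))"
        using \<kappa> by (intro mult_left_mono) auto
      also have "L powr q = L * L powr (q - 1)" using L0 powr_mult_base[of L "q - 1"] by simp
      also have "\<kappa>' * (2 powr q * (L * L powr (q - 1)) * ((\<epsilon> * \<epsilon>) * K2 + 2 * D powr q * (\<epsilon> * \<epsilon> + c * (\<epsilon> * \<epsilon>)))) = (\<epsilon> * X) * (L * \<epsilon>)"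
        by (simp add: X_def algebra_simps)
      also have "\<dots> \<le> 1 * (L * \<epsilon>)" using \<epsilon>1 L0 \<epsilon> by (intro mult_right_mono) auto
      finally show "368 * C' * 2 powr (q - 1) * integral {0..t} (decay_kernel (real CARD('n) / 4 + 1 / 2) (real CARD('n) * (q - 1) / 2) q t a) \<le> L * \<epsilon>"
        unfolding a34 n \<kappa>'_def by simp
    qed (use n pq \<epsilon> L0 J in auto)
  qed
  moreover have "0 < \<epsilon>0" using X0 by (simp add: \<epsilon>0_def)
  ultimately show ?thesis by (intro exI[of _ \<epsilon>0]) auto
qed

theorem theorem2p2:
  assumes "CARD('n::finite) \<in> {1, 2}"
  shows "\<exists>c :: real \<Rightarrow> real. (\<forall>J. 0 < c J) \<and>
    (\<forall>(p::real) (q::real) (u0 :: (real^'n, real) L2) u1 v0 v1.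
      2 \<le> p \<longrightarrow> 2 \<le> q \<longrightarrow>
      (max p q + 1) / (p * q - 1) = real CARD('n) / 2 \<longrightarrow>
      ((u0, u1), (v0, v1)) \<in> data_space \<longrightarrow>
      (\<exists>\<epsilon>0>0. \<forall>\<epsilon>\<in>{0<..\<epsilon>0}.
        lifespan p q \<epsilon> u0 u1 v0 v1 \<ge>
          ereal (if p = q
            then exp (c (data_norm u0 u1 v0 v1) * \<epsilon> powr (- (p - 1)))
            else exp (c (data_norm u0 u1 v0 v1) *
              \<epsilon> powr (- max (p * (p * q - 1) / (p + 1)) (q * (p * q - 1) / (q + 1)))))))"
proof -
  \<comment> \<open>The one exponent compatible with criticality when \<open>p = q\<close>. Fixing
    it before \<open>p\<close> and \<open>q\<close> are introduced makes \<open>C\<close>, and with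
    it \<open>c\<close>, a matter of the dimension and the data norm.\<close>
  let ?P = "1 + 2 / real CARD('n)"
  have n: "CARD('n) \<le> 2" using assms by auto
  have "\<exists>C. power_estimate TYPE('n) ?P C"
    using assms power_estimate_dim1[where 'n='n, of 3] power_estimate_dim2[where 'n='n] by auto
  then obtain C where pe: "power_estimate TYPE('n) ?P C" by blast
  have C: "0 < C" using pe by (simp add: power_estimate_def)
  \<comment> \<open>The value required by \<open>lifespan_diagonal\<close>; the absolute value keeps
    it positive at every real argument and has no effect on data norms, which are
    non-negative.\<close>
  define c where "c J = 1 / (4 * (368 * C * 2 powr (?P - 1)) * (368 * (\<bar>J\<bar> + 1)) powr (?P - 1))" for J :: real
  have c: "0 < c J" for J using C by (simp add: c_def add_nonneg_pos)
  \<comment> \<open>Here \<open>d\<close> is arbitrary. It will be the value of \<open>c\<close>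
    fixed above for the diagonal case, whose \<open>C\<close> has no relation to the estimates for
    these exponents.\<close>
  have off: "\<exists>\<epsilon>0>0. \<forall>\<epsilon>\<in>{0<..\<epsilon>0}. ereal (exp (d * \<epsilon> powr (- max (p * (p * q - 1) / (p + 1)) (q * (p * q - 1) / (q + 1))))) \<le> lifespan p q \<epsilon> u0 u1 v0 v1"
    if pq: "2 \<le> p" "p < q" "(q + 1) / (p * q - 1) = real CARD('n) / 2" and data: "((u0, u1), (v0, v1)) \<in> data_space" and d: "0 < d"
    for p q d :: real and u0 u1 v0 v1 :: "(real^'n, real) L2"
  proof -
    have pos: "0 < p * q - 1" using pq mult_mono[of 2 p 2 q] by simp
    \<comment> \<open>In dimension two criticality reads \<open>p * q = q + 2\<close>, and
      \<open>p \<ge> 2\<close> would then force \<open>q \<le> 2 \<le> p\<close>.\<close>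
    have n1: "CARD('n) = 1"
    proof (rule ccontr)
      assume "CARD('n) \<noteq> 1"
      then have "CARD('n) = 2" using assms by auto
      with pq(3) have "(q + 1) / (p * q - 1) = 1" by simp
      then have "q + 1 = p * q - 1" using pos by (simp add: field_simps)
      moreover have "2 * q \<le> p * q" using pq by (intro mult_right_mono) auto
      ultimately show False using pq by simp
    qed
    have "2 * (q + 1) = p * q - 1" using pq(3) pos n1 by (simp add: field_simps)
    then have pq': "p * q - 1 = 2 * (q + 1)" by simp
    have q0: "0 < q" "0 < p" using pq by auto
    have "q * (p * q - 1) / (q + 1) = 2 * q" unfolding pq' using q0 by (simp add: field_simps)
    moreover have "p * (p * q - 1) / (p + 1) \<le> 2 * q"
      unfolding pq' using q0 pq(2) by (simp add: divide_le_eq algebra_simps)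
    ultimately have m: "max (p * (p * q - 1) / (p + 1)) (q * (p * q - 1) / (q + 1)) = 2 * q" by simp
    obtain C1 where C1: "power_estimate TYPE('n) p C1" using power_estimate_dim1[OF n1 pq(1)] by blast
    obtain C2 where C2: "power_estimate TYPE('n) q C2" using power_estimate_dim1[OF n1, of q] pq by auto
    show ?thesis unfolding m
      by (rule lifespan_off_diagonal[OF n1 C1 C2 pq(1,2) _ data d]) (use pq' in simp)
  qed
  have "\<exists>\<epsilon>0>0. \<forall>\<epsilon>\<in>{0<..\<epsilon>0}.
        lifespan p q \<epsilon> u0 u1 v0 v1 \<ge>
          ereal (if p = q
            then exp (c (data_norm u0 u1 v0 v1) * \<epsilon> powr (- (p - 1)))
            else exp (c (data_norm u0 u1 v0 v1) *
              \<epsilon> powr (- max (p * (p * q - 1) / (p + 1)) (q * (p * q - 1) / (q + 1)))))"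
    if pq: "2 \<le> p" "2 \<le> q" "(max p q + 1) / (p * q - 1) = real CARD('n) / 2" and data: "((u0, u1), (v0, v1)) \<in> data_space"
    for p q :: real and u0 u1 v0 v1 :: "(real^'n, real) L2"
  proof -
    let ?J = "data_norm u0 u1 v0 v1"
    consider "p = q" | "p < q" | "q < p" by linarith
    then show ?thesis
    proof cases
      case 1
      have "(p + 1) / (p * p - 1) = real CARD('n) / 2" using pq(3) 1 by simp
      moreover have "p * p - 1 = (p - 1) * (p + 1)" by (simp add: algebra_simps)
      ultimately have "1 / (p - 1) = real CARD('n) / 2" using pq by simp
      then have P: "p = ?P" using pq by (simp add: field_simps)
      let ?c = "c ?J"
      have cJ: "?c = 1 / (4 * (368 * C * 2 powr (p - 1)) * (368 * (?J + 1)) powr (p - 1))"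
        unfolding c_def P[symmetric] using data_norm_nonneg[of u0 u1 v0 v1] by simp
      have crit: "real CARD('n) * (p - 1) / 2 = 1" unfolding P by simp
      have "ereal (exp (?c * \<epsilon> powr (- (p - 1)))) \<le> lifespan p p \<epsilon> u0 u1 v0 v1"
        if \<epsilon>: "\<epsilon> \<in> {0<..?c powr (1 / (p - 1))}" for \<epsilon>
      proof -
        have "\<epsilon> powr (p - 1) \<le> (?c powr (1 / (p - 1))) powr (p - 1)" using \<epsilon> pq by (intro powr_mono2) auto
        also have "\<dots> = ?c" using pq c[of ?J] by (simp add: powr_powr)
        finally have "\<epsilon> powr (p - 1) \<le> ?c" .
        then show ?thesis
          using \<epsilon> pq by (intro lifespan_diagonal[OF n pe[folded P] _ crit data refl cJ]) auto
      qed
      then show ?thesis using 1 c[of ?J] by (intro exI[of _ "?c powr (1 / (p - 1))"]) auto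
    next
      case 2
      then show ?thesis using off[OF pq(1) 2 _ data c[of ?J]] pq(3) by (simp add: max_def)
    next
      case 3
      have data': "((v0, v1), (u0, u1)) \<in> data_space" using data by (auto simp: data_space_def)
      have "(p + 1) / (q * p - 1) = real CARD('n) / 2" using pq(3) 3 by (simp add: max_def mult.commute)
      from off[OF pq(2) 3 this data' c[of ?J]] show ?thesis
        using 3 by (simp add: lifespan_swap[of q p] max.commute mult.commute)
    qed
  qed
  then show ?thesis using c by (intro exI[of _ c]) blast
qed
end
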